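(* Let $k$ be an algebraically closed field and let $A=\bigoplus_{i\geqslant 0}A_i$ be a locally finite graded $k$-algebra generated in degrees $0$ and $1$ such that $\mathrm{fin.dim}\,A_0=0=\mathrm{fin.dim}\,A_0^{\mathrm{op}}$. Suppose that $A$ is a projective $A_0$-module. Let $M=\bigoplus_{i\geqslant 0}M_i$ be a locally finite graded $A$-module. Then $M$ is generalized Koszul if and only if $M$ is a projective $A_0$-module and the graded module $\mathrm{Ext}_A^{*}(M,A_0)$ over $\Gamma=\mathrm{Ext}_A^{*}(A_0,A_0)$ is generated in degree $0$, i.e. $$\mathrm{Ext}_A^{1}(A_0,A_0)\cdot \mathrm{Ext}_A^{i}(M,A_0)=\mathrm{Ext}_A^{i+1}(M,A_0)\quad\text{for all } i\geqslant 0.$$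
   Context: Modules are left modules. A graded algebra $A=\bigoplus_{i\geqslant0}A_i$ is locally finite and generated in degrees $0$ and $1$ if $\dim_k A_i<\infty$ and $A_1\cdot A_i=A_{i+1}$ for all $i\geqslant 0$. A graded module $M=\bigoplus_{i\geqslant0}M_i$ satisfies $A_iM_j\subseteq M_{i+j}$; it is locally finite if all $\dim_k M_i<\infty$; it is generated in degree $s$ if $M=A\cdot M_s$. The zero module is regarded as projective. $A_0$ is viewed as the graded $A$-module $A/\bigoplus_{i\geqslant1}A_i$ concentrated in degree $0$. For a finite-dimensional algebra $\Lambda$, $\mathrm{fin.dim}\,\Lambda$ is the supremum of the projective dimensions of all indecomposable $\Lambda$-modules of finite projective dimension; $\Lambda^{\mathrm{op}}$ is the opposite algebra. $M$ is generalized Koszul if it has a (minimal) linear projective resolution, i.e. a graded projective resolution $\cdots\to P^n\to\cdots\to P^0\to M\to 0$ with $P^i$ generated in degree $i$ for all $i\geqslant 0$. $\mathrm{Ext}_A^{*}(M,A_0)=\bigoplus_{i\geqslant0}\mathrm{Ext}_A^i(M,A_0)$ is formed from all (not necessarily graded) homomorphisms; $\Gamma$ is a graded algebra under the Yoneda product (with $gf$ denoting first $f$, then $g$), and $\mathrm{Ext}_A^{*}(M,A_0)$ is a graded left $\Gamma$-module under the Yoneda product.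
   Formalization: The module M is additionally assumed to be generated in degree 0 (M = A·M_0); without this the "if" direction fails, e.g. for A = A_0 = k and M = k placed in degree 1, while generalized Koszul modules satisfy it automatically. *)

theory Defs
  imports "HOL-Library.FSet" "HOL-Library.Extended_Nat" "HOL-Algebra.Algebra"
begin

section \<open>Left modules over arbitrary rings\<close>

text \<open>
  The locale \<^locale>\<open>module\<close> of HOL-Algebra requires a commutative ring of scalars. The record
  type is reused here; as there, its multiplicative fields \<open>mult\<close> and \<open>one\<close> carry no meaning
  for a module and are left undefined in the constructions below.
\<close>

locale left_module = R?: ring R + M?: abelian_group M
  for R :: "('r, 'e) ring_scheme" (structure) and M :: "('r, 'm, 'f) module_scheme" (structure) +
  assumes smult_closed [simp, intro]:
      "\<lbrakk>a \<in> carrier R; x \<in> carrier M\<rbrakk> \<Longrightarrow> a \<odot>\<^bsub>M\<^esub> x \<in> carrier M"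
    and smult_l_distr:
      "\<lbrakk>a \<in> carrier R; b \<in> carrier R; x \<in> carrier M\<rbrakk> \<Longrightarrow>
        (a \<oplus>\<^bsub>R\<^esub> b) \<odot>\<^bsub>M\<^esub> x = a \<odot>\<^bsub>M\<^esub> x \<oplus>\<^bsub>M\<^esub> b \<odot>\<^bsub>M\<^esub> x"
    and smult_r_distr:
      "\<lbrakk>a \<in> carrier R; x \<in> carrier M; y \<in> carrier M\<rbrakk> \<Longrightarrow>
        a \<odot>\<^bsub>M\<^esub> (x \<oplus>\<^bsub>M\<^esub> y) = a \<odot>\<^bsub>M\<^esub> x \<oplus>\<^bsub>M\<^esub> a \<odot>\<^bsub>M\<^esub> y"
    and smult_assoc1:
      "\<lbrakk>a \<in> carrier R; b \<in> carrier R; x \<in> carrier M\<rbrakk> \<Longrightarrow>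
        (a \<otimes>\<^bsub>R\<^esub> b) \<odot>\<^bsub>M\<^esub> x = a \<odot>\<^bsub>M\<^esub> (b \<odot>\<^bsub>M\<^esub> x)"
    and smult_one [simp]:
      "x \<in> carrier M \<Longrightarrow> \<one>\<^bsub>R\<^esub> \<odot>\<^bsub>M\<^esub> x = x"

definition regular_module :: "('r, 'e) ring_scheme \<Rightarrow> ('r, 'r) module" where
  "regular_module R = \<lparr>carrier = carrier R, monoid.mult = undefined, one = undefined,
     ring.zero = \<zero>\<^bsub>R\<^esub>, add = add R, smult = monoid.mult R\<rparr>"

definition restrict_scalars :: "('s \<Rightarrow> 'r) \<Rightarrow> ('r, 'm, 'f) module_scheme \<Rightarrow> ('s, 'm) module" where
  "restrict_scalars \<phi> M = \<lparr>carrier = carrier M, monoid.mult = undefined, one = undefined,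
     ring.zero = \<zero>\<^bsub>M\<^esub>, add = add M, smult = (\<lambda>c. smult M (\<phi> c))\<rparr>"

definition opposite_ring :: "('r, 'e) ring_scheme \<Rightarrow> ('r, 'e) ring_scheme" where
  "opposite_ring R = R\<lparr>monoid.mult := (\<lambda>x y. y \<otimes>\<^bsub>R\<^esub> x)\<rparr>"

text \<open>Homomorphisms are extensional, so that equality of homomorphisms is equality in HOL.\<close>

definition mod_hom ::
  "('r, 'e) ring_scheme \<Rightarrow> ('r, 'm, 'f) module_scheme \<Rightarrow> ('r, 'n, 'g) module_scheme \<Rightarrow> ('m \<Rightarrow> 'n) set"
  where "mod_hom R M N = {h \<in> carrier M \<rightarrow>\<^sub>E carrier N.
     (\<forall>x\<in>carrier M. \<forall>y\<in>carrier M. h (x \<oplus>\<^bsub>M\<^esub> y) = h x \<oplus>\<^bsub>N\<^esub> h y) \<and>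
     (\<forall>a\<in>carrier R. \<forall>x\<in>carrier M. h (a \<odot>\<^bsub>M\<^esub> x) = a \<odot>\<^bsub>N\<^esub> h x)}"

definition finitely_generated :: "('r, 'e) ring_scheme \<Rightarrow> ('r, 'm, 'f) module_scheme \<Rightarrow> bool" where
  "finitely_generated R M \<longleftrightarrow> (\<exists>S \<subseteq> carrier M. finite S \<and>
     (\<forall>x\<in>carrier M. \<exists>c \<in> S \<rightarrow> carrier R. x = (\<Oplus>\<^bsub>M\<^esub> s\<in>S. c s \<odot>\<^bsub>M\<^esub> s)))"

definition indecomposable :: "('r, 'e) ring_scheme \<Rightarrow> ('r, 'm, 'f) module_scheme \<Rightarrow> bool" where
  "indecomposable R M \<longleftrightarrow> carrier M \<noteq> {\<zero>\<^bsub>M\<^esub>} \<and>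
     (\<forall>U V. submodule U R M \<and> submodule V R M \<and> U \<inter> V = {\<zero>\<^bsub>M\<^esub>} \<and> U <+>\<^bsub>M\<^esub> V = carrier M \<longrightarrow>
        U = {\<zero>\<^bsub>M\<^esub>} \<or> V = {\<zero>\<^bsub>M\<^esub>})"


section \<open>Free and projective modules, projective resolutions\<close>

definition free_module :: "('r, 'e) ring_scheme \<Rightarrow> 'x set \<Rightarrow> ('r, 'x \<Rightarrow> 'r) module" where
  "free_module R B = \<lparr>carrier = {f. (\<forall>x. f x \<in> carrier R) \<and> (\<forall>x. x \<notin> B \<longrightarrow> f x = \<zero>\<^bsub>R\<^esub>) \<and>
       finite {x. f x \<noteq> \<zero>\<^bsub>R\<^esub>}},
     monoid.mult = undefined, one = undefined, ring.zero = (\<lambda>x. \<zero>\<^bsub>R\<^esub>),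
     add = (\<lambda>f g x. f x \<oplus>\<^bsub>R\<^esub> g x), smult = (\<lambda>a f x. a \<otimes>\<^bsub>R\<^esub> f x)\<rparr>"

text \<open>
  A module is projective if it is (isomorphic to) a direct summand of a free module. If there is
  such a free module at all, there is one with basis indexed by the underlying set of \<open>P\<close>, so it
  is no restriction to take the index set inside the type of the elements of \<open>P\<close>; see
  \<open>projective_moduleI\<close> and \<open>projective_module_lifting\<close> below for the lifting property.
\<close>

definition projective_module :: "('r, 'e) ring_scheme \<Rightarrow> ('r, 'm, 'f) module_scheme \<Rightarrow> bool" where
  "projective_module R P \<longleftrightarrow> left_module R P \<and>
     (\<exists>(B :: 'm set) \<iota> \<pi>. \<iota> \<in> mod_hom R P (free_module R B) \<and> \<pi> \<in> mod_hom R (free_module R B) P \<and>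
        (\<forall>p\<in>carrier P. \<pi> (\<iota> p) = p))"

text \<open>The exact sequence \<open>\<cdots> \<rightarrow> P 1 \<rightarrow> P 0 \<rightarrow> M \<rightarrow> 0\<close> with \<open>d n : P (n + 1) \<rightarrow> P n\<close> and
  \<open>\<epsilon> : P 0 \<rightarrow> M\<close>.\<close>

definition projective_resolution ::
  "('r, 'e) ring_scheme \<Rightarrow> ('r, 'm, 'f) module_scheme \<Rightarrow>
     (nat \<Rightarrow> ('r, 'p, 'g) module_scheme) \<Rightarrow> (nat \<Rightarrow> 'p \<Rightarrow> 'p) \<Rightarrow> ('p \<Rightarrow> 'm) \<Rightarrow> bool"
  where "projective_resolution R M P d \<epsilon> \<longleftrightarrow>
     (\<forall>n. projective_module R (P n)) \<and>
     (\<forall>n. d n \<in> mod_hom R (P (Suc n)) (P n)) \<and>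
     \<epsilon> \<in> mod_hom R (P 0) M \<and>
     \<epsilon> ` carrier (P 0) = carrier M \<and>
     d 0 ` carrier (P 1) = {x \<in> carrier (P 0). \<epsilon> x = \<zero>\<^bsub>M\<^esub>} \<and>
     (\<forall>n. d (Suc n) ` carrier (P (Suc (Suc n))) = {x \<in> carrier (P (Suc n)). d n x = \<zero>\<^bsub>P n\<^esub>})"


section \<open>The standard free resolution\<close>

text \<open>
  Every module \<open>M\<close> has the functorial free resolution in which \<open>F 0\<close> is free on the underlying set
  of \<open>M\<close> and \<open>F (n + 1)\<close> is free on the underlying set of the kernel of the preceding map; each map
  sends a basis element to the element it stands for. The datatype holds the basis elements
  of all \<open>F n\<close> in one type: \<open>Gen m\<close> is the basis element for \<open>m\<close> in \<open>M\<close>, and a finitely supported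
  function \<open>f\<close> in a kernel is named by its finite graph \<open>{(x, f x) | f x \<noteq> 0}\<close>.
\<close>

datatype ('r, 'm) std_basis = Gen 'm | Syz "(('r, 'm) std_basis \<times> 'r) fset"

definition syz_name ::
  "('r, 'e) ring_scheme \<Rightarrow> (('r, 'm) std_basis \<Rightarrow> 'r) \<Rightarrow> ('r, 'm) std_basis" where
  "syz_name R f = Syz (Abs_fset {(x, f x) | x. f x \<noteq> \<zero>\<^bsub>R\<^esub>})"

definition lin_ext ::
  "('r, 'e) ring_scheme \<Rightarrow> 'x set \<Rightarrow> ('r, 'n, 'g) module_scheme \<Rightarrow> ('x \<Rightarrow> 'n) \<Rightarrow> ('x \<Rightarrow> 'r) \<Rightarrow> 'n"
  where "lin_ext R B N v =
     (\<lambda>f\<in>carrier (free_module R B). \<Oplus>\<^bsub>N\<^esub> x\<in>{x. f x \<noteq> \<zero>\<^bsub>R\<^esub>}. f x \<odot>\<^bsub>N\<^esub> v x)"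

definition std_aug :: "('r, 'e) ring_scheme \<Rightarrow> ('r, 'm, 'f) module_scheme \<Rightarrow>
    (('r, 'm) std_basis \<Rightarrow> 'r) \<Rightarrow> 'm" where
  "std_aug R M = lin_ext R (Gen ` carrier M) M (inv_into (carrier M) Gen)"

text \<open>\<open>syz_map R S\<close> is the map from the free module on \<open>S\<close> that sends the basis element named by
  \<open>f \<in> S\<close> to \<open>f\<close>; its values lie in the free module containing \<open>S\<close>.\<close>

definition syz_map :: "('r, 'e) ring_scheme \<Rightarrow> (('r, 'm) std_basis \<Rightarrow> 'r) set \<Rightarrow>
    (('r, 'm) std_basis \<Rightarrow> 'r) \<Rightarrow> (('r, 'm) std_basis \<Rightarrow> 'r)" where
  "syz_map R S = lin_ext R (syz_name R ` S) (free_module R UNIV) (inv_into S (syz_name R))"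

primrec std_syz :: "('r, 'e) ring_scheme \<Rightarrow> ('r, 'm, 'f) module_scheme \<Rightarrow> nat \<Rightarrow>
    (('r, 'm) std_basis \<Rightarrow> 'r) set" where
  "std_syz R M 0 = {f \<in> carrier (free_module R (Gen ` carrier M)). std_aug R M f = \<zero>\<^bsub>M\<^esub>}"
| "std_syz R M (Suc n) = {f \<in> carrier (free_module R (syz_name R ` std_syz R M n)).
     syz_map R (std_syz R M n) f = (\<lambda>x. \<zero>\<^bsub>R\<^esub>)}"

primrec std_mod :: "('r, 'e) ring_scheme \<Rightarrow> ('r, 'm, 'f) module_scheme \<Rightarrow> nat \<Rightarrow>
    ('r, ('r, 'm) std_basis \<Rightarrow> 'r) module" where
  "std_mod R M 0 = free_module R (Gen ` carrier M)"
| "std_mod R M (Suc n) = free_module R (syz_name R ` std_syz R M n)"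

definition std_diff :: "('r, 'e) ring_scheme \<Rightarrow> ('r, 'm, 'f) module_scheme \<Rightarrow> nat \<Rightarrow>
    (('r, 'm) std_basis \<Rightarrow> 'r) \<Rightarrow> (('r, 'm) std_basis \<Rightarrow> 'r)" where
  "std_diff R M n = syz_map R (std_syz R M n)"


subsection \<open>Free modules, the lifting property, exactness of the standard resolution\<close>

lemma free_module_simps [simp]:
  "\<zero>\<^bsub>free_module R B\<^esub> = (\<lambda>x. \<zero>\<^bsub>R\<^esub>)"
  "f \<oplus>\<^bsub>free_module R B\<^esub> g = (\<lambda>x. f x \<oplus>\<^bsub>R\<^esub> g x)"
  "a \<odot>\<^bsub>free_module R B\<^esub> f = (\<lambda>x. a \<otimes>\<^bsub>R\<^esub> f x)"
  by (simp_all add: free_module_def)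

lemma free_module_carrier:
  "f \<in> carrier (free_module R B) \<longleftrightarrow> (\<forall>x. f x \<in> carrier R) \<and> {x. f x \<noteq> \<zero>\<^bsub>R\<^esub>} \<subseteq> B \<and>
     finite {x. f x \<noteq> \<zero>\<^bsub>R\<^esub>}"
  by (auto simp: free_module_def)

context ring
begin

lemma free_module_left_module: "left_module R (free_module R B)"
proof -
  have fin2: "finite {x. f x \<oplus> g x \<noteq> \<zero>}"
    if "finite {x. f x \<noteq> \<zero>}" "finite {x. g x \<noteq> \<zero>}" for f g :: "'x \<Rightarrow> 'a"
    by (rule finite_subset[OF _ finite_UnI[OF that]]) auto
  have fin1: "finite {x. a \<otimes> f x \<noteq> \<zero>}" if "finite {x. f x \<noteq> \<zero>}" "a \<in> carrier R"
    for f :: "'x \<Rightarrow> 'a" and a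
    by (rule finite_subset[OF _ that(1)]) (use that in auto)
  interpret F: abelian_group "free_module R B"
  proof (rule abelian_groupI, goal_cases)
    case (1 f g)
    then have "f x \<oplus> g x = \<zero>" if "x \<notin> B" for x
      using that by (auto simp: free_module_def)
    with 1 show ?case using fin2[of f g] by (auto simp: free_module_def)
  next
    case (6 f)
    have "finite {x. \<ominus> f x \<noteq> \<zero>}"
      by (rule finite_subset[of _ "{x. f x \<noteq> \<zero>}"]) (use 6 in \<open>auto simp: free_module_def\<close>)
    then have "(\<lambda>x. \<ominus> f x) \<in> carrier (free_module R B)"
      using 6 by (auto simp: free_module_def)
    moreover have "(\<lambda>x. \<ominus> f x) \<oplus>\<^bsub>free_module R B\<^esub> f = \<zero>\<^bsub>free_module R B\<^esub>"
      using 6 by (auto simp: free_module_def l_neg)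
    ultimately show ?case by blast
  qed (auto simp: free_module_def a_ac)
  show ?thesis
  proof (unfold_locales, goal_cases)
    case (1 a f) then show ?case using fin1[of f a] by (auto simp: free_module_def)
  qed (auto simp: free_module_def l_distr r_distr m_assoc)
qed


definition unit_vec :: "'x \<Rightarrow> 'x \<Rightarrow> 'a" where
  "unit_vec b = (\<lambda>x. if x = b then \<one> else \<zero>)"

lemma unit_vec_carrier: "b \<in> B \<Longrightarrow> unit_vec b \<in> carrier (free_module R B)"
proof -
  have "finite {x. unit_vec b x \<noteq> \<zero>}"
    by (rule finite_subset[of _ "{b}"]) (auto simp: unit_vec_def)
  then show "b \<in> B \<Longrightarrow> ?thesis" by (auto simp: free_module_def unit_vec_def)
qed

end

lemma mod_homD:
  assumes "h \<in> mod_hom R M N"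
  shows "h \<in> extensional (carrier M)" "x \<in> carrier M \<Longrightarrow> h x \<in> carrier N"
    "x \<in> carrier M \<Longrightarrow> y \<in> carrier M \<Longrightarrow> h (x \<oplus>\<^bsub>M\<^esub> y) = h x \<oplus>\<^bsub>N\<^esub> h y"
    "a \<in> carrier R \<Longrightarrow> x \<in> carrier M \<Longrightarrow> h (a \<odot>\<^bsub>M\<^esub> x) = a \<odot>\<^bsub>N\<^esub> h x"
  using assms by (auto simp: mod_hom_def PiE_iff)

lemma mod_hom_compose:
  assumes "left_module R L" "h \<in> mod_hom R L M" "k \<in> mod_hom R M N"
  shows "compose (carrier L) k h \<in> mod_hom R L N"
proof -
  interpret left_module R L by fact
  show ?thesis
    using assms by (auto simp: mod_hom_def compose_def PiE_iff Pi_def)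
qed

lemma mod_hom_id: "left_module R M \<Longrightarrow> (\<lambda>x\<in>carrier M. x) \<in> mod_hom R M M"
proof -
  assume "left_module R M"
  then interpret left_module R M .
  show ?thesis by (auto simp: mod_hom_def)
qed

context left_module
begin

lemma smult_l_null: "x \<in> carrier M \<Longrightarrow> \<zero>\<^bsub>R\<^esub> \<odot>\<^bsub>M\<^esub> x = \<zero>\<^bsub>M\<^esub>"
  using smult_l_distr[of "\<zero>\<^bsub>R\<^esub>" "\<zero>\<^bsub>R\<^esub>" x] M.add.l_cancel_one[of "\<zero>\<^bsub>R\<^esub> \<odot>\<^bsub>M\<^esub> x" "\<zero>\<^bsub>R\<^esub> \<odot>\<^bsub>M\<^esub> x"] by simp

lemma smult_r_null: "a \<in> carrier R \<Longrightarrow> a \<odot>\<^bsub>M\<^esub> \<zero>\<^bsub>M\<^esub> = \<zero>\<^bsub>M\<^esub>"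
  using smult_r_distr[of a "\<zero>\<^bsub>M\<^esub>" "\<zero>\<^bsub>M\<^esub>"] M.add.l_cancel_one[of "a \<odot>\<^bsub>M\<^esub> \<zero>\<^bsub>M\<^esub>" "a \<odot>\<^bsub>M\<^esub> \<zero>\<^bsub>M\<^esub>"] by simp

lemma finsum_smult:
  assumes "finite T" "a \<in> carrier R" "g \<in> T \<rightarrow> carrier M"
  shows "a \<odot>\<^bsub>M\<^esub> (\<Oplus>\<^bsub>M\<^esub> i\<in>T. g i) = (\<Oplus>\<^bsub>M\<^esub> i\<in>T. a \<odot>\<^bsub>M\<^esub> g i)"
  using assms
proof (induction T)
  case empty then show ?case by (simp add: smult_r_null)
next
  case (insert x T) then show ?case by (simp add: Pi_def smult_r_distr)
qed

lemma lin_ext_superset: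
  assumes f: "f \<in> carrier (free_module R B)" and v: "v \<in> B \<rightarrow> carrier M"
    and T: "finite T" "{x. f x \<noteq> \<zero>\<^bsub>R\<^esub>} \<subseteq> T" "T \<subseteq> B"
  shows "lin_ext R B M v f = (\<Oplus>\<^bsub>M\<^esub> x\<in>T. f x \<odot>\<^bsub>M\<^esub> v x)"
proof -
  have fR: "f x \<in> carrier R" for x using f by (simp add: free_module_def)
  have vM: "x \<in> T \<Longrightarrow> v x \<in> carrier M" for x using v T by auto
  show ?thesis
    unfolding lin_ext_def using f
    by (simp, intro M.add.finprod_mono_neutral_cong_left)
       (use T fR vM in \<open>auto simp: smult_l_null\<close>)
qed

lemma lin_ext_hom:
  assumes v: "v \<in> B \<rightarrow> carrier M"
  shows "lin_ext R B M v \<in> mod_hom R (free_module R B) M"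
proof -
  interpret F: left_module R "free_module R B" by (rule R.free_module_left_module)
  have fR: "f x \<in> carrier R" if "f \<in> carrier (free_module R B)" for f x
    using that by (simp add: free_module_def)
  have clo: "lin_ext R B M v f \<in> carrier M" if f: "f \<in> carrier (free_module R B)" for f
  proof -
    have "(\<Oplus>\<^bsub>M\<^esub> x\<in>{x. f x \<noteq> \<zero>\<^bsub>R\<^esub>}. f x \<odot>\<^bsub>M\<^esub> v x) \<in> carrier M"
      using f v by (intro M.finsum_closed) (auto simp: free_module_carrier)
    then show ?thesis using f by (simp add: lin_ext_def)
  qed
  have add: "lin_ext R B M v (f \<oplus>\<^bsub>free_module R B\<^esub> g) = lin_ext R B M v f \<oplus>\<^bsub>M\<^esub> lin_ext R B M v g"
    if f: "f \<in> carrier (free_module R B)" and g: "g \<in> carrier (free_module R B)" for f g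
  proof -
    let ?T = "{x. f x \<noteq> \<zero>\<^bsub>R\<^esub>} \<union> {x. g x \<noteq> \<zero>\<^bsub>R\<^esub>}"
    have T: "finite ?T" "?T \<subseteq> B" using f g by (auto simp: free_module_carrier)
    have vM: "x \<in> ?T \<Longrightarrow> v x \<in> carrier M" for x using v T by blast
    have fg: "f \<oplus>\<^bsub>free_module R B\<^esub> g \<in> carrier (free_module R B)" using f g by blast
    have "lin_ext R B M v (f \<oplus>\<^bsub>free_module R B\<^esub> g)
        = (\<Oplus>\<^bsub>M\<^esub> x\<in>?T. (f x \<oplus>\<^bsub>R\<^esub> g x) \<odot>\<^bsub>M\<^esub> v x)"
      by (subst lin_ext_superset[OF fg v T(1) _ T(2)]) auto
    also have "\<dots> = (\<Oplus>\<^bsub>M\<^esub> x\<in>?T. f x \<odot>\<^bsub>M\<^esub> v x \<oplus>\<^bsub>M\<^esub> g x \<odot>\<^bsub>M\<^esub> v x)"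
      by (intro M.finsum_cong') (use fR[OF f] fR[OF g] vM in \<open>auto simp: smult_l_distr\<close>)
    also have "\<dots> = (\<Oplus>\<^bsub>M\<^esub> x\<in>?T. f x \<odot>\<^bsub>M\<^esub> v x) \<oplus>\<^bsub>M\<^esub> (\<Oplus>\<^bsub>M\<^esub> x\<in>?T. g x \<odot>\<^bsub>M\<^esub> v x)"
      by (intro M.finsum_addf) (use fR[OF f] fR[OF g] vM in auto)
    also have "(\<Oplus>\<^bsub>M\<^esub> x\<in>?T. f x \<odot>\<^bsub>M\<^esub> v x) = lin_ext R B M v f"
      by (rule lin_ext_superset[OF f v T(1) _ T(2), symmetric]) auto
    also have "(\<Oplus>\<^bsub>M\<^esub> x\<in>?T. g x \<odot>\<^bsub>M\<^esub> v x) = lin_ext R B M v g"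
      by (rule lin_ext_superset[OF g v T(1) _ T(2), symmetric]) auto
    finally show ?thesis .
  qed
  have smult: "lin_ext R B M v (a \<odot>\<^bsub>free_module R B\<^esub> f) = a \<odot>\<^bsub>M\<^esub> lin_ext R B M v f"
    if f: "f \<in> carrier (free_module R B)" and a: "a \<in> carrier R" for f a
  proof -
    let ?T = "{x. f x \<noteq> \<zero>\<^bsub>R\<^esub>}"
    have T: "finite ?T" "?T \<subseteq> B" using f by (auto simp: free_module_carrier)
    have vM: "x \<in> ?T \<Longrightarrow> v x \<in> carrier M" for x using v T by blast
    have af: "a \<odot>\<^bsub>free_module R B\<^esub> f \<in> carrier (free_module R B)" using f a by blast
    have "lin_ext R B M v (a \<odot>\<^bsub>free_module R B\<^esub> f) = (\<Oplus>\<^bsub>M\<^esub> x\<in>?T. (a \<otimes>\<^bsub>R\<^esub> f x) \<odot>\<^bsub>M\<^esub> v x)"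
      by (subst lin_ext_superset[OF af v T(1) _ T(2)]) (use a in auto)
    also have "\<dots> = (\<Oplus>\<^bsub>M\<^esub> x\<in>?T. a \<odot>\<^bsub>M\<^esub> (f x \<odot>\<^bsub>M\<^esub> v x))"
      by (intro M.finsum_cong') (use fR[OF f] vM a in \<open>auto simp: smult_assoc1\<close>)
    also have "\<dots> = a \<odot>\<^bsub>M\<^esub> (\<Oplus>\<^bsub>M\<^esub> x\<in>?T. f x \<odot>\<^bsub>M\<^esub> v x)"
      by (rule finsum_smult[symmetric]) (use T fR[OF f] vM a in auto)
    also have "(\<Oplus>\<^bsub>M\<^esub> x\<in>?T. f x \<odot>\<^bsub>M\<^esub> v x) = lin_ext R B M v f"
      using f by (simp add: lin_ext_def)
    finally show ?thesis .
  qed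
  have "lin_ext R B M v \<in> extensional (carrier (free_module R B))"
    unfolding lin_ext_def by (rule restrict_extensional)
  then show ?thesis
    unfolding mod_hom_def using clo add smult by (simp add: PiE_iff)
qed

lemma lin_ext_unit_vec:
  assumes v: "v \<in> B \<rightarrow> carrier M" and b: "b \<in> B"
  shows "lin_ext R B M v (R.unit_vec b) = v b"
proof -
  have vb: "v b \<in> carrier M" using v b by blast
  have "lin_ext R B M v (R.unit_vec b) = (\<Oplus>\<^bsub>M\<^esub> x\<in>{b}. R.unit_vec b x \<odot>\<^bsub>M\<^esub> v x)"
    by (rule lin_ext_superset[OF R.unit_vec_carrier[OF b] v]) (use b in \<open>auto simp: R.unit_vec_def\<close>)
  also have "\<dots> = v b"
    using vb by (subst M.finsum_insert) (auto simp: R.unit_vec_def)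
  finally show ?thesis .
qed

lemma free_hom_eq_lin_ext:
  assumes h: "h \<in> mod_hom R (free_module R B) M" and f: "f \<in> carrier (free_module R B)"
  shows "h f = lin_ext R B M (\<lambda>b. h (R.unit_vec b)) f"
proof -
  interpret F: left_module R "free_module R B" by (rule R.free_module_left_module)
  have hz: "h (\<lambda>x. \<zero>\<^bsub>R\<^esub>) = \<zero>\<^bsub>M\<^esub>"
  proof -
    have z: "(\<lambda>x. \<zero>\<^bsub>R\<^esub>) \<in> carrier (free_module R B)" using F.zero_closed by simp
    have "h (\<zero>\<^bsub>R\<^esub> \<odot>\<^bsub>free_module R B\<^esub> (\<lambda>x. \<zero>\<^bsub>R\<^esub>)) = \<zero>\<^bsub>R\<^esub> \<odot>\<^bsub>M\<^esub> h (\<lambda>x. \<zero>\<^bsub>R\<^esub>)"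
      by (rule mod_homD(4)[OF h]) (use z in auto)
    then show ?thesis using smult_l_null[OF mod_homD(2)[OF h z]] by simp
  qed
  have hM: "b \<in> B \<Longrightarrow> h (R.unit_vec b) \<in> carrier M" for b
    by (rule mod_homD(2)[OF h R.unit_vec_carrier])
  have main: "h f = (\<Oplus>\<^bsub>M\<^esub> x\<in>T. f x \<odot>\<^bsub>M\<^esub> h (R.unit_vec x))"
    if "finite T" "T \<subseteq> B" "f \<in> carrier (free_module R B)" "{x. f x \<noteq> \<zero>\<^bsub>R\<^esub>} \<subseteq> T" for T f
    using that
  proof (induction T arbitrary: f)
    case empty
    then have "f = (\<lambda>x. \<zero>\<^bsub>R\<^esub>)" by auto
    then show ?case using hz by simp
  next
    case (insert b T)
    let ?g = "f(b := \<zero>\<^bsub>R\<^esub>)"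
    have fR: "f x \<in> carrier R" for x using insert.prems by (simp add: free_module_def)
    have "finite {x. ?g x \<noteq> \<zero>\<^bsub>R\<^esub>}"
      by (rule finite_subset[of _ "{x. f x \<noteq> \<zero>\<^bsub>R\<^esub>}"])
         (use insert.prems in \<open>auto simp: free_module_def\<close>)
    then have g: "?g \<in> carrier (free_module R B)"
      using insert.prems by (auto simp: free_module_def)
    have b: "R.unit_vec b \<in> carrier (free_module R B)"
      using insert.prems by (intro R.unit_vec_carrier) auto
    have split: "f = ?g \<oplus>\<^bsub>free_module R B\<^esub> (f b \<odot>\<^bsub>free_module R B\<^esub> R.unit_vec b)"
      using fR by (auto simp: R.unit_vec_def)
    have fb: "f b \<odot>\<^bsub>free_module R B\<^esub> R.unit_vec b \<in> carrier (free_module R B)"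
      using fR b by blast
    have "h f = h ?g \<oplus>\<^bsub>M\<^esub> f b \<odot>\<^bsub>M\<^esub> h (R.unit_vec b)"
      by (subst split) (simp only: mod_homD(3)[OF h g fb] mod_homD(4)[OF h fR b])
    also have "h ?g = (\<Oplus>\<^bsub>M\<^esub> x\<in>T. ?g x \<odot>\<^bsub>M\<^esub> h (R.unit_vec x))"
    proof (rule insert.IH)
      show "T \<subseteq> B" using insert.prems by blast
      show "{x. ?g x \<noteq> \<zero>\<^bsub>R\<^esub>} \<subseteq> T" using insert.prems by auto
    qed (rule g)
    also have "\<dots> = (\<Oplus>\<^bsub>M\<^esub> x\<in>T. f x \<odot>\<^bsub>M\<^esub> h (R.unit_vec x))"
      by (intro M.finsum_cong') (use insert.hyps insert.prems fR hM in auto)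
    finally have "h f = (\<Oplus>\<^bsub>M\<^esub> x\<in>T. f x \<odot>\<^bsub>M\<^esub> h (R.unit_vec x)) \<oplus>\<^bsub>M\<^esub> f b \<odot>\<^bsub>M\<^esub> h (R.unit_vec b)" .
    also have "\<dots> = f b \<odot>\<^bsub>M\<^esub> h (R.unit_vec b) \<oplus>\<^bsub>M\<^esub> (\<Oplus>\<^bsub>M\<^esub> x\<in>T. f x \<odot>\<^bsub>M\<^esub> h (R.unit_vec x))"
      by (rule M.a_comm) (use insert.prems fR hM in \<open>auto intro!: M.finsum_closed\<close>)
    also have "\<dots> = (\<Oplus>\<^bsub>M\<^esub> x\<in>insert b T. f x \<odot>\<^bsub>M\<^esub> h (R.unit_vec x))"
      by (rule M.finsum_insert[symmetric]) (use insert.hyps insert.prems fR hM in auto)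
    finally show ?case .
  qed
  show ?thesis
    using main[of "{x. f x \<noteq> \<zero>\<^bsub>R\<^esub>}" f] f
    by (auto simp: lin_ext_def free_module_carrier)
qed

lemma free_hom_eqI:
  assumes "h \<in> mod_hom R (free_module R B) M" "k \<in> mod_hom R (free_module R B) M"
    and eq: "\<And>b. b \<in> B \<Longrightarrow> h (R.unit_vec b) = k (R.unit_vec b)"
    and f: "f \<in> carrier (free_module R B)"
  shows "h f = k f"
proof -
  have "lin_ext R B M (\<lambda>b. h (R.unit_vec b)) f = lin_ext R B M (\<lambda>b. k (R.unit_vec b)) f"
  proof -
    have "(\<Oplus>\<^bsub>M\<^esub> x\<in>{x. f x \<noteq> \<zero>\<^bsub>R\<^esub>}. f x \<odot>\<^bsub>M\<^esub> h (R.unit_vec x))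
        = (\<Oplus>\<^bsub>M\<^esub> x\<in>{x. f x \<noteq> \<zero>\<^bsub>R\<^esub>}. f x \<odot>\<^bsub>M\<^esub> k (R.unit_vec x))"
    proof (intro M.finsum_cong')
      show "(\<lambda>x. f x \<odot>\<^bsub>M\<^esub> k (R.unit_vec x)) \<in> {x. f x \<noteq> \<zero>\<^bsub>R\<^esub>} \<rightarrow> carrier M"
        using f mod_homD(2)[OF assms(2) R.unit_vec_carrier] by (auto simp: free_module_carrier)
    qed (use f eq in \<open>auto simp: free_module_carrier\<close>)
    then show ?thesis using f by (simp add: lin_ext_def)
  qed
  then show ?thesis
    using free_hom_eq_lin_ext[OF assms(1) f] free_hom_eq_lin_ext[OF assms(2) f] by simp
qed

end

lemma free_module_lifting:
  assumes N: "left_module R N" and N': "left_module R N'"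
    and p: "p \<in> mod_hom R N N'" and surj: "p ` carrier N = carrier N'"
    and g: "g \<in> mod_hom R (free_module R B) N'"
  shows "\<exists>h \<in> mod_hom R (free_module R B) N. \<forall>f\<in>carrier (free_module R B). p (h f) = g f"
proof -
  interpret N: left_module R N by fact
  interpret N': left_module R N' by fact
  note F = N.R.free_module_left_module[of B]
  have "\<exists>y\<in>carrier N. p y = g (N.R.unit_vec b)" if "b \<in> B" for b
    using surj mod_homD(2)[OF g N.R.unit_vec_carrier[OF that]] by (metis imageE)
  then obtain v where v: "\<And>b. b \<in> B \<Longrightarrow> v b \<in> carrier N \<and> p (v b) = g (N.R.unit_vec b)"
    by metis
  then have vN: "v \<in> B \<rightarrow> carrier N" by auto
  let ?h = "lin_ext R B N v"
  have h: "?h \<in> mod_hom R (free_module R B) N" by (rule N.lin_ext_hom[OF vN])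
  have "p (?h f) = g f" if f: "f \<in> carrier (free_module R B)" for f
  proof -
    have "compose (carrier (free_module R B)) p ?h f = g f"
    proof (rule N'.free_hom_eqI[OF mod_hom_compose[OF F h p] g _ f])
      fix b assume b: "b \<in> B"
      then show "compose (carrier (free_module R B)) p ?h (N.R.unit_vec b) = g (N.R.unit_vec b)"
        using v[OF b] N.lin_ext_unit_vec[OF vN b] N.R.unit_vec_carrier[OF b]
        by (simp add: compose_def)
    qed
    then show ?thesis using f by (simp add: compose_def)
  qed
  then show ?thesis using h by blast
qed

lemma projective_module_lifting:
  fixes P :: "('r, 'm, 'f) module_scheme"
  assumes P: "projective_module R P"
    and N: "left_module R N" and N': "left_module R N'"
    and p: "p \<in> mod_hom R N N'" and surj: "p ` carrier N = carrier N'"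
    and g: "g \<in> mod_hom R P N'"
  shows "\<exists>h \<in> mod_hom R P N. \<forall>x\<in>carrier P. p (h x) = g x"
proof -
  interpret N: left_module R N by fact
  from P obtain B :: "'m set" and \<iota> \<pi> where PM: "left_module R P"
    and i: "\<iota> \<in> mod_hom R P (free_module R B)" and pi: "\<pi> \<in> mod_hom R (free_module R B) P"
    and ret: "\<forall>p\<in>carrier P. \<pi> (\<iota> p) = p"
    unfolding projective_module_def by blast
  note F = N.R.free_module_left_module[of B]
  obtain h where h: "h \<in> mod_hom R (free_module R B) N"
    and hl: "\<forall>f\<in>carrier (free_module R B). p (h f) = compose (carrier (free_module R B)) g \<pi> f"
    using free_module_lifting[OF N N' p surj mod_hom_compose[OF F pi g]] by blast
  have "compose (carrier P) h \<iota> \<in> mod_hom R P N" by (rule mod_hom_compose[OF PM i h])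
  moreover have "\<forall>x\<in>carrier P. p (compose (carrier P) h \<iota> x) = g x"
    using hl ret mod_homD(2)[OF i] by (simp add: compose_def)
  ultimately show ?thesis by blast
qed

lemma projective_moduleI:
  fixes P :: "('r, 'm, 'f) module_scheme"
  assumes P: "left_module R P"
    and lift: "\<And>p. p \<in> mod_hom R (free_module R (carrier P)) P \<Longrightarrow>
      p ` carrier (free_module R (carrier P)) = carrier P \<Longrightarrow>
      \<exists>h \<in> mod_hom R P (free_module R (carrier P)). \<forall>x\<in>carrier P. p (h x) = x"
  shows "projective_module R P"
proof -
  interpret P: left_module R P by fact
  let ?p = "lin_ext R (carrier P) P (\<lambda>x. x)"
  have p: "?p \<in> mod_hom R (free_module R (carrier P)) P" by (rule P.lin_ext_hom) auto
  have "x \<in> ?p ` carrier (free_module R (carrier P))" if x: "x \<in> carrier P" for x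
    by (rule image_eqI[of _ _ "P.R.unit_vec x"])
       (use P.lin_ext_unit_vec[of "\<lambda>x. x", OF _ x] P.R.unit_vec_carrier[OF x] in auto)
  then have "?p ` carrier (free_module R (carrier P)) = carrier P"
    using mod_homD(2)[OF p] by blast
  from lift[OF p this] show ?thesis
    unfolding projective_module_def using P p by blast
qed

lemma (in ring) projective_free_module: "projective_module R (free_module R B)"
proof (rule projective_moduleI)
  show F: "left_module R (free_module R B)" by (rule free_module_left_module)
  fix p assume p: "p \<in> mod_hom R (free_module R (carrier (free_module R B))) (free_module R B)"
    and surj: "p ` carrier (free_module R (carrier (free_module R B))) = carrier (free_module R B)"
  from free_module_lifting[OF free_module_left_module F p surj mod_hom_id[OF F]]
  show "\<exists>h\<in>mod_hom R (free_module R B) (free_module R (carrier (free_module R B))).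
      \<forall>x\<in>carrier (free_module R B). p (h x) = x" by auto
qed

lemma inj_on_syz_name: "inj_on (syz_name R) (carrier (free_module R B))"
proof (rule inj_onI)
  fix f g assume f: "f \<in> carrier (free_module R B)" and g: "g \<in> carrier (free_module R B)"
    and eq: "syz_name R f = syz_name R g"
  have fin: "finite {(x, f x) | x. f x \<noteq> \<zero>\<^bsub>R\<^esub>}" if "f \<in> carrier (free_module R B)" for f
  proof -
    have "{(x, f x) | x. f x \<noteq> \<zero>\<^bsub>R\<^esub>} = (\<lambda>x. (x, f x)) ` {x. f x \<noteq> \<zero>\<^bsub>R\<^esub>}" by auto
    then show ?thesis using that by (simp add: free_module_def)
  qed
  have "{(x, f x) | x. f x \<noteq> \<zero>\<^bsub>R\<^esub>} = {(x, g x) | x. g x \<noteq> \<zero>\<^bsub>R\<^esub>}" (is "?F = ?G")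
    using eq fin[OF f] fin[OF g] by (simp add: syz_name_def Abs_fset_inject)
  then have *: "(x, y) \<in> ?F \<longleftrightarrow> (x, y) \<in> ?G" for x y by simp
  show "f = g"
  proof
    fix x
    show "f x = g x" using *[of x "f x"] *[of x "g x"] by auto
  qed
qed

lemma (in ring) syz_map_free:
  assumes S: "S \<subseteq> carrier (free_module R B)"
  shows "syz_map R S = lin_ext R (syz_name R ` S) (free_module R B) (inv_into S (syz_name R))"
proof -
  interpret F: left_module R "free_module R B" by (rule free_module_left_module)
  interpret U: left_module R "free_module R UNIV" by (rule free_module_left_module)
  have sub: "x \<in> carrier (free_module R B) \<Longrightarrow> x \<in> carrier (free_module R UNIV)" for x
    by (simp add: free_module_def)
  have fs: "finsum (free_module R UNIV) h T = finsum (free_module R B) h T"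
    if "finite T" "h \<in> T \<rightarrow> carrier (free_module R B)" for h and T :: "'z set"
    using that
  proof (induction T)
    case (insert x T)
    then have "h \<in> T \<rightarrow> carrier (free_module R UNIV)" "h x \<in> carrier (free_module R UNIV)"
      using sub by auto
    with insert show ?case by (simp add: Pi_def)
  qed simp
  show ?thesis
    unfolding syz_map_def lin_ext_def
  proof (rule restrict_ext)
    fix f assume f: "f \<in> carrier (free_module R (syz_name R ` S))"
    have "(\<lambda>x. f x \<odot>\<^bsub>free_module R B\<^esub> inv_into S (syz_name R) x) \<in> {x. f x \<noteq> \<zero>} \<rightarrow> carrier (free_module R B)"
    proof (intro Pi_I F.smult_closed)
      fix x assume "x \<in> {x. f x \<noteq> \<zero>}"
      then have "x \<in> syz_name R ` S" using f by (auto simp: free_module_carrier)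
      then show "inv_into S (syz_name R) x \<in> carrier (free_module R B)"
        using S inv_into_into by (metis subsetD)
      show "f x \<in> carrier R" using f by (simp add: free_module_def)
    qed
    then show "(\<Oplus>\<^bsub>free_module R UNIV\<^esub>x\<in>{x. f x \<noteq> \<zero>}. f x \<odot>\<^bsub>free_module R UNIV\<^esub> inv_into S (syz_name R) x) =
         (\<Oplus>\<^bsub>free_module R B\<^esub>x\<in>{x. f x \<noteq> \<zero>}. f x \<odot>\<^bsub>free_module R B\<^esub> inv_into S (syz_name R) x)"
      using fs[of "{x. f x \<noteq> \<zero>}"] f by (simp add: free_module_carrier)
  qed
qed

lemma syz_map_kernel:
  assumes N: "left_module R N" and k: "k \<in> mod_hom R (free_module R B) N"
    and S: "S = {f \<in> carrier (free_module R B). k f = \<zero>\<^bsub>N\<^esub>}"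
  shows "syz_map R S \<in> mod_hom R (free_module R (syz_name R ` S)) (free_module R B)"
    and "syz_map R S ` carrier (free_module R (syz_name R ` S)) = S"
proof -
  interpret N: left_module R N by fact
  interpret F: left_module R "free_module R B" by (rule N.R.free_module_left_module)
  let ?F' = "free_module R (syz_name R ` S)"
  note F' = N.R.free_module_left_module[of "syz_name R ` S"]
  have SF: "S \<subseteq> carrier (free_module R B)" using S by auto
  have inj: "inj_on (syz_name R) S" by (rule inj_on_subset[OF inj_on_syz_name SF])
  let ?v = "inv_into S (syz_name R)"
  have v: "?v \<in> syz_name R ` S \<rightarrow> carrier (free_module R B)"
    using SF by (auto simp: inv_into_f_f[OF inj])
  note eq = N.R.syz_map_free[OF SF]
  show hom: "syz_map R S \<in> mod_hom R ?F' (free_module R B)"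
    unfolding eq by (rule F.lin_ext_hom[OF v])
  have unit: "syz_map R S (N.R.unit_vec (syz_name R s)) = s" if "s \<in> S" for s
    unfolding eq using F.lin_ext_unit_vec[OF v, of "syz_name R s"] that inj by simp
  have zero: "(\<lambda>x\<in>carrier ?F'. \<zero>\<^bsub>N\<^esub>) \<in> mod_hom R ?F' N"
  proof -
    interpret F': left_module R ?F' by (rule F')
    show ?thesis
      unfolding mod_hom_def
      using N.smult_r_null F'.M.a_closed F'.smult_closed by (auto simp del: free_module_simps)
  qed
  have "syz_map R S f \<in> S" if f: "f \<in> carrier ?F'" for f
  proof -
    have "compose (carrier ?F') k (syz_map R S) f = (\<lambda>x\<in>carrier ?F'. \<zero>\<^bsub>N\<^esub>) f"
    proof (rule N.free_hom_eqI[OF mod_hom_compose[OF F' hom k] zero _ f])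
      fix b assume b: "b \<in> syz_name R ` S"
      then show "compose (carrier ?F') k (syz_map R S) (N.R.unit_vec b) = (\<lambda>x\<in>carrier ?F'. \<zero>\<^bsub>N\<^esub>) (N.R.unit_vec b)"
        using N.R.unit_vec_carrier[OF b] unit S by (auto simp: compose_def)
    qed
    then show ?thesis using f mod_homD(2)[OF hom f] S by (simp add: compose_def)
  qed
  moreover have "s \<in> syz_map R S ` carrier ?F'" if "s \<in> S" for s
    by (rule image_eqI[of _ _ "N.R.unit_vec (syz_name R s)"])
       (use unit[OF that] N.R.unit_vec_carrier[of "syz_name R s"] that in auto)
  ultimately show "syz_map R S ` carrier ?F' = S" by blast
qed

theorem std_projective_resolution:
  fixes R :: "('r, 'e) ring_scheme" and M :: "('r, 'm, 'f) module_scheme"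
  assumes M: "left_module R M"
  shows "projective_resolution R M (std_mod R M) (std_diff R M) (std_aug R M)"
proof -
  interpret M: left_module R M by fact
  let ?Gen = "Gen :: 'm \<Rightarrow> ('r, 'm) std_basis"
  have inj: "inj_on ?Gen (carrier M)" by (simp add: inj_on_def)
  have v: "inv_into (carrier M) ?Gen \<in> ?Gen ` carrier M \<rightarrow> carrier M"
    by (auto simp: inv_into_f_f[OF inj])
  have aug: "std_aug R M \<in> mod_hom R (std_mod R M 0) M"
    unfolding std_aug_def by (simp add: M.lin_ext_hom[OF v])
  have "m \<in> std_aug R M ` carrier (std_mod R M 0)" if m: "m \<in> carrier M" for m
    by (rule image_eqI[of _ _ "M.R.unit_vec (?Gen m)"])
       (use M.lin_ext_unit_vec[OF v, of "?Gen m"] m inv_into_f_f[OF inj m] M.R.unit_vec_carrier[of "?Gen m" "?Gen ` carrier M"]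
        in \<open>auto simp: std_aug_def\<close>)
  then have surj: "std_aug R M ` carrier (std_mod R M 0) = carrier M"
    using mod_homD(2)[OF aug] by blast
  have free: "\<exists>B. std_mod R M n = free_module R B" for n
    by (cases n) auto
  have lm: "left_module R (std_mod R M n)" for n
    using free[of n] M.R.free_module_left_module by metis
  have step: "std_diff R M n \<in> mod_hom R (std_mod R M (Suc n)) (std_mod R M n) \<and>
      std_diff R M n ` carrier (std_mod R M (Suc n)) = std_syz R M n" for n
  proof (induction n)
    case 0
    then show ?case
      using syz_map_kernel[of R M "std_aug R M" "Gen ` carrier M" "std_syz R M 0"] aug M
      by (simp add: std_diff_def)
  next
    case (Suc n)
    have "std_syz R M (Suc n) = {f \<in> carrier (std_mod R M (Suc n)).
        std_diff R M n f = \<zero>\<^bsub>std_mod R M n\<^esub>}"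
      using free[of n] by (auto simp: std_diff_def)
    with Suc show ?case
      using syz_map_kernel[of R "std_mod R M n" "std_diff R M n" "syz_name R ` std_syz R M n" "std_syz R M (Suc n)"] lm[of n]
      by (simp add: std_diff_def)
  qed
  have ker: "std_syz R M (Suc n) = {x \<in> carrier (std_mod R M (Suc n)). std_diff R M n x = \<zero>\<^bsub>std_mod R M n\<^esub>}" for n
    using free[of n] by (auto simp: std_diff_def)
  have proj: "projective_module R (std_mod R M n)" for n
    using free[of n] M.R.projective_free_module by metis
  show ?thesis
    unfolding projective_resolution_def
    using proj step aug surj ker by (auto simp del: std_syz.simps(2) std_mod.simps(2)) 
qed


section \<open>Projective and finitistic dimension\<close>

text \<open>
  Resolutions are taken inside the type of the standard resolution. This loses nothing: if \<open>M\<close> has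
  a projective resolution of length \<open>n\<close> in any type, then by Schanuel's lemma
  \<open>0 \<rightarrow> std_syz R M (n - 1) \<rightarrow> std_mod R M (n - 1) \<rightarrow> \<cdots> \<rightarrow> std_mod R M 0 \<rightarrow> M \<rightarrow> 0\<close> is one
  (and for \<open>n = 0\<close> the projective module \<open>M\<close> is isomorphic to a submodule of \<open>std_mod R M 0\<close>).
\<close>

definition proj_dim :: "('r, 'e) ring_scheme \<Rightarrow> ('r, 'm, 'f) module_scheme \<Rightarrow> enat" where
  "proj_dim R M = Inf {enat n | n.
     \<exists>(P :: nat \<Rightarrow> ('r, ('r, 'm) std_basis \<Rightarrow> 'r) module) d \<epsilon>.
       projective_resolution R M P d \<epsilon> \<and> (\<forall>i>n. carrier (P i) = {\<zero>\<^bsub>P i\<^esub>})}"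

text \<open>
  The supremum runs over the finitely generated modules, i.e. over the finite-dimensional ones when
  \<open>R\<close> is a finite-dimensional algebra. Every finitely generated module is isomorphic to one whose
  elements lie in the type \<open>nat \<Rightarrow> 'r\<close>: it is a quotient of some free module \<open>R ^ n\<close>, and cosets can
  be represented by elements.
\<close>

definition fin_dim :: "('r, 'e) ring_scheme \<Rightarrow> enat" where
  "fin_dim R = Sup {proj_dim R V | V :: ('r, nat \<Rightarrow> 'r) module.
     left_module R V \<and> finitely_generated R V \<and> indecomposable R V \<and> proj_dim R V < \<infinity>}"


section \<open>Ext groups and the Yoneda product\<close>

definition hom_group :: "('r, 'e) ring_scheme \<Rightarrow> ('r, 'm, 'f) module_scheme \<Rightarrow>
    ('r, 'n, 'g) module_scheme \<Rightarrow> ('m \<Rightarrow> 'n) monoid" where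
  "hom_group R M N = \<lparr>carrier = mod_hom R M N,
     monoid.mult = (\<lambda>f g. \<lambda>x\<in>carrier M. f x \<oplus>\<^bsub>N\<^esub> g x), one = (\<lambda>x\<in>carrier M. \<zero>\<^bsub>N\<^esub>)\<rparr>"

definition cocycles :: "('r, 'e) ring_scheme \<Rightarrow> ('r, 'm, 'f) module_scheme \<Rightarrow>
    ('r, 'n, 'g) module_scheme \<Rightarrow> nat \<Rightarrow> ((('r, 'm) std_basis \<Rightarrow> 'r) \<Rightarrow> 'n) set" where
  "cocycles R M N i = {f \<in> mod_hom R (std_mod R M i) N.
     \<forall>x\<in>carrier (std_mod R M (Suc i)). f (std_diff R M i x) = \<zero>\<^bsub>N\<^esub>}"

primrec coboundaries :: "('r, 'e) ring_scheme \<Rightarrow> ('r, 'm, 'f) module_scheme \<Rightarrow>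
    ('r, 'n, 'g) module_scheme \<Rightarrow> nat \<Rightarrow> ((('r, 'm) std_basis \<Rightarrow> 'r) \<Rightarrow> 'n) set" where
  "coboundaries R M N 0 = {\<lambda>x\<in>carrier (std_mod R M 0). \<zero>\<^bsub>N\<^esub>}"
| "coboundaries R M N (Suc i) =
     (\<lambda>h. compose (carrier (std_mod R M (Suc i))) h (std_diff R M i)) ` mod_hom R (std_mod R M i) N"

text \<open>The \<open>i\<close>-th cohomology group of the complex \<open>Hom (std_mod R M *, N)\<close>.\<close>

definition Ext :: "('r, 'e) ring_scheme \<Rightarrow> ('r, 'm, 'f) module_scheme \<Rightarrow>
    ('r, 'n, 'g) module_scheme \<Rightarrow> nat \<Rightarrow> ((('r, 'm) std_basis \<Rightarrow> 'r) \<Rightarrow> 'n) set monoid" where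
  "Ext R M N i = (hom_group R (std_mod R M i) N)\<lparr>carrier := cocycles R M N i\<rparr> Mod coboundaries R M N i"

definition ext_class :: "('r, 'e) ring_scheme \<Rightarrow> ('r, 'm, 'f) module_scheme \<Rightarrow>
    ('r, 'n, 'g) module_scheme \<Rightarrow> nat \<Rightarrow> ((('r, 'm) std_basis \<Rightarrow> 'r) \<Rightarrow> 'n) \<Rightarrow>
    ((('r, 'm) std_basis \<Rightarrow> 'r) \<Rightarrow> 'n) set" where
  "ext_class R M N i f = coboundaries R M N i #>\<^bsub>hom_group R (std_mod R M i) N\<^esub> f"

text \<open>\<open>\<phi>\<close> is a chain map \<open>std_mod R L (i + *) \<rightarrow> std_mod R M *\<close> lifting \<open>f : std_mod R L i \<rightarrow> M\<close>.\<close>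

definition chain_lift :: "('r, 'e) ring_scheme \<Rightarrow> ('r, 'l, 'f) module_scheme \<Rightarrow>
    ('r, 'm, 'g) module_scheme \<Rightarrow> nat \<Rightarrow> ((('r, 'l) std_basis \<Rightarrow> 'r) \<Rightarrow> 'm) \<Rightarrow>
    (nat \<Rightarrow> (('r, 'l) std_basis \<Rightarrow> 'r) \<Rightarrow> (('r, 'm) std_basis \<Rightarrow> 'r)) \<Rightarrow> bool" where
  "chain_lift R L M i f \<phi> \<longleftrightarrow>
     (\<forall>j. \<phi> j \<in> mod_hom R (std_mod R L (i + j)) (std_mod R M j)) \<and>
     (\<forall>x\<in>carrier (std_mod R L i). std_aug R M (\<phi> 0 x) = f x) \<and>
     (\<forall>j. \<forall>x\<in>carrier (std_mod R L (i + Suc j)).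
        std_diff R M j (\<phi> (Suc j) x) = \<phi> j (std_diff R L (i + j) x))"

text \<open>
  The Yoneda product \<open>Ext\<^sup>j(M,N) \<times> Ext\<^sup>i(L,M) \<rightarrow> Ext\<^bsup>i+j\<^esup>(L,N)\<close>, first \<open>F\<close>, then \<open>G\<close>: the class of
  \<open>g \<circ> \<phi> j\<close> for representatives \<open>f\<close>, \<open>g\<close> and a lift \<open>\<phi>\<close> of \<open>f\<close>. By the comparison theorem the
  class does not depend on these choices.
\<close>

definition yoneda :: "('r, 'e) ring_scheme \<Rightarrow> ('r, 'l, 'f) module_scheme \<Rightarrow>
    ('r, 'm, 'g) module_scheme \<Rightarrow> ('r, 'n, 'h) module_scheme \<Rightarrow> nat \<Rightarrow> nat \<Rightarrow>
    ((('r, 'm) std_basis \<Rightarrow> 'r) \<Rightarrow> 'n) set \<Rightarrow> ((('r, 'l) std_basis \<Rightarrow> 'r) \<Rightarrow> 'm) set \<Rightarrow>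
    ((('r, 'l) std_basis \<Rightarrow> 'r) \<Rightarrow> 'n) set" where
  "yoneda R L M N j i G F = (SOME C. \<exists>g\<in>G. \<exists>f\<in>F. \<exists>\<phi>. chain_lift R L M i f \<phi> \<and>
     C = ext_class R L N (i + j) (compose (carrier (std_mod R L (i + j))) g (\<phi> j)))"

text \<open>\<open>Ext\<^sup>j(M,N) \<cdot> Ext\<^sup>i(L,M)\<close>: all finite sums of products.\<close>

definition ext_prod :: "('r, 'e) ring_scheme \<Rightarrow> ('r, 'l, 'f) module_scheme \<Rightarrow>
    ('r, 'm, 'g) module_scheme \<Rightarrow> ('r, 'n, 'h) module_scheme \<Rightarrow> nat \<Rightarrow> nat \<Rightarrow>
    ((('r, 'l) std_basis \<Rightarrow> 'r) \<Rightarrow> 'n) set set" where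
  "ext_prod R L M N j i = generate (Ext R L N (i + j))
     {yoneda R L M N j i G F | G F. G \<in> carrier (Ext R M N j) \<and> F \<in> carrier (Ext R L M i)}"


section \<open>Graded algebras and modules\<close>

definition homogeneous_parts ::
  "('m, 'f) ring_scheme \<Rightarrow> (nat \<Rightarrow> 'm set) \<Rightarrow> 'm \<Rightarrow> (nat \<Rightarrow> 'm) \<Rightarrow> bool" where
  "homogeneous_parts G V x c \<longleftrightarrow> (\<forall>i. c i \<in> V i) \<and> finite {i. c i \<noteq> \<zero>\<^bsub>G\<^esub>} \<and>
     x = (\<Oplus>\<^bsub>G\<^esub> i\<in>{i. c i \<noteq> \<zero>\<^bsub>G\<^esub>}. c i)"

definition direct_sum_decomposition :: "('m, 'f) ring_scheme \<Rightarrow> (nat \<Rightarrow> 'm set) \<Rightarrow> bool" where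
  "direct_sum_decomposition G V \<longleftrightarrow> (\<forall>i. subgroup (V i) (add_monoid G)) \<and>
     (\<forall>x\<in>carrier G. \<exists>!c. homogeneous_parts G V x c)"

definition homogeneous_part :: "('m, 'f) ring_scheme \<Rightarrow> (nat \<Rightarrow> 'm set) \<Rightarrow> nat \<Rightarrow> 'm \<Rightarrow> 'm" where
  "homogeneous_part G V i x = (THE c. homogeneous_parts G V x c) i"

text \<open>\<open>U \<cdot> V\<close>: all finite sums of products \<open>u \<cdot> v\<close>.\<close>

definition span_prod :: "('r, 'm, 'f) module_scheme \<Rightarrow> 'r set \<Rightarrow> 'm set \<Rightarrow> 'm set" where
  "span_prod M U V = generate (add_monoid M) {u \<odot>\<^bsub>M\<^esub> v | u v. u \<in> U \<and> v \<in> V}"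

text \<open>The field \<open>smult\<close> of \<open>A\<close> is the action of the ground field \<open>K\<close>.\<close>

definition graded_algebra ::
  "('k, 'e) ring_scheme \<Rightarrow> ('k, 'a) module \<Rightarrow> (nat \<Rightarrow> 'a set) \<Rightarrow> bool" where
  "graded_algebra K A \<A> \<longleftrightarrow> ring A \<and> module K A \<and>
     (\<forall>c\<in>carrier K. \<forall>a\<in>carrier A. \<forall>b\<in>carrier A.
        (c \<odot>\<^bsub>A\<^esub> a) \<otimes>\<^bsub>A\<^esub> b = c \<odot>\<^bsub>A\<^esub> (a \<otimes>\<^bsub>A\<^esub> b) \<and> a \<otimes>\<^bsub>A\<^esub> (c \<odot>\<^bsub>A\<^esub> b) = c \<odot>\<^bsub>A\<^esub> (a \<otimes>\<^bsub>A\<^esub> b)) \<and>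
     direct_sum_decomposition A \<A> \<and> (\<forall>i. submodule (\<A> i) K A) \<and>
     \<one>\<^bsub>A\<^esub> \<in> \<A> 0 \<and> (\<forall>i j. \<forall>a\<in>\<A> i. \<forall>b\<in>\<A> j. a \<otimes>\<^bsub>A\<^esub> b \<in> \<A> (i + j))"

definition locally_finite_algebra ::
  "('k, 'e) ring_scheme \<Rightarrow> ('k, 'a) module \<Rightarrow> (nat \<Rightarrow> 'a set) \<Rightarrow> bool" where
  "locally_finite_algebra K A \<A> \<longleftrightarrow> (\<forall>i. finitely_generated K (A\<lparr>carrier := \<A> i\<rparr>))"

definition generated_in_degrees_0_1 :: "('k, 'a) module \<Rightarrow> (nat \<Rightarrow> 'a set) \<Rightarrow> bool" where
  "generated_in_degrees_0_1 A \<A> \<longleftrightarrow> (\<forall>i. span_prod (regular_module A) (\<A> 1) (\<A> i) = \<A> (i + 1))"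

definition degree_0_ring :: "('k, 'a) module \<Rightarrow> (nat \<Rightarrow> 'a set) \<Rightarrow> ('k, 'a) module" where
  "degree_0_ring A \<A> = A\<lparr>carrier := \<A> 0\<rparr>"

text \<open>\<open>A\<^sub>0\<close> as the \<open>A\<close>-module \<open>A / \<Oplus>\<^sub>i\<^sub>\<ge>\<^sub>1 A\<^sub>i\<close>: the class of \<open>a\<close> corresponds to its part of degree 0.\<close>

definition degree_0_module :: "('k, 'a) module \<Rightarrow> (nat \<Rightarrow> 'a set) \<Rightarrow> ('a, 'a) module" where
  "degree_0_module A \<A> = \<lparr>carrier = \<A> 0, monoid.mult = undefined, one = undefined,
     ring.zero = \<zero>\<^bsub>A\<^esub>, add = add A, smult = (\<lambda>a x. homogeneous_part A \<A> 0 a \<otimes>\<^bsub>A\<^esub> x)\<rparr>"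

definition graded_module ::
  "('k, 'a) module \<Rightarrow> (nat \<Rightarrow> 'a set) \<Rightarrow> ('a, 'm) module \<Rightarrow> (nat \<Rightarrow> 'm set) \<Rightarrow> bool" where
  "graded_module A \<A> M \<M> \<longleftrightarrow> left_module A M \<and> direct_sum_decomposition M \<M> \<and>
     (\<forall>i j. \<forall>a\<in>\<A> i. \<forall>x\<in>\<M> j. a \<odot>\<^bsub>M\<^esub> x \<in> \<M> (i + j))"

text \<open>The ground field acts on an \<open>A\<close>-module through \<open>c \<mapsto> c \<cdot> 1\<close>.\<close>

definition locally_finite_module ::
  "('k, 'e) ring_scheme \<Rightarrow> ('k, 'a) module \<Rightarrow> ('a, 'm) module \<Rightarrow> (nat \<Rightarrow> 'm set) \<Rightarrow> bool" where
  "locally_finite_module K A M \<M> \<longleftrightarrow>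
     (\<forall>i. finitely_generated K (restrict_scalars (\<lambda>c. c \<odot>\<^bsub>A\<^esub> \<one>\<^bsub>A\<^esub>) (M\<lparr>carrier := \<M> i\<rparr>)))"

text \<open>
  Generation in degree 0 is an explicit hypothesis of the theorem; its second implication fails
  without it. For \<open>A = K\<close> (concentrated in degree 0) and \<open>M = K\<close> placed in degree 1 all other
  hypotheses hold, \<open>M\<close> is projective over \<open>A\<^sub>0\<close> and both \<open>Ext\<^sup>1(A\<^sub>0,A\<^sub>0)\<close> and \<open>Ext\<^bsup>i+1\<^esup>(M,A\<^sub>0)\<close> vanish, but no
  module generated in degree 0 maps onto \<open>M\<close> by a map of degree 0.
\<close>

definition generated_in_degree ::
  "('k, 'a) module \<Rightarrow> ('a, 'm) module \<Rightarrow> (nat \<Rightarrow> 'm set) \<Rightarrow> nat \<Rightarrow> bool" where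
  "generated_in_degree A M \<M> s \<longleftrightarrow> span_prod M (carrier A) (\<M> s) = carrier M"

text \<open>
  A linear projective resolution; all maps are homogeneous of degree 0. The modules \<open>P n\<close> are taken
  inside the type of the standard resolution. This loses nothing when \<open>A\<close> and \<open>M\<close> are locally
  finite: exactness in degree \<open>n\<close> makes \<open>P n\<close>, being generated in degree \<open>n\<close>, finitely generated,
  hence isomorphic to a direct summand of a free module of finite rank.
\<close>

definition generalized_koszul ::
  "('k, 'a) module \<Rightarrow> (nat \<Rightarrow> 'a set) \<Rightarrow> ('a, 'm) module \<Rightarrow> (nat \<Rightarrow> 'm set) \<Rightarrow> bool" where
  "generalized_koszul A \<A> M \<M> \<longleftrightarrow>
     (\<exists>(P :: nat \<Rightarrow> ('a, ('a, 'm) std_basis \<Rightarrow> 'a) module) \<P> d \<epsilon>.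
        projective_resolution A M P d \<epsilon> \<and>
        (\<forall>n. graded_module A \<A> (P n) (\<P> n) \<and> generated_in_degree A (P n) (\<P> n) n) \<and>
        (\<forall>i. \<epsilon> ` \<P> 0 i \<subseteq> \<M> i) \<and>
        (\<forall>n i. d n ` \<P> (Suc n) i \<subseteq> \<P> n i))"

end

theory Submission
  imports Defs "HOL-Library.Countable_Set"
begin

text \<open>
  Write \<^term>\<open>N\<close> for the syzygy of a projective \<^term>\<open>P\<close> in a stage of a linear resolution, so that
  \<^term>\<open>P\<close> is generated in degree \<^term>\<open>n\<close> and \<^term>\<open>N\<close> vanishes in degrees up to \<^term>\<open>n\<close>. Comparing the
  resolution with the standard one, a class in \<open>Ext\<^bsup>n+1\<^esup>(M, A\<^sub>0)\<close> becomes a homomorphism \<open>N \<rightarrow> A\<^sub>0\<close>, and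
  it lies in \<open>Ext\<^sup>1(A\<^sub>0, A\<^sub>0) \<cdot> Ext\<^sup>n(M, A\<^sub>0)\<close> iff this homomorphism is a sum of compositions of maps
  \<open>P \<rightarrow> A\<close>, which send \<^term>\<open>N\<close> into the augmentation ideal \<open>J\<close>, with maps \<open>J \<rightarrow> A\<^sub>0\<close>. Every map \<open>J \<rightarrow> A\<^sub>0\<close>
  kills the components of \<open>J\<close> of degree at least 2, since these are \<open>A\<^sub>1 \<cdot> A\<^sub>i\<close>.

  Hence, if the products generate, every homomorphism \<open>N \<rightarrow> A\<^sub>0\<close> kills the components of \<^term>\<open>N\<close> of
  degree other than \<open>n + 1\<close>. As \<open>fin.dim A\<^sub>0\<^sup>o\<^sup>p = 0\<close>, a nonzero finite-dimensional \<open>A\<^sub>0\<close>-module has a nonzero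
  homomorphism to \<open>A\<^sub>0\<close>, so \<^term>\<open>N\<close> is generated in degree \<open>n + 1\<close>, and the resolution continues with a
  projective cover induced from a free module on that component.

  Conversely, in a linear resolution the degree \<open>j\<close> parts form a finite exact sequence, because the
  \<open>n\<close>-th module starts in degree \<open>n\<close>. As \<open>fin.dim A\<^sub>0 = 0\<close>, all syzygies and \<open>M\<close> itself are projective over
  \<open>A\<^sub>0\<close>; thus the degree \<open>n + 1\<close> part of \<^term>\<open>N\<close> is a direct summand of that of \<^term>\<open>P\<close>, and a homomorphism
  \<open>N \<rightarrow> A\<^sub>0\<close> factors as required through a finite dual basis of the degree \<open>n\<close> part of \<^term>\<open>P\<close>.
\<close>

section \<open>Linear maps and submodules\<close>

text \<open>Ext is formed from the standard free resolution and from all homomorphisms, while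
  linearity concerns a graded resolution. Comparison maps connect the two, and their composite is
  the identity on a syzygy only up to a map defined on the whole projective module. Such an error is
  harmless on either side: on the standard side it contributes a coboundary, and on the linear side
  it vanishes, because a syzygy lying above the generating degree is killed by every homomorphism
  from its projective module to the degree 0 module. The finitistic conditions speak of
  indecomposable modules, whereas syzygies and cokernels decompose freely. Finite dimension yields a
  strictly monotone measure on submodules, and induction along it reduces to indecomposables. Over
  the opposite ring the condition makes an injection of a projective right module into a finitely
  generated projective one split; hence a proper left ideal has a nonzero right annihilator, which
  is where functionals into the ring come from. Every free cover takes its basis from names of the
  elements to be hit, so that an infinite resolution can be built inside one type.\<close>

text \<open>Unlike the elements of \<^const>\<open>mod_hom\<close>, linear maps in the following sense are not
  extensional, so they compose and restrict without bookkeeping.\<close>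

definition lin_map ::
  "('r, 'e) ring_scheme \<Rightarrow> ('r, 'm, 'f) module_scheme \<Rightarrow> ('r, 'n, 'g) module_scheme \<Rightarrow> ('m \<Rightarrow> 'n) \<Rightarrow> bool"
  where "lin_map R M N h \<longleftrightarrow> (\<forall>x\<in>carrier M. h x \<in> carrier N) \<and>
    (\<forall>x\<in>carrier M. \<forall>y\<in>carrier M. h (x \<oplus>\<^bsub>M\<^esub> y) = h x \<oplus>\<^bsub>N\<^esub> h y) \<and>
    (\<forall>a\<in>carrier R. \<forall>x\<in>carrier M. h (a \<odot>\<^bsub>M\<^esub> x) = a \<odot>\<^bsub>N\<^esub> h x)"

lemma lin_mapI:
  assumes "\<And>x. x \<in> carrier M \<Longrightarrow> h x \<in> carrier N"
    and "\<And>x y. x \<in> carrier M \<Longrightarrow> y \<in> carrier M \<Longrightarrow> h (x \<oplus>\<^bsub>M\<^esub> y) = h x \<oplus>\<^bsub>N\<^esub> h y"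
    and "\<And>a x. a \<in> carrier R \<Longrightarrow> x \<in> carrier M \<Longrightarrow> h (a \<odot>\<^bsub>M\<^esub> x) = a \<odot>\<^bsub>N\<^esub> h x"
  shows "lin_map R M N h"
  using assms by (simp add: lin_map_def)

lemma lin_mapD:
  assumes "lin_map R M N h"
  shows "x \<in> carrier M \<Longrightarrow> h x \<in> carrier N"
    and "x \<in> carrier M \<Longrightarrow> y \<in> carrier M \<Longrightarrow> h (x \<oplus>\<^bsub>M\<^esub> y) = h x \<oplus>\<^bsub>N\<^esub> h y"
    and "a \<in> carrier R \<Longrightarrow> x \<in> carrier M \<Longrightarrow> h (a \<odot>\<^bsub>M\<^esub> x) = a \<odot>\<^bsub>N\<^esub> h x"
  using assms by (simp_all add: lin_map_def)

lemma mod_hom_lin_map: "h \<in> mod_hom R M N \<Longrightarrow> lin_map R M N h"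
  by (auto simp: mod_hom_def lin_map_def PiE_iff)

lemma lin_map_cong:
  assumes "left_module R M" and "\<And>x. x \<in> carrier M \<Longrightarrow> h x = k x"
  shows "lin_map R M N h \<longleftrightarrow> lin_map R M N k"
proof -
  interpret left_module R M by fact
  show ?thesis using assms(2) by (simp add: lin_map_def)
qed

lemma restrict_mod_hom:
  assumes "left_module R M" "lin_map R M N h"
  shows "restrict h (carrier M) \<in> mod_hom R M N"
proof -
  interpret left_module R M by fact
  show ?thesis using assms(2) by (auto simp: mod_hom_def lin_map_def)
qed

lemma lin_map_id: "lin_map R M M (\<lambda>x. x)"
  by (simp add: lin_map_def)

lemma lin_map_comp: "lin_map R L M h \<Longrightarrow> lin_map R M N k \<Longrightarrow> lin_map R L N (\<lambda>x. k (h x))"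
  by (simp add: lin_map_def)

lemma lin_map_0:
  assumes "left_module R M" "left_module R N" "lin_map R M N h"
  shows "h \<zero>\<^bsub>M\<^esub> = \<zero>\<^bsub>N\<^esub>"
proof -
  interpret M: left_module R M by fact
  interpret N: left_module R N by fact
  have "h (\<zero>\<^bsub>R\<^esub> \<odot>\<^bsub>M\<^esub> \<zero>\<^bsub>M\<^esub>) = \<zero>\<^bsub>R\<^esub> \<odot>\<^bsub>N\<^esub> h \<zero>\<^bsub>M\<^esub>" using assms(3) by (simp add: lin_map_def)
  then show ?thesis using M.smult_l_null N.smult_l_null lin_mapD(1)[OF assms(3)] by simp
qed

lemma (in left_module) smult_m1: "x \<in> carrier M \<Longrightarrow> (\<ominus>\<^bsub>R\<^esub> \<one>\<^bsub>R\<^esub>) \<odot>\<^bsub>M\<^esub> x = \<ominus>\<^bsub>M\<^esub> x"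
proof -
  assume x: "x \<in> carrier M"
  have "(\<ominus>\<^bsub>R\<^esub> \<one>\<^bsub>R\<^esub>) \<odot>\<^bsub>M\<^esub> x \<oplus>\<^bsub>M\<^esub> x = (\<ominus>\<^bsub>R\<^esub> \<one>\<^bsub>R\<^esub> \<oplus>\<^bsub>R\<^esub> \<one>\<^bsub>R\<^esub>) \<odot>\<^bsub>M\<^esub> x"
    using x by (subst smult_l_distr) auto
  also have "\<dots> = \<zero>\<^bsub>M\<^esub>" using x smult_l_null by (simp add: R.l_neg)
  finally show ?thesis using x by (intro M.minus_equality[symmetric]) auto
qed

lemma lin_map_neg:
  assumes "left_module R M" "left_module R N" "lin_map R M N h" "x \<in> carrier M"
  shows "h (\<ominus>\<^bsub>M\<^esub> x) = \<ominus>\<^bsub>N\<^esub> h x"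
proof -
  interpret M: left_module R M by fact
  interpret N: left_module R N by fact
  have "h (\<ominus>\<^bsub>M\<^esub> x) = (\<ominus>\<^bsub>R\<^esub> \<one>\<^bsub>R\<^esub>) \<odot>\<^bsub>N\<^esub> h x"
    using lin_mapD(3)[OF assms(3), of "\<ominus>\<^bsub>R\<^esub> \<one>\<^bsub>R\<^esub>" x] assms(4) by (simp add: M.smult_m1)
  then show ?thesis using N.smult_m1 lin_mapD(1)[OF assms(3,4)] by simp
qed

lemma lin_map_minus:
  assumes "left_module R M" "left_module R N" "lin_map R M N h" "x \<in> carrier M" "y \<in> carrier M"
  shows "h (x \<ominus>\<^bsub>M\<^esub> y) = h x \<ominus>\<^bsub>N\<^esub> h y"
proof -
  interpret M: left_module R M by fact
  show ?thesis using assms lin_map_neg[OF assms(1-3)]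
    by (simp add: a_minus_def lin_mapD(2))
qed

lemma lin_map_finsum:
  assumes "left_module R M" "left_module R N" "lin_map R M N h" "f \<in> T \<rightarrow> carrier M"
  shows "h (\<Oplus>\<^bsub>M\<^esub> i\<in>T. f i) = (\<Oplus>\<^bsub>N\<^esub> i\<in>T. h (f i))"
proof -
  interpret M: left_module R M by fact
  interpret N: left_module R N by fact
  show ?thesis
  proof (cases "finite T")
    case True
    then show ?thesis using assms(4)
    proof (induction T)
      case empty
      then show ?case using lin_map_0[OF assms(1-3)] by simp
    next
      case (insert i T)
      then show ?case using assms(3) by (simp add: Pi_def lin_mapD)
    qed
  next
    case False
    then show ?thesis using lin_map_0[OF assms(1-3)]
      by (simp add: M.add.finprod_infinite N.add.finprod_infinite)
  qed
qed

lemma lin_map_add: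
  assumes "left_module R N" "lin_map R M N h" "lin_map R M N k"
  shows "lin_map R M N (\<lambda>x. h x \<oplus>\<^bsub>N\<^esub> k x)"
proof -
  interpret N: left_module R N by fact
  show ?thesis using assms(2,3) by (auto simp: lin_map_def N.smult_r_distr N.M.a_ac)
qed

lemma lin_map_zero: "left_module R N \<Longrightarrow> lin_map R M N (\<lambda>x. \<zero>\<^bsub>N\<^esub>)"
proof -
  assume "left_module R N"
  then interpret N: left_module R N .
  show ?thesis by (simp add: lin_map_def N.smult_r_null)
qed

lemma lin_map_uminus:
  assumes "left_module R N" "lin_map R M N h"
  shows "lin_map R M N (\<lambda>x. \<ominus>\<^bsub>N\<^esub> h x)"
proof -
  interpret N: left_module R N by fact
  have "\<ominus>\<^bsub>N\<^esub> (a \<odot>\<^bsub>N\<^esub> h x) = a \<odot>\<^bsub>N\<^esub> (\<ominus>\<^bsub>N\<^esub> h x)" if "a \<in> carrier R" "x \<in> carrier M" for a x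
    by (rule N.M.minus_equality)
       (use that lin_mapD(1)[OF assms(2)] N.smult_r_distr[of a "\<ominus>\<^bsub>N\<^esub> h x" "h x"] in \<open>auto simp: N.M.l_neg N.smult_r_null\<close>)
  then show ?thesis using assms(2) by (auto simp: lin_map_def N.M.minus_add)
qed

lemma lin_map_diff:
  assumes "left_module R N" "lin_map R M N h" "lin_map R M N k"
  shows "lin_map R M N (\<lambda>x. h x \<ominus>\<^bsub>N\<^esub> k x)"
  using lin_map_add[OF assms(1,2) lin_map_uminus[OF assms(1,3)]] by (simp add: a_minus_def)

lemma lin_map_sum:
  assumes "left_module R N" and M: "left_module R M" and "\<And>t. t \<in> T \<Longrightarrow> lin_map R M N (h t)"
  shows "lin_map R M N (\<lambda>x. \<Oplus>\<^bsub>N\<^esub> t\<in>T. h t x)"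
proof -
  interpret N: left_module R N by fact
  show ?thesis
  proof (cases "finite T")
    case True
    then show ?thesis using assms(3)
    proof (induction T)
      case empty then show ?case using lin_map_zero[OF assms(1)] by simp
    next
      case (insert t T)
      have *: "lin_map R M N (\<lambda>x. h t x \<oplus>\<^bsub>N\<^esub> (\<Oplus>\<^bsub>N\<^esub> t\<in>T. h t x))"
        using insert by (intro lin_map_add[OF assms(1)]) auto
      have "(\<Oplus>\<^bsub>N\<^esub> t\<in>insert t T. h t x) = h t x \<oplus>\<^bsub>N\<^esub> (\<Oplus>\<^bsub>N\<^esub> t\<in>T. h t x)" if "x \<in> carrier M" for x
        using insert that by (intro N.M.finsum_insert) (auto intro: lin_mapD(1))
      then have "lin_map R M N (\<lambda>x. \<Oplus>\<^bsub>N\<^esub> t\<in>insert t T. h t x) \<longleftrightarrow>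
          lin_map R M N (\<lambda>x. h t x \<oplus>\<^bsub>N\<^esub> (\<Oplus>\<^bsub>N\<^esub> t\<in>T. h t x))"
        by (rule lin_map_cong[OF M])
      then show ?case using * by (rule iffD2)
    qed
  next
    case False
    then show ?thesis using lin_map_zero[OF assms(1)] by (simp add: N.add.finprod_infinite)
  qed
qed

section \<open>Submodules, kernels, images and transported module structures\<close>

lemma (in left_module) submoduleI:
  assumes "U \<subseteq> carrier M" "\<zero>\<^bsub>M\<^esub> \<in> U"
    and "\<And>x y. x \<in> U \<Longrightarrow> y \<in> U \<Longrightarrow> x \<oplus>\<^bsub>M\<^esub> y \<in> U"
    and "\<And>a x. a \<in> carrier R \<Longrightarrow> x \<in> U \<Longrightarrow> a \<odot>\<^bsub>M\<^esub> x \<in> U"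
  shows "submodule U R M"
proof (intro submodule.intro subgroup.intro)
  show "submodule_axioms U R M" using assms by (simp add: submodule_axioms_def)
next
  fix x assume "x \<in> U"
  then have "\<ominus>\<^bsub>M\<^esub> x \<in> U" using smult_m1[of x] assms by (metis R.add.inv_closed R.one_closed subsetD)
  then show "inv\<^bsub>add_monoid M\<^esub> x \<in> U" by (simp add: a_inv_def)
qed (use assms in auto)

lemma submoduleD:
  assumes "submodule U R M"
  shows "U \<subseteq> carrier M" "\<zero>\<^bsub>M\<^esub> \<in> U"
    and "x \<in> U \<Longrightarrow> x \<in> carrier M"
    and "x \<in> U \<Longrightarrow> y \<in> U \<Longrightarrow> x \<oplus>\<^bsub>M\<^esub> y \<in> U"
    and "x \<in> U \<Longrightarrow> \<ominus>\<^bsub>M\<^esub> x \<in> U"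
    and "a \<in> carrier R \<Longrightarrow> x \<in> U \<Longrightarrow> a \<odot>\<^bsub>M\<^esub> x \<in> U"
    and "x \<in> U \<Longrightarrow> y \<in> U \<Longrightarrow> x \<ominus>\<^bsub>M\<^esub> y \<in> U"
proof -
  interpret submodule U R M by fact
  show "U \<subseteq> carrier M" "\<zero>\<^bsub>M\<^esub> \<in> U" "x \<in> U \<Longrightarrow> x \<in> carrier M" "x \<in> U \<Longrightarrow> y \<in> U \<Longrightarrow> x \<oplus>\<^bsub>M\<^esub> y \<in> U"
    "a \<in> carrier R \<Longrightarrow> x \<in> U \<Longrightarrow> a \<odot>\<^bsub>M\<^esub> x \<in> U"
    using subset one_closed mem_carrier m_closed by auto
  show neg: "\<ominus>\<^bsub>M\<^esub> x \<in> U" if "x \<in> U" for x using m_inv_closed[OF that] by (simp add: a_inv_def)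
  show "x \<in> U \<Longrightarrow> y \<in> U \<Longrightarrow> x \<ominus>\<^bsub>M\<^esub> y \<in> U" using m_closed[OF _ neg] by (simp add: a_minus_def)
qed

lemma submodule_left_module:
  assumes "left_module R M" "submodule U R M"
  shows "left_module R (M\<lparr>carrier := U\<rparr>)"
proof -
  interpret M: left_module R M by fact
  note U = submoduleD[OF assms(2)]
  interpret U: abelian_group "M\<lparr>carrier := U\<rparr>"
  proof (rule abelian_groupI, goal_cases)
    case (6 x)
    then show ?case using U by (intro bexI[of _ "\<ominus>\<^bsub>M\<^esub> x"]) (auto simp: M.M.l_neg)
  qed (use U in \<open>auto simp: M.M.a_ac subsetD\<close>)
  show ?thesis
    by unfold_locales
       (use U in \<open>auto simp: M.smult_l_distr M.smult_r_distr M.smult_assoc1 subsetD\<close>)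
qed

lemma left_module_ring: "left_module R M \<Longrightarrow> ring R"
  by (simp add: left_module_def)

lemma finsum_submodule:
  assumes "left_module R M" "submodule U R M" "f \<in> T \<rightarrow> U"
  shows "finsum (M\<lparr>carrier := U\<rparr>) f T = finsum M f T"
  using lin_map_finsum[OF submodule_left_module[OF assms(1,2)] assms(1), of "\<lambda>x. x" f T] assms(3)
    submoduleD(3)[OF assms(2)] by (simp add: lin_map_def)

lemma carrier_submodule: "left_module R M \<Longrightarrow> submodule (carrier M) R M"
  by (rule left_module.submoduleI)
     (auto intro: left_module.smult_closed simp: left_module_def abelian_group_def
       abelian_monoid.zero_closed abelian_monoid.a_closed)

lemma zero_submodule: "left_module R M \<Longrightarrow> submodule {\<zero>\<^bsub>M\<^esub>} R M"
proof -
  assume "left_module R M"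
  then interpret left_module R M .
  show ?thesis by (rule submoduleI) (auto simp: smult_r_null)
qed

lemma kernel_submodule:
  assumes "left_module R M" "left_module R N" "lin_map R M N h"
  shows "submodule {x \<in> carrier M. h x = \<zero>\<^bsub>N\<^esub>} R M"
proof -
  interpret M: left_module R M by fact
  interpret N: left_module R N by fact
  show ?thesis
    by (rule M.submoduleI)
       (use lin_map_0[OF assms] lin_mapD[OF assms(3)] in \<open>auto simp: N.smult_r_null\<close>)
qed

lemma vimage_submodule:
  assumes "left_module R M" "left_module R N" "lin_map R M N h" "submodule U R N"
  shows "submodule {x \<in> carrier M. h x \<in> U} R M"
proof -
  interpret M: left_module R M by fact
  show ?thesis
    by (rule M.submoduleI)
       (use lin_map_0[OF assms(1-3)] lin_mapD[OF assms(3)] submoduleD[OF assms(4)] in auto)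
qed

lemma image_submodule:
  assumes "left_module R M" "left_module R N" "lin_map R M N h" "submodule U R M"
  shows "submodule (h ` U) R N"
proof -
  interpret N: left_module R N by fact
  note U = submoduleD[OF assms(4)] and h = lin_mapD[OF assms(3)]
  show ?thesis
  proof (rule N.submoduleI)
    show "\<zero>\<^bsub>N\<^esub> \<in> h ` U" using lin_map_0[OF assms(1-3)] U(2) by (metis imageI)
  qed (use U h in \<open>auto simp flip: h(2,3) simp: subsetD\<close>)
qed

lemma Int_submodule:
  assumes "left_module R M" "submodule U R M" "submodule V R M"
  shows "submodule (U \<inter> V) R M"
  by (rule left_module.submoduleI[OF assms(1)]) (use submoduleD[OF assms(2)] submoduleD[OF assms(3)] in auto)

lemma submodule_of_submodule:
  assumes "left_module R M" "submodule U R M"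
  shows "submodule V R (M\<lparr>carrier := U\<rparr>) \<longleftrightarrow> submodule V R M \<and> V \<subseteq> U"
proof
  assume V: "submodule V R (M\<lparr>carrier := U\<rparr>)"
  have "submodule V R M"
    by (rule left_module.submoduleI[OF assms(1)])
       (use submoduleD[OF V] submoduleD[OF assms(2)] in auto)
  then show "submodule V R M \<and> V \<subseteq> U" using submoduleD(1)[OF V] by simp
next
  assume V: "submodule V R M \<and> V \<subseteq> U"
  then have V': "submodule V R M" by simp
  show "submodule V R (M\<lparr>carrier := U\<rparr>)"
    by (rule left_module.submoduleI[OF submodule_left_module[OF assms]])
       (use V submoduleD[OF V'] in auto)
qed

text \<open>A map with kernel \<^term>\<open>U\<close> transports the module structure to its image.\<close>

definition push_module :: "('m \<Rightarrow> 'n) \<Rightarrow> ('r, 'm, 'f) module_scheme \<Rightarrow> ('r, 'n) module" where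
  "push_module f M = \<lparr>carrier = f ` carrier M, monoid.mult = undefined, one = undefined,
     ring.zero = f \<zero>\<^bsub>M\<^esub>, add = (\<lambda>u v. f (inv_into (carrier M) f u \<oplus>\<^bsub>M\<^esub> inv_into (carrier M) f v)),
     smult = (\<lambda>a u. f (a \<odot>\<^bsub>M\<^esub> inv_into (carrier M) f u))\<rparr>"

lemma push_module:
  assumes "left_module R M" "submodule U R M"
    and ker: "\<forall>x\<in>carrier M. \<forall>y\<in>carrier M. f x = f y \<longleftrightarrow> x \<ominus>\<^bsub>M\<^esub> y \<in> U"
  shows "left_module R (push_module f M)" "lin_map R M (push_module f M) f"
    "carrier (push_module f M) = f ` carrier M" "\<zero>\<^bsub>push_module f M\<^esub> = f \<zero>\<^bsub>M\<^esub>"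
proof -
  interpret M: left_module R M by fact
  note U = submoduleD[OF assms(2)]
  let ?N = "push_module f M" and ?g = "inv_into (carrier M) f"
  show carr: "carrier ?N = f ` carrier M" and zero: "\<zero>\<^bsub>?N\<^esub> = f \<zero>\<^bsub>M\<^esub>" by (simp_all add: push_module_def)
  \<comment> \<open>The operations of \<open>push_module\<close> are computed on the preimages
    picked by \<open>inv_into\<close>. A picked preimage of \<open>f x\<close> differs from
    \<open>x\<close> by an element of \<open>U\<close>, and such an error is invisible to
    \<open>f\<close>; this is all that the module laws need.\<close>
  have g: "?g (f x) \<in> carrier M" "?g (f x) \<ominus>\<^bsub>M\<^esub> x \<in> U" if "x \<in> carrier M" for x
  proof -
    show *: "?g (f x) \<in> carrier M" using that by (simp add: inv_into_into)
    have "f (?g (f x)) = f x" using that by (simp add: f_inv_into_f)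
    then show "?g (f x) \<ominus>\<^bsub>M\<^esub> x \<in> U" using ker * that by simp
  qed
  have add: "f x \<oplus>\<^bsub>?N\<^esub> f y = f (x \<oplus>\<^bsub>M\<^esub> y)" if x: "x \<in> carrier M" and y: "y \<in> carrier M" for x y
  proof -
    have "(?g (f x) \<oplus>\<^bsub>M\<^esub> ?g (f y)) \<ominus>\<^bsub>M\<^esub> (x \<oplus>\<^bsub>M\<^esub> y) = (?g (f x) \<ominus>\<^bsub>M\<^esub> x) \<oplus>\<^bsub>M\<^esub> (?g (f y) \<ominus>\<^bsub>M\<^esub> y)"
      using g(1)[OF x] g(1)[OF y] x y by (simp add: a_minus_def M.M.minus_add M.M.a_ac)
    then have "f (?g (f x) \<oplus>\<^bsub>M\<^esub> ?g (f y)) = f (x \<oplus>\<^bsub>M\<^esub> y)"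
      using g[OF x] g[OF y] x y U(4) by (simp add: ker)
    then show ?thesis by (simp add: push_module_def)
  qed
  have smult: "a \<odot>\<^bsub>?N\<^esub> f x = f (a \<odot>\<^bsub>M\<^esub> x)" if a: "a \<in> carrier R" and x: "x \<in> carrier M" for a x
  proof -
    have "(a \<odot>\<^bsub>M\<^esub> ?g (f x)) \<ominus>\<^bsub>M\<^esub> (a \<odot>\<^bsub>M\<^esub> x) = a \<odot>\<^bsub>M\<^esub> (?g (f x) \<ominus>\<^bsub>M\<^esub> x)"
      using lin_map_uminus[OF assms(1) lin_map_id[of R M]] g(1)[OF x] x a
      by (simp add: a_minus_def M.smult_r_distr lin_map_def)
    then have "f (a \<odot>\<^bsub>M\<^esub> ?g (f x)) = f (a \<odot>\<^bsub>M\<^esub> x)"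
      using g[OF x] a x U(6) by (simp add: ker)
    then show ?thesis by (simp add: push_module_def)
  qed
  interpret N: abelian_group ?N
  proof (rule abelian_groupI, goal_cases)
    case (6 u)
    then obtain x where x: "x \<in> carrier M" "u = f x" by (auto simp: carr)
    then show ?case by (intro bexI[of _ "f (\<ominus>\<^bsub>M\<^esub> x)"]) (auto simp: carr add zero M.M.l_neg)
  qed (auto simp: carr add zero M.M.a_ac)
  show "left_module R ?N"
    by unfold_locales
       (auto simp: carr smult add M.smult_l_distr M.smult_r_distr M.smult_assoc1)
  show "lin_map R M ?N f"
    by (auto simp: lin_map_def carr add smult)
qed

section \<open>Change of scalars and the regular module\<close>

lemma left_module_subring:
  assumes "left_module R M" "ring S" "carrier S \<subseteq> carrier R"
    and "\<And>a b. a \<in> carrier S \<Longrightarrow> b \<in> carrier S \<Longrightarrow> a \<oplus>\<^bsub>S\<^esub> b = a \<oplus>\<^bsub>R\<^esub> b"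
    and "\<And>a b. a \<in> carrier S \<Longrightarrow> b \<in> carrier S \<Longrightarrow> a \<otimes>\<^bsub>S\<^esub> b = a \<otimes>\<^bsub>R\<^esub> b" and "\<one>\<^bsub>S\<^esub> = \<one>\<^bsub>R\<^esub>"
  shows "left_module S M"
proof -
  interpret M: left_module R M by fact
  interpret S: ring S by fact
  show ?thesis
    by unfold_locales
       (use assms(3-) in \<open>auto simp: M.smult_l_distr M.smult_r_distr M.smult_assoc1 subsetD\<close>)
qed

lemma restrict_scalars_simps [simp]:
  "carrier (restrict_scalars \<phi> M) = carrier M" "\<zero>\<^bsub>restrict_scalars \<phi> M\<^esub> = \<zero>\<^bsub>M\<^esub>"
  "x \<oplus>\<^bsub>restrict_scalars \<phi> M\<^esub> y = x \<oplus>\<^bsub>M\<^esub> y" "c \<odot>\<^bsub>restrict_scalars \<phi> M\<^esub> x = \<phi> c \<odot>\<^bsub>M\<^esub> x"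
  by (simp_all add: restrict_scalars_def)

lemma restrict_scalars_carrier_update:
  "restrict_scalars \<phi> (M\<lparr>carrier := U\<rparr>) = (restrict_scalars \<phi> M)\<lparr>carrier := U\<rparr>"
  by (simp add: restrict_scalars_def)

lemma restrict_scalars_left_module:
  assumes "left_module R M" "ring S" "\<phi> \<in> ring_hom S R"
  shows "left_module S (restrict_scalars \<phi> M)"
proof -
  interpret M: left_module R M by fact
  interpret S: ring S by fact
  interpret N: abelian_group "restrict_scalars \<phi> M"
  proof (rule abelian_groupI, goal_cases)
    case (6 x)
    then show ?case by (intro bexI[of _ "\<ominus>\<^bsub>M\<^esub> x"]) (auto simp: M.M.l_neg)
  qed (auto simp: M.M.a_ac)
  show ?thesis
    by unfold_locales
       (use assms(3) in \<open>auto simp: ring_hom_def Pi_def M.smult_l_distr M.smult_r_distr M.smult_assoc1\<close>)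
qed

lemma lin_map_restrict_scalars:
  "lin_map R M N h \<Longrightarrow> \<phi> \<in> carrier S \<rightarrow> carrier R \<Longrightarrow> lin_map S (restrict_scalars \<phi> M) (restrict_scalars \<phi> N) h"
  by (auto simp: lin_map_def)

lemma regular_module_simps [simp]:
  "carrier (regular_module R) = carrier R" "\<zero>\<^bsub>regular_module R\<^esub> = \<zero>\<^bsub>R\<^esub>"
  "x \<oplus>\<^bsub>regular_module R\<^esub> y = x \<oplus>\<^bsub>R\<^esub> y" "c \<odot>\<^bsub>regular_module R\<^esub> x = c \<otimes>\<^bsub>R\<^esub> x"
  by (simp_all add: regular_module_def)

lemma (in ring) regular_left_module: "left_module R (regular_module R)"
proof -
  interpret N: abelian_group "regular_module R"
  proof (rule abelian_groupI, goal_cases)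
    case (6 x)
    then show ?case by (intro bexI[of _ "\<ominus> x"]) (auto simp: l_neg)
  qed (auto simp: a_ac)
  show ?thesis by unfold_locales (auto simp: l_distr r_distr m_assoc)
qed

lemma (in abelian_group) add_minus_cancel:
  assumes "x \<in> carrier G" "y \<in> carrier G" shows "(x \<oplus> y) \<ominus> x = y"
  using assms a_comm[of x y] by (simp add: a_minus_def a_assoc r_neg)

section \<open>Finitely generated modules\<close>

text \<open>An intersection instead of linear combinations: to bound \<open>lspan R M S\<close> from
  above, one submodule containing \<open>S\<close> is enough, and kernels and preimages of linear
  maps supply such submodules without any handling of coefficients.\<close>

definition lspan :: "('r, 'e) ring_scheme \<Rightarrow> ('r, 'm, 'f) module_scheme \<Rightarrow> 'm set \<Rightarrow> 'm set" where
  "lspan R M S = \<Inter>{U. submodule U R M \<and> S \<subseteq> U}"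

lemma lspan_superset: "S \<subseteq> lspan R M S"
  by (auto simp: lspan_def)

lemma lspan_least: "submodule U R M \<Longrightarrow> S \<subseteq> U \<Longrightarrow> lspan R M S \<subseteq> U"
  by (auto simp: lspan_def)

lemma lspan_submodule:
  assumes M: "left_module R M" and S: "S \<subseteq> carrier M"
  shows "submodule (lspan R M S) R M"
proof (rule left_module.submoduleI[OF M])
  show "lspan R M S \<subseteq> carrier M" by (rule lspan_least[OF carrier_submodule[OF M] S])
qed (auto simp: lspan_def submoduleD)

lemma submodule_finsum:
  assumes "left_module R M" "submodule U R M" "f \<in> T \<rightarrow> U"
  shows "finsum M f T \<in> U"
proof -
  interpret U: left_module R "M\<lparr>carrier := U\<rparr>" by (rule submodule_left_module[OF assms(1,2)])
  have "finsum (M\<lparr>carrier := U\<rparr>) f T \<in> carrier (M\<lparr>carrier := U\<rparr>)"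
    using assms(3) by (intro U.M.finsum_closed) auto
  then show ?thesis by (simp add: finsum_submodule[OF assms])
qed

text \<open>Passes between explicit coefficients and least submodules. The linear combinations of
  \<open>S\<close> form the image of the free module on \<open>S\<close>, which is a submodule
  containing \<open>S\<close>.\<close>

lemma finitely_generated_iff_lspan:
  assumes M: "left_module R M"
  shows "finitely_generated R M \<longleftrightarrow> (\<exists>S \<subseteq> carrier M. finite S \<and> lspan R M S = carrier M)"
proof
  interpret left_module R M by fact
  assume "finitely_generated R M"
  then obtain S where S: "S \<subseteq> carrier M" "finite S"
    and gen: "\<forall>x\<in>carrier M. \<exists>c \<in> S \<rightarrow> carrier R. x = (\<Oplus>\<^bsub>M\<^esub> s\<in>S. c s \<odot>\<^bsub>M\<^esub> s)"
    unfolding finitely_generated_def by blast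
  have "x \<in> lspan R M S" if x: "x \<in> carrier M" for x
  proof -
    obtain c where c: "c \<in> S \<rightarrow> carrier R" "x = (\<Oplus>\<^bsub>M\<^esub> s\<in>S. c s \<odot>\<^bsub>M\<^esub> s)" using gen x by blast
    show ?thesis unfolding c(2)
      by (rule submodule_finsum[OF M lspan_submodule[OF M S(1)]])
         (use c(1) lspan_superset[of S R M] submoduleD(6)[OF lspan_submodule[OF M S(1)]] in auto)
  qed
  then show "\<exists>S \<subseteq> carrier M. finite S \<and> lspan R M S = carrier M"
    using S submoduleD(1)[OF lspan_submodule[OF M S(1)]] by blast
next
  interpret left_module R M by fact
  assume "\<exists>S \<subseteq> carrier M. finite S \<and> lspan R M S = carrier M"
  then obtain S where S: "S \<subseteq> carrier M" "finite S" and gen: "lspan R M S = carrier M" by blast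
  let ?F = "free_module R S" and ?L = "lin_ext R S M (\<lambda>x. x)"
  have id: "(\<lambda>x. x) \<in> S \<rightarrow> carrier M" using S by auto
  have L: "lin_map R ?F M ?L" by (rule mod_hom_lin_map[OF lin_ext_hom[OF id]])
  have F: "left_module R ?F" by (rule R.free_module_left_module)
  have "submodule (?L ` carrier ?F) R M"
    by (rule image_submodule[OF F M L carrier_submodule[OF F]])
  moreover have "S \<subseteq> ?L ` carrier ?F"
  proof
    fix s assume s: "s \<in> S"
    show "s \<in> ?L ` carrier ?F"
      by (rule image_eqI[of _ _ "R.unit_vec s"])
         (use lin_ext_unit_vec[OF id s] R.unit_vec_carrier[OF s] in auto)
  qed
  ultimately have car: "carrier M \<subseteq> ?L ` carrier ?F"
    using lspan_least[of "?L ` carrier ?F" R M S] gen by simp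
  have "\<exists>c \<in> S \<rightarrow> carrier R. x = (\<Oplus>\<^bsub>M\<^esub> s\<in>S. c s \<odot>\<^bsub>M\<^esub> s)" if "x \<in> carrier M" for x
  proof -
    from subsetD[OF car that] obtain f where fx: "x = ?L f" and f: "f \<in> carrier ?F" by (rule imageE)
    have "x = (\<Oplus>\<^bsub>M\<^esub> s\<in>S. f s \<odot>\<^bsub>M\<^esub> s)"
      unfolding fx by (rule lin_ext_superset[OF f id S(2)]) (use f in \<open>auto simp: free_module_carrier\<close>)
    moreover have "f \<in> S \<rightarrow> carrier R" using f by (simp add: free_module_carrier Pi_def)
    ultimately show ?thesis by blast
  qed
  then show "finitely_generated R M" using S unfolding finitely_generated_def by blast
qed

lemma finitely_generated_image:
  assumes M: "left_module R M" and N: "left_module R N" and h: "lin_map R M N h"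
    and surj: "h ` carrier M = carrier N" and fg: "finitely_generated R M"
  shows "finitely_generated R N"
proof -
  obtain S where S: "S \<subseteq> carrier M" "finite S" "lspan R M S = carrier M"
    using fg finitely_generated_iff_lspan[OF M] by blast
  have hS: "h ` S \<subseteq> carrier N" using S(1) lin_mapD(1)[OF h] by auto
  have "lspan R M S \<subseteq> {x \<in> carrier M. h x \<in> lspan R N (h ` S)}"
    by (rule lspan_least[OF vimage_submodule[OF M N h lspan_submodule[OF N hS]]])
       (use S(1) lspan_superset[of "h ` S" R N] in auto)
  then have "h x \<in> lspan R N (h ` S)" if "x \<in> carrier M" for x using S(3) that by blast
  then have "carrier N \<subseteq> lspan R N (h ` S)" using surj by (metis image_subsetI)
  then have "lspan R N (h ` S) = carrier N" using submoduleD(1)[OF lspan_submodule[OF N hS]] by blast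
  then show ?thesis using finitely_generated_iff_lspan[OF N] hS S(2) by blast
qed

lemma submodule_restrict_scalars:
  assumes "\<phi> \<in> ring_hom S R" "left_module R M" "ring S" "submodule U R M"
  shows "submodule U S (restrict_scalars \<phi> M)"
  by (rule left_module.submoduleI[OF restrict_scalars_left_module[OF assms(2,3,1)]])
     (use submoduleD[OF assms(4)] assms(1) in \<open>auto simp: ring_hom_def Pi_def\<close>)

lemma finitely_generated_restrict_scalarsD:
  assumes \<phi>: "\<phi> \<in> ring_hom S R" and M: "left_module R M" and S: "ring S"
    and fg: "finitely_generated S (restrict_scalars \<phi> M)"
  shows "finitely_generated R M"
proof -
  obtain T where T: "T \<subseteq> carrier M" "finite T" "lspan S (restrict_scalars \<phi> M) T = carrier M"
    using fg finitely_generated_iff_lspan[OF restrict_scalars_left_module[OF M S \<phi>]] by auto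
  have "carrier M \<subseteq> lspan R M T"
    unfolding T(3)[symmetric]
    by (rule lspan_least[OF submodule_restrict_scalars[OF \<phi> M S lspan_submodule[OF M T(1)]] lspan_superset])
  then show ?thesis
    using finitely_generated_iff_lspan[OF M] T submoduleD(1)[OF lspan_submodule[OF M T(1)]] by blast
qed

text \<open>Products of generators of \<open>R\<close> over \<open>S\<close> with generators of
  \<open>M\<close> over \<open>R\<close> suffice. This is how modules over a finite-dimensional
  algebra become finite-dimensional vector spaces.\<close>

lemma finitely_generated_restrict_scalars:
  assumes \<phi>: "\<phi> \<in> ring_hom S R" and M: "left_module R M" and S: "ring S"
    and fgR: "finitely_generated S (restrict_scalars \<phi> (regular_module R))"
    and fg: "finitely_generated R M"
  shows "finitely_generated S (restrict_scalars \<phi> M)"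
proof -
  interpret left_module R M by fact
  note R = R.regular_left_module
  let ?M = "restrict_scalars \<phi> M" and ?R = "restrict_scalars \<phi> (regular_module R)"
  have MS: "left_module S ?M" by (rule restrict_scalars_left_module[OF M S \<phi>])
  have RS: "left_module S ?R" by (rule restrict_scalars_left_module[OF R S \<phi>])
  obtain T where T: "T \<subseteq> carrier M" "finite T" "lspan R M T = carrier M"
    using fg finitely_generated_iff_lspan[OF M] by blast
  obtain B where B: "B \<subseteq> carrier R" "finite B" "lspan S ?R B = carrier R"
    using fgR finitely_generated_iff_lspan[OF RS] by auto
  define G where "G = (\<lambda>(r, t). r \<odot>\<^bsub>M\<^esub> t) ` (B \<times> T)"
  have G: "G \<subseteq> carrier M" "finite G" using T B by (auto simp: G_def subsetD)
  then have G': "G \<subseteq> carrier ?M" by simp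
  let ?U = "lspan S ?M G"
  note U = submoduleD[OF lspan_submodule[OF MS G']]
  have \<phi>R: "\<phi> c \<in> carrier R" if "c \<in> carrier S" for c using \<phi> that by (auto simp: ring_hom_def)
  have *: "r \<odot>\<^bsub>M\<^esub> t \<in> ?U" if t: "t \<in> T" and r: "r \<in> carrier R" for r t
  proof -
    have tM: "t \<in> carrier M" using T t by blast
    have "lin_map S ?R ?M (\<lambda>r. r \<odot>\<^bsub>M\<^esub> t)"
      using tM \<phi>R by (auto simp: lin_map_def smult_l_distr smult_assoc1)
    from vimage_submodule[OF RS MS this lspan_submodule[OF MS G']]
    have "lspan S ?R B \<subseteq> {r \<in> carrier ?R. r \<odot>\<^bsub>M\<^esub> t \<in> ?U}"
      by (rule lspan_least) (use B(1) t lspan_superset[of G S ?M] in \<open>auto simp: G_def\<close>)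
    then show ?thesis using B(3) r by auto
  qed
  \<comment> \<open>The span \<open>?U\<close> is only known to be closed under scalars from
    \<open>S\<close>. The elements all of whose multiples by \<open>R\<close> lie in
    \<open>?U\<close> do form an \<open>R\<close>-submodule; it contains \<open>T\<close>, hence is
    everything, and the multiple by one shows that \<open>?U\<close> is everything.\<close>
  have "submodule {x \<in> carrier M. \<forall>r\<in>carrier R. r \<odot>\<^bsub>M\<^esub> x \<in> ?U} R M"
    by (rule submoduleI) (use U in \<open>auto simp: smult_r_distr smult_r_null simp flip: smult_assoc1\<close>)
  then have "lspan R M T \<subseteq> {x \<in> carrier M. \<forall>r\<in>carrier R. r \<odot>\<^bsub>M\<^esub> x \<in> ?U}"
    by (rule lspan_least) (use T(1) * in auto)
  then have "carrier M \<subseteq> ?U" using T(3) smult_one[symmetric] R.one_closed by fastforce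
  then have "?U = carrier ?M" using U(1) by auto
  then show ?thesis using finitely_generated_iff_lspan[OF MS] G' G(2) by blast
qed

text \<open>A substitute for dimension: what is used later is that a proper inclusion strictly
  increases a natural number, which turns finite dimension into induction and into the existence of
  maximal submodules. The empty set spans zero, where no proper inclusion exists, so any function
  starts the induction.\<close>

lemma subspace_measure_lspan:
  fixes V :: "('k, 'm, 'f) module_scheme"
  assumes K: "field K" and V: "left_module K V" and S: "finite S" "S \<subseteq> carrier V"
  shows "\<exists>\<mu> :: 'm set \<Rightarrow> nat. \<forall>U U'. submodule U K V \<and> submodule U' K V \<and> U \<subset> U' \<and> U' \<subseteq> lspan K V S \<longrightarrow>
    \<mu> U < \<mu> U'"
  using S
proof (induction S)
  case empty
  have "lspan K V {} \<subseteq> {\<zero>\<^bsub>V\<^esub>}" by (rule lspan_least[OF zero_submodule[OF V] empty_subsetI])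
  have False if "submodule U K V" "U \<subset> U'" "U' \<subseteq> lspan K V {}" for U U'
    using that \<open>lspan K V {} \<subseteq> _\<close> submoduleD(2)[OF that(1)] by blast
  then show ?case by blast
next
  case (insert s T)
  interpret K: field K by fact
  interpret V: left_module K V by fact
  let ?W = "lspan K V T"
  have s: "s \<in> carrier V" and T: "T \<subseteq> carrier V" using insert.prems by auto
  have W: "submodule ?W K V" by (rule lspan_submodule[OF V T])
  note Wd = submoduleD[OF W]
  obtain \<mu> :: "'m set \<Rightarrow> nat" where \<mu>: "\<And>U U'. submodule U K V \<Longrightarrow> submodule U' K V \<Longrightarrow> U \<subset> U' \<Longrightarrow>
      U' \<subseteq> ?W \<Longrightarrow> \<mu> U < \<mu> U'" using insert.IH[OF T] by blast
  let ?X = "{c \<odot>\<^bsub>V\<^esub> s \<oplus>\<^bsub>V\<^esub> t | c t. c \<in> carrier K \<and> t \<in> ?W}"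
  have X: "submodule ?X K V"
  proof (rule V.submoduleI)
    show "?X \<subseteq> carrier V" using s Wd(3) by auto
    show "\<zero>\<^bsub>V\<^esub> \<in> ?X" using V.smult_l_null[OF s] Wd(2) by (force intro!: exI[of _ "\<zero>\<^bsub>K\<^esub>"])
    fix x y assume "x \<in> ?X" "y \<in> ?X"
    then obtain c t d u where ct: "c \<in> carrier K" "t \<in> ?W" "x = c \<odot>\<^bsub>V\<^esub> s \<oplus>\<^bsub>V\<^esub> t"
      and du: "d \<in> carrier K" "u \<in> ?W" "y = d \<odot>\<^bsub>V\<^esub> s \<oplus>\<^bsub>V\<^esub> u" by auto
    have "x \<oplus>\<^bsub>V\<^esub> y = (c \<oplus>\<^bsub>K\<^esub> d) \<odot>\<^bsub>V\<^esub> s \<oplus>\<^bsub>V\<^esub> (t \<oplus>\<^bsub>V\<^esub> u)"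
      using ct du s Wd(3)[of t] Wd(3)[of u] by (simp add: V.smult_l_distr V.M.a_ac)
    then show "x \<oplus>\<^bsub>V\<^esub> y \<in> ?X" using ct du Wd(4) by blast
  next
    fix a x assume a: "a \<in> carrier K" and "x \<in> ?X"
    then obtain c t where ct: "c \<in> carrier K" "t \<in> ?W" "x = c \<odot>\<^bsub>V\<^esub> s \<oplus>\<^bsub>V\<^esub> t" by auto
    have "a \<odot>\<^bsub>V\<^esub> x = (a \<otimes>\<^bsub>K\<^esub> c) \<odot>\<^bsub>V\<^esub> s \<oplus>\<^bsub>V\<^esub> a \<odot>\<^bsub>V\<^esub> t"
      using ct a s Wd(3)[of t] by (simp add: V.smult_r_distr V.smult_assoc1)
    then show "a \<odot>\<^bsub>V\<^esub> x \<in> ?X" using ct a Wd(6) by blast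
  qed
  have "t \<in> ?X" if "t \<in> ?W" for t
    using V.smult_l_null[OF s] Wd(3)[OF that] that by (force intro!: exI[of _ "\<zero>\<^bsub>K\<^esub>"])
  moreover have "s \<in> ?X" using s Wd(2) by (force intro!: exI[of _ "\<one>\<^bsub>K\<^esub>"])
  ultimately have sub: "lspan K V (insert s T) \<subseteq> ?X"
    using lspan_superset[of T K V] by (intro lspan_least[OF X]) blast
  \<comment> \<open>Splits \<open>U\<close> into \<open>U \<inter> ?W\<close> and its image modulo
    \<open>?W\<close>. That image lies in the line spanned by \<open>s\<close>, so it counts one
    unless it is zero, that is, unless \<open>U \<subseteq> ?W\<close>.\<close>
  let ?\<mu> = "\<lambda>U. \<mu> (U \<inter> ?W) + (if U \<subseteq> ?W then 0 else 1)"
  have "?\<mu> U < ?\<mu> U'" if U: "submodule U K V" and U': "submodule U' K V" and lt: "U \<subset> U'"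
    and le: "U' \<subseteq> lspan K V (insert s T)" for U U'
  proof (cases "U \<inter> ?W = U' \<inter> ?W")
    case False
    then have "U \<inter> ?W \<subset> U' \<inter> ?W" using lt by blast
    then have "\<mu> (U \<inter> ?W) < \<mu> (U' \<inter> ?W)" by (intro \<mu> Int_submodule[OF V] U U' W) auto
    then show ?thesis using lt by auto
  next
    case True
    have "\<not> U' \<subseteq> ?W" using True lt by blast
    moreover have "U \<subseteq> ?W"
    proof (rule ccontr)
      assume "\<not> U \<subseteq> ?W"
      then obtain u where u: "u \<in> U" "u \<notin> ?W" by blast
      then obtain c t where ct: "c \<in> carrier K" "t \<in> ?W" "u = c \<odot>\<^bsub>V\<^esub> s \<oplus>\<^bsub>V\<^esub> t"
        using sub le lt by blast
      have tV: "t \<in> carrier V" using Wd(3) ct by blast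
      have c: "c \<noteq> \<zero>\<^bsub>K\<^esub>" using u(2) ct V.smult_l_null[OF s] Wd(3)[of t] by auto
      then have ic: "inv\<^bsub>K\<^esub> c \<in> carrier K" "inv\<^bsub>K\<^esub> c \<otimes>\<^bsub>K\<^esub> c = \<one>\<^bsub>K\<^esub>"
        using ct(1) K.field_Units by auto
      have "u' \<in> U" if u': "u' \<in> U'" for u'
      proof -
        obtain d t' where dt: "d \<in> carrier K" "t' \<in> ?W" "u' = d \<odot>\<^bsub>V\<^esub> s \<oplus>\<^bsub>V\<^esub> t'"
          using sub le u' by blast
        have t'V: "t' \<in> carrier V" using Wd(3) dt by blast
        \<comment> \<open>Subtracting \<open>e\<close> times \<open>u\<close> removes the multiple
          of \<open>s\<close> from \<open>u'\<close>. The difference lies in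
          \<open>U' \<inter> ?W\<close>, which equals \<open>U \<inter> ?W\<close> in this case, so
          \<open>u'\<close> is in \<open>U\<close>.\<close>
        define e where "e = d \<otimes>\<^bsub>K\<^esub> inv\<^bsub>K\<^esub> c"
        have e: "e \<in> carrier K" "e \<otimes>\<^bsub>K\<^esub> c = d" using dt(1) ic ct(1) by (simp_all add: e_def K.m_assoc)
        have eu: "e \<odot>\<^bsub>V\<^esub> u \<in> U" by (rule submoduleD(6)[OF U e(1) u(1)])
        have "e \<odot>\<^bsub>V\<^esub> u = d \<odot>\<^bsub>V\<^esub> s \<oplus>\<^bsub>V\<^esub> e \<odot>\<^bsub>V\<^esub> t"
          using ct e s tV by (simp add: V.smult_r_distr flip: V.smult_assoc1)
        then have u'_eq: "u' = e \<odot>\<^bsub>V\<^esub> u \<oplus>\<^bsub>V\<^esub> (t' \<ominus>\<^bsub>V\<^esub> e \<odot>\<^bsub>V\<^esub> t)"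
          using dt e(1) s tV t'V by (simp add: a_minus_def V.M.a_ac V.M.r_neg V.M.r_neg2)
        moreover have "u' \<ominus>\<^bsub>V\<^esub> e \<odot>\<^bsub>V\<^esub> u = t' \<ominus>\<^bsub>V\<^esub> e \<odot>\<^bsub>V\<^esub> t"
          unfolding calculation using e(1) tV t'V submoduleD(3)[OF U eu]
          by (intro V.M.add_minus_cancel) auto
        moreover have "u' \<ominus>\<^bsub>V\<^esub> e \<odot>\<^bsub>V\<^esub> u \<in> U'" using submoduleD(7)[OF U' u'] eu lt by blast
        moreover have "t' \<ominus>\<^bsub>V\<^esub> e \<odot>\<^bsub>V\<^esub> t \<in> ?W" using Wd(6,7) dt(2) ct(2) e(1) by blast
        ultimately have "t' \<ominus>\<^bsub>V\<^esub> e \<odot>\<^bsub>V\<^esub> t \<in> U" using True by auto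
        then show ?thesis using u'_eq submoduleD(4)[OF U eu] by simp
      qed
      then show False using lt by blast
    qed
    ultimately show ?thesis using True by simp
  qed
  then show ?case by (intro exI[of _ ?\<mu>]) blast
qed

lemma subspace_measure:
  fixes V :: "('k, 'm, 'f) module_scheme"
  assumes "field K" "left_module K V" "finitely_generated K V"
  obtains \<mu> :: "'m set \<Rightarrow> nat" where
    "\<And>U U'. submodule U K V \<Longrightarrow> submodule U' K V \<Longrightarrow> U \<subset> U' \<Longrightarrow> \<mu> U < \<mu> U'"
proof -
  obtain S where "S \<subseteq> carrier V" "finite S" "lspan K V S = carrier V"
    using assms(3) finitely_generated_iff_lspan[OF assms(2)] by blast
  then show ?thesis
    using subspace_measure_lspan[OF assms(1,2), of S] submoduleD(1)[of _ K V] that by metis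
qed

text \<open>A finite subset of \<open>U\<close> whose span has the largest measure must span
  \<open>U\<close>, since an element outside its span would raise the measure. The measure of
  \<open>U\<close> itself is the bound.\<close>

lemma finitely_generated_subspace:
  fixes V :: "('k, 'm, 'f) module_scheme"
  assumes K: "field K" and V: "left_module K V" and fg: "finitely_generated K V" and U: "submodule U K V"
  shows "finitely_generated K (V\<lparr>carrier := U\<rparr>)"
proof -
  obtain \<mu> :: "'m set \<Rightarrow> nat" where
    \<mu>: "\<And>U U'. submodule U K V \<Longrightarrow> submodule U' K V \<Longrightarrow> U \<subset> U' \<Longrightarrow> \<mu> U < \<mu> U'"
    by (rule subspace_measure[OF K V fg]) blast
  note UV = submoduleD(1)[OF U]
  have sp: "submodule (lspan K V S) K V" if "S \<subseteq> U" for S using that UV by (intro lspan_submodule[OF V]) auto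
  have bound: "\<mu> (lspan K V S) < Suc (\<mu> U)" if S: "finite S \<and> S \<subseteq> U" for S
    using \<mu>[OF sp[of S] U] lspan_least[OF U, of S] S by (cases "lspan K V S = U") (auto simp: psubset_eq)
  obtain S where S: "finite S" "S \<subseteq> U"
    and max: "\<And>T. finite T \<and> T \<subseteq> U \<Longrightarrow> \<mu> (lspan K V T) \<le> \<mu> (lspan K V S)"
    using ex_has_greatest_nat[of "\<lambda>S. finite S \<and> S \<subseteq> U" "{}" "\<lambda>S. \<mu> (lspan K V S)" "Suc (\<mu> U)"] bound
    by auto
  have "u \<in> lspan K V S" if u: "u \<in> U" for u
  proof (rule ccontr)
    assume "u \<notin> lspan K V S"
    moreover have "lspan K V S \<subseteq> lspan K V (insert u S)" "u \<in> lspan K V (insert u S)"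
      by (auto simp: lspan_def)
    ultimately have "lspan K V S \<subset> lspan K V (insert u S)" by blast
    then have "\<mu> (lspan K V S) < \<mu> (lspan K V (insert u S))" using S(2) u by (intro \<mu> sp) auto
    then show False using max[of "insert u S"] S u by auto
  qed
  moreover have "lspan K V S \<subseteq> lspan K (V\<lparr>carrier := U\<rparr>) S"
    unfolding lspan_def using submodule_of_submodule[OF V U] by auto
  ultimately have "lspan K (V\<lparr>carrier := U\<rparr>) S = U"
    using submoduleD(1)[OF lspan_submodule[OF submodule_left_module[OF V U]], of S] S(2) by auto
  then show ?thesis
    using finitely_generated_iff_lspan[OF submodule_left_module[OF V U]] S by auto
qed

section \<open>Projective modules\<close>

lemma projective_left_module: "projective_module R P \<Longrightarrow> left_module R P"
  by (simp add: projective_module_def)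

text \<open>Corestricting \<open>p\<close> to its image reduces to the surjective case, so only the
  image of \<open>g\<close> has to be covered by \<open>p\<close>.\<close>

lemma projective_lift:
  assumes P: "projective_module R P" and N: "left_module R N" and N': "left_module R N'"
    and p: "lin_map R N N' p" and g: "lin_map R P N' g" and sub: "g ` carrier P \<subseteq> p ` carrier N"
  obtains h where "lin_map R P N h" "\<And>x. x \<in> carrier P \<Longrightarrow> p (h x) = g x"
proof -
  note PM = projective_left_module[OF P]
  let ?I = "p ` carrier N"
  let ?N = "N'\<lparr>carrier := ?I\<rparr>"
  have I: "left_module R ?N"
    by (rule submodule_left_module[OF N' image_submodule[OF N N' p carrier_submodule[OF N]]])
  have p': "restrict p (carrier N) \<in> mod_hom R N ?N"
    by (rule restrict_mod_hom[OF N]) (use p in \<open>auto simp: lin_map_def\<close>)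
  have g': "restrict g (carrier P) \<in> mod_hom R P ?N"
    by (rule restrict_mod_hom[OF PM]) (use g sub in \<open>auto simp: lin_map_def\<close>)
  obtain h where h: "h \<in> mod_hom R P N" "\<forall>x\<in>carrier P. restrict p (carrier N) (h x) = restrict g (carrier P) x"
    using projective_module_lifting[OF P N I p' _ g'] by auto
  show ?thesis
    by (rule that[OF mod_hom_lin_map[OF h(1)]]) (use h mod_homD(2)[OF h(1)] in auto)
qed

text \<open>The free module on the carrier of \<open>P\<close> is the decisive test, and its
  elements have type \<open>'m \<Rightarrow> 'r\<close>. Modules of one fixed type can be quantified
  over in a hypothesis, modules of all types cannot.\<close>

lemma projective_sectionI:
  fixes P :: "('r, 'm, 'f) module_scheme"
  assumes P: "left_module R P"
    and lift: "\<And>(E :: ('r, 'm \<Rightarrow> 'r) module) p. left_module R E \<Longrightarrow> lin_map R E P p \<Longrightarrow>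
      p ` carrier E = carrier P \<Longrightarrow> \<exists>h. lin_map R P E h \<and> (\<forall>x\<in>carrier P. p (h x) = x)"
  shows "projective_module R P"
proof (rule projective_moduleI[OF P])
  fix p assume p: "p \<in> mod_hom R (free_module R (carrier P)) P"
    and surj: "p ` carrier (free_module R (carrier P)) = carrier P"
  have F: "left_module R (free_module R (carrier P))"
    using ring.free_module_left_module[OF left_module_ring[OF P]] .
  obtain h where h: "lin_map R P (free_module R (carrier P)) h" "\<forall>x\<in>carrier P. p (h x) = x"
    using lift[OF F mod_hom_lin_map[OF p] surj] by blast
  then show "\<exists>h\<in>mod_hom R P (free_module R (carrier P)). \<forall>x\<in>carrier P. p (h x) = x"
    using restrict_mod_hom[OF P h(1)] by (intro bexI[of _ "restrict h (carrier P)"]) auto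
qed

lemma projective_retract:
  fixes R :: "('r, 'e) ring_scheme" and N :: "('r, 'm, 'f) module_scheme"
  assumes P: "projective_module R P" and N: "left_module R N"
    and i: "lin_map R N P i" and p: "lin_map R P N p" and ret: "\<And>x. x \<in> carrier N \<Longrightarrow> p (i x) = x"
  shows "projective_module R N"
proof (rule projective_sectionI[OF N])
  fix E :: "('r, 'm \<Rightarrow> 'r) module" and q
  assume E: "left_module R E" and q: "lin_map R E N q" and surj: "q ` carrier E = carrier N"
  obtain h where h: "lin_map R P E h" "\<And>x. x \<in> carrier P \<Longrightarrow> q (h x) = p x"
    by (rule projective_lift[OF P E N q p]) (use surj lin_mapD(1)[OF p] in auto)
  then show "\<exists>h. lin_map R N E h \<and> (\<forall>x\<in>carrier N. q (h x) = x)"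
    using lin_map_comp[OF i h(1)] lin_mapD(1)[OF i] ret by (intro exI[of _ "\<lambda>x. h (i x)"]) auto
qed

lemma projective_zero_module:
  fixes R :: "('r, 'e) ring_scheme" and N :: "('r, 'm, 'f) module_scheme"
  assumes N: "left_module R N" and z: "carrier N = {\<zero>\<^bsub>N\<^esub>}"
  shows "projective_module R N"
proof (rule projective_sectionI[OF N])
  fix E :: "('r, 'm \<Rightarrow> 'r) module" and q
  assume E: "left_module R E" and q: "lin_map R E N q" and "q ` carrier E = carrier N"
  then show "\<exists>h. lin_map R N E h \<and> (\<forall>x\<in>carrier N. q (h x) = x)"
    using lin_map_zero[OF E, of N] lin_map_0[OF E N q] z by (intro exI[of _ "\<lambda>x. \<zero>\<^bsub>E\<^esub>"]) auto
qed

text \<open>A possibly infinite direct sum, given by inclusions and coordinates instead of a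
  constructed module. It serves for a free \<open>A\<close>-module seen over the degree 0 ring and
  for a graded module as the sum of its components. The section is glued from lifts of the maps
  \<open>j b\<close>.\<close>

lemma projective_locally_finite_sum:
  fixes R :: "('r, 'e) ring_scheme" and N :: "('r, 'm, 'f) module_scheme"
  assumes N: "left_module R N" and P: "\<And>b. b \<in> B \<Longrightarrow> projective_module R (P b)"
    and j: "\<And>b. b \<in> B \<Longrightarrow> lin_map R (P b) N (j b)" and \<pi>: "\<And>b. b \<in> B \<Longrightarrow> lin_map R N (P b) (\<pi> b)"
    and fin: "\<And>x. x \<in> carrier N \<Longrightarrow> finite {b \<in> B. \<pi> b x \<noteq> \<zero>\<^bsub>P b\<^esub>}"
    and sum: "\<And>x. x \<in> carrier N \<Longrightarrow> x = (\<Oplus>\<^bsub>N\<^esub> b\<in>{b \<in> B. \<pi> b x \<noteq> \<zero>\<^bsub>P b\<^esub>}. j b (\<pi> b x))"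
  shows "projective_module R N"
proof (rule projective_sectionI[OF N])
  fix E :: "('r, 'm \<Rightarrow> 'r) module" and q
  assume E: "left_module R E" and q: "lin_map R E N q" and surj: "q ` carrier E = carrier N"
  interpret N: left_module R N by fact
  interpret E: left_module R E by fact
  have "\<exists>h. lin_map R (P b) E h \<and> (\<forall>y\<in>carrier (P b). q (h y) = j b y)" if b: "b \<in> B" for b
    by (rule projective_lift[OF P[OF b] E N q j[OF b]]) (use surj lin_mapD(1)[OF j[OF b]] in auto)
  then obtain h where h: "\<And>b. b \<in> B \<Longrightarrow> lin_map R (P b) E (h b)"
    "\<And>b y. b \<in> B \<Longrightarrow> y \<in> carrier (P b) \<Longrightarrow> q (h b y) = j b y" by metis
  let ?s = "\<lambda>x. {b \<in> B. \<pi> b x \<noteq> \<zero>\<^bsub>P b\<^esub>}"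
  define H where "H x = (\<Oplus>\<^bsub>E\<^esub> b\<in>?s x. h b (\<pi> b x))" for x
  have hE: "h b (\<pi> b x) \<in> carrier E" if "b \<in> B" "x \<in> carrier N" for b x
    using that h(1) \<pi> lin_mapD(1) by metis
  \<comment> \<open>The support of a sum can be smaller than the union of the supports, so
    \<open>H\<close> has to be evaluated over any finite index set containing the support.\<close>
  have H_sup: "H x = (\<Oplus>\<^bsub>E\<^esub> b\<in>T. h b (\<pi> b x))" if "finite T" "?s x \<subseteq> T" "T \<subseteq> B" "x \<in> carrier N" for T x
    unfolding H_def
    by (intro E.M.add.finprod_mono_neutral_cong_left)
       (use that hE lin_map_0[OF projective_left_module[OF P] E h(1)] in auto)
  have HE: "H x \<in> carrier E" if "x \<in> carrier N" for x
    unfolding H_def using that hE by (intro E.M.finsum_closed) auto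
  have "lin_map R N E H"
  proof (rule lin_mapI)
    fix x y assume x: "x \<in> carrier N" and y: "y \<in> carrier N"
    have add: "\<pi> b (x \<oplus>\<^bsub>N\<^esub> y) = \<pi> b x \<oplus>\<^bsub>P b\<^esub> \<pi> b y" if "b \<in> B" for b
      using lin_mapD(2)[OF \<pi>[OF that]] x y by simp
    have "?s (x \<oplus>\<^bsub>N\<^esub> y) \<subseteq> ?s x \<union> ?s y"
    proof
      fix b assume b: "b \<in> ?s (x \<oplus>\<^bsub>N\<^esub> y)"
      then interpret Pb: left_module R "P b" using projective_left_module[OF P] by auto
      show "b \<in> ?s x \<union> ?s y" using b add by force
    qed
    then have "H (x \<oplus>\<^bsub>N\<^esub> y) = (\<Oplus>\<^bsub>E\<^esub> b\<in>?s x \<union> ?s y. h b (\<pi> b (x \<oplus>\<^bsub>N\<^esub> y)))"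
      using fin x y by (intro H_sup) auto
    also have "\<dots> = (\<Oplus>\<^bsub>E\<^esub> b\<in>?s x \<union> ?s y. h b (\<pi> b x) \<oplus>\<^bsub>E\<^esub> h b (\<pi> b y))"
      using x y hE add lin_mapD(1)[OF \<pi>] lin_mapD(2)[OF h(1)] by (intro E.M.finsum_cong') auto
    also have "\<dots> = (\<Oplus>\<^bsub>E\<^esub> b\<in>?s x \<union> ?s y. h b (\<pi> b x)) \<oplus>\<^bsub>E\<^esub> (\<Oplus>\<^bsub>E\<^esub> b\<in>?s x \<union> ?s y. h b (\<pi> b y))"
      using x y hE by (intro E.M.finsum_addf) auto
    also have "\<dots> = H x \<oplus>\<^bsub>E\<^esub> H y"
      using fin x y by (subst (1 2) H_sup[of "?s x \<union> ?s y"]) auto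
    finally show "H (x \<oplus>\<^bsub>N\<^esub> y) = H x \<oplus>\<^bsub>E\<^esub> H y" .
  next
    fix a x assume a: "a \<in> carrier R" and x: "x \<in> carrier N"
    have sm: "\<pi> b (a \<odot>\<^bsub>N\<^esub> x) = a \<odot>\<^bsub>P b\<^esub> \<pi> b x" if "b \<in> B" for b
      using lin_mapD(3)[OF \<pi>[OF that]] x a by simp
    have "?s (a \<odot>\<^bsub>N\<^esub> x) \<subseteq> ?s x"
      using sm left_module.smult_r_null[OF projective_left_module[OF P] a] by auto
    then have "H (a \<odot>\<^bsub>N\<^esub> x) = (\<Oplus>\<^bsub>E\<^esub> b\<in>?s x. h b (\<pi> b (a \<odot>\<^bsub>N\<^esub> x)))"
      using fin x a by (intro H_sup) auto
    also have "\<dots> = (\<Oplus>\<^bsub>E\<^esub> b\<in>?s x. a \<odot>\<^bsub>E\<^esub> h b (\<pi> b x))"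
      using x a hE sm lin_mapD(1)[OF \<pi>] lin_mapD(3)[OF h(1)] by (intro E.M.finsum_cong') auto
    also have "\<dots> = a \<odot>\<^bsub>E\<^esub> H x" unfolding H_def
      using x a fin hE by (intro E.finsum_smult[symmetric]) auto
    finally show "H (a \<odot>\<^bsub>N\<^esub> x) = a \<odot>\<^bsub>E\<^esub> H x" .
  qed (rule HE)
  moreover have "q (H x) = x" if x: "x \<in> carrier N" for x
  proof -
    have "q (H x) = (\<Oplus>\<^bsub>N\<^esub> b\<in>?s x. q (h b (\<pi> b x)))"
      unfolding H_def using x hE by (intro lin_map_finsum[OF E N q]) auto
    also have "\<dots> = (\<Oplus>\<^bsub>N\<^esub> b\<in>?s x. j b (\<pi> b x))"
      using h(2) lin_mapD(1)[OF \<pi>] lin_mapD(1)[OF j] x by (intro N.M.finsum_cong') (auto simp: Pi_def)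
    finally show ?thesis using sum[OF x] by simp
  qed
  ultimately show "\<exists>h. lin_map R N E h \<and> (\<forall>x\<in>carrier N. q (h x) = x)" by blast
qed

text \<open>For a section \<open>s\<close> of \<open>q\<close>, the map sending \<open>x\<close> to
  \<open>x - s (q x)\<close> lands in the kernel and fixes it pointwise.\<close>

lemma kernel_retraction:
  assumes Q: "left_module R Q" and N: "projective_module R N"
    and q: "lin_map R Q N q" and surj: "q ` carrier Q = carrier N"
  obtains r where "lin_map R Q (Q\<lparr>carrier := {x \<in> carrier Q. q x = \<zero>\<^bsub>N\<^esub>}\<rparr>) r"
    "\<And>x. x \<in> carrier Q \<Longrightarrow> q x = \<zero>\<^bsub>N\<^esub> \<Longrightarrow> r x = x"
proof -
  note NM = projective_left_module[OF N]
  interpret Q: left_module R Q by fact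
  interpret N: left_module R N by fact
  obtain s where s: "lin_map R N Q s" "\<And>x. x \<in> carrier N \<Longrightarrow> q (s x) = x"
    by (rule projective_lift[OF N Q NM q lin_map_id]) (use surj in auto)
  let ?r = "\<lambda>x. x \<ominus>\<^bsub>Q\<^esub> s (q x)"
  have r: "lin_map R Q Q ?r" by (rule lin_map_diff[OF Q lin_map_id lin_map_comp[OF q s(1)]])
  have "q (?r x) = \<zero>\<^bsub>N\<^esub>" if "x \<in> carrier Q" for x
    using lin_map_minus[OF Q NM q that lin_mapD(1)[OF s(1) lin_mapD(1)[OF q that]]] s(2) lin_mapD(1)[OF q that]
    by (simp add: N.M.r_neg a_minus_def)
  then have "lin_map R Q (Q\<lparr>carrier := {x \<in> carrier Q. q x = \<zero>\<^bsub>N\<^esub>}\<rparr>) ?r"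
    using r by (auto simp: lin_map_def)
  moreover have "?r x = x" if "x \<in> carrier Q" "q x = \<zero>\<^bsub>N\<^esub>" for x
    using that lin_map_0[OF NM Q s(1)] by (simp add: a_minus_def)
  ultimately show ?thesis by (rule that)
qed

lemma kernel_projective:
  assumes Q: "projective_module R Q" and N: "projective_module R N"
    and q: "lin_map R Q N q" and surj: "q ` carrier Q = carrier N"
  shows "projective_module R (Q\<lparr>carrier := {x \<in> carrier Q. q x = \<zero>\<^bsub>N\<^esub>}\<rparr>)"
proof -
  note QM = projective_left_module[OF Q]
  obtain r where r: "lin_map R Q (Q\<lparr>carrier := {x \<in> carrier Q. q x = \<zero>\<^bsub>N\<^esub>}\<rparr>) r"
    "\<And>x. x \<in> carrier Q \<Longrightarrow> q x = \<zero>\<^bsub>N\<^esub> \<Longrightarrow> r x = x"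
    by (rule kernel_retraction[OF QM N q surj]) blast
  show ?thesis
    by (rule projective_retract[OF Q submodule_left_module[OF QM kernel_submodule[OF QM projective_left_module[OF N] q]] _ r(1)])
       (use r(2) in \<open>auto simp: lin_map_def\<close>)
qed

text \<open>A form of Schanuel's lemma: having a projective first syzygy does not depend on the
  projective cover, and it passes to retracts.\<close>

lemma syzygy_projective_retract:
  fixes R :: "('r, 'e) ring_scheme" and G :: "('r, 'g, 'f) module_scheme"
  assumes N: "left_module R N" and U: "left_module R U"
    and F: "projective_module R F" and G: "projective_module R G"
    and q: "lin_map R F N q" and q_surj: "q ` carrier F = carrier N"
    and ker: "projective_module R (F\<lparr>carrier := {x \<in> carrier F. q x = \<zero>\<^bsub>N\<^esub>}\<rparr>)"
    and r: "lin_map R G U r" and r_surj: "r ` carrier G = carrier U"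
    and i: "lin_map R U N i" and p: "lin_map R N U p" and ret: "\<And>x. x \<in> carrier U \<Longrightarrow> p (i x) = x"
  shows "projective_module R (G\<lparr>carrier := {x \<in> carrier G. r x = \<zero>\<^bsub>U\<^esub>}\<rparr>)" (is "projective_module R ?K")
proof -
  note FM = projective_left_module[OF F] and GM = projective_left_module[OF G]
  interpret U: left_module R U by fact
  interpret G: left_module R G by (rule GM)
  note K = submodule_left_module[OF GM kernel_submodule[OF GM U r]]
  interpret K: left_module R ?K by (rule K)
  obtain a where a: "lin_map R G F a" "\<And>x. x \<in> carrier G \<Longrightarrow> q (a x) = i (r x)"
    by (rule projective_lift[OF G FM N q lin_map_comp[OF r i]])
       (use q_surj lin_mapD(1)[OF lin_map_comp[OF r i]] in auto)
  obtain b where b: "lin_map R F G b" "\<And>x. x \<in> carrier F \<Longrightarrow> r (b x) = p (q x)"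
    by (rule projective_lift[OF F GM U r lin_map_comp[OF q p]])
       (use r_surj lin_mapD(1)[OF lin_map_comp[OF q p]] in auto)
  note aD = lin_mapD[OF a(1)] and bD = lin_mapD[OF b(1)]
  \<comment> \<open>\<open>r (b (a x)) = p (q (a x)) = p (i (r x)) = r x\<close>, so
    \<open>b \<circ> a\<close> is the identity modulo the kernel of \<open>r\<close>.\<close>
  have e: "lin_map R G ?K (\<lambda>x. x \<ominus>\<^bsub>G\<^esub> b (a x))"
  proof -
    have "r (x \<ominus>\<^bsub>G\<^esub> b (a x)) = \<zero>\<^bsub>U\<^esub>" if x: "x \<in> carrier G" for x
    proof -
      have "r (b (a x)) = r x" using b(2)[OF aD(1)[OF x]] a(2)[OF x] ret lin_mapD(1)[OF r x] by simp
      then show ?thesis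
        using lin_map_minus[OF GM U r x bD(1)[OF aD(1)[OF x]]] lin_mapD(1)[OF r x]
        by (simp add: a_minus_def U.M.r_neg)
    qed
    then show ?thesis
      using lin_map_diff[OF GM lin_map_id lin_map_comp[OF a(1) b(1)]] by (auto simp: lin_map_def)
  qed
  have b': "lin_map R (F\<lparr>carrier := {x \<in> carrier F. q x = \<zero>\<^bsub>N\<^esub>}\<rparr>) ?K b"
    using b lin_map_0[OF N U p] by (auto simp: lin_map_def)
  have a': "a x \<in> carrier (F\<lparr>carrier := {x \<in> carrier F. q x = \<zero>\<^bsub>N\<^esub>}\<rparr>)" if "x \<in> carrier ?K" for x
    using that aD(1) a(2) lin_map_0[OF U N i] by auto
  show ?thesis
  proof (rule projective_sectionI[OF K])
    fix E :: "('r, 'g \<Rightarrow> 'r) module" and t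
    assume E: "left_module R E" and t: "lin_map R E ?K t" and surj: "t ` carrier E = carrier ?K"
    interpret E: left_module R E by fact
    \<comment> \<open>\<open>?K\<close> is a retract of the direct sum of the kernel of
      \<open>q\<close> and \<open>G\<close>: an element \<open>x\<close> goes to the pair of
      \<open>a x\<close> and \<open>x\<close>, and a pair of \<open>k\<close> and \<open>g\<close>
      goes to \<open>b k + (g - b (a g))\<close>. Lifting the two coordinates separately replaces
      forming the direct sum.\<close>
    obtain h1 where h1: "lin_map R (F\<lparr>carrier := {x \<in> carrier F. q x = \<zero>\<^bsub>N\<^esub>}\<rparr>) E h1"
      "\<And>x. x \<in> carrier (F\<lparr>carrier := {x \<in> carrier F. q x = \<zero>\<^bsub>N\<^esub>}\<rparr>) \<Longrightarrow> t (h1 x) = b x"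
      by (rule projective_lift[OF ker E K t b']) (use surj lin_mapD(1)[OF b'] in auto)
    obtain h2 where h2: "lin_map R G E h2" "\<And>x. x \<in> carrier G \<Longrightarrow> t (h2 x) = x \<ominus>\<^bsub>G\<^esub> b (a x)"
      by (rule projective_lift[OF G E K t e]) (use surj lin_mapD(1)[OF e] in auto)
    have h1': "lin_map R ?K E (\<lambda>x. h1 (a x))"
      by (rule lin_map_comp[OF _ h1(1)]) (use a(1) a' in \<open>auto simp: lin_map_def\<close>)
    have h2': "lin_map R ?K E h2" using h2(1) by (simp add: lin_map_def)
    have "t (h1 (a x) \<oplus>\<^bsub>E\<^esub> h2 x) = x" if x: "x \<in> carrier ?K" for x
    proof -
      have xG: "x \<in> carrier G" using x by simp
      have "t (h1 (a x) \<oplus>\<^bsub>E\<^esub> h2 x) = b (a x) \<oplus>\<^bsub>G\<^esub> (x \<ominus>\<^bsub>G\<^esub> b (a x))"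
        using lin_mapD(2)[OF t lin_mapD(1)[OF h1' x] lin_mapD(1)[OF h2' x]] h1(2)[OF a'[OF x]] h2(2)[OF xG] by simp
      also have "\<dots> = x" using xG bD(1)[OF aD(1)[OF xG]]
        by (simp add: a_minus_def G.M.a_ac G.M.r_neg G.M.r_neg2)
      finally show ?thesis .
    qed
    then show "\<exists>h. lin_map R ?K E h \<and> (\<forall>x\<in>carrier ?K. t (h x) = x)"
      using lin_map_add[OF E h1' h2'] by blast
  qed
qed

lemma (in abelian_group) add_minus_cancel_right:
  assumes "x \<in> carrier G" "y \<in> carrier G" shows "x \<oplus> (y \<ominus> x) = y"
  using add_minus_cancel[OF assms] assms by (simp add: a_minus_def a_assoc)

lemma (in abelian_group) minus_zero_right: "x \<in> carrier G \<Longrightarrow> x \<ominus> \<zero> = x"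
  using add_minus_cancel[of \<zero> x] by simp

lemma (in abelian_group) minus_eq_zero_iff:
  assumes "x \<in> carrier G" "y \<in> carrier G" shows "x \<ominus> y = \<zero> \<longleftrightarrow> x = y"
  using add_minus_cancel_right[OF assms(2,1)] assms by (auto simp: a_minus_def r_neg)

section \<open>Finite-dimensional algebras of finitistic dimension zero\<close>

lemma lin_map_inj_on:
  assumes M: "left_module R M" and N: "left_module R N" and h: "lin_map R M N h"
    and ker: "\<And>x. x \<in> carrier M \<Longrightarrow> h x = \<zero>\<^bsub>N\<^esub> \<Longrightarrow> x = \<zero>\<^bsub>M\<^esub>"
  shows "inj_on h (carrier M)"
proof (rule inj_onI)
  interpret M: left_module R M by fact
  interpret N: left_module R N by fact
  fix x y assume x: "x \<in> carrier M" and y: "y \<in> carrier M" and eq: "h x = h y"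
  have "h (x \<ominus>\<^bsub>M\<^esub> y) = \<zero>\<^bsub>N\<^esub>"
    using lin_map_minus[OF M N h x y] eq lin_mapD(1)[OF h y] by (simp add: a_minus_def N.M.r_neg)
  then show "x = y" using ker[of "x \<ominus>\<^bsub>M\<^esub> y"] x y M.M.minus_eq_zero_iff by simp
qed

lemma lin_map_inv_into:
  assumes M: "left_module R M" and h: "lin_map R M N h"
    and inj: "inj_on h (carrier M)" and surj: "h ` carrier M = carrier N"
  shows "lin_map R N M (inv_into (carrier M) h)"
proof -
  interpret M: left_module R M by fact
  let ?g = "inv_into (carrier M) h"
  have g: "?g y \<in> carrier M" "h (?g y) = y" if "y \<in> carrier N" for y
    using that surj by (auto simp: inv_into_into f_inv_into_f)
  have *: "?g (h x) = x" if "x \<in> carrier M" for x using inj that by simp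
  show ?thesis
  proof (rule lin_mapI)
    fix x y assume xy: "x \<in> carrier N" "y \<in> carrier N"
    have "?g (h (?g x \<oplus>\<^bsub>M\<^esub> ?g y)) = ?g x \<oplus>\<^bsub>M\<^esub> ?g y" using * g xy by simp
    then show "?g (x \<oplus>\<^bsub>N\<^esub> y) = ?g x \<oplus>\<^bsub>M\<^esub> ?g y" using lin_mapD(2)[OF h] g xy by simp
  next
    fix a x assume ax: "a \<in> carrier R" "x \<in> carrier N"
    have "?g (h (a \<odot>\<^bsub>M\<^esub> ?g x)) = a \<odot>\<^bsub>M\<^esub> ?g x" using * g ax by simp
    then show "?g (a \<odot>\<^bsub>N\<^esub> x) = a \<odot>\<^bsub>M\<^esub> ?g x" using lin_mapD(3)[OF h] g ax by simp
  qed (rule g)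
qed

text \<open>\<open>indecomposable\<close> speaks of internal direct sums. The projection along
  \<open>V\<close> makes \<open>U\<close> a retract, which is the form in which syzygies are
  compared.\<close>

lemma direct_sum_projections:
  assumes N: "left_module R N" and U: "submodule U R N" and V: "submodule V R N"
    and int: "U \<inter> V = {\<zero>\<^bsub>N\<^esub>}" and sum: "U <+>\<^bsub>N\<^esub> V = carrier N"
  obtains p where "lin_map R N N p" "\<And>x. x \<in> carrier N \<Longrightarrow> p x \<in> U"
    "\<And>x. x \<in> carrier N \<Longrightarrow> x \<ominus>\<^bsub>N\<^esub> p x \<in> V" "\<And>x. x \<in> U \<Longrightarrow> p x = x" "\<And>x. x \<in> V \<Longrightarrow> p x = \<zero>\<^bsub>N\<^esub>"
proof -
  interpret N: left_module R N by fact
  note Ud = submoduleD[OF U] and Vd = submoduleD[OF V]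
  have ex: "\<exists>u. u \<in> U \<and> x \<ominus>\<^bsub>N\<^esub> u \<in> V" if x: "x \<in> carrier N" for x
  proof -
    obtain u v where uv: "u \<in> U" "v \<in> V" "x = u \<oplus>\<^bsub>N\<^esub> v"
      using x[folded sum] unfolding set_add_defs by (auto simp del: UN_iff elim!: UN_E)
    then show ?thesis using N.M.add_minus_cancel[of u v] Ud(3) Vd(3) by auto
  qed
  define p where "p x = (SOME u. u \<in> U \<and> x \<ominus>\<^bsub>N\<^esub> u \<in> V)" for x
  have p: "p x \<in> U" "x \<ominus>\<^bsub>N\<^esub> p x \<in> V" if "x \<in> carrier N" for x
    using someI_ex[OF ex[OF that]] by (auto simp: p_def)
  \<comment> \<open>Two admissible values differ by an element of \<open>U \<inter> V\<close>.
    Linearity of \<open>p\<close> follows from this uniqueness.\<close>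
  have uniq: "p x = u" if "x \<in> carrier N" "u \<in> U" "x \<ominus>\<^bsub>N\<^esub> u \<in> V" for x u
  proof -
    have c: "u \<in> carrier N" "p x \<in> carrier N" using Ud(3) that p by auto
    have "(x \<ominus>\<^bsub>N\<^esub> p x) \<ominus>\<^bsub>N\<^esub> (x \<ominus>\<^bsub>N\<^esub> u) = (x \<oplus>\<^bsub>N\<^esub> (u \<ominus>\<^bsub>N\<^esub> p x)) \<ominus>\<^bsub>N\<^esub> x"
      using that(1) c by (simp add: a_minus_def N.M.minus_add N.M.a_ac)
    also have "\<dots> = u \<ominus>\<^bsub>N\<^esub> p x" using that(1) c by (intro N.M.add_minus_cancel) auto
    finally have "u \<ominus>\<^bsub>N\<^esub> p x \<in> V" using Vd(7)[OF p(2)[OF that(1)] that(3)] by simp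
    moreover have "u \<ominus>\<^bsub>N\<^esub> p x \<in> U" using Ud(7) that p by blast
    ultimately have "u \<ominus>\<^bsub>N\<^esub> p x = \<zero>\<^bsub>N\<^esub>" using int by blast
    then show ?thesis using c N.M.minus_eq_zero_iff by simp
  qed
  have "lin_map R N N p"
  proof (rule lin_mapI)
    fix x y assume x: "x \<in> carrier N" and y: "y \<in> carrier N"
    have c: "p x \<in> carrier N" "p y \<in> carrier N" using Ud(3) p x y by auto
    have "(x \<oplus>\<^bsub>N\<^esub> y) \<ominus>\<^bsub>N\<^esub> (p x \<oplus>\<^bsub>N\<^esub> p y) = (x \<ominus>\<^bsub>N\<^esub> p x) \<oplus>\<^bsub>N\<^esub> (y \<ominus>\<^bsub>N\<^esub> p y)"
      using x y c by (simp add: a_minus_def N.M.minus_add N.M.a_ac)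
    then show "p (x \<oplus>\<^bsub>N\<^esub> y) = p x \<oplus>\<^bsub>N\<^esub> p y"
      using x y p Ud(4) Vd(4) by (intro uniq) auto
  next
    fix a x assume a: "a \<in> carrier R" and x: "x \<in> carrier N"
    have c: "p x \<in> carrier N" using Ud(3) p x by auto
    have "a \<odot>\<^bsub>N\<^esub> x \<ominus>\<^bsub>N\<^esub> a \<odot>\<^bsub>N\<^esub> p x = a \<odot>\<^bsub>N\<^esub> (x \<ominus>\<^bsub>N\<^esub> p x)"
      using lin_map_uminus[OF N lin_map_id[of R N]] c x a
      by (simp add: a_minus_def N.smult_r_distr lin_map_def)
    then show "p (a \<odot>\<^bsub>N\<^esub> x) = a \<odot>\<^bsub>N\<^esub> p x"
      using x a p Ud(6) Vd(6) by (intro uniq) auto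
  qed (use p Ud(3) in auto)
  moreover have "p x = x" if "x \<in> U" for x
    using that Ud(3) Vd(2) by (intro uniq) (auto simp: a_minus_def N.M.r_neg)
  moreover have "p x = \<zero>\<^bsub>N\<^esub>" if "x \<in> V" for x
    using that Ud(2) Vd(3) by (intro uniq) (auto simp: N.M.minus_zero_right)
  ultimately show ?thesis using p that by blast
qed

text \<open>Sending \<open>x\<close> to its coset, taken as a set, identifies exactly the elements
  that differ by \<open>U\<close>, so \<open>push_module\<close> along this map is the
  quotient.\<close>

lemma quotient_module:
  fixes M :: "('r, 'm, 'f) module_scheme"
  assumes M: "left_module R M" and U: "submodule U R M"
  obtains C :: "('r, 'm set) module" and q where "left_module R C" "lin_map R M C q"
    "q ` carrier M = carrier C" "{x \<in> carrier M. q x = \<zero>\<^bsub>C\<^esub>} = U"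
proof -
  interpret M: left_module R M by fact
  note Ud = submoduleD[OF U]
  let ?f = "\<lambda>x. {y \<in> carrier M. x \<ominus>\<^bsub>M\<^esub> y \<in> U}"
  have swap: "x \<ominus>\<^bsub>M\<^esub> z = (x \<ominus>\<^bsub>M\<^esub> y) \<oplus>\<^bsub>M\<^esub> (y \<ominus>\<^bsub>M\<^esub> z)"
    if "x \<in> carrier M" "y \<in> carrier M" "z \<in> carrier M" for x y z
    using that by (simp add: a_minus_def M.M.a_assoc M.M.r_neg1)
  have neg: "\<ominus>\<^bsub>M\<^esub> (x \<ominus>\<^bsub>M\<^esub> y) = y \<ominus>\<^bsub>M\<^esub> x" if "x \<in> carrier M" "y \<in> carrier M" for x y
    using that by (simp add: a_minus_def M.M.minus_add M.M.a_comm)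
  have eq: "?f x = ?f y \<longleftrightarrow> x \<ominus>\<^bsub>M\<^esub> y \<in> U" if x: "x \<in> carrier M" and y: "y \<in> carrier M" for x y
  proof
    assume "?f x = ?f y"
    moreover have "y \<in> ?f y" using y Ud(2) by (simp add: a_minus_def M.M.r_neg)
    ultimately show "x \<ominus>\<^bsub>M\<^esub> y \<in> U" by blast
  next
    assume xy: "x \<ominus>\<^bsub>M\<^esub> y \<in> U"
    then have yx: "y \<ominus>\<^bsub>M\<^esub> x \<in> U" using Ud(5)[OF xy] neg[OF x y] by simp
    have "x \<ominus>\<^bsub>M\<^esub> z \<in> U \<longleftrightarrow> y \<ominus>\<^bsub>M\<^esub> z \<in> U" if z: "z \<in> carrier M" for z
      using Ud(4)[OF xy, of "y \<ominus>\<^bsub>M\<^esub> z", folded swap[OF x y z]]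
        Ud(4)[OF yx, of "x \<ominus>\<^bsub>M\<^esub> z", folded swap[OF y x z]] by blast
    then show "?f x = ?f y" by blast
  qed
  then have "\<forall>x\<in>carrier M. \<forall>y\<in>carrier M. ?f x = ?f y \<longleftrightarrow> x \<ominus>\<^bsub>M\<^esub> y \<in> U" by blast
  note C = push_module[OF M U this]
  have "?f x = \<zero>\<^bsub>push_module ?f M\<^esub> \<longleftrightarrow> x \<in> U" if "x \<in> carrier M" for x
    unfolding C(4) eq[OF that M.M.zero_closed] using that by (simp add: M.M.minus_zero_right)
  then have "{x \<in> carrier M. ?f x = \<zero>\<^bsub>push_module ?f M\<^esub>} = U" using Ud(3) by blast
  then show ?thesis by (rule that[OF C(1,2) C(3)[symmetric]])
qed

abbreviation std_first_syzygy ::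
  "('r, 'e) ring_scheme \<Rightarrow> ('r, 'm, 'f) module_scheme \<Rightarrow> ('r, ('r, 'm) std_basis \<Rightarrow> 'r) module" where
  "std_first_syzygy R N \<equiv> std_mod R N 0\<lparr>carrier := std_syz R N 0\<rparr>"

lemma std_aug_lin_map:
  assumes "left_module R N"
  shows "lin_map R (std_mod R N 0) N (std_aug R N)"
    "std_aug R N ` carrier (std_mod R N 0) = carrier N"
    "projective_module R (std_mod R N 0)"
    "std_syz R N 0 = {x \<in> carrier (std_mod R N 0). std_aug R N x = \<zero>\<^bsub>N\<^esub>}"
proof -
  note res = std_projective_resolution[OF assms, unfolded projective_resolution_def]
  show "lin_map R (std_mod R N 0) N (std_aug R N)"
    by (rule mod_hom_lin_map) (use res in blast)
  show "std_aug R N ` carrier (std_mod R N 0) = carrier N" "projective_module R (std_mod R N 0)"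
    using res by blast+
qed simp

text \<open>\<open>fin_dim\<close> takes account of modules with finite \<open>proj_dim\<close>
  only, so finiteness has to be known before a bound on \<open>fin_dim\<close> says anything. A
  projective first syzygy gives a resolution of length one, continued by zeros.\<close>

lemma proj_dim_finite:
  fixes N :: "('r, 'm, 'f) module_scheme"
  assumes N: "left_module R N" and syz: "projective_module R (std_first_syzygy R N)"
  shows "proj_dim R N < \<infinity>"
proof -
  note aug = std_aug_lin_map[OF N]
  note F = projective_left_module[OF aug(3)]
  interpret F: left_module R "std_mod R N 0" by (rule F)
  have S: "submodule (std_syz R N 0) R (std_mod R N 0)"
    unfolding aug(4) by (rule kernel_submodule[OF F N aug(1)])
  let ?Z = "std_mod R N 0\<lparr>carrier := {\<zero>\<^bsub>std_mod R N 0\<^esub>}\<rparr>"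
  have Z: "projective_module R ?Z"
    by (rule projective_zero_module[OF submodule_left_module[OF F zero_submodule[OF F]]]) simp
  note K = projective_left_module[OF syz]
  \<comment> \<open>The zero modules are realized inside \<open>std_mod R N 0\<close>, so that all
    terms share one type and one zero element; the differentials are an inclusion and then zero
    maps.\<close>
  define P where "P n = (if n = 0 then std_mod R N 0 else if n = 1 then std_first_syzygy R N else ?Z)" for n :: nat
  define d where "d n = (\<lambda>x\<in>carrier (P (Suc n)). if n = 0 then x else \<zero>\<^bsub>std_mod R N 0\<^esub>)" for n :: nat
  have zero: "\<zero>\<^bsub>P n\<^esub> = \<zero>\<^bsub>std_mod R N 0\<^esub>" for n by (simp add: P_def)
  have S0: "\<zero>\<^bsub>std_mod R N 0\<^esub> \<in> std_syz R N 0" by (rule submoduleD(2)[OF S])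
  have PM: "projective_module R (P n)" for n using aug(3) syz Z by (simp add: P_def)
  have d0: "d 0 \<in> mod_hom R (P 1) (P 0)"
    using restrict_mod_hom[OF K, of "P 0" "\<lambda>x. x"] submoduleD(1)[OF S]
    by (auto simp: P_def d_def lin_map_def)
  have dn: "d (Suc n) \<in> mod_hom R (P (Suc (Suc n))) (P (Suc n))" for n
    using restrict_mod_hom[OF projective_left_module[OF PM[of "Suc (Suc n)"]]
        lin_map_zero[OF projective_left_module[OF PM[of "Suc n"]]]]
    by (simp add: d_def zero)
  have "projective_resolution R N P d (std_aug R N)"
    unfolding projective_resolution_def
  proof (intro conjI allI)
    show "d n \<in> mod_hom R (P (Suc n)) (P n)" for n using d0 dn by (cases n) auto
    show "std_aug R N \<in> mod_hom R (P 0) N"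
      using std_projective_resolution[OF N] by (simp add: projective_resolution_def P_def)
    show "std_aug R N ` carrier (P 0) = carrier N" using aug(2) by (simp add: P_def)
    show "d 0 ` carrier (P 1) = {x \<in> carrier (P 0). std_aug R N x = \<zero>\<^bsub>N\<^esub>}"
      using aug(4) by (simp add: P_def d_def image_restrict_eq)
    show "d (Suc n) ` carrier (P (Suc (Suc n))) = {x \<in> carrier (P (Suc n)). d n x = \<zero>\<^bsub>P n\<^esub>}" for n
      using S0 submoduleD(1)[OF S] by (auto simp: d_def zero) (auto simp: P_def split: if_splits)
  qed (rule PM)
  moreover have "\<forall>i>1. carrier (P i) = {\<zero>\<^bsub>P i\<^esub>}" by (simp add: P_def)
  ultimately have "proj_dim R N \<le> enat 1"
    unfolding proj_dim_def by (intro Inf_lower) blast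
  then show ?thesis by (metis enat_ord_code(4) order_le_less_trans)
qed

lemma proj_dim_zero_projective:
  fixes N :: "('r, 'm, 'f) module_scheme"
  assumes N: "left_module R N" and zero: "proj_dim R N = 0"
  shows "projective_module R N"
proof -
  let ?S = "{enat n | n. \<exists>(P :: nat \<Rightarrow> ('r, ('r, 'm) std_basis \<Rightarrow> 'r) module) d \<epsilon>.
       projective_resolution R N P d \<epsilon> \<and> (\<forall>i>n. carrier (P i) = {\<zero>\<^bsub>P i\<^esub>})}"
  \<comment> \<open>The infimum of the empty set is \<infinity>, so the value zero forces a
    resolution to exist, and an infimum of a nonempty set of extended naturals is attained. A
    resolution of length zero is an isomorphism from a projective module.\<close>
  have "?S \<noteq> {}" using zero unfolding proj_dim_def by (metis (lifting) Inf_enat_def i0_ne_infinity)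
  then have "Inf ?S \<in> ?S" using wellorder_InfI[of _ ?S] by blast
  then have "0 \<in> ?S" using zero unfolding proj_dim_def by simp
  then obtain P :: "nat \<Rightarrow> ('r, ('r, 'm) std_basis \<Rightarrow> 'r) module" and d \<epsilon>
    where res: "projective_resolution R N P d \<epsilon>" and P: "\<forall>i>0. carrier (P i) = {\<zero>\<^bsub>P i\<^esub>}"
    by (auto simp: zero_enat_def)
  have P0: "projective_module R (P 0)" and P1: "left_module R (P 1)" and d: "lin_map R (P 1) (P 0) (d 0)"
    and \<epsilon>: "lin_map R (P 0) N \<epsilon>" and surj: "\<epsilon> ` carrier (P 0) = carrier N"
    and ker: "d 0 ` carrier (P 1) = {x \<in> carrier (P 0). \<epsilon> x = \<zero>\<^bsub>N\<^esub>}"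
    using res by (auto simp: projective_resolution_def intro: mod_hom_lin_map projective_left_module)
  note P0M = projective_left_module[OF P0]
  have inj: "inj_on \<epsilon> (carrier (P 0))"
    by (rule lin_map_inj_on[OF P0M N \<epsilon>]) (use ker P lin_map_0[OF P1 P0M d] in auto)
  show ?thesis
    by (rule projective_retract[OF P0 N lin_map_inv_into[OF P0M \<epsilon> inj surj] \<epsilon>])
       (use surj in \<open>auto simp: f_inv_into_f\<close>)
qed

text \<open>The structure map is a parameter so that the degree 0 ring and its opposite are both
  instances. The field supplies the measure on submodules and the finite generation of
  submodules.\<close>

locale finite_dimensional_ring =
  fixes K :: "('k, 'e) ring_scheme" and R :: "('r, 'f) ring_scheme" and \<phi> :: "'k \<Rightarrow> 'r"
  assumes K: "field K" and R: "ring R" and \<phi>: "\<phi> \<in> ring_hom K R"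
    and fg: "finitely_generated K (restrict_scalars \<phi> (regular_module R))"
begin

lemma K_ring: "ring K"
  using K by (simp add: field_def domain_def cring_def)

lemma finitely_generated_scalars:
  assumes "left_module R N" "finitely_generated R N"
  shows "finitely_generated K (restrict_scalars \<phi> N)"
  by (rule finitely_generated_restrict_scalars[OF \<phi> assms(1) K_ring fg assms(2)])

text \<open>Submodules over \<open>R\<close> are subspaces over \<open>K\<close>, and
  \<open>N\<close> has finite dimension over \<open>K\<close>. The measure plays the role of
  composition length.\<close>

lemma submodule_measure:
  fixes N :: "('r, 'm, 'g) module_scheme"
  assumes N: "left_module R N" "finitely_generated R N"
  obtains \<mu> :: "'m set \<Rightarrow> nat" where
    "\<And>U U'. submodule U R N \<Longrightarrow> submodule U' R N \<Longrightarrow> U \<subset> U' \<Longrightarrow> \<mu> U < \<mu> U'"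
  using subspace_measure[OF K restrict_scalars_left_module[OF N(1) K_ring \<phi>] finitely_generated_scalars[OF N]]
    submodule_restrict_scalars[OF \<phi> N(1) K_ring] by metis

lemma finitely_generated_submodule:
  assumes N: "left_module R N" "finitely_generated R N" and U: "submodule U R N"
  shows "finitely_generated R (N\<lparr>carrier := U\<rparr>)"
proof (rule finitely_generated_restrict_scalarsD[OF \<phi> submodule_left_module[OF N(1) U] K_ring])
  show "finitely_generated K (restrict_scalars \<phi> (N\<lparr>carrier := U\<rparr>))"
    unfolding restrict_scalars_carrier_update
    by (rule finitely_generated_subspace[OF K restrict_scalars_left_module[OF N(1) K_ring \<phi>]
          finitely_generated_scalars[OF N] submodule_restrict_scalars[OF \<phi> N(1) K_ring U]])
qed

text \<open>The passage from indecomposable modules, which are all that \<open>fin_dim\<close> sees,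
  to arbitrary ones. A projective first syzygy is inherited by direct summands, which are smaller,
  so induction applies; an indecomposable module with a projective first syzygy has finite
  projective dimension, hence projective dimension zero. Working with submodules of one
  \<open>V\<close> keeps the induction in the type over which \<open>fin_dim\<close> ranges.\<close>

lemma projective_of_syzygy_aux:
  fixes V :: "('r, nat \<Rightarrow> 'r) module"
  assumes fd: "fin_dim R = 0" and V: "left_module R V" and fgV: "finitely_generated R V"
    and U: "submodule U R V" and syz: "projective_module R (std_first_syzygy R (V\<lparr>carrier := U\<rparr>))"
  shows "projective_module R (V\<lparr>carrier := U\<rparr>)"
proof -
  obtain \<mu> :: "(nat \<Rightarrow> 'r) set \<Rightarrow> nat" where
    \<mu>: "\<And>U U'. submodule U R V \<Longrightarrow> submodule U' R V \<Longrightarrow> U \<subset> U' \<Longrightarrow> \<mu> U < \<mu> U'"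
    by (rule submodule_measure[OF V fgV]) blast
  show ?thesis
    using U syz
  proof (induction "\<mu> U" arbitrary: U rule: less_induct)
    case less
    let ?N = "V\<lparr>carrier := U\<rparr>"
    have N: "left_module R ?N" by (rule submodule_left_module[OF V less.prems(1)])
    interpret N: left_module R ?N by (rule N)
    note aug = std_aug_lin_map[OF N]
    consider "U = {\<zero>\<^bsub>V\<^esub>}" | "indecomposable R ?N" | "U \<noteq> {\<zero>\<^bsub>V\<^esub>}" "\<not> indecomposable R ?N" by blast
    then show ?case
    proof cases
      case 1
      then show ?thesis by (intro projective_zero_module[OF N]) simp
    next
      case 2
      have "proj_dim R ?N \<le> fin_dim R"
        unfolding fin_dim_def
        using N 2 finitely_generated_submodule[OF V fgV less.prems(1)] proj_dim_finite[OF N less.prems(2)]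
        by (intro Sup_upper) blast
      then show ?thesis using fd by (intro proj_dim_zero_projective[OF N]) simp
    next
      case 3
      then obtain U1 U2 where U1: "submodule U1 R ?N" and U2: "submodule U2 R ?N"
        and int: "U1 \<inter> U2 = {\<zero>\<^bsub>V\<^esub>}" and sum: "U1 <+>\<^bsub>?N\<^esub> U2 = U" and ne: "U1 \<noteq> {\<zero>\<^bsub>V\<^esub>}" "U2 \<noteq> {\<zero>\<^bsub>V\<^esub>}"
        unfolding indecomposable_def by auto
      have swap: "U2 <+>\<^bsub>?N\<^esub> U1 = U1 <+>\<^bsub>?N\<^esub> U2"
        using submoduleD(3)[OF U1] submoduleD(3)[OF U2] N.M.a_comm by (force simp: set_add_defs)
      have summand: "projective_module R (V\<lparr>carrier := W\<rparr>)"
        if W: "submodule W R ?N" "submodule W' R ?N" and i: "W \<inter> W' = {\<zero>\<^bsub>V\<^esub>}"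
          and s: "W <+>\<^bsub>?N\<^esub> W' = U" and nz: "W' \<noteq> {\<zero>\<^bsub>V\<^esub>}" for W W'
      proof -
        have sub: "submodule W R V \<and> W \<subseteq> U" "W' \<subseteq> U"
          using W submodule_of_submodule[OF V less.prems(1)] by auto
        \<comment> \<open>If \<open>W\<close> were all of \<open>U\<close>, then \<open>W'\<close>,
          being contained in \<open>U\<close>, would equal \<open>W \<inter> W'\<close> and be zero.
          Hence the measure drops.\<close>
        have "W \<noteq> U" using i nz sub(2) by auto
        then have lt: "\<mu> W < \<mu> U" using sub by (intro \<mu> less.prems(1)) auto
        have WM: "left_module R (V\<lparr>carrier := W\<rparr>)" by (rule submodule_left_module[OF V]) (use sub in simp)
        obtain p where p: "lin_map R ?N ?N p" "\<And>x. x \<in> carrier ?N \<Longrightarrow> p x \<in> W" "\<And>x. x \<in> W \<Longrightarrow> p x = x"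
          by (rule direct_sum_projections[OF N W]) (use i s in auto)
        note aW = std_aug_lin_map[OF WM]
        have "projective_module R (std_mod R (V\<lparr>carrier := W\<rparr>) 0\<lparr>carrier :=
            {x \<in> carrier (std_mod R (V\<lparr>carrier := W\<rparr>) 0). std_aug R (V\<lparr>carrier := W\<rparr>) x = \<zero>\<^bsub>V\<lparr>carrier := W\<rparr>\<^esub>}\<rparr>)"
        proof (rule syzygy_projective_retract[OF N WM aug(3) aW(3) aug(1,2) _ aW(1,2)])
          show "projective_module R (std_mod R ?N 0\<lparr>carrier :=
              {x \<in> carrier (std_mod R ?N 0). std_aug R ?N x = \<zero>\<^bsub>?N\<^esub>}\<rparr>)"
            using less.prems(2) unfolding aug(4) .
          show "lin_map R (V\<lparr>carrier := W\<rparr>) ?N (\<lambda>x. x)" using sub by (auto simp: lin_map_def)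
          show "lin_map R ?N (V\<lparr>carrier := W\<rparr>) p" using p(1,2) by (auto simp: lin_map_def)
        qed (use p(3) in simp)
        then have "projective_module R (std_first_syzygy R (V\<lparr>carrier := W\<rparr>))" unfolding aW(4) .
        then show ?thesis using less.hyps[OF lt] sub by blast
      qed
      have P1: "projective_module R (V\<lparr>carrier := U1\<rparr>)"
        by (rule summand[OF U1 U2 int sum ne(2)])
      have P2: "projective_module R (V\<lparr>carrier := U2\<rparr>)"
        by (rule summand[OF U2 U1 _ _ ne(1)]) (use int sum swap in auto)
      obtain p where p: "lin_map R ?N ?N p" "\<And>x. x \<in> carrier ?N \<Longrightarrow> p x \<in> U1"
        "\<And>x. x \<in> carrier ?N \<Longrightarrow> x \<ominus>\<^bsub>?N\<^esub> p x \<in> U2"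
        by (rule direct_sum_projections[OF N U1 U2]) (use int sum in auto)
      have p2: "lin_map R ?N ?N (\<lambda>x. x \<ominus>\<^bsub>?N\<^esub> p x)" by (rule lin_map_diff[OF N lin_map_id p(1)])
      \<comment> \<open>The two summands are lifted separately, and the lifts are added along
        \<open>x = p x + (x - p x)\<close>.\<close>
      show ?thesis
      proof (rule projective_sectionI[OF N])
        fix E :: "('r, (nat \<Rightarrow> 'r) \<Rightarrow> 'r) module" and q
        assume E: "left_module R E" and q: "lin_map R E ?N q" and surj: "q ` carrier E = carrier ?N"
        interpret E: left_module R E by fact
        have sub: "U1 \<subseteq> U" "U2 \<subseteq> U" using submoduleD(1)[OF U1] submoduleD(1)[OF U2] by auto
        obtain h1 where h1: "lin_map R (V\<lparr>carrier := U1\<rparr>) E h1" "\<And>x. x \<in> carrier (V\<lparr>carrier := U1\<rparr>) \<Longrightarrow> q (h1 x) = x"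
          by (rule projective_lift[OF P1 E N q, of "\<lambda>x. x"]) (use sub surj in \<open>auto simp: lin_map_def\<close>)
        obtain h2 where h2: "lin_map R (V\<lparr>carrier := U2\<rparr>) E h2" "\<And>x. x \<in> carrier (V\<lparr>carrier := U2\<rparr>) \<Longrightarrow> q (h2 x) = x"
          by (rule projective_lift[OF P2 E N q, of "\<lambda>x. x"]) (use sub surj in \<open>auto simp: lin_map_def\<close>)
        have k1: "lin_map R ?N E (\<lambda>x. h1 (p x))"
          by (rule lin_map_comp[OF _ h1(1)]) (use p in \<open>auto simp: lin_map_def\<close>)
        have k2: "lin_map R ?N E (\<lambda>x. h2 (x \<ominus>\<^bsub>?N\<^esub> p x))"
          by (rule lin_map_comp[OF _ h2(1)]) (use p2 p(3) in \<open>auto simp: lin_map_def\<close>)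
        have "q (h1 (p x) \<oplus>\<^bsub>E\<^esub> h2 (x \<ominus>\<^bsub>?N\<^esub> p x)) = x" if x: "x \<in> carrier ?N" for x
        proof -
          have "q (h1 (p x) \<oplus>\<^bsub>E\<^esub> h2 (x \<ominus>\<^bsub>?N\<^esub> p x)) = p x \<oplus>\<^bsub>?N\<^esub> (x \<ominus>\<^bsub>?N\<^esub> p x)"
            using lin_mapD(2)[OF q lin_mapD(1)[OF k1 x] lin_mapD(1)[OF k2 x]] h1(2) h2(2) p(2)[OF x] p(3)[OF x] by simp
          also have "\<dots> = x" by (rule N.M.add_minus_cancel_right[OF lin_mapD(1)[OF p(1) x] x])
          finally show ?thesis .
        qed
        then show "\<exists>h. lin_map R ?N E h \<and> (\<forall>x\<in>carrier ?N. q (h x) = x)"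
          using lin_map_add[OF E k1 k2] by blast
      qed
    qed
  qed
qed

text \<open>\<open>fin_dim\<close> ranges over modules whose elements have type
  \<open>nat \<Rightarrow> 'r\<close>. An element of a finitely generated module is determined by a
  chosen coefficient vector, indexed through a numbering of the generators.\<close>

lemma finitely_generated_encoding:
  fixes N :: "('r, 'm, 'g) module_scheme"
  assumes N: "left_module R N" and fgN: "finitely_generated R N"
  obtains \<sigma> :: "'m \<Rightarrow> nat \<Rightarrow> 'r" where "inj_on \<sigma> (carrier N)"
proof -
  interpret N: left_module R N by fact
  from fgN obtain S where S: "S \<subseteq> carrier N \<and> finite S \<and>
      (\<forall>x\<in>carrier N. \<exists>c\<in>S \<rightarrow> carrier R. x = (\<Oplus>\<^bsub>N\<^esub> s\<in>S. c s \<odot>\<^bsub>N\<^esub> s))"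
    unfolding finitely_generated_def by (rule exE)
  then have "\<forall>x\<in>carrier N. \<exists>c. c \<in> S \<rightarrow> carrier R \<and> x = (\<Oplus>\<^bsub>N\<^esub> s\<in>S. c s \<odot>\<^bsub>N\<^esub> s)" by blast
  from bchoice[OF this] obtain c where c: "x \<in> carrier N \<Longrightarrow> c x \<in> S \<rightarrow> carrier R"
    "x \<in> carrier N \<Longrightarrow> x = (\<Oplus>\<^bsub>N\<^esub> s\<in>S. c x s \<odot>\<^bsub>N\<^esub> s)" for x by blast
  have fin: "finite S" and SN: "S \<subseteq> carrier N" using S by simp_all
  obtain f :: "'m \<Rightarrow> nat" where f: "inj_on f S" using countable_finite[OF fin] by (rule countableE)
  \<comment> \<open>Outside the range of \<open>f\<close> the value of \<open>inv_into\<close> is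
    arbitrary; only the indices \<open>f s\<close> are compared.\<close>
  have "inj_on (\<lambda>x i. c x (inv_into S f i)) (carrier N)"
  proof (rule inj_onI)
    fix x y assume x: "x \<in> carrier N" and y: "y \<in> carrier N"
      and eq: "(\<lambda>i. c x (inv_into S f i)) = (\<lambda>i. c y (inv_into S f i))"
    have "c x s = c y s" if "s \<in> S" for s
      using fun_cong[OF eq, of "f s"] f that by simp
    then have "(\<Oplus>\<^bsub>N\<^esub> s\<in>S. c x s \<odot>\<^bsub>N\<^esub> s) = (\<Oplus>\<^bsub>N\<^esub> s\<in>S. c y s \<odot>\<^bsub>N\<^esub> s)"
      using c(1)[OF y] SN by (intro N.M.finsum_cong') auto
    then show "x = y" using c(2)[OF x] c(2)[OF y] by simp
  qed
  then show ?thesis by (rule that)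
qed

text \<open>Finitistic dimension zero excludes projective dimension one. The encoding moves
  \<open>N\<close> to the type of \<open>fin_dim\<close>, and Schanuel's lemma replaces the given
  short resolution by the standard one.\<close>

theorem projective_of_short_resolution:
  fixes N :: "('r, 'm, 'g) module_scheme"
  assumes fd: "fin_dim R = 0" and N: "left_module R N" and fgN: "finitely_generated R N"
    and Q: "projective_module R Q" and q: "lin_map R Q N q" and surj: "q ` carrier Q = carrier N"
    and ker: "projective_module R (Q\<lparr>carrier := {x \<in> carrier Q. q x = \<zero>\<^bsub>N\<^esub>}\<rparr>)"
  shows "projective_module R N"
proof -
  interpret N: left_module R N by fact
  obtain \<sigma> :: "'m \<Rightarrow> nat \<Rightarrow> 'r" where \<sigma>: "inj_on \<sigma> (carrier N)"
    by (rule finitely_generated_encoding[OF N fgN])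
  have eq: "\<forall>x\<in>carrier N. \<forall>y\<in>carrier N. \<sigma> x = \<sigma> y \<longleftrightarrow> x \<ominus>\<^bsub>N\<^esub> y \<in> {\<zero>\<^bsub>N\<^esub>}"
    using \<sigma> by (simp add: inj_on_eq_iff N.M.minus_eq_zero_iff)
  let ?V = "push_module \<sigma> N"
  note V = push_module[OF N zero_submodule[OF N] eq]
  note aug = std_aug_lin_map[OF V(1)]
  note surj_\<sigma> = V(3)[symmetric]
  have inv: "lin_map R ?V N (inv_into (carrier N) \<sigma>)"
    by (rule lin_map_inv_into[OF N V(2) \<sigma> surj_\<sigma>])
  have \<sigma>_inv: "\<sigma> (inv_into (carrier N) \<sigma> v) = v" if "v \<in> carrier ?V" for v
    by (rule f_inv_into_f) (use that V(3) in blast)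
  have VM: "?V\<lparr>carrier := carrier ?V\<rparr> = ?V" by simp
  have "projective_module R (std_mod R ?V 0\<lparr>carrier :=
      {x \<in> carrier (std_mod R ?V 0). std_aug R ?V x = \<zero>\<^bsub>?V\<^esub>}\<rparr>)"
    by (rule syzygy_projective_retract[OF N V(1) Q aug(3) q surj ker aug(1,2) inv V(2) \<sigma>_inv])
  then have "projective_module R (std_first_syzygy R (?V\<lparr>carrier := carrier ?V\<rparr>))" unfolding VM aug(4) .
  from projective_of_syzygy_aux[OF fd V(1) finitely_generated_image[OF N V(1,2) surj_\<sigma> fgN] carrier_submodule[OF V(1)] this]
  have "projective_module R ?V" unfolding VM .
  then show ?thesis
    by (rule projective_retract[OF _ N V(2) inv]) (use \<sigma> in simp)
qed

text \<open>The cokernel is resolved by \<open>P\<close> and \<open>Q\<close>, so it is projective,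
  and \<open>Q\<close> retracts onto the image of \<open>P\<close>.\<close>

lemma injection_splits:
  fixes Q :: "('r, 'q, 'g) module_scheme"
  assumes fd: "fin_dim R = 0" and P: "projective_module R P" and Q: "projective_module R Q"
    and fgQ: "finitely_generated R Q" and \<rho>: "lin_map R P Q \<rho>" and inj: "inj_on \<rho> (carrier P)"
  obtains s where "lin_map R Q P s" "\<And>x. x \<in> carrier P \<Longrightarrow> s (\<rho> x) = x"
proof -
  note PM = projective_left_module[OF P] and QM = projective_left_module[OF Q]
  let ?I = "\<rho> ` carrier P"
  have I: "submodule ?I R Q" by (rule image_submodule[OF PM QM \<rho> carrier_submodule[OF PM]])
  have \<rho>': "lin_map R P (Q\<lparr>carrier := ?I\<rparr>) \<rho>" using \<rho> by (auto simp: lin_map_def)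
  have inv: "lin_map R (Q\<lparr>carrier := ?I\<rparr>) P (inv_into (carrier P) \<rho>)"
    by (rule lin_map_inv_into[OF PM \<rho>' inj]) simp
  have IP: "projective_module R (Q\<lparr>carrier := ?I\<rparr>)"
    by (rule projective_retract[OF P submodule_left_module[OF QM I] inv \<rho>']) (auto simp: f_inv_into_f)
  obtain C :: "('r, 'q set) module" and q where C: "left_module R C" "lin_map R Q C q" "q ` carrier Q = carrier C"
    "{x \<in> carrier Q. q x = \<zero>\<^bsub>C\<^esub>} = ?I" by (rule quotient_module[OF QM I])
  have CP: "projective_module R C"
    by (rule projective_of_short_resolution[OF fd C(1) finitely_generated_image[OF QM C(1-3) fgQ] Q C(2,3)])
       (unfold C(4), rule IP)
  obtain r where r: "lin_map R Q (Q\<lparr>carrier := {x \<in> carrier Q. q x = \<zero>\<^bsub>C\<^esub>}\<rparr>) r"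
    "\<And>x. x \<in> carrier Q \<Longrightarrow> q x = \<zero>\<^bsub>C\<^esub> \<Longrightarrow> r x = x"
    by (rule kernel_retraction[OF QM CP C(2,3)]) blast
  have r_id: "r x = x" if x: "x \<in> ?I" for x
    using x[folded C(4)] by (intro r(2)) simp_all
  show ?thesis
  proof (rule that[OF lin_map_comp[OF r(1)[unfolded C(4)] inv]])
    fix x assume x: "x \<in> carrier P"
    show "inv_into (carrier P) \<rho> (r (\<rho> x)) = x"
      unfolding r_id[OF imageI[OF x]] by (rule inv_into_f_f[OF inj x])
  qed
qed

end

section \<open>The opposite ring and functionals into the regular module\<close>

lemma (in left_module) smult_l_minus:
  assumes "a \<in> carrier R" "c \<in> carrier R" "x \<in> carrier M"
  shows "(a \<ominus>\<^bsub>R\<^esub> c) \<odot>\<^bsub>M\<^esub> x = a \<odot>\<^bsub>M\<^esub> x \<ominus>\<^bsub>M\<^esub> c \<odot>\<^bsub>M\<^esub> x"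
proof -
  have "a \<odot>\<^bsub>M\<^esub> x = (c \<oplus>\<^bsub>R\<^esub> (a \<ominus>\<^bsub>R\<^esub> c)) \<odot>\<^bsub>M\<^esub> x" using assms by (simp add: R.add_minus_cancel_right)
  also have "\<dots> = c \<odot>\<^bsub>M\<^esub> x \<oplus>\<^bsub>M\<^esub> (a \<ominus>\<^bsub>R\<^esub> c) \<odot>\<^bsub>M\<^esub> x" using assms by (intro smult_l_distr) auto
  finally show ?thesis using assms M.add_minus_cancel[of "c \<odot>\<^bsub>M\<^esub> x" "(a \<ominus>\<^bsub>R\<^esub> c) \<odot>\<^bsub>M\<^esub> x"] by simp
qed

lemma opposite_ring_simps [simp]:
  "carrier (opposite_ring R) = carrier R" "\<zero>\<^bsub>opposite_ring R\<^esub> = \<zero>\<^bsub>R\<^esub>" "\<one>\<^bsub>opposite_ring R\<^esub> = \<one>\<^bsub>R\<^esub>"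
  "x \<oplus>\<^bsub>opposite_ring R\<^esub> y = x \<oplus>\<^bsub>R\<^esub> y" "x \<otimes>\<^bsub>opposite_ring R\<^esub> y = y \<otimes>\<^bsub>R\<^esub> x"
  by (simp_all add: opposite_ring_def)

lemma (in ring) opposite_ring: "ring (opposite_ring R)"
proof (rule ringI)
  show "abelian_group (opposite_ring R)"
  proof (rule abelian_groupI, goal_cases)
    case (6 x)
    then show ?case by (intro bexI[of _ "\<ominus> x"]) (auto simp: l_neg)
  qed (auto simp: a_ac)
  show "monoid (opposite_ring R)" by (rule monoidI) (auto simp: m_assoc)
qed (auto simp: l_distr r_distr)

lemma (in ring) projective_regular_module: "projective_module R (regular_module R)"
proof (rule projective_sectionI[OF regular_left_module])
  fix E :: "('a, 'a \<Rightarrow> 'a) module" and p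
  assume E: "left_module R E" and p: "lin_map R E (regular_module R) p"
    and surj: "p ` carrier E = carrier (regular_module R)"
  interpret E: left_module R E by fact
  have "\<one> \<in> p ` carrier E" unfolding surj by simp
  then obtain e where e: "e \<in> carrier E" "p e = \<one>" by auto
  then have "lin_map R (regular_module R) E (\<lambda>a. a \<odot>\<^bsub>E\<^esub> e)"
    by (auto simp: lin_map_def E.smult_l_distr E.smult_assoc1)
  then show "\<exists>h. lin_map R (regular_module R) E h \<and> (\<forall>x\<in>carrier (regular_module R). p (h x) = x)"
    using e lin_mapD(3)[OF p] by (intro exI[of _ "\<lambda>a. a \<odot>\<^bsub>E\<^esub> e"]) auto
qed

lemma (in ring) regular_module_finitely_generated: "finitely_generated R (regular_module R)"
proof -
  have "carrier R \<subseteq> lspan R (regular_module R) {\<one>}"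
    using submoduleD(6)[OF lspan_submodule[OF regular_left_module], of "{\<one>}" _ \<one>]
      lspan_superset[of "{\<one>}" R "regular_module R"] by auto
  then have "lspan R (regular_module R) {\<one>} = carrier (regular_module R)"
    using submoduleD(1)[OF lspan_submodule[OF regular_left_module, of "{\<one>}"]] by auto
  then show ?thesis unfolding finitely_generated_iff_lspan[OF regular_left_module]
    by (intro exI[of _ "{\<one>}"]) auto
qed

lemma (in ring) free_module_finitely_generated:
  assumes S: "finite S"
  shows "finitely_generated R (free_module R S)"
proof -
  let ?F = "free_module R S"
  note F = free_module_left_module[of S]
  interpret F: left_module R ?F by (rule F)
  let ?T = "unit_vec ` S"
  have T: "?T \<subseteq> carrier ?F" using unit_vec_carrier by (rule image_subsetI)
  note L = lspan_submodule[OF F T]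
  have "f \<in> lspan R ?F ?T" if f: "f \<in> carrier ?F" for f
  proof -
    have fS: "f x \<in> carrier R" "f x \<noteq> \<zero> \<Longrightarrow> x \<in> S" for x using f by (auto simp: free_module_carrier)
    have "f = (\<lambda>x\<in>carrier ?F. x) f" using f by simp
    also have "\<dots> = lin_ext R S ?F (\<lambda>b. (\<lambda>x\<in>carrier ?F. x) (unit_vec b)) f"
      by (rule F.free_hom_eq_lin_ext[OF mod_hom_id[OF F] f])
    also have "\<dots> = (\<Oplus>\<^bsub>?F\<^esub> x\<in>{x. f x \<noteq> \<zero>}. f x \<odot>\<^bsub>?F\<^esub> (\<lambda>x\<in>carrier ?F. x) (unit_vec x))"
      using f by (simp add: lin_ext_def)
    also have "\<dots> \<in> lspan R ?F ?T"
    proof (rule submodule_finsum[OF F L], rule Pi_I)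
      fix x assume "x \<in> {x. f x \<noteq> \<zero>}"
      then have x: "x \<in> S" using fS(2) by simp
      then have "(\<lambda>x\<in>carrier ?F. x) (unit_vec x) \<in> lspan R ?F ?T"
        using unit_vec_carrier[OF x] lspan_superset[of ?T R ?F] by auto
      then show "f x \<odot>\<^bsub>?F\<^esub> (\<lambda>x\<in>carrier ?F. x) (unit_vec x) \<in> lspan R ?F ?T"
        by (rule submoduleD(6)[OF L fS(1)])
    qed
    finally show ?thesis .
  qed
  then have "lspan R ?F ?T = carrier ?F" using submoduleD(1)[OF L] by blast
  then show ?thesis unfolding finitely_generated_iff_lspan[OF F] using S T by (intro exI[of _ ?T]) simp
qed

text \<open>Left multiplication by the elements of \<^term>\<open>S\<close> is an injection of right modules, which splits;
  a splitting writes \<^term>\<open>\<one>\<^bsub>R\<^esub>\<close> as a combination of \<^term>\<open>S\<close>.\<close>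

lemma one_in_left_ideal:
  fixes R :: "('r, 'f) ring_scheme"
  assumes R: "ring R" and op: "finite_dimensional_ring K (opposite_ring R) \<phi>"
    and fd: "fin_dim (opposite_ring R) = 0" and S: "finite S" "S \<subseteq> carrier R"
    and ann: "\<And>x. x \<in> carrier R \<Longrightarrow> (\<forall>r\<in>S. r \<otimes>\<^bsub>R\<^esub> x = \<zero>\<^bsub>R\<^esub>) \<Longrightarrow> x = \<zero>\<^bsub>R\<^esub>"
  shows "\<one>\<^bsub>R\<^esub> \<in> lspan R (regular_module R) S"
proof -
  interpret R: ring R by fact
  interpret op: finite_dimensional_ring K "opposite_ring R" \<phi> by fact
  interpret R': ring "opposite_ring R" by (rule R.opposite_ring)
  let ?R = "opposite_ring R"
  let ?P = "regular_module ?R" and ?F = "free_module ?R S"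
  note P = R'.regular_left_module and F = R'.free_module_left_module[of S]
  interpret P: left_module ?R ?P by (rule P)
  have in_F: "f \<in> carrier ?F \<longleftrightarrow> (\<forall>x. f x \<in> carrier R) \<and> (\<forall>x. x \<notin> S \<longrightarrow> f x = \<zero>\<^bsub>R\<^esub>)" for f
    using S(1) finite_subset[of "{x. f x \<noteq> \<zero>\<^bsub>R\<^esub>}" S] by (auto simp: free_module_carrier)
  \<comment> \<open>\<open>\<rho> x\<close> is the family of all products \<open>r x\<close> with
    \<open>r\<close> in \<open>S\<close>. Right multiplication is the action over the opposite ring,
    so \<open>\<rho>\<close> is linear there; its kernel is the right annihilator of
    \<open>S\<close>, which is zero by \<open>ann\<close>.\<close>
  define \<rho> where "\<rho> x = (\<lambda>r. if r \<in> S then r \<otimes>\<^bsub>R\<^esub> x else \<zero>\<^bsub>R\<^esub>)" for x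
  have SR: "r \<in> S \<Longrightarrow> r \<in> carrier R" for r using S(2) by blast
  have \<rho>: "lin_map ?R ?P ?F \<rho>"
    by (rule lin_mapI) (auto simp: in_F \<rho>_def SR R.r_distr R.m_assoc fun_eq_iff)
  have inj: "inj_on \<rho> (carrier ?P)"
  proof (rule lin_map_inj_on[OF P F \<rho>])
    fix x assume x: "x \<in> carrier ?P" and \<rho>0: "\<rho> x = \<zero>\<^bsub>?F\<^esub>"
    have "r \<otimes>\<^bsub>R\<^esub> x = \<zero>\<^bsub>R\<^esub>" if "r \<in> S" for r
      using fun_cong[OF \<rho>0, of r] that by (simp add: \<rho>_def)
    then show "x = \<zero>\<^bsub>?P\<^esub>" using ann x by simp
  qed
  obtain s where s: "lin_map ?R ?F ?P s" "\<And>x. x \<in> carrier ?P \<Longrightarrow> s (\<rho> x) = x"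
    by (rule op.injection_splits[OF fd R'.projective_regular_module R'.projective_free_module
          R'.free_module_finitely_generated[OF S(1)] \<rho> inj]) blast
  have s': "restrict s (carrier ?F) \<in> mod_hom ?R ?F ?P" by (rule restrict_mod_hom[OF F s(1)])
  \<comment> \<open>\<open>\<rho>\<close> sends one to the family of the elements of
    \<open>S\<close>. The splitting expands one along the unit vectors into a sum of terms
    \<open>?v b\<close> times \<open>b\<close>: the opposite multiplication puts the coefficient on
    the left, so the sum lies in the left ideal.\<close>
  let ?v = "\<lambda>b. restrict s (carrier ?F) (R'.unit_vec b)"
  have \<rho>1: "\<rho> \<one>\<^bsub>R\<^esub> \<in> carrier ?F" using lin_mapD(1)[OF \<rho>] by simp
  have v: "?v b \<in> carrier R" if "b \<in> S" for b
    using lin_mapD(1)[OF s(1) R'.unit_vec_carrier[OF that]] R'.unit_vec_carrier[OF that] by simp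
  have "\<one>\<^bsub>R\<^esub> = restrict s (carrier ?F) (\<rho> \<one>\<^bsub>R\<^esub>)" using s(2)[of "\<one>\<^bsub>R\<^esub>"] \<rho>1 by simp
  also have "\<dots> = lin_ext ?R S ?P ?v (\<rho> \<one>\<^bsub>R\<^esub>)"
    by (rule P.free_hom_eq_lin_ext[OF s' \<rho>1])
  also have "\<dots> = (\<Oplus>\<^bsub>?P\<^esub> b\<in>S. \<rho> \<one>\<^bsub>R\<^esub> b \<odot>\<^bsub>?P\<^esub> ?v b)"
    by (rule P.lin_ext_superset[OF \<rho>1 _ S(1)]) (use v in \<open>auto simp: \<rho>_def split: if_splits\<close>)
  \<comment> \<open>Both regular modules carry the additive structure of \<open>R\<close>, so their
    finite sums coincide.\<close>
  also have "\<dots> = (\<Oplus>\<^bsub>regular_module R\<^esub> b\<in>S. \<rho> \<one>\<^bsub>R\<^esub> b \<odot>\<^bsub>?P\<^esub> ?v b)"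
    by (simp add: finsum_def regular_module_def opposite_ring_def)
  also have "\<dots> \<in> lspan R (regular_module R) S"
  proof (rule submodule_finsum[OF R.regular_left_module lspan_submodule[OF R.regular_left_module]])
    show "S \<subseteq> carrier (regular_module R)" using S(2) by simp
    then have L: "submodule (lspan R (regular_module R) S) R (regular_module R)"
      by (rule lspan_submodule[OF R.regular_left_module])
    show "(\<lambda>b. \<rho> \<one>\<^bsub>R\<^esub> b \<odot>\<^bsub>?P\<^esub> ?v b) \<in> S \<rightarrow> lspan R (regular_module R) S"
    proof (rule Pi_I)
      fix b assume b: "b \<in> S"
      have "b \<in> lspan R (regular_module R) S" by (rule subsetD[OF lspan_superset b])
      from submoduleD(6)[OF L v[OF b] this]
      show "\<rho> \<one>\<^bsub>R\<^esub> b \<odot>\<^bsub>?P\<^esub> ?v b \<in> lspan R (regular_module R) S" using b SR by (simp add: \<rho>_def)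
    qed
  qed
  finally show ?thesis .
qed

text \<open>Modulo a maximal proper submodule \<open>W\<close> above \<open>U\<close>, the module is
  generated by any \<open>s\<close> outside \<open>W\<close>. The left ideal of all \<open>a\<close>
  with \<open>a s\<close> in \<open>W\<close> does not contain one, so it has a nonzero right
  annihilator \<open>x\<close>; the functional kills \<open>W\<close> and sends \<open>a s\<close>
  to \<open>a x\<close>.\<close>

lemma nonzero_functional:
  fixes R :: "('r, 'f) ring_scheme" and N :: "('r, 'm, 'g) module_scheme"
  assumes fR: "finite_dimensional_ring K R \<phi>" and op: "finite_dimensional_ring K (opposite_ring R) \<phi>"
    and fd: "fin_dim (opposite_ring R) = 0" and N: "left_module R N" and fgN: "finitely_generated R N"
    and U: "submodule U R N" and ne: "U \<noteq> carrier N"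
  obtains h x where "lin_map R N (regular_module R) h" "\<And>u. u \<in> U \<Longrightarrow> h u = \<zero>\<^bsub>R\<^esub>"
    "x \<in> carrier N" "h x \<noteq> \<zero>\<^bsub>R\<^esub>"
proof -
  interpret fd: finite_dimensional_ring K R \<phi> by fact
  interpret N: left_module R N by fact
  let ?R = "regular_module R"
  note RM = N.R.regular_left_module
  obtain \<mu> :: "'m set \<Rightarrow> nat" where
    \<mu>: "\<And>U U'. submodule U R N \<Longrightarrow> submodule U' R N \<Longrightarrow> U \<subset> U' \<Longrightarrow> \<mu> U < \<mu> U'"
    by (rule fd.submodule_measure[OF N fgN]) blast
  let ?good = "\<lambda>W. submodule W R N \<and> U \<subseteq> W \<and> W \<noteq> carrier N"
  \<comment> \<open>The measure of submodules is bounded by that of \<open>N\<close>, so a proper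
    submodule above \<open>U\<close> of largest measure exists.\<close>
  have "\<mu> W < Suc (\<mu> (carrier N))" if "?good W" for W
    using \<mu>[OF _ carrier_submodule[OF N], of W] that submoduleD(1)[of W R N] by (simp add: psubset_eq less_Suc_eq)
  then obtain W where W: "submodule W R N" "U \<subseteq> W" "W \<noteq> carrier N"
    and max: "\<And>W'. ?good W' \<Longrightarrow> \<mu> W' \<le> \<mu> W"
    using ex_has_greatest_nat[of ?good U \<mu> "Suc (\<mu> (carrier N))"] U ne by blast
  note Wd = submoduleD[OF W(1)]
  obtain s where s: "s \<in> carrier N" "s \<notin> W" using W Wd(1) by blast
  have ls: "lin_map R ?R N (\<lambda>a. a \<odot>\<^bsub>N\<^esub> s)"
    using s by (auto simp: lin_map_def N.smult_l_distr N.smult_assoc1)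
  let ?I = "{a \<in> carrier ?R. a \<odot>\<^bsub>N\<^esub> s \<in> W}"
  have I: "submodule ?I R ?R" by (rule vimage_submodule[OF RM N ls W(1)])
  obtain S where S: "S \<subseteq> ?I" "finite S" "lspan R (?R\<lparr>carrier := ?I\<rparr>) S = ?I"
    using fd.finitely_generated_submodule[OF RM N.R.regular_module_finitely_generated I]
      finitely_generated_iff_lspan[OF submodule_left_module[OF RM I]] by auto
  have "\<one>\<^bsub>R\<^esub> \<notin> lspan R ?R S"
    using lspan_least[OF I S(1)] s by auto
  then obtain x where x: "x \<in> carrier R" "\<forall>r\<in>S. r \<otimes>\<^bsub>R\<^esub> x = \<zero>\<^bsub>R\<^esub>" "x \<noteq> \<zero>\<^bsub>R\<^esub>"
    using one_in_left_ideal[OF N.R.ring_axioms op fd S(2)] S(1) by auto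
  \<comment> \<open>\<open>x\<close> is annihilated by the generators \<open>S\<close> of
    \<open>?I\<close> by choice. The elements of \<open>?I\<close> that annihilate \<open>x\<close>
    form a submodule containing \<open>S\<close>, so all of \<open>?I\<close> does.\<close>
  have lx: "lin_map R ?R ?R (\<lambda>a. a \<otimes>\<^bsub>R\<^esub> x)"
    using x(1) by (auto simp: lin_map_def N.R.l_distr N.R.m_assoc)
  have "submodule {a \<in> carrier ?R. a \<otimes>\<^bsub>R\<^esub> x = \<zero>\<^bsub>?R\<^esub>} R ?R" by (rule kernel_submodule[OF RM RM lx])
  from Int_submodule[OF RM this I]
  have "submodule ({a \<in> carrier ?R. a \<otimes>\<^bsub>R\<^esub> x = \<zero>\<^bsub>?R\<^esub>} \<inter> ?I) R (?R\<lparr>carrier := ?I\<rparr>)"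
    using submodule_of_submodule[OF RM I] by auto
  then have "?I \<subseteq> {a \<in> carrier ?R. a \<otimes>\<^bsub>R\<^esub> x = \<zero>\<^bsub>?R\<^esub>} \<inter> ?I"
    using S x(2) by (subst S(3)[symmetric]) (rule lspan_least, auto)
  then have ann: "a \<otimes>\<^bsub>R\<^esub> x = \<zero>\<^bsub>R\<^esub>" if "a \<in> carrier R" "a \<odot>\<^bsub>N\<^esub> s \<in> W" for a using that by auto
  let ?X = "{w \<oplus>\<^bsub>N\<^esub> a \<odot>\<^bsub>N\<^esub> s | w a. w \<in> W \<and> a \<in> carrier R}"
  have X: "submodule ?X R N"
  proof (rule N.submoduleI)
    show "?X \<subseteq> carrier N" using s Wd(3) by auto
    show "\<zero>\<^bsub>N\<^esub> \<in> ?X" using N.smult_l_null[OF s(1)] Wd(2) by (force intro!: exI[of _ "\<zero>\<^bsub>N\<^esub>"] exI[of _ "\<zero>\<^bsub>R\<^esub>"])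
    fix y z assume "y \<in> ?X" "z \<in> ?X"
    then obtain w a v b where wa: "w \<in> W" "a \<in> carrier R" "y = w \<oplus>\<^bsub>N\<^esub> a \<odot>\<^bsub>N\<^esub> s"
      and vb: "v \<in> W" "b \<in> carrier R" "z = v \<oplus>\<^bsub>N\<^esub> b \<odot>\<^bsub>N\<^esub> s" by auto
    have "y \<oplus>\<^bsub>N\<^esub> z = (w \<oplus>\<^bsub>N\<^esub> v) \<oplus>\<^bsub>N\<^esub> (a \<oplus>\<^bsub>R\<^esub> b) \<odot>\<^bsub>N\<^esub> s"
      using wa vb s Wd(3)[of w] Wd(3)[of v] by (simp add: N.smult_l_distr N.M.a_ac)
    then show "y \<oplus>\<^bsub>N\<^esub> z \<in> ?X" using wa vb Wd(4) by blast
  next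
    fix c y assume c: "c \<in> carrier R" and "y \<in> ?X"
    then obtain w a where wa: "w \<in> W" "a \<in> carrier R" "y = w \<oplus>\<^bsub>N\<^esub> a \<odot>\<^bsub>N\<^esub> s" by auto
    have "c \<odot>\<^bsub>N\<^esub> y = c \<odot>\<^bsub>N\<^esub> w \<oplus>\<^bsub>N\<^esub> (c \<otimes>\<^bsub>R\<^esub> a) \<odot>\<^bsub>N\<^esub> s"
      using wa c s Wd(3)[of w] by (simp add: N.smult_r_distr N.smult_assoc1)
    then show "c \<odot>\<^bsub>N\<^esub> y \<in> ?X" using wa c Wd(6) by blast
  qed
  have WX: "w \<in> ?X" if "w \<in> W" for w
    using N.smult_l_null[OF s(1)] Wd(3)[OF that] that by (force intro!: exI[of _ w] exI[of _ "\<zero>\<^bsub>R\<^esub>"])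
  have sX: "s \<in> ?X" using s Wd(2) by (force intro!: exI[of _ "\<zero>\<^bsub>N\<^esub>"] exI[of _ "\<one>\<^bsub>R\<^esub>"])
  have XN: "?X = carrier N"
  proof (rule ccontr)
    assume "?X \<noteq> carrier N"
    then have "\<mu> ?X \<le> \<mu> W" using max[of ?X] X W(2) WX by blast
    moreover have "W \<subset> ?X" using WX sX s(2) by blast
    ultimately show False using \<mu>[OF W(1) X] by simp
  qed
  \<comment> \<open>A representation \<open>w + a s\<close> is not unique, so \<open>h\<close> picks
    one. Two choices of \<open>a\<close> differ by an element of \<open>?I\<close>, which
    annihilates \<open>x\<close>.\<close>
  define h where "h y = (SOME b. \<exists>w\<in>W. \<exists>a\<in>carrier R. y = w \<oplus>\<^bsub>N\<^esub> a \<odot>\<^bsub>N\<^esub> s \<and> b = a \<otimes>\<^bsub>R\<^esub> x)" for y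
  have h: "h (w \<oplus>\<^bsub>N\<^esub> a \<odot>\<^bsub>N\<^esub> s) = a \<otimes>\<^bsub>R\<^esub> x" if w: "w \<in> W" and a: "a \<in> carrier R" for w a
  proof -
    have "\<exists>b. \<exists>v\<in>W. \<exists>c\<in>carrier R. w \<oplus>\<^bsub>N\<^esub> a \<odot>\<^bsub>N\<^esub> s = v \<oplus>\<^bsub>N\<^esub> c \<odot>\<^bsub>N\<^esub> s \<and> b = c \<otimes>\<^bsub>R\<^esub> x"
      using w a by blast
    from someI_ex[OF this] obtain v c where vc: "v \<in> W" "c \<in> carrier R"
      "w \<oplus>\<^bsub>N\<^esub> a \<odot>\<^bsub>N\<^esub> s = v \<oplus>\<^bsub>N\<^esub> c \<odot>\<^bsub>N\<^esub> s" "h (w \<oplus>\<^bsub>N\<^esub> a \<odot>\<^bsub>N\<^esub> s) = c \<otimes>\<^bsub>R\<^esub> x"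
      unfolding h_def by blast
    have m: "w \<in> carrier N" "v \<in> carrier N" "a \<odot>\<^bsub>N\<^esub> s \<in> carrier N" "c \<odot>\<^bsub>N\<^esub> s \<in> carrier N"
      using w vc a s Wd(3) by auto
    have "(a \<ominus>\<^bsub>R\<^esub> c) \<odot>\<^bsub>N\<^esub> s = a \<odot>\<^bsub>N\<^esub> s \<ominus>\<^bsub>N\<^esub> c \<odot>\<^bsub>N\<^esub> s"
      using a vc(2) s(1) by (rule N.smult_l_minus)
    also have "\<dots> = v \<ominus>\<^bsub>N\<^esub> w"
    proof -
      have "a \<odot>\<^bsub>N\<^esub> s = (w \<oplus>\<^bsub>N\<^esub> a \<odot>\<^bsub>N\<^esub> s) \<ominus>\<^bsub>N\<^esub> w" using m by (simp add: N.M.add_minus_cancel)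
      also have "\<dots> = (v \<ominus>\<^bsub>N\<^esub> w) \<oplus>\<^bsub>N\<^esub> c \<odot>\<^bsub>N\<^esub> s" unfolding vc(3) using m by (simp add: a_minus_def N.M.a_ac)
      finally have "a \<odot>\<^bsub>N\<^esub> s = c \<odot>\<^bsub>N\<^esub> s \<oplus>\<^bsub>N\<^esub> (v \<ominus>\<^bsub>N\<^esub> w)" using m by (simp add: N.M.a_comm)
      then show ?thesis using N.M.add_minus_cancel[of "c \<odot>\<^bsub>N\<^esub> s" "v \<ominus>\<^bsub>N\<^esub> w"] m by simp
    qed
    finally have "(a \<ominus>\<^bsub>R\<^esub> c) \<odot>\<^bsub>N\<^esub> s \<in> W" using Wd(7) w vc(1) by simp
    then have "(a \<ominus>\<^bsub>R\<^esub> c) \<otimes>\<^bsub>R\<^esub> x = \<zero>\<^bsub>R\<^esub>" using ann a vc by simp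
    then have "a \<otimes>\<^bsub>R\<^esub> x \<ominus>\<^bsub>R\<^esub> c \<otimes>\<^bsub>R\<^esub> x = \<zero>\<^bsub>R\<^esub>"
      using a vc(2) x(1) by (simp add: a_minus_def N.R.l_distr N.R.l_minus)
    then show ?thesis using vc(4) a vc(2) x(1) by (simp add: N.R.minus_eq_zero_iff)
  qed
  have hs: "h s = x" using h[OF Wd(2) N.R.one_closed] s x by simp
  have hW: "h w = \<zero>\<^bsub>R\<^esub>" if "w \<in> W" for w
    using h[OF that N.R.zero_closed] N.smult_l_null[OF s(1)] Wd(3)[OF that] x by simp
  have "lin_map R N ?R h"
  proof (rule lin_mapI)
    fix y assume "y \<in> carrier N"
    then have "y \<in> ?X" using XN by blast
    then show "h y \<in> carrier ?R" using h x by auto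
  next
    fix y z assume "y \<in> carrier N" "z \<in> carrier N"
    then have "y \<in> ?X" "z \<in> ?X" unfolding XN by blast+
    then obtain w a v b where wa: "w \<in> W" "a \<in> carrier R" "y = w \<oplus>\<^bsub>N\<^esub> a \<odot>\<^bsub>N\<^esub> s"
      and vb: "v \<in> W" "b \<in> carrier R" "z = v \<oplus>\<^bsub>N\<^esub> b \<odot>\<^bsub>N\<^esub> s" by blast
    have "y \<oplus>\<^bsub>N\<^esub> z = (w \<oplus>\<^bsub>N\<^esub> v) \<oplus>\<^bsub>N\<^esub> (a \<oplus>\<^bsub>R\<^esub> b) \<odot>\<^bsub>N\<^esub> s"
      using wa vb s Wd(3)[of w] Wd(3)[of v] by (simp add: N.smult_l_distr N.M.a_ac)
    then show "h (y \<oplus>\<^bsub>N\<^esub> z) = h y \<oplus>\<^bsub>?R\<^esub> h z"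
      using h wa vb Wd(4) x by (simp add: N.R.l_distr)
  next
    fix c y assume c: "c \<in> carrier R" and "y \<in> carrier N"
    then have "y \<in> ?X" unfolding XN by blast
    then obtain w a where wa: "w \<in> W" "a \<in> carrier R" "y = w \<oplus>\<^bsub>N\<^esub> a \<odot>\<^bsub>N\<^esub> s" by blast
    have "c \<odot>\<^bsub>N\<^esub> y = c \<odot>\<^bsub>N\<^esub> w \<oplus>\<^bsub>N\<^esub> (c \<otimes>\<^bsub>R\<^esub> a) \<odot>\<^bsub>N\<^esub> s"
      using wa c s Wd(3)[of w] by (simp add: N.smult_r_distr N.smult_assoc1)
    then show "h (c \<odot>\<^bsub>N\<^esub> y) = c \<odot>\<^bsub>?R\<^esub> h y"
      using h wa c Wd(6) x by (simp add: N.R.m_assoc)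
  qed
  then show ?thesis using that hW W(2) s(1) hs x(3) by blast
qed

section \<open>Graded modules\<close>

context abelian_group
begin

lemma homogeneous_partsI:
  assumes V: "\<And>i. V i \<subseteq> carrier G" and c: "\<And>i. c i \<in> V i"
    and T: "finite T" "{i. c i \<noteq> \<zero>} \<subseteq> T" and x: "x = (\<Oplus>i\<in>T. c i)"
  shows "homogeneous_parts G V x c"
proof -
  have "(\<Oplus>i\<in>T. c i) = (\<Oplus>i\<in>{i. c i \<noteq> \<zero>}. c i)"
    by (rule add.finprod_mono_neutral_cong_left[symmetric]) (use T V c in auto)
  then show ?thesis unfolding homogeneous_parts_def using T c x finite_subset[OF T(2,1)] by auto
qed

context
  fixes V assumes dsd: "direct_sum_decomposition G V"
begin

lemma component_subgroup: "subgroup (V i) (add_monoid G)"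
  using dsd by (simp add: direct_sum_decomposition_def)

lemma component_subset: "V i \<subseteq> carrier G"
  using subgroup.subset[OF component_subgroup] by simp

lemma component_carrier: "x \<in> V i \<Longrightarrow> x \<in> carrier G"
  using component_subset by blast

lemma component_zero: "\<zero> \<in> V i"
  using subgroup.one_closed[OF component_subgroup] by simp

lemma component_add: "x \<in> V i \<Longrightarrow> y \<in> V i \<Longrightarrow> x \<oplus> y \<in> V i"
  using subgroup.m_closed[OF component_subgroup] by simp

lemma homogeneous_part_unique:
  assumes x: "x \<in> carrier G" and c: "homogeneous_parts G V x c"
  shows "homogeneous_part G V i x = c i"
proof -
  have "\<exists>!c. homogeneous_parts G V x c" using dsd x by (simp add: direct_sum_decomposition_def)
  from the1_equality[OF this, OF c] show ?thesis by (simp add: homogeneous_part_def)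
qed

lemma homogeneous_parts_part:
  assumes x: "x \<in> carrier G"
  shows "homogeneous_parts G V x (\<lambda>i. homogeneous_part G V i x)"
proof -
  have "\<exists>!c. homogeneous_parts G V x c" using dsd x by (simp add: direct_sum_decomposition_def)
  from theI'[OF this] show ?thesis by (simp add: homogeneous_part_def[abs_def])
qed

lemma homogeneous_part_in: "x \<in> carrier G \<Longrightarrow> homogeneous_part G V i x \<in> V i"
  using homogeneous_parts_part by (simp add: homogeneous_parts_def)

lemma homogeneous_part_closed: "x \<in> carrier G \<Longrightarrow> homogeneous_part G V i x \<in> carrier G"
  using homogeneous_part_in component_carrier by blast

lemma homogeneous_part_finite: "x \<in> carrier G \<Longrightarrow> finite {i. homogeneous_part G V i x \<noteq> \<zero>}"
  using homogeneous_parts_part by (simp add: homogeneous_parts_def)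

lemma homogeneous_part_sum:
  assumes x: "x \<in> carrier G" and T: "finite T" "{i. homogeneous_part G V i x \<noteq> \<zero>} \<subseteq> T"
  shows "x = (\<Oplus>i\<in>T. homogeneous_part G V i x)"
proof -
  have "x = (\<Oplus>i\<in>{i. homogeneous_part G V i x \<noteq> \<zero>}. homogeneous_part G V i x)"
    using homogeneous_parts_part[OF x] by (simp add: homogeneous_parts_def)
  also have "\<dots> = (\<Oplus>i\<in>T. homogeneous_part G V i x)"
    by (rule add.finprod_mono_neutral_cong_left) (use T homogeneous_part_closed[OF x] in auto)
  finally show ?thesis .
qed

lemma homogeneous_part_homogeneous:
  assumes x: "x \<in> V i"
  shows "homogeneous_part G V j x = (if j = i then x else \<zero>)"
proof -
  have xG: "x \<in> carrier G" by (rule component_carrier[OF x])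
  have "homogeneous_parts G V x (\<lambda>j. if j = i then x else \<zero>)"
    by (rule homogeneous_partsI[of _ _ "{i}"]) (use component_subset component_zero x xG in auto)
  from homogeneous_part_unique[OF xG this] show ?thesis .
qed

lemma homogeneous_part_add:
  assumes x: "x \<in> carrier G" and y: "y \<in> carrier G"
  shows "homogeneous_part G V i (x \<oplus> y) = homogeneous_part G V i x \<oplus> homogeneous_part G V i y"
proof -
  let ?h = "\<lambda>x i. homogeneous_part G V i x"
  let ?T = "{i. ?h x i \<noteq> \<zero>} \<union> {i. ?h y i \<noteq> \<zero>}"
  have T: "finite ?T" using homogeneous_part_finite x y by simp
  have "homogeneous_parts G V (x \<oplus> y) (\<lambda>i. ?h x i \<oplus> ?h y i)"
  proof (rule homogeneous_partsI[OF component_subset _ T])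
    show "?h x i \<oplus> ?h y i \<in> V i" for i by (intro component_add homogeneous_part_in x y)
    have "x \<oplus> y = (\<Oplus>i\<in>?T. ?h x i) \<oplus> (\<Oplus>i\<in>?T. ?h y i)"
      using homogeneous_part_sum[OF x T] homogeneous_part_sum[OF y T] by simp
    also have "\<dots> = (\<Oplus>i\<in>?T. ?h x i \<oplus> ?h y i)"
      using T homogeneous_part_closed x y by (intro finsum_addf[symmetric]) auto
    finally show "x \<oplus> y = (\<Oplus>i\<in>?T. ?h x i \<oplus> ?h y i)" .
  qed auto
  from homogeneous_part_unique[OF add.m_closed[OF x y] this] show ?thesis .
qed

lemma homogeneous_part_finsum:
  assumes "finite T" "f \<in> T \<rightarrow> carrier G"
  shows "homogeneous_part G V i (\<Oplus>t\<in>T. f t) = (\<Oplus>t\<in>T. homogeneous_part G V i (f t))"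
  using assms
proof (induction T)
  case empty
  then show ?case using homogeneous_part_homogeneous[OF component_zero[of i]] by simp
next
  case (insert t T)
  then show ?case by (simp add: homogeneous_part_add homogeneous_part_closed Pi_def)
qed

text \<open>Scalars are absent from this context, so linearity of \<open>q\<close> is expressed by
  compatibility with finite sums. Applying \<open>q\<close> to the decomposition of \<open>x\<close>
  gives a decomposition of \<open>q x\<close>, which is unique.\<close>

lemma homogeneous_part_lin:
  assumes "abelian_group G'" and dsd': "direct_sum_decomposition G' V'"
    and qG: "\<And>x. x \<in> carrier G \<Longrightarrow> q x \<in> carrier G'"
    and q_add: "\<And>(T :: nat set) f. finite T \<Longrightarrow> f \<in> T \<rightarrow> carrier G \<Longrightarrow> q (\<Oplus>t\<in>T. f t) = (\<Oplus>\<^bsub>G'\<^esub> t\<in>T. q (f t))"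
    and q0: "q \<zero> = \<zero>\<^bsub>G'\<^esub>" and qV: "\<And>i. q ` V i \<subseteq> V' i" and x: "x \<in> carrier G"
  shows "homogeneous_part G' V' i (q x) = q (homogeneous_part G V i x)"
proof -
  interpret G': abelian_group G' by fact
  let ?h = "\<lambda>i. homogeneous_part G V i x"
  let ?T = "{i. ?h i \<noteq> \<zero>}"
  have T: "finite ?T" by (rule homogeneous_part_finite[OF x])
  have "homogeneous_parts G' V' (q x) (\<lambda>i. q (?h i))"
  proof (rule G'.homogeneous_partsI[OF G'.component_subset[OF dsd'] _ T])
    show "q (?h i) \<in> V' i" for i using qV homogeneous_part_in[OF x] by blast
    have "q (\<Oplus>i\<in>?T. ?h i) = (\<Oplus>\<^bsub>G'\<^esub> i\<in>?T. q (?h i))"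
      using homogeneous_part_closed[OF x] by (intro q_add[OF T]) auto
    then show "q x = (\<Oplus>\<^bsub>G'\<^esub> i\<in>?T. q (?h i))" using homogeneous_part_sum[OF x T] by simp
  qed (use q0 in auto)
  from G'.homogeneous_part_unique[OF dsd' qG[OF x] this] show ?thesis .
qed

end
end

section \<open>Spans of products\<close>

lemma span_prod_least:
  assumes "left_module R M" "submodule W R M" "\<And>u v. u \<in> U \<Longrightarrow> v \<in> V \<Longrightarrow> u \<odot>\<^bsub>M\<^esub> v \<in> W"
  shows "span_prod M U V \<subseteq> W"
proof -
  interpret left_module R M by fact
  interpret submodule W R M by fact
  show ?thesis unfolding span_prod_def
    by (rule M.add.generate_subgroup_incl) (use assms(3) subgroup_axioms in auto)
qed

lemma span_prod_superset: "u \<in> U \<Longrightarrow> v \<in> V \<Longrightarrow> u \<odot>\<^bsub>M\<^esub> v \<in> span_prod M U V"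
  unfolding span_prod_def by (rule generate.incl) blast

lemma span_prod_add: "x \<in> span_prod M U V \<Longrightarrow> y \<in> span_prod M U V \<Longrightarrow> x \<oplus>\<^bsub>M\<^esub> y \<in> span_prod M U V"
  using generate.eng[of x "add_monoid M" _ y] by (simp add: span_prod_def)

lemma span_prod_zero: "\<zero>\<^bsub>M\<^esub> \<in> span_prod M U V"
  using generate.one[of "add_monoid M"] by (simp add: span_prod_def)

text \<open>\<open>generate\<close> also adjoins inverses. They are absorbed because
  \<open>U\<close> is closed under negation and the negative of \<open>u v\<close> is
  \<open>(- u) v\<close>; so the induction has to treat only zero, products and sums.\<close>

lemma span_prod_induct:
  assumes M: "left_module R M" and U: "U \<subseteq> carrier R" "\<And>u. u \<in> U \<Longrightarrow> \<ominus>\<^bsub>R\<^esub> u \<in> U" and V: "V \<subseteq> carrier M"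
    and x: "x \<in> span_prod M U V"
    and P_zero: "P \<zero>\<^bsub>M\<^esub>" and P_gen: "\<And>u v. u \<in> U \<Longrightarrow> v \<in> V \<Longrightarrow> P (u \<odot>\<^bsub>M\<^esub> v)"
    and P_add: "\<And>x y. x \<in> carrier M \<Longrightarrow> y \<in> carrier M \<Longrightarrow> P x \<Longrightarrow> P y \<Longrightarrow> P (x \<oplus>\<^bsub>M\<^esub> y)"
  shows "P x"
proof -
  interpret left_module R M by fact
  let ?S = "{u \<odot>\<^bsub>M\<^esub> v | u v. u \<in> U \<and> v \<in> V}"
  have S: "?S \<subseteq> carrier (add_monoid M)" using U V by auto
  have "x \<in> carrier M \<and> P x" using x unfolding span_prod_def
  proof (induction rule: generate.induct)
    case one
    then show ?case using P_zero by simp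
  next
    case (incl h)
    then show ?case using S P_gen by auto
  next
    case (inv h)
    then obtain u v where uv: "u \<in> U" "v \<in> V" "h = u \<odot>\<^bsub>M\<^esub> v" by blast
    have c: "u \<in> carrier R" "v \<in> carrier M" using uv U V by auto
    have "(\<ominus>\<^bsub>R\<^esub> u) \<odot>\<^bsub>M\<^esub> v \<oplus>\<^bsub>M\<^esub> u \<odot>\<^bsub>M\<^esub> v = \<zero>\<^bsub>M\<^esub>"
      using c smult_l_distr[of "\<ominus>\<^bsub>R\<^esub> u" u v] by (simp add: R.l_neg smult_l_null)
    then have "\<ominus>\<^bsub>M\<^esub> (u \<odot>\<^bsub>M\<^esub> v) = (\<ominus>\<^bsub>R\<^esub> u) \<odot>\<^bsub>M\<^esub> v" using c by (intro M.minus_equality) auto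
    then show ?case using P_gen[OF U(2)[OF uv(1)] uv(2)] c uv(3) by (simp flip: a_inv_def)
  next
    case (eng h1 h2)
    then show ?case using P_add by simp
  qed
  then show ?thesis by simp
qed

lemma span_prod_submodule:
  assumes M: "left_module R M" and V: "V \<subseteq> carrier M"
  shows "submodule (span_prod M (carrier R) V) R M"
proof -
  interpret left_module R M by fact
  have neg: "u \<in> carrier R \<Longrightarrow> \<ominus>\<^bsub>R\<^esub> u \<in> carrier R" for u by simp
  show ?thesis
  proof (rule submoduleI)
    show "span_prod M (carrier R) V \<subseteq> carrier M"
      by (rule span_prod_least[OF M carrier_submodule[OF M]]) (use V in auto)
    show "x \<in> span_prod M (carrier R) V \<Longrightarrow> y \<in> span_prod M (carrier R) V \<Longrightarrow>
        x \<oplus>\<^bsub>M\<^esub> y \<in> span_prod M (carrier R) V" for x y by (rule span_prod_add)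
    fix a x assume a: "a \<in> carrier R" and x: "x \<in> span_prod M (carrier R) V"
    show "a \<odot>\<^bsub>M\<^esub> x \<in> span_prod M (carrier R) V"
    proof (rule span_prod_induct[OF M order_refl neg V x])
      show "a \<odot>\<^bsub>M\<^esub> \<zero>\<^bsub>M\<^esub> \<in> span_prod M (carrier R) V" using a by (simp add: smult_r_null span_prod_zero)
    next
      fix u v assume uv: "u \<in> carrier R" "v \<in> V"
      then have "a \<odot>\<^bsub>M\<^esub> (u \<odot>\<^bsub>M\<^esub> v) = (a \<otimes>\<^bsub>R\<^esub> u) \<odot>\<^bsub>M\<^esub> v" using a V by (simp add: smult_assoc1 subsetD)
      then show "a \<odot>\<^bsub>M\<^esub> (u \<odot>\<^bsub>M\<^esub> v) \<in> span_prod M (carrier R) V" using uv a by (simp add: span_prod_superset)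
    next
      fix x y assume "x \<in> carrier M" "y \<in> carrier M"
        "a \<odot>\<^bsub>M\<^esub> x \<in> span_prod M (carrier R) V" "a \<odot>\<^bsub>M\<^esub> y \<in> span_prod M (carrier R) V"
      then show "a \<odot>\<^bsub>M\<^esub> (x \<oplus>\<^bsub>M\<^esub> y) \<in> span_prod M (carrier R) V" using a by (simp add: smult_r_distr span_prod_add)
    qed
  qed (rule span_prod_zero)
qed

lemma graded_moduleD:
  assumes "graded_module A \<A> M \<M>"
  shows "left_module A M" "direct_sum_decomposition M \<M>" "abelian_group M"
    "a \<in> \<A> i \<Longrightarrow> x \<in> \<M> j \<Longrightarrow> a \<odot>\<^bsub>M\<^esub> x \<in> \<M> (i + j)"
  using assms by (auto simp: graded_module_def left_module_def)

lemma (in ring) finsum_regular_module: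
  assumes c: "c \<in> T \<rightarrow> carrier R"
  shows "finsum (regular_module R) c T = finsum R c T"
proof -
  interpret M: left_module R "regular_module R" by (rule regular_left_module)
  show ?thesis
  proof (cases "finite T")
    case True
    then show ?thesis using c by (induction T) (auto simp: Pi_def)
  qed (simp add: M.M.add.finprod_infinite add.finprod_infinite)
qed

lemma lin_map_homogeneous_part:
  assumes M: "graded_module A \<A> M \<M>" and N: "graded_module A \<A> N \<N>" and q: "lin_map A M N q"
    and gr: "\<And>i. q ` \<M> i \<subseteq> \<N> i" and x: "x \<in> carrier M"
  shows "homogeneous_part N \<N> i (q x) = q (homogeneous_part M \<M> i x)"
proof -
  note MD = graded_moduleD[OF M] and ND = graded_moduleD[OF N]
  show ?thesis
    by (rule abelian_group.homogeneous_part_lin[OF MD(3,2) ND(3,2) lin_mapD(1)[OF q]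
          lin_map_finsum[OF MD(1) ND(1) q] lin_map_0[OF MD(1) ND(1) q] gr x])
qed

section \<open>The graded algebra, its degree 0 ring and its scalars\<close>

locale graded_setup =
  fixes K :: "'k ring" and A :: "('k, 'a) module" and \<A> :: "nat \<Rightarrow> 'a set"
  assumes K: "field K" and A: "graded_algebra K A \<A>" and locally_finite: "locally_finite_algebra K A \<A>"
    and generated: "generated_in_degrees_0_1 A \<A>"
begin

abbreviation R\<^sub>0 :: "('k, 'a) module" where "R\<^sub>0 \<equiv> degree_0_ring A \<A>"
abbreviation D :: "('a, 'a) module" where "D \<equiv> degree_0_module A \<A>"
abbreviation A_mod :: "('a, 'a) module" where "A_mod \<equiv> regular_module A"
abbreviation \<phi> :: "'k \<Rightarrow> 'a" where "\<phi> \<equiv> \<lambda>c. c \<odot>\<^bsub>A\<^esub> \<one>\<^bsub>A\<^esub>"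
abbreviation A_part :: "nat \<Rightarrow> 'a \<Rightarrow> 'a" where "A_part \<equiv> homogeneous_part A \<A>"
abbreviation fd :: "('a, 'm) module \<Rightarrow> 'm set \<Rightarrow> bool" where
  "fd M U \<equiv> finitely_generated K (restrict_scalars \<phi> (M\<lparr>carrier := U\<rparr>))"

end

sublocale graded_setup \<subseteq> A: ring A
  using A by (simp add: graded_algebra_def)

sublocale graded_setup \<subseteq> KA: module K A
  using A by (simp add: graded_algebra_def)

context graded_setup
begin

lemma K_ring: "ring K"
  using K by (simp add: field_def domain_def cring_def)

lemma A_dsd: "direct_sum_decomposition A \<A>"
  and one_degree_0: "\<one>\<^bsub>A\<^esub> \<in> \<A> 0"
  and degree_mult: "a \<in> \<A> i \<Longrightarrow> b \<in> \<A> j \<Longrightarrow> a \<otimes>\<^bsub>A\<^esub> b \<in> \<A> (i + j)"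
  and scalar_l: "c \<in> carrier K \<Longrightarrow> a \<in> carrier A \<Longrightarrow> b \<in> carrier A \<Longrightarrow> (c \<odot>\<^bsub>A\<^esub> a) \<otimes>\<^bsub>A\<^esub> b = c \<odot>\<^bsub>A\<^esub> (a \<otimes>\<^bsub>A\<^esub> b)"
  and scalar_r: "c \<in> carrier K \<Longrightarrow> a \<in> carrier A \<Longrightarrow> b \<in> carrier A \<Longrightarrow> a \<otimes>\<^bsub>A\<^esub> (c \<odot>\<^bsub>A\<^esub> b) = c \<odot>\<^bsub>A\<^esub> (a \<otimes>\<^bsub>A\<^esub> b)"
  and degree_submodule: "submodule (\<A> i) K A"
  using A by (simp_all add: graded_algebra_def)

lemmas A_component_subset = A.component_subset[OF A_dsd]
lemmas A_component_carrier = A.component_carrier[OF A_dsd]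
lemmas A_part_in = A.homogeneous_part_in[OF A_dsd]
lemmas A_part_closed = A.homogeneous_part_closed[OF A_dsd]
lemmas A_part_homogeneous = A.homogeneous_part_homogeneous[OF A_dsd]

lemma R0_simps [simp]:
  "carrier R\<^sub>0 = \<A> 0" "\<zero>\<^bsub>R\<^sub>0\<^esub> = \<zero>\<^bsub>A\<^esub>" "\<one>\<^bsub>R\<^sub>0\<^esub> = \<one>\<^bsub>A\<^esub>" "x \<oplus>\<^bsub>R\<^sub>0\<^esub> y = x \<oplus>\<^bsub>A\<^esub> y" "x \<otimes>\<^bsub>R\<^sub>0\<^esub> y = x \<otimes>\<^bsub>A\<^esub> y"
  by (simp_all add: degree_0_ring_def)

lemma D_simps [simp]:
  "carrier D = \<A> 0" "\<zero>\<^bsub>D\<^esub> = \<zero>\<^bsub>A\<^esub>" "x \<oplus>\<^bsub>D\<^esub> y = x \<oplus>\<^bsub>A\<^esub> y" "a \<odot>\<^bsub>D\<^esub> x = A_part 0 a \<otimes>\<^bsub>A\<^esub> x"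
  by (simp_all add: degree_0_module_def)

lemma A_component_closed:
  "\<zero>\<^bsub>A\<^esub> \<in> \<A> i" "x \<in> \<A> i \<Longrightarrow> y \<in> \<A> i \<Longrightarrow> x \<oplus>\<^bsub>A\<^esub> y \<in> \<A> i" "x \<in> \<A> i \<Longrightarrow> \<ominus>\<^bsub>A\<^esub> x \<in> \<A> i"
  using submoduleD[OF degree_submodule] by blast+

lemma degree_0_mult: "a \<in> \<A> 0 \<Longrightarrow> b \<in> \<A> i \<Longrightarrow> a \<otimes>\<^bsub>A\<^esub> b \<in> \<A> i"
  using degree_mult[of a 0 b i] by simp

lemma R0_ring: "ring R\<^sub>0"
proof (rule ringI)
  show "abelian_group R\<^sub>0"
  proof (rule abelian_groupI, goal_cases)
    case (6 x)
    then show ?case using A_component_closed(3)[of x 0] A_component_carrier[of x 0]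
      by (intro bexI[of _ "\<ominus>\<^bsub>A\<^esub> x"]) (auto simp: A.l_neg)
  qed (use A_component_closed A_component_carrier[of _ 0] in \<open>auto simp: A.a_ac\<close>)
  show "Group.monoid R\<^sub>0"
    by (rule monoidI) (use one_degree_0 degree_0_mult A_component_carrier[of _ 0] in \<open>auto simp: A.m_assoc\<close>)
qed (use A_component_carrier[of _ 0] in \<open>auto simp: A.l_distr A.r_distr\<close>)

lemma left_module_R0:
  assumes "left_module A M" shows "left_module R\<^sub>0 M"
  by (rule left_module_subring[OF assms R0_ring]) (use A_component_subset in auto)

lemma lin_map_R0: "lin_map A M N h \<Longrightarrow> lin_map R\<^sub>0 M N h"
  using A_component_carrier[of _ 0] by (simp add: lin_map_def)

lemma submodule_R0: "left_module A M \<Longrightarrow> submodule U A M \<Longrightarrow> submodule U R\<^sub>0 M"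
  by (rule left_module.submoduleI[OF left_module_R0]) (use A_component_carrier[of _ 0] in \<open>auto dest: submoduleD\<close>)

lemma \<phi>_closed: "c \<in> carrier K \<Longrightarrow> \<phi> c \<in> \<A> 0"
  using submoduleD(6)[OF degree_submodule] one_degree_0 by blast

lemma \<phi>_mult: "c \<in> carrier K \<Longrightarrow> a \<in> carrier A \<Longrightarrow> \<phi> c \<otimes>\<^bsub>A\<^esub> a = c \<odot>\<^bsub>A\<^esub> a"
  and \<phi>_comm: "c \<in> carrier K \<Longrightarrow> a \<in> carrier A \<Longrightarrow> a \<otimes>\<^bsub>A\<^esub> \<phi> c = \<phi> c \<otimes>\<^bsub>A\<^esub> a"
  by (simp_all add: scalar_l scalar_r)

lemma \<phi>_hom: "\<phi> \<in> ring_hom K R\<^sub>0"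
  using \<phi>_closed A_component_carrier[of _ 0] KA.smult_l_distr KA.smult_assoc1
  by (intro ring_hom_memI) (auto simp: scalar_l KA.smult_one)

lemma \<phi>_hom_A: "\<phi> \<in> ring_hom K A"
  using \<phi>_hom A_component_carrier[of _ 0] by (auto simp: ring_hom_def Pi_def)

lemma scalar_left_module: "left_module A M \<Longrightarrow> left_module K (restrict_scalars \<phi> M)"
  by (rule restrict_scalars_left_module[OF _ K_ring \<phi>_hom_A])

lemma scalar_submodule: "left_module A M \<Longrightarrow> submodule U R\<^sub>0 M \<Longrightarrow> submodule U K (restrict_scalars \<phi> M)"
  by (rule submodule_restrict_scalars[OF \<phi>_hom left_module_R0 K_ring])

lemma fd_subset:
  assumes M: "left_module A M" and U: "submodule U R\<^sub>0 M" and V: "submodule V R\<^sub>0 M" and le: "U \<subseteq> V"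
    and fd: "fd M V"
  shows "fd M U"
proof -
  let ?M = "restrict_scalars \<phi> M"
  note MK = scalar_left_module[OF M] and UK = scalar_submodule[OF M U] and VK = scalar_submodule[OF M V]
  have "submodule U K (?M\<lparr>carrier := V\<rparr>)" using submodule_of_submodule[OF MK VK] UK le by simp
  from finitely_generated_subspace[OF K submodule_left_module[OF MK VK] _ this] fd
  show ?thesis by (simp add: restrict_scalars_carrier_update)
qed

lemma fd_image:
  assumes M: "left_module A M" and N: "left_module A N" and U: "submodule U R\<^sub>0 M" and fd: "fd M U"
    and h: "lin_map R\<^sub>0 (M\<lparr>carrier := U\<rparr>) (N\<lparr>carrier := V\<rparr>) h" and V: "submodule V R\<^sub>0 N" and surj: "h ` U = V"
  shows "fd N V"
proof (rule finitely_generated_image[OF _ _ _ _ fd])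
  show "left_module K (restrict_scalars \<phi> (M\<lparr>carrier := U\<rparr>))"
    by (rule restrict_scalars_left_module[OF submodule_left_module[OF left_module_R0[OF M] U] K_ring \<phi>_hom])
  show "left_module K (restrict_scalars \<phi> (N\<lparr>carrier := V\<rparr>))"
    by (rule restrict_scalars_left_module[OF submodule_left_module[OF left_module_R0[OF N] V] K_ring \<phi>_hom])
  show "lin_map K (restrict_scalars \<phi> (M\<lparr>carrier := U\<rparr>)) (restrict_scalars \<phi> (N\<lparr>carrier := V\<rparr>)) h"
    by (rule lin_map_restrict_scalars[OF h]) (use \<phi>_closed in auto)
qed (use surj in simp)

lemma fd_finitely_generated:
  assumes "left_module A M" "submodule U R\<^sub>0 M" "fd M U"
  shows "finitely_generated R\<^sub>0 (M\<lparr>carrier := U\<rparr>)"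
  by (rule finitely_generated_restrict_scalarsD[OF \<phi>_hom
        submodule_left_module[OF left_module_R0[OF assms(1)] assms(2)] K_ring assms(3)])

lemma regular_A: "left_module A A_mod" "graded_module A \<A> A_mod \<A>"
proof -
  show M: "left_module A A_mod" by (rule A.regular_left_module)
  \<comment> \<open>Sums in the record \<open>A_mod\<close> and sums in \<open>A\<close> are
    different terms, so decompositions have to be transferred between the two.\<close>
  have "homogeneous_parts A_mod \<A> x c \<longleftrightarrow> homogeneous_parts A \<A> x c" for x c
  proof -
    have "finsum A_mod c T = finsum A c T" if "\<forall>i. c i \<in> \<A> i" for T
      using that A_component_carrier by (intro A.finsum_regular_module) auto
    then show ?thesis unfolding homogeneous_parts_def by auto
  qed
  then have parts: "homogeneous_parts A_mod \<A> x = homogeneous_parts A \<A> x" for x by blast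
  have sub: "subgroup (\<A> i) (add_monoid A_mod)" for i
  proof -
    have "submodule (\<A> i) R\<^sub>0 A_mod"
      by (rule left_module.submoduleI[OF left_module_R0[OF M]])
         (use A_component_subset A_component_closed degree_0_mult in auto)
    then show ?thesis by (rule submodule.axioms(1))
  qed
  have "direct_sum_decomposition A_mod \<A>"
    using A_dsd sub unfolding direct_sum_decomposition_def by (simp add: parts)
  then show "graded_module A \<A> A_mod \<A>" using M degree_mult unfolding graded_module_def by simp
qed

lemma A_mod_part: "a \<in> carrier A \<Longrightarrow> homogeneous_part A_mod \<A> i a = A_part i a"
proof -
  assume a: "a \<in> carrier A"
  interpret M: left_module A A_mod by (rule regular_A)
  have "finsum A_mod (\<lambda>i. A_part i a) T = finsum A (\<lambda>i. A_part i a) T" for T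
    using A_part_closed[OF a] by (intro A.finsum_regular_module) auto
  then have "homogeneous_parts A_mod \<A> a (\<lambda>i. A_part i a)"
    using A.homogeneous_parts_part[OF A_dsd a] unfolding homogeneous_parts_def by simp
  from M.M.homogeneous_part_unique[OF graded_moduleD(2)[OF regular_A(2)] _ this] a show ?thesis by simp
qed

section \<open>Homogeneous parts in a graded module\<close>

context
  fixes M :: "('a, 'm) module" and \<M> assumes M: "graded_module A \<A> M \<M>"
begin

interpretation M: left_module A M
  by (rule graded_moduleD[OF M])

lemmas M_dsd = graded_moduleD(2)[OF M]
lemmas part_in = M.M.homogeneous_part_in[OF M_dsd]
lemmas part_closed = M.M.homogeneous_part_closed[OF M_dsd]
lemmas part_homogeneous = M.M.homogeneous_part_homogeneous[OF M_dsd]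
lemmas part_add = M.M.homogeneous_part_add[OF M_dsd]
lemmas component_carrier = M.M.component_carrier[OF M_dsd]

lemma part_zero: "homogeneous_part M \<M> j \<zero>\<^bsub>M\<^esub> = \<zero>\<^bsub>M\<^esub>"
  using part_homogeneous[OF M.M.component_zero[OF M_dsd, of 0]] by simp

lemma component_submodule: "submodule (\<M> i) R\<^sub>0 M"
  by (rule left_module.submoduleI[OF left_module_R0[OF graded_moduleD(1)[OF M]]])
     (use M.M.component_subset[OF M_dsd] M.M.component_zero[OF M_dsd] M.M.component_add[OF M_dsd]
       graded_moduleD(4)[OF M, of _ 0 _ i] in auto)

lemma part_smult_homogeneous:
  assumes a: "a \<in> \<A> k" and x: "x \<in> carrier M"
  shows "homogeneous_part M \<M> j (a \<odot>\<^bsub>M\<^esub> x) = (if k \<le> j then a \<odot>\<^bsub>M\<^esub> homogeneous_part M \<M> (j - k) x else \<zero>\<^bsub>M\<^esub>)"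
proof -
  have aA: "a \<in> carrier A" by (rule A_component_carrier[OF a])
  let ?h = "\<lambda>i. homogeneous_part M \<M> i x"
  let ?T = "{i. ?h i \<noteq> \<zero>\<^bsub>M\<^esub>}"
  let ?c = "\<lambda>j. if k \<le> j then a \<odot>\<^bsub>M\<^esub> ?h (j - k) else \<zero>\<^bsub>M\<^esub>"
  have T: "finite ?T" by (rule M.M.homogeneous_part_finite[OF M_dsd x])
  have "homogeneous_parts M \<M> (a \<odot>\<^bsub>M\<^esub> x) ?c"
  proof (rule M.M.homogeneous_partsI[OF M.M.component_subset[OF M_dsd]])
    show "?c j \<in> \<M> j" for j
      using graded_moduleD(4)[OF M a part_in[OF x, of "j - k"]] M.M.component_zero[OF M_dsd] by auto
    show "finite ((+) k ` ?T)" using T by simp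
    show "{j. ?c j \<noteq> \<zero>\<^bsub>M\<^esub>} \<subseteq> (+) k ` ?T"
    proof
      fix j assume "j \<in> {j. ?c j \<noteq> \<zero>\<^bsub>M\<^esub>}"
      then have "k \<le> j" "?h (j - k) \<noteq> \<zero>\<^bsub>M\<^esub>" using M.smult_r_null[OF aA] by (auto split: if_splits)
      then show "j \<in> (+) k ` ?T" by (intro image_eqI[of _ _ "j - k"]) auto
    qed
    have "a \<odot>\<^bsub>M\<^esub> x = a \<odot>\<^bsub>M\<^esub> (\<Oplus>\<^bsub>M\<^esub> i\<in>?T. ?h i)" using M.M.homogeneous_part_sum[OF M_dsd x T] by simp
    also have "\<dots> = (\<Oplus>\<^bsub>M\<^esub> i\<in>?T. a \<odot>\<^bsub>M\<^esub> ?h i)"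
      by (rule M.finsum_smult[OF T aA]) (use part_closed[OF x] in auto)
    also have "\<dots> = (\<Oplus>\<^bsub>M\<^esub> i\<in>?T. ?c (k + i))"
      using part_closed[OF x] aA by (intro M.M.finsum_cong') auto
    also have "\<dots> = (\<Oplus>\<^bsub>M\<^esub> j\<in>(+) k ` ?T. ?c j)"
      by (rule M.M.finsum_reindex[symmetric]) (use part_closed[OF x] aA in auto)
    finally show "a \<odot>\<^bsub>M\<^esub> x = (\<Oplus>\<^bsub>M\<^esub> j\<in>(+) k ` ?T. ?c j)" .
  qed
  from M.M.homogeneous_part_unique[OF M_dsd M.smult_closed[OF aA x] this] show ?thesis .
qed

text \<open>The convolution formula. The truncated subtraction \<open>j - i\<close> is exact because
  \<open>i\<close> runs up to \<open>j\<close> only.\<close>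

lemma part_smult:
  assumes a: "a \<in> carrier A" and x: "x \<in> carrier M"
  shows "homogeneous_part M \<M> j (a \<odot>\<^bsub>M\<^esub> x) = (\<Oplus>\<^bsub>M\<^esub> i\<in>{..j}. A_part i a \<odot>\<^bsub>M\<^esub> homogeneous_part M \<M> (j - i) x)"
proof -
  let ?T = "{i. A_part i a \<noteq> \<zero>\<^bsub>A\<^esub>}"
  have T: "finite ?T" by (rule A.homogeneous_part_finite[OF A_dsd a])
  have lx: "lin_map A A_mod M (\<lambda>a. a \<odot>\<^bsub>M\<^esub> x)"
    using x by (auto simp: lin_map_def M.smult_l_distr M.smult_assoc1)
  have "a \<odot>\<^bsub>M\<^esub> x = (\<Oplus>\<^bsub>A\<^esub> i\<in>?T. A_part i a) \<odot>\<^bsub>M\<^esub> x"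
    using A.homogeneous_part_sum[OF A_dsd a T] by simp
  also have "\<dots> = (\<Oplus>\<^bsub>A_mod\<^esub> i\<in>?T. A_part i a) \<odot>\<^bsub>M\<^esub> x"
    using A.finsum_regular_module[of "\<lambda>i. A_part i a" ?T] A_part_closed[OF a] by simp
  also have "\<dots> = (\<Oplus>\<^bsub>M\<^esub> i\<in>?T. A_part i a \<odot>\<^bsub>M\<^esub> x)"
    by (rule lin_map_finsum[OF regular_A(1) graded_moduleD(1)[OF M] lx]) (use A_part_closed[OF a] in auto)
  finally have "homogeneous_part M \<M> j (a \<odot>\<^bsub>M\<^esub> x) = (\<Oplus>\<^bsub>M\<^esub> i\<in>?T. homogeneous_part M \<M> j (A_part i a \<odot>\<^bsub>M\<^esub> x))"
    using M.M.homogeneous_part_finsum[OF M_dsd T, of "\<lambda>i. A_part i a \<odot>\<^bsub>M\<^esub> x"] A_part_closed[OF a] x by simp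
  \<comment> \<open>A common index set for two cuts: outside the support of \<open>a\<close> the
    terms vanish because the coefficient does, above \<open>j\<close> they vanish for reasons of
    degree.\<close>
  also have "\<dots> = (\<Oplus>\<^bsub>M\<^esub> i\<in>?T \<union> {..j}. homogeneous_part M \<M> j (A_part i a \<odot>\<^bsub>M\<^esub> x))"
  proof (rule M.M.add.finprod_mono_neutral_cong_left)
    show "homogeneous_part M \<M> j (A_part i a \<odot>\<^bsub>M\<^esub> x) = \<zero>\<^bsub>M\<^esub>" if "i \<in> ?T \<union> {..j} - ?T" for i
      using x that by (auto simp: M.smult_l_null part_zero)
  qed (use T x A_part_closed[OF a] part_closed in auto)
  also have "\<dots> = (\<Oplus>\<^bsub>M\<^esub> i\<in>{..j}. A_part i a \<odot>\<^bsub>M\<^esub> homogeneous_part M \<M> (j - i) x)"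
  proof (rule M.M.add.finprod_mono_neutral_cong_right)
    show "homogeneous_part M \<M> j (A_part i a \<odot>\<^bsub>M\<^esub> x) = \<zero>\<^bsub>M\<^esub>" if "i \<in> ?T \<union> {..j} - {..j}" for i
      using part_smult_homogeneous[OF A_part_in[OF a] x] that by auto
    show "homogeneous_part M \<M> j (A_part i a \<odot>\<^bsub>M\<^esub> x) = A_part i a \<odot>\<^bsub>M\<^esub> homogeneous_part M \<M> (j - i) x"
      if "i \<in> {..j}" for i using part_smult_homogeneous[OF A_part_in[OF a] x] that by simp
  qed (use T x A_part_closed[OF a] part_closed in auto)
  finally show ?thesis .
qed

lemma part_smult_component:
  assumes a: "a \<in> carrier A" and x: "x \<in> \<M> s"
  shows "homogeneous_part M \<M> j (a \<odot>\<^bsub>M\<^esub> x) = (if s \<le> j then A_part (j - s) a \<odot>\<^bsub>M\<^esub> x else \<zero>\<^bsub>M\<^esub>)"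
proof -
  have xM: "x \<in> carrier M" by (rule component_carrier[OF x])
  have "homogeneous_part M \<M> j (a \<odot>\<^bsub>M\<^esub> x) =
      (\<Oplus>\<^bsub>M\<^esub> i\<in>{..j}. A_part i a \<odot>\<^bsub>M\<^esub> (if j - i = s then x else \<zero>\<^bsub>M\<^esub>))"
    unfolding part_smult[OF a xM] part_homogeneous[OF x] by (rule refl)
  also have "\<dots> = (\<Oplus>\<^bsub>M\<^esub> i\<in>{..j}. if i = j - s then (if s \<le> j then A_part (j - s) a \<odot>\<^bsub>M\<^esub> x else \<zero>\<^bsub>M\<^esub>) else \<zero>\<^bsub>M\<^esub>)"
    using A_part_closed[OF a] xM by (intro M.M.finsum_cong') (auto simp: M.smult_r_null)
  also have "\<dots> = (if s \<le> j then A_part (j - s) a \<odot>\<^bsub>M\<^esub> x else \<zero>\<^bsub>M\<^esub>)"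
    by (subst M.M.add.finprod_singleton_swap) (use A_part_closed[OF a] xM in auto)
  finally show ?thesis .
qed

lemma part_lin_map: "lin_map R\<^sub>0 M (M\<lparr>carrier := \<M> i\<rparr>) (homogeneous_part M \<M> i)"
  using part_smult_homogeneous[of _ 0 _ i] part_in part_add by (intro lin_mapI) auto

text \<open>An expression of \<open>x\<close> by products \<open>u v\<close> with \<open>v\<close>
  in degree \<open>s\<close> need not be homogeneous. Taking parts replaces \<open>u\<close> by its
  part of degree \<open>j - s\<close>, so the induction over the span carries a claim about the
  parts of all degrees at once.\<close>

lemma generated_component:
  assumes gen: "generated_in_degree A M \<M> s" and x: "x \<in> \<M> j"
  shows "j < s \<Longrightarrow> x = \<zero>\<^bsub>M\<^esub>" "s \<le> j \<Longrightarrow> x \<in> span_prod M (\<A> (j - s)) (\<M> s)"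
proof -
  let ?P = "\<lambda>j. if s \<le> j then span_prod M (\<A> (j - s)) (\<M> s) else {\<zero>\<^bsub>M\<^esub>}"
  have xM: "x \<in> carrier M" by (rule component_carrier[OF x])
  have neg: "\<ominus>\<^bsub>A\<^esub> u \<in> carrier A" if "u \<in> carrier A" for u using that by simp
  have xs: "x \<in> span_prod M (carrier A) (\<M> s)" using gen xM by (simp add: generated_in_degree_def)
  have "\<forall>j. homogeneous_part M \<M> j x \<in> ?P j"
  proof (rule span_prod_induct[OF graded_moduleD(1)[OF M] order_refl neg M.M.component_subset[OF M_dsd] xs])
    show "\<forall>j. homogeneous_part M \<M> j \<zero>\<^bsub>M\<^esub> \<in> ?P j"
      by (simp add: part_zero span_prod_zero)
  next
    fix u v assume "u \<in> carrier A" "v \<in> \<M> s"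
    then show "\<forall>j. homogeneous_part M \<M> j (u \<odot>\<^bsub>M\<^esub> v) \<in> ?P j"
      by (simp add: part_smult_component span_prod_superset A_part_in)
  next
    fix x y assume xy: "x \<in> carrier M" "y \<in> carrier M" and P: "\<forall>j. homogeneous_part M \<M> j x \<in> ?P j"
      "\<forall>j. homogeneous_part M \<M> j y \<in> ?P j"
    have "homogeneous_part M \<M> j x \<oplus>\<^bsub>M\<^esub> homogeneous_part M \<M> j y \<in> ?P j" for j
      using P[THEN spec, of j] by (cases "s \<le> j") (simp_all add: span_prod_add)
    then show "\<forall>j. homogeneous_part M \<M> j (x \<oplus>\<^bsub>M\<^esub> y) \<in> ?P j" using xy by (simp add: part_add)
  qed
  then have "homogeneous_part M \<M> j x \<in> ?P j" by (rule spec)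
  then have "x \<in> ?P j" using part_homogeneous[OF x, of j] by simp
  then show "j < s \<Longrightarrow> x = \<zero>\<^bsub>M\<^esub>" "s \<le> j \<Longrightarrow> x \<in> span_prod M (\<A> (j - s)) (\<M> s)" by (auto split: if_splits)
qed

end


section \<open>The degree 0 module and the augmentation ideal\<close>

lemma A_part_mult_0:
  assumes a: "a \<in> carrier A" and b: "b \<in> carrier A"
  shows "A_part 0 (a \<otimes>\<^bsub>A\<^esub> b) = A_part 0 a \<otimes>\<^bsub>A\<^esub> A_part 0 b"
  using part_smult[OF regular_A(2) a, of b 0] a b
    A.finsum_regular_module[of "\<lambda>i. A_part i a \<otimes>\<^bsub>A\<^esub> A_part (0 - i) b" "{..0}"] A_part_closed
  by (simp add: A_mod_part)

text \<open>The other term of the convolution contains the degree 0 part of \<open>b\<close>. So on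
  the augmentation ideal the degree 1 part is linear for the action through degree 0 parts, the
  action that \<open>D\<close> carries.\<close>

lemma A_part_mult_1:
  assumes a: "a \<in> carrier A" and b: "b \<in> carrier A" "A_part 0 b = \<zero>\<^bsub>A\<^esub>"
  shows "A_part 1 (a \<otimes>\<^bsub>A\<^esub> b) = A_part 0 a \<otimes>\<^bsub>A\<^esub> A_part 1 b"
proof -
  have "A_part 1 (a \<otimes>\<^bsub>A\<^esub> b) = (\<Oplus>\<^bsub>A_mod\<^esub> i\<in>{..1}. A_part i a \<otimes>\<^bsub>A\<^esub> A_part (1 - i) b)"
    using part_smult[OF regular_A(2) a, of b 1] a b by (simp add: A_mod_part)
  also have "\<dots> = (\<Oplus>\<^bsub>A\<^esub> i\<in>{..1}. A_part i a \<otimes>\<^bsub>A\<^esub> A_part (1 - i) b)"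
    using A_part_closed a b by (intro A.finsum_regular_module) auto
  also have "{..1} = {0, 1 :: nat}" by auto
  also have "(\<Oplus>\<^bsub>A\<^esub> i\<in>{0, 1}. A_part i a \<otimes>\<^bsub>A\<^esub> A_part (1 - i) b) = A_part 0 a \<otimes>\<^bsub>A\<^esub> A_part 1 b"
    using A_part_closed a b by simp
  finally show ?thesis .
qed

lemma A_part_0_degree_0: "a \<in> \<A> 0 \<Longrightarrow> A_part 0 a = a"
  using A_part_homogeneous by simp

lemma D_left_module: "left_module A D"
proof -
  interpret R0: ring R\<^sub>0 by (rule R0_ring)
  interpret D: abelian_group D
  proof (rule abelian_groupI, goal_cases)
    case (6 x)
    then show ?case using A_component_closed(3)[of x 0] A_component_carrier[of x 0]
      by (intro bexI[of _ "\<ominus>\<^bsub>A\<^esub> x"]) (auto simp: A.l_neg)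
  qed (use A_component_closed A_component_carrier[of _ 0] in \<open>auto simp: A.a_ac\<close>)
  show ?thesis
    by unfold_locales
       (use A_part_in[of _ 0] A_part_closed degree_0_mult A_component_carrier[of _ 0] one_degree_0 in
         \<open>auto simp: A.homogeneous_part_add[OF A_dsd] A_part_mult_0 A.l_distr A.r_distr A.m_assoc A_part_0_degree_0\<close>)
qed

lemma D_projection: "lin_map A A_mod D (A_part 0)" "A_part 0 ` carrier A_mod = carrier D"
proof -
  show "lin_map A A_mod D (A_part 0)"
    using A_part_in[of _ 0] A_part_closed
    by (auto simp: lin_map_def A.homogeneous_part_add[OF A_dsd] A_part_mult_0 A_part_0_degree_0)
  have "x \<in> A_part 0 ` carrier A" if "x \<in> \<A> 0" for x
    using that A_part_0_degree_0[OF that] A_component_carrier[OF that] by (metis imageI)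
  then show "A_part 0 ` carrier A_mod = carrier D" using A_part_in by auto
qed

text \<open>The augmentation ideal. It is the first syzygy of \<open>D\<close> in a resolution
  starting with \<open>A\<close>, so homomorphisms from \<open>J\<close> to \<open>D\<close>
  represent the classes of \<open>Ext\<^sup>1(D, D)\<close>.\<close>

definition J :: "'a set" where "J = {a \<in> carrier A. A_part 0 a = \<zero>\<^bsub>A\<^esub>}"

abbreviation J_mod :: "('a, 'a) module" where "J_mod \<equiv> A_mod\<lparr>carrier := J\<rparr>"

lemma J_submodule: "submodule J A A_mod"
  using kernel_submodule[OF regular_A(1) D_left_module D_projection(1)] by (simp add: J_def)

lemma J_left_module: "left_module A J_mod"
  by (rule submodule_left_module[OF regular_A(1) J_submodule])

lemma J_carrier: "a \<in> J \<Longrightarrow> a \<in> carrier A"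
  by (simp add: J_def)

lemma positive_degree_J: "a \<in> \<A> k \<Longrightarrow> 1 \<le> k \<Longrightarrow> a \<in> J"
  using A_part_homogeneous[of a k 0] A_component_carrier by (auto simp: J_def)

lemma J_mult: "a \<in> J \<Longrightarrow> b \<in> carrier A \<Longrightarrow> a \<otimes>\<^bsub>A\<^esub> b \<in> J" "a \<in> carrier A \<Longrightarrow> b \<in> J \<Longrightarrow> a \<otimes>\<^bsub>A\<^esub> b \<in> J"
  using A_part_closed by (auto simp: J_def A_part_mult_0)

text \<open>\<open>J\<close> acts on \<open>D\<close> by zero, and this bears on homomorphisms that
  ignore the grading, such as those in Ext.\<close>

lemma lin_map_D_J:
  assumes h: "lin_map A Z D h" and a: "a \<in> J" and x: "x \<in> carrier Z"
  shows "h (a \<odot>\<^bsub>Z\<^esub> x) = \<zero>\<^bsub>A\<^esub>"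
  using lin_mapD(3)[OF h J_carrier[OF a] x] a lin_mapD(1)[OF h x] A_component_carrier
  by (auto simp: J_def)

lemma lin_map_D_span:
  assumes Z: "left_module A Z" and h: "lin_map A Z D h" and k: "1 \<le> k" and V: "V \<subseteq> carrier Z"
    and x: "x \<in> span_prod Z (\<A> k) V"
  shows "h x = \<zero>\<^bsub>A\<^esub>"
proof -
  interpret Z: left_module A Z by fact
  have "span_prod Z (\<A> k) V \<subseteq> {x \<in> carrier Z. h x = \<zero>\<^bsub>D\<^esub>}"
    by (rule span_prod_least[OF Z kernel_submodule[OF Z D_left_module h]])
       (use lin_map_D_J[OF h positive_degree_J[OF _ k]] V A_component_carrier in auto)
  then show ?thesis using x by auto
qed

text \<open>\<open>\<A> k\<close> is spanned by products \<open>u v\<close> with \<open>u\<close> in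
  degree 1 and \<open>v\<close> in degree \<open>k - 1\<close>, both in \<open>J\<close>, and
  \<open>\<gamma> (u v b) = u \<gamma> (v b) = 0\<close>. The factor \<open>b\<close> is arbitrary
  because it will be a value of an ungraded map into \<open>A\<close>.\<close>

lemma lin_map_J_square:
  assumes \<gamma>: "lin_map A J_mod D \<gamma>" and a: "a \<in> \<A> k" and k: "2 \<le> k" and b: "b \<in> carrier A"
  shows "\<gamma> (a \<otimes>\<^bsub>A\<^esub> b) = \<zero>\<^bsub>A\<^esub>"
proof -
  interpret M: left_module A A_mod by (rule regular_A)
  note JD = submoduleD[OF J_submodule]
  \<comment> \<open>With \<open>b\<close> fixed, the condition on \<open>a\<close> defines a left
    submodule, so it can be checked on the products that span \<open>\<A> k\<close>.\<close>
  let ?W = "{a \<in> carrier A. a \<otimes>\<^bsub>A\<^esub> b \<in> J \<and> \<gamma> (a \<otimes>\<^bsub>A\<^esub> b) = \<zero>\<^bsub>A\<^esub>}"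
  have \<gamma>0: "\<gamma> \<zero>\<^bsub>A\<^esub> = \<zero>\<^bsub>A\<^esub>" using lin_map_0[OF J_left_module D_left_module \<gamma>] by simp
  have W: "submodule ?W A A_mod"
  proof (rule M.submoduleI)
    show "?W \<subseteq> carrier A_mod" "\<zero>\<^bsub>A_mod\<^esub> \<in> ?W" using b \<gamma>0 JD(2) by auto
  next
    fix x y assume "x \<in> ?W" "y \<in> ?W"
    then show "x \<oplus>\<^bsub>A_mod\<^esub> y \<in> ?W"
      using b JD(4)[of "x \<otimes>\<^bsub>A\<^esub> b" "y \<otimes>\<^bsub>A\<^esub> b"] lin_mapD(2)[OF \<gamma>, of "x \<otimes>\<^bsub>A\<^esub> b" "y \<otimes>\<^bsub>A\<^esub> b"]
      by (simp add: A.l_distr)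
  next
    fix c x assume c: "c \<in> carrier A" and x: "x \<in> ?W"
    then show "c \<odot>\<^bsub>A_mod\<^esub> x \<in> ?W"
      using b J_mult(2)[of c "x \<otimes>\<^bsub>A\<^esub> b"] lin_mapD(3)[OF \<gamma> c, of "x \<otimes>\<^bsub>A\<^esub> b"] A_part_closed[OF c]
      by (simp add: A.m_assoc)
  qed
  have "u \<odot>\<^bsub>A_mod\<^esub> v \<in> ?W" if u: "u \<in> \<A> 1" and v: "v \<in> \<A> (k - 1)" for u v
  proof -
    have uJ: "u \<in> J" and vJ: "v \<in> J" using positive_degree_J u v k by auto
    have vb: "v \<otimes>\<^bsub>A\<^esub> b \<in> J" by (rule J_mult(1)[OF vJ b])
    have "\<gamma> (u \<otimes>\<^bsub>A\<^esub> (v \<otimes>\<^bsub>A\<^esub> b)) = \<zero>\<^bsub>A\<^esub>" using lin_map_D_J[OF \<gamma> uJ, of "v \<otimes>\<^bsub>A\<^esub> b"] vb by simp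
    moreover have "u \<otimes>\<^bsub>A\<^esub> v \<otimes>\<^bsub>A\<^esub> b = u \<otimes>\<^bsub>A\<^esub> (v \<otimes>\<^bsub>A\<^esub> b)"
      using J_carrier uJ vJ b by (simp add: A.m_assoc)
    ultimately show ?thesis using J_mult(2)[OF J_carrier[OF uJ] vb] J_carrier uJ vJ by simp
  qed
  then have "span_prod A_mod (\<A> 1) (\<A> (k - 1)) \<subseteq> ?W" by (intro span_prod_least[OF regular_A(1) W])
  moreover have "span_prod A_mod (\<A> 1) (\<A> (k - 1)) = \<A> k"
  proof -
    have "span_prod A_mod (\<A> 1) (\<A> (k - 1)) = \<A> (k - 1 + 1)"
      using generated unfolding generated_in_degrees_0_1_def by (rule spec)
    then show ?thesis using k by simp
  qed
  ultimately show ?thesis using a by auto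
qed

section \<open>Finite-dimensional components and degrees of generation\<close>

lemma K_left_module_component: "left_module K (A\<lparr>carrier := \<A> i\<rparr>)"
proof -
  have "left_module K A"
    by (intro left_module.intro left_module_axioms.intro A.is_abelian_group K_ring)
       (auto simp: KA.smult_l_distr KA.smult_r_distr KA.smult_assoc1)
  then show ?thesis by (rule submodule_left_module[OF _ degree_submodule])
qed

lemma fd_component: "fd A_mod (\<A> i)"
proof (rule finitely_generated_image[OF K_left_module_component])
  show "left_module K (restrict_scalars \<phi> (A_mod\<lparr>carrier := \<A> i\<rparr>))"
    by (rule restrict_scalars_left_module[OF submodule_left_module[OF left_module_R0[OF regular_A(1)]
          component_submodule[OF regular_A(2)]] K_ring \<phi>_hom])
  show "lin_map K (A\<lparr>carrier := \<A> i\<rparr>) (restrict_scalars \<phi> (A_mod\<lparr>carrier := \<A> i\<rparr>)) (\<lambda>x. x)"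
    using \<phi>_mult A_component_carrier by (auto simp: lin_map_def)
  show "finitely_generated K (A\<lparr>carrier := \<A> i\<rparr>)"
    using locally_finite by (simp add: locally_finite_algebra_def)
qed simp

lemma finite_dimensional_R0: "finite_dimensional_ring K R\<^sub>0 \<phi>"
proof (intro finite_dimensional_ring.intro K R0_ring \<phi>_hom)
  show "finitely_generated K (restrict_scalars \<phi> (regular_module R\<^sub>0))"
  proof (rule finitely_generated_image[OF K_left_module_component[of 0]])
    show "left_module K (restrict_scalars \<phi> (regular_module R\<^sub>0))"
      by (rule restrict_scalars_left_module[OF ring.regular_left_module[OF R0_ring] K_ring \<phi>_hom])
    show "lin_map K (A\<lparr>carrier := \<A> 0\<rparr>) (restrict_scalars \<phi> (regular_module R\<^sub>0)) (\<lambda>x. x)"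
      using \<phi>_mult A_component_carrier by (auto simp: lin_map_def)
    show "finitely_generated K (A\<lparr>carrier := \<A> 0\<rparr>)"
      using locally_finite by (simp add: locally_finite_algebra_def)
  qed simp
qed

text \<open>Scalars are central in \<open>A\<close>, so the structure map is multiplicative for the
  opposite multiplication as well.\<close>

lemma finite_dimensional_R0_op: "finite_dimensional_ring K (opposite_ring R\<^sub>0) \<phi>"
proof (intro finite_dimensional_ring.intro K ring.opposite_ring[OF R0_ring])
  show \<phi>': "\<phi> \<in> ring_hom K (opposite_ring R\<^sub>0)"
  proof (rule ring_hom_memI)
    fix x y assume x: "x \<in> carrier K" and y: "y \<in> carrier K"
    have "\<phi> (x \<otimes>\<^bsub>K\<^esub> y) = \<phi> x \<otimes>\<^bsub>A\<^esub> \<phi> y" using ring_hom_mult[OF \<phi>_hom x y] by simp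
    also have "\<dots> = \<phi> y \<otimes>\<^bsub>A\<^esub> \<phi> x" by (rule \<phi>_comm[OF y A_component_carrier[OF \<phi>_closed[OF x]]])
    finally show "\<phi> (x \<otimes>\<^bsub>K\<^esub> y) = \<phi> x \<otimes>\<^bsub>opposite_ring R\<^sub>0\<^esub> \<phi> y" by simp
  qed (use \<phi>_closed ring_hom_add[OF \<phi>_hom] ring_hom_one[OF \<phi>_hom] in simp_all)
  show "finitely_generated K (restrict_scalars \<phi> (regular_module (opposite_ring R\<^sub>0)))"
  proof (rule finitely_generated_image[OF K_left_module_component[of 0]])
    show "left_module K (restrict_scalars \<phi> (regular_module (opposite_ring R\<^sub>0)))"
      by (rule restrict_scalars_left_module[OF ring.regular_left_module[OF ring.opposite_ring[OF R0_ring]] K_ring \<phi>'])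
    show "lin_map K (A\<lparr>carrier := \<A> 0\<rparr>) (restrict_scalars \<phi> (regular_module (opposite_ring R\<^sub>0))) (\<lambda>x. x)"
      using A_component_carrier by (auto simp: lin_map_def scalar_r)
    show "finitely_generated K (A\<lparr>carrier := \<A> 0\<rparr>)"
      using locally_finite by (simp add: locally_finite_algebra_def)
  qed simp
qed

lemma span_prod_R0_submodule:
  assumes M: "left_module A M" and V: "V \<subseteq> carrier M"
  shows "submodule (span_prod M (\<A> k) V) R\<^sub>0 M"
proof -
  interpret M: left_module A M by fact
  interpret M0: left_module R\<^sub>0 M by (rule left_module_R0[OF M])
  show ?thesis
  proof (rule M0.submoduleI)
    show "span_prod M (\<A> k) V \<subseteq> carrier M"
      by (rule span_prod_least[OF M carrier_submodule[OF M]]) (use V A_component_carrier in auto)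
    fix a x assume a: "a \<in> carrier R\<^sub>0" and x: "x \<in> span_prod M (\<A> k) V"
    have aA: "a \<in> carrier A" using a A_component_carrier by simp
    show "a \<odot>\<^bsub>M\<^esub> x \<in> span_prod M (\<A> k) V"
    proof (rule span_prod_induct[OF M A_component_subset A_component_closed(3) V x])
      show "a \<odot>\<^bsub>M\<^esub> \<zero>\<^bsub>M\<^esub> \<in> span_prod M (\<A> k) V" using aA by (simp add: M.smult_r_null span_prod_zero)
    next
      fix u v assume uv: "u \<in> \<A> k" "v \<in> V"
      then have "a \<odot>\<^bsub>M\<^esub> (u \<odot>\<^bsub>M\<^esub> v) = (a \<otimes>\<^bsub>A\<^esub> u) \<odot>\<^bsub>M\<^esub> v"
        using aA V A_component_carrier[OF uv(1)] by (simp add: M.smult_assoc1 subsetD)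
      then show "a \<odot>\<^bsub>M\<^esub> (u \<odot>\<^bsub>M\<^esub> v) \<in> span_prod M (\<A> k) V"
        using uv a degree_0_mult by (simp add: span_prod_superset)
    next
      fix x y assume "x \<in> carrier M" "y \<in> carrier M"
        "a \<odot>\<^bsub>M\<^esub> x \<in> span_prod M (\<A> k) V" "a \<odot>\<^bsub>M\<^esub> y \<in> span_prod M (\<A> k) V"
      then show "a \<odot>\<^bsub>M\<^esub> (x \<oplus>\<^bsub>M\<^esub> y) \<in> span_prod M (\<A> k) V" using aA by (simp add: M.smult_r_distr span_prod_add)
    qed
  qed (rule span_prod_zero, rule span_prod_add)
qed

text \<open>Products of finitely many generators of \<open>\<A> k\<close> and of \<open>V\<close>
  span over \<open>K\<close>. The bilinear product is exhausted one factor at a time, and central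
  scalars can pass the left factor.\<close>

lemma fd_span_prod:
  assumes M: "left_module A M" and V: "submodule V R\<^sub>0 M" and fdV: "fd M V"
  shows "fd M (span_prod M (\<A> k) V)"
proof -
  interpret M: left_module A M by fact
  let ?M = "restrict_scalars \<phi> M" and ?S = "span_prod M (\<A> k) V"
  note VM = submoduleD(1)[OF V]
  note S = span_prod_R0_submodule[OF M VM, of k]
  note MK = scalar_left_module[OF M]
  note Ak = component_submodule[OF regular_A(2), of k]
  obtain B where B: "B \<subseteq> \<A> k" "finite B" "lspan K (restrict_scalars \<phi> A_mod\<lparr>carrier := \<A> k\<rparr>) B = \<A> k"
    using fd_component[of k] finitely_generated_iff_lspan[OF submodule_left_module[OF scalar_left_module[OF regular_A(1)]
          scalar_submodule[OF regular_A(1) Ak]]] by (auto simp: restrict_scalars_carrier_update)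
  obtain C where C: "C \<subseteq> V" "finite C" "lspan K (?M\<lparr>carrier := V\<rparr>) C = V"
    using fdV finitely_generated_iff_lspan[OF submodule_left_module[OF MK scalar_submodule[OF M V]]]
    by (auto simp: restrict_scalars_carrier_update)
  define G where "G = (\<lambda>(b, c). b \<odot>\<^bsub>M\<^esub> c) ` (B \<times> C)"
  have G: "G \<subseteq> ?S" "finite G" using B C by (auto simp: G_def intro!: span_prod_superset)
  note SK = submodule_left_module[OF MK scalar_submodule[OF M S]]
  let ?U = "lspan K (?M\<lparr>carrier := ?S\<rparr>) G"
  have U: "submodule ?U K (?M\<lparr>carrier := ?S\<rparr>)" by (rule lspan_submodule[OF SK]) (use G in simp)
  then have U': "submodule ?U K ?M" using submodule_of_submodule[OF MK scalar_submodule[OF M S]] by blast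
  have mult: "a \<odot>\<^bsub>M\<^esub> c \<in> ?U" if a: "a \<in> \<A> k" and c: "c \<in> C" for a c
  proof -
    have cM: "c \<in> carrier M" using c C VM by blast
    have l: "lin_map K (restrict_scalars \<phi> A_mod\<lparr>carrier := \<A> k\<rparr>) ?M (\<lambda>a. a \<odot>\<^bsub>M\<^esub> c)"
      using cM A_component_carrier \<phi>_closed by (auto simp: lin_map_def M.smult_l_distr M.smult_assoc1)
    have "lspan K (restrict_scalars \<phi> A_mod\<lparr>carrier := \<A> k\<rparr>) B \<subseteq>
        {a \<in> carrier (restrict_scalars \<phi> A_mod\<lparr>carrier := \<A> k\<rparr>). a \<odot>\<^bsub>M\<^esub> c \<in> ?U}"
    proof (rule lspan_least[OF vimage_submodule[OF submodule_left_module[OF scalar_left_module[OF regular_A(1)]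
              scalar_submodule[OF regular_A(1) Ak]] MK l U']])
      have "b \<odot>\<^bsub>M\<^esub> c \<in> ?U" if "b \<in> B" for b
        by (rule subsetD[OF lspan_superset]) (use that c in \<open>auto simp: G_def\<close>)
      then show "B \<subseteq> {a \<in> carrier (restrict_scalars \<phi> A_mod\<lparr>carrier := \<A> k\<rparr>). a \<odot>\<^bsub>M\<^esub> c \<in> ?U}"
        using B(1) by auto
    qed
    then show ?thesis using a B(3) by auto
  qed
  have "lspan K (?M\<lparr>carrier := V\<rparr>) C \<subseteq> {x \<in> V. \<forall>a\<in>\<A> k. a \<odot>\<^bsub>M\<^esub> x \<in> ?U}"
  proof (rule lspan_least)
    note VK = scalar_submodule[OF M V]
    show "submodule {x \<in> V. \<forall>a\<in>\<A> k. a \<odot>\<^bsub>M\<^esub> x \<in> ?U} K (?M\<lparr>carrier := V\<rparr>)"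
    proof (rule left_module.submoduleI[OF submodule_left_module[OF MK VK]])
      fix c x assume c: "c \<in> carrier K" and x: "x \<in> {x \<in> V. \<forall>a\<in>\<A> k. a \<odot>\<^bsub>M\<^esub> x \<in> ?U}"
      have "a \<odot>\<^bsub>M\<^esub> (\<phi> c \<odot>\<^bsub>M\<^esub> x) \<in> ?U" if a: "a \<in> \<A> k" for a
      proof -
        note cl = A_component_carrier[OF a] A_component_carrier[OF \<phi>_closed[OF c]]
        have xM: "x \<in> carrier M" using x VM by blast
        have "a \<odot>\<^bsub>M\<^esub> (\<phi> c \<odot>\<^bsub>M\<^esub> x) = (a \<otimes>\<^bsub>A\<^esub> \<phi> c) \<odot>\<^bsub>M\<^esub> x" by (rule M.smult_assoc1[symmetric, OF cl xM])
        also have "\<dots> = (\<phi> c \<otimes>\<^bsub>A\<^esub> a) \<odot>\<^bsub>M\<^esub> x" by (simp only: \<phi>_comm[OF c cl(1)])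
        also have "\<dots> = \<phi> c \<odot>\<^bsub>M\<^esub> (a \<odot>\<^bsub>M\<^esub> x)" by (rule M.smult_assoc1[OF cl(2,1) xM])
        finally have "a \<odot>\<^bsub>M\<^esub> (\<phi> c \<odot>\<^bsub>M\<^esub> x) = \<phi> c \<odot>\<^bsub>M\<^esub> (a \<odot>\<^bsub>M\<^esub> x)" .
        then show ?thesis using submoduleD(6)[OF U' c, of "a \<odot>\<^bsub>M\<^esub> x"] x a by auto
      qed
      then show "c \<odot>\<^bsub>?M\<lparr>carrier := V\<rparr>\<^esub> x \<in> {x \<in> V. \<forall>a\<in>\<A> k. a \<odot>\<^bsub>M\<^esub> x \<in> ?U}"
        using x submoduleD(6)[OF VK c] by auto
    next
      fix x y assume x: "x \<in> {x \<in> V. \<forall>a\<in>\<A> k. a \<odot>\<^bsub>M\<^esub> x \<in> ?U}" and y: "y \<in> {x \<in> V. \<forall>a\<in>\<A> k. a \<odot>\<^bsub>M\<^esub> x \<in> ?U}"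
      have "a \<odot>\<^bsub>M\<^esub> (x \<oplus>\<^bsub>M\<^esub> y) \<in> ?U" if a: "a \<in> \<A> k" for a
        using submoduleD(4)[OF U', of "a \<odot>\<^bsub>M\<^esub> x" "a \<odot>\<^bsub>M\<^esub> y"] x y a A_component_carrier[OF a] VM
        by (auto simp: M.smult_r_distr subsetD)
      then show "x \<oplus>\<^bsub>?M\<lparr>carrier := V\<rparr>\<^esub> y \<in> {x \<in> V. \<forall>a\<in>\<A> k. a \<odot>\<^bsub>M\<^esub> x \<in> ?U}"
        using x y submoduleD(4)[OF V] by auto
    qed (use submoduleD(2)[OF V] submoduleD(2)[OF U'] A_component_carrier in \<open>auto simp: M.smult_r_null\<close>)
    show "C \<subseteq> {x \<in> V. \<forall>a\<in>\<A> k. a \<odot>\<^bsub>M\<^esub> x \<in> ?U}" using C(1) mult by auto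
  qed
  then have "V \<subseteq> {x \<in> V. \<forall>a\<in>\<A> k. a \<odot>\<^bsub>M\<^esub> x \<in> ?U}" by (simp only: C(3))
  then have "u \<odot>\<^bsub>M\<^esub> v \<in> ?U" if "u \<in> \<A> k" "v \<in> V" for u v using that by blast
  then have "?S \<subseteq> ?U"
  proof (intro subsetI)
    fix x assume gen: "\<And>u v. u \<in> \<A> k \<Longrightarrow> v \<in> V \<Longrightarrow> u \<odot>\<^bsub>M\<^esub> v \<in> ?U" and x: "x \<in> ?S"
    show "x \<in> ?U"
      by (rule span_prod_induct[OF M A_component_subset A_component_closed(3) VM x])
         (use gen submoduleD(2)[OF U'] submoduleD(4)[OF U'] in auto)
  qed
  then have "?U = carrier (?M\<lparr>carrier := ?S\<rparr>)" using submoduleD(1)[OF U] by auto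
  then show ?thesis
    unfolding restrict_scalars_carrier_update finitely_generated_iff_lspan[OF SK] using G by auto
qed

lemma fd_generated:
  assumes M: "graded_module A \<A> M \<M>" and gen: "generated_in_degree A M \<M> s" and fds: "fd M (\<M> s)"
  shows "fd M (\<M> j)"
proof -
  note MM = graded_moduleD(1)[OF M]
  interpret M: left_module A M by (rule MM)
  note sub = component_submodule[OF M]
  show ?thesis
  proof (cases "s \<le> j")
    case True
    show ?thesis
      by (rule fd_subset[OF MM sub span_prod_R0_submodule[OF MM submoduleD(1)[OF sub]] _ fd_span_prod[OF MM sub fds, of "j - s"]])
         (use generated_component(2)[OF M gen _ True] in blast)
  next
    case False
    have "x \<in> \<M> s" if x: "x \<in> \<M> j" for x
      unfolding generated_component(1)[OF M gen x False[unfolded not_le]] by (rule submoduleD(2)[OF sub])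
    then have "\<M> j \<subseteq> \<M> s" by blast
    then show ?thesis by (rule fd_subset[OF MM sub sub _ fds])
  qed
qed

text \<open>A functional of the degree \<open>j\<close> component that kills \<open>N'\<close> is
  extended by the projection to degree \<open>j\<close>. The obstacle is that parts of
  \<open>y\<close> below degree \<open>j\<close> contribute to degree \<open>j\<close> of
  \<open>a y\<close>; these contributions lie in \<open>N'\<close>, because below degree
  \<open>j\<close> the module is contained in \<open>N'\<close>.\<close>

lemma graded_functional:
  assumes fin: "fin_dim (opposite_ring R\<^sub>0) = 0" and N: "graded_module A \<A> N \<N>" and fdN: "fd N (\<N> j)"
    and N': "submodule N' A N" and below: "\<And>i. i < j \<Longrightarrow> \<N> i \<subseteq> N'" and ne: "\<not> \<N> j \<subseteq> N'"
  obtains h x where "lin_map A N D h" "x \<in> \<N> j" "h x \<noteq> \<zero>\<^bsub>A\<^esub>"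
proof -
  note NM = graded_moduleD(1)[OF N]
  interpret N: left_module A N by (rule NM)
  interpret N0: left_module R\<^sub>0 N by (rule left_module_R0[OF NM])
  note sub = component_submodule[OF N, of j]
  let ?N = "N\<lparr>carrier := \<N> j\<rparr>"
  have Nj: "left_module R\<^sub>0 ?N" by (rule submodule_left_module[OF left_module_R0[OF NM] sub])
  have I: "submodule (N' \<inter> \<N> j) R\<^sub>0 N" by (rule Int_submodule[OF left_module_R0[OF NM] submodule_R0[OF NM N'] sub])
  then have I': "submodule (N' \<inter> \<N> j) R\<^sub>0 ?N" using submodule_of_submodule[OF left_module_R0[OF NM] sub] by simp
  obtain h0 x where h0: "lin_map R\<^sub>0 ?N (regular_module R\<^sub>0) h0" "\<And>u. u \<in> N' \<inter> \<N> j \<Longrightarrow> h0 u = \<zero>\<^bsub>R\<^sub>0\<^esub>"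
    "x \<in> carrier ?N" "h0 x \<noteq> \<zero>\<^bsub>R\<^sub>0\<^esub>"
    by (rule nonzero_functional[OF finite_dimensional_R0 finite_dimensional_R0_op fin Nj
          fd_finitely_generated[OF NM sub fdN] I']) (use ne in auto)
  let ?p = "\<lambda>i x. homogeneous_part N \<N> i x"
  define h where "h y = h0 (?p j y)" for y
  have "lin_map A N D h"
  proof (rule lin_mapI)
    show "h y \<in> carrier D" if "y \<in> carrier N" for y
      using lin_mapD(1)[OF h0(1)] part_in[OF N that] by (simp add: h_def)
  next
    fix y z assume "y \<in> carrier N" "z \<in> carrier N"
    then show "h (y \<oplus>\<^bsub>N\<^esub> z) = h y \<oplus>\<^bsub>D\<^esub> h z"
      using lin_mapD(2)[OF h0(1)] part_in[OF N] by (simp add: h_def part_add[OF N])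
  next
    fix a y assume a: "a \<in> carrier A" and y: "y \<in> carrier N"
    let ?t = "\<lambda>i. A_part i a \<odot>\<^bsub>N\<^esub> ?p (j - i) y"
    have tN: "?t i \<in> carrier N" for i using A_part_closed[OF a] part_closed[OF N y] by simp
    have tj: "?t i \<in> N' \<inter> \<N> j" if "i \<in> {1..j}" for i
    proof -
      have "?p (j - i) y \<in> N'" using below[of "j - i"] part_in[OF N y, of "j - i"] that by auto
      then show ?thesis
        using submoduleD(6)[OF N' A_part_closed[OF a]] that
          graded_moduleD(4)[OF N A_part_in[OF a] part_in[OF N y], of i "j - i"] by simp
    qed
    have a0: "A_part 0 a \<in> \<A> 0" by (rule A_part_in[OF a])
    have t0: "?t 0 \<in> \<N> j" using graded_moduleD(4)[OF N a0 part_in[OF N y], of j] by simp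
    have s: "(\<Oplus>\<^bsub>N\<^esub> i\<in>{1..j}. ?t i) \<in> N' \<inter> \<N> j"
      by (rule submodule_finsum[OF left_module_R0[OF NM] I]) (use tj in blast)
    have "?p j (a \<odot>\<^bsub>N\<^esub> y) = (\<Oplus>\<^bsub>N\<^esub> i\<in>{..j}. ?t i)" by (rule part_smult[OF N a y])
    also have "{..j} = insert 0 {1..j}" by auto
    also have "(\<Oplus>\<^bsub>N\<^esub> i\<in>insert 0 {1..j}. ?t i) = ?t 0 \<oplus>\<^bsub>N\<^esub> (\<Oplus>\<^bsub>N\<^esub> i\<in>{1..j}. ?t i)"
      using tN tN[of 0] by (intro N.M.finsum_insert) auto
    finally have "h (a \<odot>\<^bsub>N\<^esub> y) = h0 (?t 0) \<oplus>\<^bsub>A\<^esub> h0 (\<Oplus>\<^bsub>N\<^esub> i\<in>{1..j}. ?t i)"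
      using lin_mapD(2)[OF h0(1), of "?t 0" "\<Oplus>\<^bsub>N\<^esub> i\<in>{1..j}. ?t i"] t0 s by (simp add: h_def)
    also have "h0 (\<Oplus>\<^bsub>N\<^esub> i\<in>{1..j}. ?t i) = \<zero>\<^bsub>A\<^esub>" using h0(2)[OF s] by simp
    also have "h0 (?t 0) = A_part 0 a \<otimes>\<^bsub>A\<^esub> h0 (?p j y)"
      using lin_mapD(3)[OF h0(1), of "A_part 0 a" "?p j y"] a0 part_in[OF N y] by simp
    finally show "h (a \<odot>\<^bsub>N\<^esub> y) = a \<odot>\<^bsub>D\<^esub> h y"
      using A_component_carrier[OF a0] lin_mapD(1)[OF h0(1), of "?p j y"] part_in[OF N y] A_component_carrier[of _ 0]
      by (simp add: h_def)
  qed
  moreover have "h x = h0 x" using part_homogeneous[OF N, of x j j] h0(3) by (simp add: h_def)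
  ultimately show ?thesis using that[of h x] h0(3,4) by simp
qed

text \<open>Nakayama's lemma with functionals into \<open>D\<close> in place of a radical. Consider
  the least degree \<open>j\<close> in which \<open>N\<close> exceeds the submodule generated by its
  component of degree \<open>s\<close>. It is above \<open>s\<close>, since nothing nonzero lies
  below \<open>s\<close>, and some functional is nonzero there.\<close>

lemma generated_in_degreeI:
  assumes fin: "fin_dim (opposite_ring R\<^sub>0) = 0" and N: "graded_module A \<A> N \<N>"
    and fdN: "\<And>j. fd N (\<N> j)" and below: "\<And>i. i < s \<Longrightarrow> \<N> i = {\<zero>\<^bsub>N\<^esub>}"
    and D0: "\<And>h j x. lin_map A N D h \<Longrightarrow> s < j \<Longrightarrow> x \<in> \<N> j \<Longrightarrow> h x = \<zero>\<^bsub>A\<^esub>"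
  shows "generated_in_degree A N \<N> s"
proof (rule ccontr)
  assume ng: "\<not> generated_in_degree A N \<N> s"
  note NM = graded_moduleD(1)[OF N]
  interpret N: left_module A N by (rule NM)
  note sub = component_submodule[OF N]
  let ?N' = "span_prod N (carrier A) (\<N> s)"
  have N': "submodule ?N' A N" by (rule span_prod_submodule[OF NM submoduleD(1)[OF sub]])
  have "\<exists>j. \<not> \<N> j \<subseteq> ?N'"
  proof (rule ccontr)
    assume "\<nexists>j. \<not> \<N> j \<subseteq> ?N'"
    then have all: "\<N> j \<subseteq> ?N'" for j by simp
    have "x \<in> ?N'" if x: "x \<in> carrier N" for x
    proof -
      have T: "finite {i. homogeneous_part N \<N> i x \<noteq> \<zero>\<^bsub>N\<^esub>}"
        by (rule N.M.homogeneous_part_finite[OF graded_moduleD(2)[OF N] x])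
      have "(\<Oplus>\<^bsub>N\<^esub> i\<in>{i. homogeneous_part N \<N> i x \<noteq> \<zero>\<^bsub>N\<^esub>}. homogeneous_part N \<N> i x) \<in> ?N'"
        by (rule submodule_finsum[OF NM N']) (use all part_in[OF N x] in blast)
      then show ?thesis using N.M.homogeneous_part_sum[OF graded_moduleD(2)[OF N] x T] by simp
    qed
    then show False using ng submoduleD(1)[OF N'] unfolding generated_in_degree_def by blast
  qed
  then obtain j where j: "\<not> \<N> j \<subseteq> ?N'" and least: "\<And>i. i < j \<Longrightarrow> \<N> i \<subseteq> ?N'"
    using exists_least_iff[of "\<lambda>j. \<not> \<N> j \<subseteq> ?N'"] by blast
  have "\<N> s \<subseteq> ?N'"
  proof
    fix x assume x: "x \<in> \<N> s"
    have "\<one>\<^bsub>A\<^esub> \<odot>\<^bsub>N\<^esub> x \<in> ?N'" by (rule span_prod_superset) (use x in auto)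
    then show "x \<in> ?N'" using component_carrier[OF N x] by simp
  qed
  then have "s < j" using j below[of j] span_prod_zero[of N "carrier A" "\<N> s"] by (metis empty_subsetI insert_subset linorder_neqE_nat)
  obtain h x where "lin_map A N D h" "x \<in> \<N> j" "h x \<noteq> \<zero>\<^bsub>A\<^esub>"
    by (rule graded_functional[OF fin N fdN N' least j])
  then show False using D0 \<open>s < j\<close> by blast
qed

end

section \<open>Comparison of resolutions\<close>

text \<open>The homotopy \<^term>\<open>s\<close> is only recorded on syzygies: there \<^term>\<open>u \<circ> v\<close> is the identity up to
  a map that extends to the whole projective module.\<close>

lemma comparison_step:
  assumes Z: "left_module R Z" and P: "projective_module R P"
    and Z': "projective_module R Z'" and P': "projective_module R P'"
    and e: "lin_map R Z' Z e" and d: "lin_map R P' P d"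
    and u: "lin_map R Z P u" "\<And>x. x \<in> e ` carrier Z' \<Longrightarrow> u x \<in> d ` carrier P'"
    and v: "lin_map R P Z v" "\<And>x. x \<in> d ` carrier P' \<Longrightarrow> v x \<in> e ` carrier Z'"
    and s: "lin_map R P P s" "\<And>x. x \<in> carrier P \<Longrightarrow> s x \<in> d ` carrier P'"
    and uv: "\<And>x. x \<in> d ` carrier P' \<Longrightarrow> u (v x) = x \<oplus>\<^bsub>P\<^esub> s x"
  obtains u' v' s' where "lin_map R Z' P' u'" "\<And>x. x \<in> carrier Z' \<Longrightarrow> d (u' x) = u (e x)"
    "lin_map R P' Z' v'" "\<And>x. x \<in> carrier P' \<Longrightarrow> e (v' x) = v (d x)"
    "lin_map R P' P' s'" "\<And>x. x \<in> carrier P' \<Longrightarrow> d (s' x) = \<zero>\<^bsub>P\<^esub>"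
    "\<And>x. x \<in> carrier P' \<Longrightarrow> d x = \<zero>\<^bsub>P\<^esub> \<Longrightarrow> u' (v' x) = x \<oplus>\<^bsub>P'\<^esub> s' x"
proof -
  note PM = projective_left_module[OF P] and ZM' = projective_left_module[OF Z']
    and PM' = projective_left_module[OF P']
  interpret P: left_module R P by (rule PM)
  interpret P': left_module R P' by (rule PM')
  obtain u' where u': "lin_map R Z' P' u'" "\<And>x. x \<in> carrier Z' \<Longrightarrow> d (u' x) = u (e x)"
    by (rule projective_lift[OF Z' PM' PM d lin_map_comp[OF e u(1)]]) (use u(2) in auto)
  obtain v' where v': "lin_map R P' Z' v'" "\<And>x. x \<in> carrier P' \<Longrightarrow> e (v' x) = v (d x)"
    by (rule projective_lift[OF P' ZM' Z e lin_map_comp[OF d v(1)]]) (use v(2) in auto)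
  obtain t where t: "lin_map R P P' t" "\<And>x. x \<in> carrier P \<Longrightarrow> d (t x) = s x"
    by (rule projective_lift[OF P PM' PM d s(1)]) (use s(2) in auto)
  let ?w = "\<lambda>x. u' (v' x) \<ominus>\<^bsub>P'\<^esub> x"
  \<comment> \<open>The uncorrected defect satisfies \<open>d (?w x) = s (d x)\<close>. Subtracting
    \<open>t (d x)\<close>, with \<open>t\<close> a lift of \<open>s\<close>, moves it into the
    kernel of \<open>d\<close>, and changes nothing on that kernel.\<close>
  let ?s = "\<lambda>x. ?w x \<ominus>\<^bsub>P'\<^esub> t (d x)"
  have w: "lin_map R P' P' ?w" by (rule lin_map_diff[OF PM' lin_map_comp[OF v'(1) u'(1)] lin_map_id])
  have td: "lin_map R P' P' (\<lambda>x. t (d x))" by (rule lin_map_comp[OF d t(1)])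
  have s': "lin_map R P' P' ?s" by (rule lin_map_diff[OF PM' w td])
  have "d (?s x) = \<zero>\<^bsub>P\<^esub>" if x: "x \<in> carrier P'" for x
  proof -
    have c: "u' (v' x) \<in> carrier P'" "?w x \<in> carrier P'" "t (d x) \<in> carrier P'" "d x \<in> carrier P"
      "s (d x) \<in> carrier P"
      using x lin_mapD(1)[OF u'(1)] lin_mapD(1)[OF v'(1)] lin_mapD(1)[OF td] lin_mapD(1)[OF d] lin_mapD(1)[OF s(1)]
      by simp_all
    have "d (?w x) = d (u' (v' x)) \<ominus>\<^bsub>P\<^esub> d x" by (rule lin_map_minus[OF PM' PM d c(1) x])
    also have "d (u' (v' x)) = d x \<oplus>\<^bsub>P\<^esub> s (d x)"
      using u'(2)[OF lin_mapD(1)[OF v'(1) x]] v'(2)[OF x] uv[OF imageI[OF x]] by simp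
    also have "(d x \<oplus>\<^bsub>P\<^esub> s (d x)) \<ominus>\<^bsub>P\<^esub> d x = s (d x)" by (rule P.M.add_minus_cancel[OF c(4,5)])
    finally have "d (?w x) = s (d x)" .
    then show ?thesis
      using lin_map_minus[OF PM' PM d c(2,3)] t(2)[OF c(4)] c(5) by (simp add: P.M.minus_eq_zero_iff)
  qed
  moreover have "u' (v' x) = x \<oplus>\<^bsub>P'\<^esub> ?s x" if x: "x \<in> carrier P'" and dx: "d x = \<zero>\<^bsub>P\<^esub>" for x
  proof -
    have c: "u' (v' x) \<in> carrier P'" using x lin_mapD(1)[OF u'(1)] lin_mapD(1)[OF v'(1)] by simp
    have "?s x = ?w x" using dx lin_map_0[OF PM PM' t(1)] c x by (simp add: P'.M.minus_zero_right)
    then show ?thesis using c x by (simp add: P'.M.add_minus_cancel_right)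
  qed
  ultimately show ?thesis using that[OF u' v' s'] by blast
qed

text \<open>At the bottom the composite lies over the identity of \<open>M\<close>, so the defect
  \<open>u' (v' x) - x\<close> is in the kernel of \<open>d\<close> without any correction.\<close>

lemma comparison_base:
  assumes M: "left_module R M" and Z': "projective_module R Z'" and P': "projective_module R P'"
    and e: "lin_map R Z' M e" "e ` carrier Z' = carrier M"
    and d: "lin_map R P' M d" "d ` carrier P' = carrier M"
  obtains u' v' s' where "lin_map R Z' P' u'" "\<And>x. x \<in> carrier Z' \<Longrightarrow> d (u' x) = e x"
    "lin_map R P' Z' v'" "\<And>x. x \<in> carrier P' \<Longrightarrow> e (v' x) = d x"
    "lin_map R P' P' s'" "\<And>x. x \<in> carrier P' \<Longrightarrow> d (s' x) = \<zero>\<^bsub>M\<^esub>"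
    "\<And>x. x \<in> carrier P' \<Longrightarrow> u' (v' x) = x \<oplus>\<^bsub>P'\<^esub> s' x"
proof -
  note ZM' = projective_left_module[OF Z'] and PM' = projective_left_module[OF P']
  interpret M: left_module R M by (rule M)
  interpret P': left_module R P' by (rule PM')
  obtain u' where u': "lin_map R Z' P' u'" "\<And>x. x \<in> carrier Z' \<Longrightarrow> d (u' x) = e x"
    by (rule projective_lift[OF Z' PM' M d(1) e(1)]) (use e(2) d(2) in auto)
  obtain v' where v': "lin_map R P' Z' v'" "\<And>x. x \<in> carrier P' \<Longrightarrow> e (v' x) = d x"
    by (rule projective_lift[OF P' ZM' M e(1) d(1)]) (use e(2) d(2) in auto)
  let ?s = "\<lambda>x. u' (v' x) \<ominus>\<^bsub>P'\<^esub> x"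
  have s: "lin_map R P' P' ?s" by (rule lin_map_diff[OF PM' lin_map_comp[OF v'(1) u'(1)] lin_map_id])
  have c: "u' (v' x) \<in> carrier P'" if "x \<in> carrier P'" for x
    using that lin_mapD(1)[OF u'(1)] lin_mapD(1)[OF v'(1)] by simp
  have "d (?s x) = \<zero>\<^bsub>M\<^esub>" if x: "x \<in> carrier P'" for x
    using lin_map_minus[OF PM' M d(1) c[OF x] x] u'(2)[OF lin_mapD(1)[OF v'(1) x]] v'(2)[OF x]
      lin_mapD(1)[OF d(1) x] by (simp add: M.M.minus_eq_zero_iff)
  moreover have "u' (v' x) = x \<oplus>\<^bsub>P'\<^esub> ?s x" if x: "x \<in> carrier P'" for x
    using c[OF x] x by (simp add: P'.M.add_minus_cancel_right)
  ultimately show ?thesis using that[OF u' v' s] by blast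
qed

text \<open>The homomorphism theorem with the quotient realized as the image \<open>W\<close>. In
  this form a cocycle becomes a homomorphism defined on a syzygy.\<close>

lemma factor_surjective:
  assumes Z: "left_module R Z" and N: "left_module R N" and Y: "left_module R Y"
    and q: "lin_map R Z N q" and W: "q ` carrier Z = W" and g: "lin_map R Z Y g"
    and ker: "\<And>x. x \<in> carrier Z \<Longrightarrow> q x = \<zero>\<^bsub>N\<^esub> \<Longrightarrow> g x = \<zero>\<^bsub>Y\<^esub>"
  obtains h where "lin_map R (N\<lparr>carrier := W\<rparr>) Y h" "\<And>x. x \<in> carrier Z \<Longrightarrow> h (q x) = g x"
proof -
  interpret Z: left_module R Z by fact
  interpret N: left_module R N by fact
  interpret Y: left_module R Y by fact
  define h where "h y = g (inv_into (carrier Z) q y)" for y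
  have h: "h (q x) = g x" if x: "x \<in> carrier Z" for x
  proof -
    let ?y = "inv_into (carrier Z) q (q x)"
    have y: "?y \<in> carrier Z" "q ?y = q x" using x by (auto simp: inv_into_into f_inv_into_f)
    have "q (?y \<ominus>\<^bsub>Z\<^esub> x) = \<zero>\<^bsub>N\<^esub>"
      using lin_map_minus[OF Z N q y(1) x] y lin_mapD(1)[OF q x] by (simp add: N.M.minus_eq_zero_iff)
    then have "g (?y \<ominus>\<^bsub>Z\<^esub> x) = \<zero>\<^bsub>Y\<^esub>" using ker y x by simp
    then show ?thesis
      using lin_map_minus[OF Z Y g y(1) x] lin_mapD(1)[OF g] y(1) x
      by (simp add: h_def Y.M.minus_eq_zero_iff)
  qed
  have "lin_map R (N\<lparr>carrier := W\<rparr>) Y h"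
  proof (rule lin_mapI)
    show "h y \<in> carrier Y" if "y \<in> carrier (N\<lparr>carrier := W\<rparr>)" for y
      using that W h lin_mapD(1)[OF g] by auto
  next
    fix y z assume "y \<in> carrier (N\<lparr>carrier := W\<rparr>)" "z \<in> carrier (N\<lparr>carrier := W\<rparr>)"
    then obtain a b where ab: "a \<in> carrier Z" "b \<in> carrier Z" "y = q a" "z = q b" using W by auto
    then show "h (y \<oplus>\<^bsub>N\<lparr>carrier := W\<rparr>\<^esub> z) = h y \<oplus>\<^bsub>Y\<^esub> h z"
      using h[of "a \<oplus>\<^bsub>Z\<^esub> b"] h lin_mapD(2)[OF q] lin_mapD(2)[OF g] by simp
  next
    fix c y assume c: "c \<in> carrier R" and "y \<in> carrier (N\<lparr>carrier := W\<rparr>)"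
    then obtain a where a: "a \<in> carrier Z" "y = q a" using W by auto
    then show "h (c \<odot>\<^bsub>N\<lparr>carrier := W\<rparr>\<^esub> y) = c \<odot>\<^bsub>Y\<^esub> h y"
      using c h[of "c \<odot>\<^bsub>Z\<^esub> a"] h lin_mapD(3)[OF q c] lin_mapD(3)[OF g c] by simp
  qed
  then show ?thesis using h that by blast
qed

section \<open>Yoneda products in degree one\<close>

lemma std_mod_projective: "left_module R M \<Longrightarrow> projective_module R (std_mod R M n)"
  using std_projective_resolution[of R M] by (simp add: projective_resolution_def)

lemma std_mod_left_module: "left_module R M \<Longrightarrow> left_module R (std_mod R M n)"
  by (rule projective_left_module[OF std_mod_projective])

lemma std_diff_lin_map: "left_module R M \<Longrightarrow> lin_map R (std_mod R M (Suc n)) (std_mod R M n) (std_diff R M n)"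
  using std_projective_resolution[of R M] unfolding projective_resolution_def by (intro mod_hom_lin_map) blast

lemma std_syz_Suc:
  assumes M: "left_module R M"
  shows "std_syz R M (Suc n) = {x \<in> carrier (std_mod R M (Suc n)). std_diff R M n x = \<zero>\<^bsub>std_mod R M n\<^esub>}"
  by (cases n) (auto simp: std_diff_def)

lemma std_diff_image:
  assumes M: "left_module R M"
  shows "std_diff R M n ` carrier (std_mod R M (Suc n)) = std_syz R M n"
proof (cases n)
  case 0
  then show ?thesis
    using std_projective_resolution[OF M] std_aug_lin_map(4)[OF M] unfolding projective_resolution_def by auto
next
  case (Suc m)
  then show ?thesis
    using std_projective_resolution[OF M] unfolding projective_resolution_def Suc std_syz_Suc[OF M] by blast
qed

lemma std_diff_diff:
  assumes M: "left_module R M" and x: "x \<in> carrier (std_mod R M (Suc (Suc n)))"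
  shows "std_diff R M n (std_diff R M (Suc n) x) = \<zero>\<^bsub>std_mod R M n\<^esub>"
  using imageI[OF x, of "std_diff R M (Suc n)"] unfolding std_diff_image[OF M] std_syz_Suc[OF M] by blast

lemma std_aug_diff:
  assumes M: "left_module R M" and x: "x \<in> carrier (std_mod R M (Suc 0))"
  shows "std_aug R M (std_diff R M 0 x) = \<zero>\<^bsub>M\<^esub>"
  using imageI[OF x, of "std_diff R M 0"] unfolding std_diff_image[OF M] std_aug_lin_map(4)[OF M] by blast

lemma cocyclesD:
  assumes "f \<in> cocycles R M N i"
  shows "lin_map R (std_mod R M i) N f" "f \<in> mod_hom R (std_mod R M i) N"
    "x \<in> carrier (std_mod R M (Suc i)) \<Longrightarrow> f (std_diff R M i x) = \<zero>\<^bsub>N\<^esub>"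
  using assms by (auto simp: cocycles_def mod_hom_lin_map)

lemma cocyclesI:
  assumes M: "left_module R M" and f: "lin_map R (std_mod R M i) N f"
    and d: "\<And>x. x \<in> carrier (std_mod R M (Suc i)) \<Longrightarrow> f (std_diff R M i x) = \<zero>\<^bsub>N\<^esub>"
  shows "restrict f (carrier (std_mod R M i)) \<in> cocycles R M N i"
  unfolding cocycles_def using restrict_mod_hom[OF std_mod_left_module[OF M] f] d
    lin_mapD(1)[OF std_diff_lin_map[OF M]] by auto

text \<open>The invariant says that the composite with the differential lands in the syzygy, which
  is exactly what the next lifting consumes. The bottom component is prescribed, so that products
  can be computed from a convenient \<open>\<phi>0\<close>.\<close>

lemma chain_lift_exists:
  fixes L :: "('r, 'l, 'f) module_scheme" and M :: "('r, 'm, 'g) module_scheme"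
  assumes L: "left_module R L" and M: "left_module R M" and f: "f \<in> cocycles R L M i"
    and \<phi>0: "lin_map R (std_mod R L i) (std_mod R M 0) \<phi>0"
    and aug: "\<And>x. x \<in> carrier (std_mod R L i) \<Longrightarrow> std_aug R M (\<phi>0 x) = f x"
  obtains \<phi> where "chain_lift R L M i f \<phi>" "\<And>x. x \<in> carrier (std_mod R L i) \<Longrightarrow> \<phi> 0 x = \<phi>0 x"
proof -
  let ?L = "std_mod R L" and ?M = "std_mod R M"
  note LM = std_mod_left_module[OF L] and MM = std_mod_left_module[OF M]
  let ?P = "\<lambda>n h. h \<in> mod_hom R (?L (i + n)) (?M n) \<and>
    (\<forall>x\<in>carrier (?L (Suc (i + n))). h (std_diff R L (i + n) x) \<in> std_syz R M n) \<and>
    (n = 0 \<longrightarrow> (\<forall>x\<in>carrier (?L i). h x = \<phi>0 x))"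
  let ?Q = "\<lambda>n h h'. \<forall>x\<in>carrier (?L (Suc (i + n))). std_diff R M n (h' x) = h (std_diff R L (i + n) x)"
  have "\<exists>\<phi>. \<forall>n. ?P n (\<phi> n) \<and> ?Q n (\<phi> n) (\<phi> (Suc n))"
  proof (rule dependent_nat_choice)
    have "std_diff R L i x \<in> carrier (?L i)" if "x \<in> carrier (?L (Suc i))" for x
      using lin_mapD(1)[OF std_diff_lin_map[OF L] that] .
    then have "?P 0 (restrict \<phi>0 (carrier (?L i)))"
      using restrict_mod_hom[OF LM \<phi>0] aug cocyclesD(3)[OF f] lin_mapD(1)[OF \<phi>0]
      unfolding std_aug_lin_map(4)[OF M] by (auto simp del: std_mod.simps)
    then show "\<exists>h. ?P 0 h" by (rule exI[of "?P 0"])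
  next
    fix h n assume P: "?P n h"
    have h: "lin_map R (?L (i + n)) (?M n) h" using conjunct1[OF P] by (rule mod_hom_lin_map)
    have hd: "lin_map R (?L (Suc (i + n))) (?M n) (\<lambda>x. h (std_diff R L (i + n) x))"
      by (rule lin_map_comp[OF std_diff_lin_map[OF L] h])
    obtain h' where h': "lin_map R (?L (Suc (i + n))) (?M (Suc n)) h'"
      "\<And>x. x \<in> carrier (?L (Suc (i + n))) \<Longrightarrow> std_diff R M n (h' x) = h (std_diff R L (i + n) x)"
    proof (rule projective_lift[OF std_mod_projective[OF L] MM MM std_diff_lin_map[OF M] hd], goal_cases)
      case 1
      show ?case unfolding std_diff_image[OF M] using P by blast
    next
      case (2 h')
      show ?case by (rule 2(1)[OF 2(2,3)])
    qed
    let ?h = "restrict h' (carrier (?L (Suc (i + n))))"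
    have Q: "?Q n h ?h" using h'(2) by simp
    have "?h (std_diff R L (Suc (i + n)) x) \<in> std_syz R M (Suc n)"
      if x: "x \<in> carrier (?L (Suc (Suc (i + n))))" for x
    proof -
      have dx: "std_diff R L (Suc (i + n)) x \<in> carrier (?L (Suc (i + n)))"
        by (rule lin_mapD(1)[OF std_diff_lin_map[OF L] x])
      have "std_diff R M n (h' (std_diff R L (Suc (i + n)) x)) = \<zero>\<^bsub>?M n\<^esub>"
        unfolding h'(2)[OF dx] std_diff_diff[OF L x] by (rule lin_map_0[OF LM MM h])
      then show ?thesis unfolding std_syz_Suc[OF M] using lin_mapD(1)[OF h'(1) dx] dx by simp
    qed
    then have "?P (Suc n) ?h" using restrict_mod_hom[OF LM h'(1)] by (simp del: std_mod.simps std_syz.simps)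
    from conjI[OF this Q] show "\<exists>h'. ?P (Suc n) h' \<and> ?Q n h h'"
      by (rule exI[of "\<lambda>h'. ?P (Suc n) h' \<and> ?Q n h h'"])
  qed
  then obtain \<phi> where \<phi>': "\<forall>n. ?P n (\<phi> n) \<and> ?Q n (\<phi> n) (\<phi> (Suc n))" by (rule exE)
  have \<phi>: "?P n (\<phi> n)" "?Q n (\<phi> n) (\<phi> (Suc n))" for n
    using spec[OF \<phi>', of n] by (rule conjunct1, rule conjunct2)
  have "chain_lift R L M i f \<phi>"
    unfolding chain_lift_def
  proof (intro conjI allI ballI)
    show "\<phi> j \<in> mod_hom R (?L (i + j)) (?M j)" for j by (rule conjunct1[OF \<phi>(1)])
    show "std_aug R M (\<phi> 0 x) = f x" if "x \<in> carrier (?L i)" for x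
      using \<phi>(1)[of 0] aug that by simp
    show "std_diff R M j (\<phi> (Suc j) x) = \<phi> j (std_diff R L (i + j) x)" if "x \<in> carrier (?L (i + Suc j))" for j x
      using \<phi>(2)[of j] that by (simp del: std_mod.simps)
  qed
  moreover have "\<phi> 0 x = \<phi>0 x" if "x \<in> carrier (?L i)" for x using \<phi>(1)[of 0] that by simp
  ultimately show ?thesis by (rule that)
qed

section \<open>Ext groups as classes of cocycles\<close>

locale ext_setting =
  fixes R :: "('r, 'e) ring_scheme" and L :: "('r, 'l, 'f) module_scheme" and N :: "('r, 'n, 'h) module_scheme"
  assumes L: "left_module R L" and N: "left_module R N"
begin

sublocale N: left_module R N by (rule N)

lemma L_std: "left_module R (std_mod R L n)"
  by (rule std_mod_left_module[OF L])

abbreviation cochains where "cochains i \<equiv> hom_group R (std_mod R L i) N"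

lemma cochain_mult: "f \<otimes>\<^bsub>cochains i\<^esub> g = (\<lambda>x\<in>carrier (std_mod R L i). f x \<oplus>\<^bsub>N\<^esub> g x)"
  and cochain_one: "\<one>\<^bsub>cochains i\<^esub> = (\<lambda>x\<in>carrier (std_mod R L i). \<zero>\<^bsub>N\<^esub>)"
  by (simp_all add: hom_group_def)

lemma cocycle_add:
  assumes f: "f \<in> cocycles R L N i" and g: "g \<in> cocycles R L N i"
  shows "(\<lambda>x\<in>carrier (std_mod R L i). f x \<oplus>\<^bsub>N\<^esub> g x) \<in> cocycles R L N i"
  by (rule cocyclesI[OF L lin_map_add[OF N cocyclesD(1)[OF f] cocyclesD(1)[OF g]]])
     (use cocyclesD(3)[OF f] cocyclesD(3)[OF g] in simp)

lemma cocycle_zero: "(\<lambda>x\<in>carrier (std_mod R L i). \<zero>\<^bsub>N\<^esub>) \<in> cocycles R L N i"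
  by (rule cocyclesI[OF L lin_map_zero[OF N]]) simp

lemma cocycle_uminus:
  assumes f: "f \<in> cocycles R L N i"
  shows "(\<lambda>x\<in>carrier (std_mod R L i). \<ominus>\<^bsub>N\<^esub> f x) \<in> cocycles R L N i"
proof (rule cocyclesI[OF L lin_map_uminus[OF N cocyclesD(1)[OF f]]])
  fix x assume "x \<in> carrier (std_mod R L (Suc i))"
  then show "\<ominus>\<^bsub>N\<^esub> f (std_diff R L i x) = \<zero>\<^bsub>N\<^esub>"
    using cocyclesD(3)[OF f] N.M.minus_equality[of "\<zero>\<^bsub>N\<^esub>" "\<zero>\<^bsub>N\<^esub>"] by simp
qed

lemma cocycle_extensional: "f \<in> cocycles R L N i \<Longrightarrow> f \<in> extensional (carrier (std_mod R L i))"
  by (rule mod_homD(1)[OF cocyclesD(2)])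

lemma cocycle_closed: "f \<in> cocycles R L N i \<Longrightarrow> x \<in> carrier (std_mod R L i) \<Longrightarrow> f x \<in> carrier N"
  by (rule lin_mapD(1)[OF cocyclesD(1)])

lemma cocycle_eqI:
  assumes "f \<in> cocycles R L N i" "g \<in> cocycles R L N i" "\<And>x. x \<in> carrier (std_mod R L i) \<Longrightarrow> f x = g x"
  shows "f = g"
  by (rule extensionalityI[OF cocycle_extensional[OF assms(1)] cocycle_extensional[OF assms(2)] assms(3)])

text \<open>Cocycles are extensional, so the group laws hold as equalities of functions.
  Commutativity is what makes the coboundaries normal.\<close>

lemma cocycle_group: "comm_group (cochains i\<lparr>carrier := cocycles R L N i\<rparr>)"
proof (rule comm_groupI, goal_cases)
  case (1 f g) then show ?case using cocycle_add by (simp add: cochain_mult)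
next
  case 2 show ?case using cocycle_zero by (simp add: cochain_one)
next
  case (3 f g h)
  then show ?case using L_std[of i]
    by (auto simp: cochain_mult cocycle_closed N.M.a_assoc restrict_def fun_eq_iff)
next
  case (4 f g)
  then show ?case by (auto simp: cochain_mult cocycle_closed N.M.a_comm restrict_def fun_eq_iff)
next
  case (5 f)
  then show ?case using cocycle_extensional[of f i]
    by (auto simp: cochain_mult cochain_one cocycle_closed restrict_def fun_eq_iff extensional_def)
next
  case (6 f)
  then have f: "f \<in> cocycles R L N i" by simp
  show ?case
    by (rule bexI[of _ "\<lambda>x\<in>carrier (std_mod R L i). \<ominus>\<^bsub>N\<^esub> f x"])
       (use cocycle_uminus[OF f] cocycle_closed[OF f] in
         \<open>auto simp: cochain_mult cochain_one N.M.l_neg restrict_def fun_eq_iff\<close>)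
qed

lemma coboundary_SucI:
  assumes "lin_map R (std_mod R L i) N h"
  shows "(\<lambda>x\<in>carrier (std_mod R L (Suc i)). h (std_diff R L i x)) \<in> coboundaries R L N (Suc i)"
proof -
  have "(\<lambda>x\<in>carrier (std_mod R L (Suc i)). h (std_diff R L i x)) =
      compose (carrier (std_mod R L (Suc i))) (restrict h (carrier (std_mod R L i))) (std_diff R L i)"
    using lin_mapD(1)[OF std_diff_lin_map[OF L, of i]] by (auto simp: compose_def restrict_def fun_eq_iff)
  then show ?thesis using restrict_mod_hom[OF L_std assms] by (simp del: std_mod.simps)
qed

lemma coboundary_SucE:
  assumes "b \<in> coboundaries R L N (Suc i)"
  obtains h where "lin_map R (std_mod R L i) N h"
    "b = (\<lambda>x\<in>carrier (std_mod R L (Suc i)). h (std_diff R L i x))"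
proof -
  obtain h where h: "h \<in> mod_hom R (std_mod R L i) N"
    "b = compose (carrier (std_mod R L (Suc i))) h (std_diff R L i)"
    using assms by (auto simp del: std_mod.simps)
  show ?thesis by (rule that[OF mod_hom_lin_map[OF h(1)]]) (use h(2) in \<open>simp add: compose_def\<close>)
qed

lemma coboundaries_subset: "coboundaries R L N i \<subseteq> cocycles R L N i"
proof (cases i)
  case 0
  then show ?thesis using cocycle_zero[of 0] by (simp del: std_mod.simps)
next
  case (Suc j)
  have "b \<in> cocycles R L N (Suc j)" if b: "b \<in> coboundaries R L N (Suc j)" for b
  proof -
    obtain h where h: "lin_map R (std_mod R L j) N h"
      "b = (\<lambda>x\<in>carrier (std_mod R L (Suc j)). h (std_diff R L j x))" by (rule coboundary_SucE[OF b])
    show ?thesis unfolding h(2)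
      by (rule cocyclesI[OF L lin_map_comp[OF std_diff_lin_map[OF L] h(1)]])
         (use lin_map_0[OF L_std N h(1)] std_diff_diff[OF L] in simp)
  qed
  then show ?thesis unfolding Suc by (rule subsetI)
qed

lemma coboundaries_subgroup: "subgroup (coboundaries R L N i) (cochains i\<lparr>carrier := cocycles R L N i\<rparr>)"
proof -
  interpret G: comm_group "cochains i\<lparr>carrier := cocycles R L N i\<rparr>" by (rule cocycle_group)
  show ?thesis
  proof (cases i)
    case 0
    have "coboundaries R L N i = {\<one>\<^bsub>cochains i\<lparr>carrier := cocycles R L N i\<rparr>\<^esub>}"
      using 0 by (simp add: cochain_one del: std_mod.simps)
    then show ?thesis using G.triv_subgroup by simp
  next
    case (Suc j)
    show ?thesis
    proof (rule G.subgroupI)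
      show "coboundaries R L N i \<subseteq> carrier (cochains i\<lparr>carrier := cocycles R L N i\<rparr>)"
        using coboundaries_subset by simp
      show "coboundaries R L N i \<noteq> {}" using coboundary_SucI[OF lin_map_zero[OF N]] Suc by blast
    next
      fix b assume b: "b \<in> coboundaries R L N i"
      then obtain h where h: "lin_map R (std_mod R L j) N h"
        "b = (\<lambda>x\<in>carrier (std_mod R L (Suc j)). h (std_diff R L j x))"
        unfolding Suc by (rule coboundary_SucE)
      let ?m = "\<lambda>x\<in>carrier (std_mod R L (Suc j)). \<ominus>\<^bsub>N\<^esub> h (std_diff R L j x)"
      have hN: "h (std_diff R L j x) \<in> carrier N" if "x \<in> carrier (std_mod R L (Suc j))" for x
        using lin_mapD(1)[OF h(1) lin_mapD(1)[OF std_diff_lin_map[OF L] that]] .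
      have m: "?m \<in> coboundaries R L N i"
        unfolding Suc by (rule coboundary_SucI[OF lin_map_uminus[OF N h(1)]])
      have "?m \<otimes>\<^bsub>cochains i\<lparr>carrier := cocycles R L N i\<rparr>\<^esub> b = \<one>\<^bsub>cochains i\<lparr>carrier := cocycles R L N i\<rparr>\<^esub>"
        unfolding h(2) Suc using hN
        by (auto simp: cochain_mult cochain_one N.M.l_neg restrict_def fun_eq_iff simp del: std_mod.simps)
      then have "inv\<^bsub>cochains i\<lparr>carrier := cocycles R L N i\<rparr>\<^esub> b = ?m"
        using b m coboundaries_subset[of i] by (intro G.inv_equality) auto
      then show "inv\<^bsub>cochains i\<lparr>carrier := cocycles R L N i\<rparr>\<^esub> b \<in> coboundaries R L N i" using m by simp
    next
      fix b c assume b: "b \<in> coboundaries R L N i" and c: "c \<in> coboundaries R L N i"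
      obtain h where h: "lin_map R (std_mod R L j) N h"
        "b = (\<lambda>x\<in>carrier (std_mod R L (Suc j)). h (std_diff R L j x))"
        by (rule coboundary_SucE[OF b[unfolded Suc]])
      obtain k where k: "lin_map R (std_mod R L j) N k"
        "c = (\<lambda>x\<in>carrier (std_mod R L (Suc j)). k (std_diff R L j x))"
        by (rule coboundary_SucE[OF c[unfolded Suc]])
      have "b \<otimes>\<^bsub>cochains i\<lparr>carrier := cocycles R L N i\<rparr>\<^esub> c =
          (\<lambda>x\<in>carrier (std_mod R L (Suc j)). h (std_diff R L j x) \<oplus>\<^bsub>N\<^esub> k (std_diff R L j x))"
        unfolding h(2) k(2) Suc by (auto simp: cochain_mult restrict_def fun_eq_iff simp del: std_mod.simps)
      then show "b \<otimes>\<^bsub>cochains i\<lparr>carrier := cocycles R L N i\<rparr>\<^esub> c \<in> coboundaries R L N i"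
        using coboundary_SucI[OF lin_map_add[OF N h(1) k(1)]] Suc by simp
    qed
  qed
qed

lemma coboundaries_normal: "coboundaries R L N i \<lhd> cochains i\<lparr>carrier := cocycles R L N i\<rparr>"
  using comm_group.normal_iff_subgroup[OF cocycle_group] coboundaries_subgroup by blast

lemma Ext_group: "Group.group (Ext R L N i)"
  unfolding Ext_def by (rule normal.factorgroup_is_group[OF coboundaries_normal])

text \<open>\<open>Ext\<close> forms cosets in the group restricted to cocycles,
  \<open>ext_class\<close> in all cochains. A coset depends on the multiplication only, which is the
  same.\<close>

lemma ext_class_eq: "ext_class R L N i f = coboundaries R L N i #>\<^bsub>cochains i\<lparr>carrier := cocycles R L N i\<rparr>\<^esub> f"
  by (simp add: ext_class_def r_coset_def)

lemma ext_class_mult: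
  assumes "f \<in> cocycles R L N i" "g \<in> cocycles R L N i"
  shows "ext_class R L N i f \<otimes>\<^bsub>Ext R L N i\<^esub> ext_class R L N i g =
    ext_class R L N i (\<lambda>x\<in>carrier (std_mod R L i). f x \<oplus>\<^bsub>N\<^esub> g x)"
  using normal.rcos_sum[OF coboundaries_normal, of f i g] assms
  by (simp add: Ext_def ext_class_eq cochain_mult)

lemma carrier_Ext: "carrier (Ext R L N i) = ext_class R L N i ` cocycles R L N i"
  by (simp add: Ext_def carrier_FactGroup ext_class_eq[abs_def])

lemma one_Ext: "\<one>\<^bsub>Ext R L N i\<^esub> = coboundaries R L N i"
  by (simp add: Ext_def)

lemma ext_class_self: "f \<in> cocycles R L N i \<Longrightarrow> f \<in> ext_class R L N i f"
  unfolding ext_class_eq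
  using group.rcos_self[OF comm_group.axioms(2)[OF cocycle_group] _ coboundaries_subgroup] by simp

lemma ext_classE:
  assumes "f' \<in> ext_class R L N i f"
  obtains b where "b \<in> coboundaries R L N i" "f' = (\<lambda>x\<in>carrier (std_mod R L i). b x \<oplus>\<^bsub>N\<^esub> f x)"
  using assms by (auto simp: ext_class_def r_coset_def cochain_mult)

lemma ext_class_eqI:
  assumes "f \<in> cocycles R L N i" "b \<in> coboundaries R L N i"
    and eq: "f' = (\<lambda>x\<in>carrier (std_mod R L i). b x \<oplus>\<^bsub>N\<^esub> f x)"
  shows "ext_class R L N i f' = ext_class R L N i f"
proof -
  have "f' \<in> coboundaries R L N i #>\<^bsub>cochains i\<lparr>carrier := cocycles R L N i\<rparr>\<^esub> f"
    using assms(2) unfolding eq by (auto simp: r_coset_def cochain_mult)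
  then show ?thesis
    unfolding ext_class_eq
    using group.repr_independence[OF comm_group.axioms(2)[OF cocycle_group] _ _ coboundaries_subgroup] assms(1)
    by simp
qed

lemma ext_class_coboundary:
  assumes b: "b \<in> coboundaries R L N i" shows "ext_class R L N i b = \<one>\<^bsub>Ext R L N i\<^esub>"
  unfolding one_Ext ext_class_eq
  using group.coset_join2[OF comm_group.axioms(2)[OF cocycle_group] _ coboundaries_subgroup b]
    coboundaries_subset b by auto

lemma ext_class_subset: "f \<in> cocycles R L N i \<Longrightarrow> ext_class R L N i f \<subseteq> cocycles R L N i"
proof
  fix f' assume f: "f \<in> cocycles R L N i" and f': "f' \<in> ext_class R L N i f"
  obtain b where b: "b \<in> coboundaries R L N i" "f' = (\<lambda>x\<in>carrier (std_mod R L i). b x \<oplus>\<^bsub>N\<^esub> f x)"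
    by (rule ext_classE[OF f'])
  show "f' \<in> cocycles R L N i"
    unfolding b(2) by (rule cocycle_add[OF subsetD[OF coboundaries_subset b(1)] f])
qed


lemma Ext_carrierE:
  assumes "C \<in> carrier (Ext R L N i)"
  obtains c where "c \<in> cocycles R L N i" "C = ext_class R L N i c"
  using assms unfolding carrier_Ext by auto

lemma Ext_carrierI: "c \<in> cocycles R L N i \<Longrightarrow> ext_class R L N i c \<in> carrier (Ext R L N i)"
  unfolding carrier_Ext by (rule imageI)

lemma Ext_carrier_cocycle:
  assumes "C \<in> carrier (Ext R L N i)" "g \<in> C" shows "g \<in> cocycles R L N i"
proof -
  obtain c where c: "c \<in> cocycles R L N i" "C = ext_class R L N i c" by (rule Ext_carrierE[OF assms(1)])
  show ?thesis using ext_class_subset[OF c(1)] assms(2) unfolding c(2) by (rule subsetD)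
qed

end

section \<open>Yoneda products with classes of degree one\<close>

locale yoneda_setting = ext_setting R L N
  for R :: "('r, 'e) ring_scheme" and L :: "('r, 'l, 'f) module_scheme" and N :: "('r, 'n, 'h) module_scheme" +
  fixes M :: "('r, 'm, 'g) module_scheme"
  assumes M: "left_module R M"
begin

sublocale LM: ext_setting R L M by (rule ext_setting.intro[OF L M])
sublocale MN: ext_setting R M N by (rule ext_setting.intro[OF M N])

lemma M_std: "left_module R (std_mod R M n)"
  by (rule std_mod_left_module[OF M])

lemma chain_liftD:
  assumes "chain_lift R L M i f \<phi>"
  shows "lin_map R (std_mod R L i) (std_mod R M 0) (\<phi> 0)"
    "lin_map R (std_mod R L (Suc i)) (std_mod R M 1) (\<phi> 1)"
    "x \<in> carrier (std_mod R L i) \<Longrightarrow> std_aug R M (\<phi> 0 x) = f x"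
    "y \<in> carrier (std_mod R L (Suc i)) \<Longrightarrow> std_diff R M 0 (\<phi> 1 y) = \<phi> 0 (std_diff R L i y)"
proof -
  have h: "\<phi> j \<in> mod_hom R (std_mod R L (i + j)) (std_mod R M j)" for j
    using assms unfolding chain_lift_def by blast
  show "lin_map R (std_mod R L i) (std_mod R M 0) (\<phi> 0)"
    using mod_hom_lin_map[OF h[of 0]] by (simp del: std_mod.simps)
  show "lin_map R (std_mod R L (Suc i)) (std_mod R M 1) (\<phi> 1)"
    using mod_hom_lin_map[OF h[of 1]] by (simp del: std_mod.simps)
  have d: "\<forall>j. \<forall>x\<in>carrier (std_mod R L (i + Suc j)).
        std_diff R M j (\<phi> (Suc j) x) = \<phi> j (std_diff R L (i + j) x)"
    using assms unfolding chain_lift_def by blast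
  show "y \<in> carrier (std_mod R L (Suc i)) \<Longrightarrow> std_diff R M 0 (\<phi> 1 y) = \<phi> 0 (std_diff R L i y)"
    using spec[OF d, of 0] by (simp del: std_mod.simps)
  show "x \<in> carrier (std_mod R L i) \<Longrightarrow> std_aug R M (\<phi> 0 x) = f x"
    using assms unfolding chain_lift_def by blast
qed

lemma product_cocycle:
  assumes g: "g \<in> cocycles R M N 1" and \<phi>: "chain_lift R L M i f \<phi>"
  shows "(\<lambda>y\<in>carrier (std_mod R L (Suc i)). g (\<phi> 1 y)) \<in> cocycles R L N (Suc i)"
proof (rule cocyclesI[OF L lin_map_comp[OF chain_liftD(2)[OF \<phi>] cocyclesD(1)[OF g]]])
  fix x assume x: "x \<in> carrier (std_mod R L (Suc (Suc i)))"
  have h: "lin_map R (std_mod R L (Suc (Suc i))) (std_mod R M 2) (\<phi> 2)"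
    using \<phi> mod_hom_lin_map[of "\<phi> 2"] unfolding chain_lift_def by (metis add_2_eq_Suc')
  have d: "\<forall>j. \<forall>x\<in>carrier (std_mod R L (i + Suc j)).
        std_diff R M j (\<phi> (Suc j) x) = \<phi> j (std_diff R L (i + j) x)"
    using \<phi> unfolding chain_lift_def by blast
  have "std_diff R M 1 (\<phi> 2 x) = \<phi> 1 (std_diff R L (Suc i) x)"
    using spec[OF d, of 1] x by (simp add: numeral_2_eq_2 del: std_mod.simps)
  then show "g (\<phi> 1 (std_diff R L (Suc i) x)) = \<zero>\<^bsub>N\<^esub>"
    using cocyclesD(3)[OF g, of "\<phi> 2 x"] lin_mapD(1)[OF h x] by (simp add: numeral_2_eq_2 del: std_mod.simps)
qed

lemma cocycle_lift:
  assumes f: "f \<in> cocycles R L M i"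
  obtains \<phi>0 where "lin_map R (std_mod R L i) (std_mod R M 0) \<phi>0"
    "\<And>x. x \<in> carrier (std_mod R L i) \<Longrightarrow> std_aug R M (\<phi>0 x) = f x"
proof (rule projective_lift[OF std_mod_projective[OF L] M_std M std_aug_lin_map(1)[OF M] cocyclesD(1)[OF f]])
  show "f ` carrier (std_mod R L i) \<subseteq> std_aug R M ` carrier (std_mod R M 0)"
    unfolding std_aug_lin_map(2)[OF M] using LM.cocycle_closed[OF f] by (rule image_subsetI)
qed (rule that)

text \<open>\<open>yoneda\<close> chooses representatives and a lift by \<open>SOME\<close>. Since
  choices exist, the value has the described form, but with representatives over which there is no
  control; \<open>yoneda_eq_ext_class\<close> removes the dependence on them.\<close>

lemma yonedaE:
  assumes G: "G \<in> carrier (Ext R M N 1)" and F: "F \<in> carrier (Ext R L M i)"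
  obtains g f \<phi> where "g \<in> G" "f \<in> F" "chain_lift R L M i f \<phi>"
    "yoneda R L M N 1 i G F = ext_class R L N (Suc i) (\<lambda>y\<in>carrier (std_mod R L (Suc i)). g (\<phi> 1 y))"
proof -
  let ?P = "\<lambda>C. \<exists>g\<in>G. \<exists>f\<in>F. \<exists>\<phi>. chain_lift R L M i f \<phi> \<and>
     C = ext_class R L N (Suc i) (\<lambda>y\<in>carrier (std_mod R L (Suc i)). g (\<phi> 1 y))"
  obtain g0 where g0: "g0 \<in> cocycles R M N 1" "G = ext_class R M N 1 g0" by (rule MN.Ext_carrierE[OF G])
  obtain f0 where f0: "f0 \<in> cocycles R L M i" "F = ext_class R L M i f0" by (rule LM.Ext_carrierE[OF F])
  obtain \<phi>0 where \<phi>0: "lin_map R (std_mod R L i) (std_mod R M 0) \<phi>0"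
    "\<And>x. x \<in> carrier (std_mod R L i) \<Longrightarrow> std_aug R M (\<phi>0 x) = f0 x" by (rule cocycle_lift[OF f0(1)]) blast
  obtain \<phi> where \<phi>: "chain_lift R L M i f0 \<phi>" by (rule chain_lift_exists[OF L M f0(1) \<phi>0]) blast+
  have g0G: "g0 \<in> G" and f0F: "f0 \<in> F"
    unfolding g0(2) f0(2) by (rule MN.ext_class_self[OF g0(1)], rule LM.ext_class_self[OF f0(1)])
  have "?P (ext_class R L N (Suc i) (\<lambda>y\<in>carrier (std_mod R L (Suc i)). g0 (\<phi> 1 y)))"
    by (intro bexI[OF _ g0G] bexI[OF _ f0F] exI[of _ \<phi>] conjI \<phi> refl)
  then have "\<exists>C. ?P C" by (rule exI[of ?P])
  from someI_ex[OF this] have "?P (SOME C. ?P C)" .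
  moreover have "yoneda R L M N 1 i G F = (SOME C. ?P C)" unfolding yoneda_def compose_def by simp
  ultimately have "?P (yoneda R L M N 1 i G F)" by (simp only:)
  then show ?thesis by (elim bexE exE conjE) (rule that)
qed

lemma yoneda_closed:
  assumes G: "G \<in> carrier (Ext R M N 1)" and F: "F \<in> carrier (Ext R L M i)"
  shows "yoneda R L M N 1 i G F \<in> carrier (Ext R L N (Suc i))"
proof -
  obtain g f \<phi> where *: "g \<in> G" "f \<in> F" "chain_lift R L M i f \<phi>"
    "yoneda R L M N 1 i G F = ext_class R L N (Suc i) (\<lambda>y\<in>carrier (std_mod R L (Suc i)). g (\<phi> 1 y))"
    by (rule yonedaE[OF G F])
  show ?thesis unfolding *(4)
    by (rule Ext_carrierI[OF product_cocycle[OF MN.Ext_carrier_cocycle[OF G *(1)] *(3)]])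
qed

lemma ext_prod_subset: "ext_prod R L M N 1 i \<subseteq> carrier (Ext R L N (Suc i))"
proof -
  have "generate (Ext R L N (Suc i))
      {yoneda R L M N 1 i G F |G F. G \<in> carrier (Ext R M N 1) \<and> F \<in> carrier (Ext R L M i)} \<subseteq>
      carrier (Ext R L N (Suc i))"
    by (rule group.generate_incl[OF Ext_group]) (use yoneda_closed in blast)
  then show ?thesis by (simp add: ext_prod_def)
qed

text \<open>Above degree 0 a coboundary has the form \<open>h \<circ> d\<close>. Lifting
  \<open>h\<close> and composing with \<open>d\<close> gives a lift that vanishes on boundaries
  because \<open>d \<circ> d = 0\<close>; it corrects a lift of one representative into a lift of
  another without changing the values on boundaries.\<close>

lemma coboundary_lift:
  assumes b: "b \<in> coboundaries R L M i"
  obtains u where "lin_map R (std_mod R L i) (std_mod R M 0) u"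
    "\<And>x. x \<in> carrier (std_mod R L i) \<Longrightarrow> std_aug R M (u x) = b x"
    "\<And>y. y \<in> carrier (std_mod R L (Suc i)) \<Longrightarrow> u (std_diff R L i y) = \<zero>\<^bsub>std_mod R M 0\<^esub>"
proof (cases i)
  case 0
  have "b = (\<lambda>x\<in>carrier (std_mod R L 0). \<zero>\<^bsub>M\<^esub>)" using b 0 by (simp del: std_mod.simps)
  then show ?thesis
    using that[of "\<lambda>x. \<zero>\<^bsub>std_mod R M 0\<^esub>"] lin_map_zero[OF M_std, of "std_mod R L 0" 0] lin_map_0[OF M_std M std_aug_lin_map(1)[OF M]] 0
    by (simp del: std_mod.simps free_module_simps)
next
  case (Suc j)
  obtain h where h: "lin_map R (std_mod R L j) M h"
    "b = (\<lambda>x\<in>carrier (std_mod R L (Suc j)). h (std_diff R L j x))"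
    by (rule LM.coboundary_SucE[OF b[unfolded Suc]])
  obtain k where k: "lin_map R (std_mod R L j) (std_mod R M 0) k"
    "\<And>x. x \<in> carrier (std_mod R L j) \<Longrightarrow> std_aug R M (k x) = h x"
  proof (rule projective_lift[OF std_mod_projective[OF L] M_std M std_aug_lin_map(1)[OF M] h(1)])
    show "h ` carrier (std_mod R L j) \<subseteq> std_aug R M ` carrier (std_mod R M 0)"
      unfolding std_aug_lin_map(2)[OF M] using lin_mapD(1)[OF h(1)] by (rule image_subsetI)
  qed blast
  show ?thesis
  proof (rule that[of "\<lambda>x. k (std_diff R L j x)"], unfold Suc)
    show "lin_map R (std_mod R L (Suc j)) (std_mod R M 0) (\<lambda>x. k (std_diff R L j x))"
      by (rule lin_map_comp[OF std_diff_lin_map[OF L] k(1)])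
    show "std_aug R M (k (std_diff R L j x)) = b x" if "x \<in> carrier (std_mod R L (Suc j))" for x
      using k(2)[OF lin_mapD(1)[OF std_diff_lin_map[OF L] that]] that h(2) by simp
    show "k (std_diff R L j (std_diff R L (Suc j) y)) = \<zero>\<^bsub>std_mod R M 0\<^esub>"
      if "y \<in> carrier (std_mod R L (Suc (Suc j)))" for y
      unfolding std_diff_diff[OF L that] by (rule lin_map_0[OF L_std M_std k(1)])
  qed
qed

text \<open>The kernel of the differential consists of boundaries, where \<open>g\<close> vanishes.
  A product can therefore be evaluated from the bottom component of a lift alone.\<close>

lemma cocycle_factor:
  assumes g: "g \<in> cocycles R M N 1"
  obtains h where "lin_map R (std_mod R M 0\<lparr>carrier := std_syz R M 0\<rparr>) N h"
    "\<And>z. z \<in> carrier (std_mod R M 1) \<Longrightarrow> h (std_diff R M 0 z) = g z"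
proof -
  have d: "lin_map R (std_mod R M 1) (std_mod R M 0) (std_diff R M 0)"
    using std_diff_lin_map[OF M, of 0] by (simp del: std_mod.simps)
  have im: "std_diff R M 0 ` carrier (std_mod R M 1) = std_syz R M 0"
    using std_diff_image[OF M, of 0] by (simp del: std_mod.simps)
  have ker: "g z = \<zero>\<^bsub>N\<^esub>" if z: "z \<in> carrier (std_mod R M 1)" "std_diff R M 0 z = \<zero>\<^bsub>std_mod R M 0\<^esub>" for z
  proof -
    have "z \<in> std_syz R M (Suc 0)" unfolding std_syz_Suc[OF M] using z by (simp del: std_mod.simps)
    then obtain w where "w \<in> carrier (std_mod R M (Suc (Suc 0)))" "z = std_diff R M (Suc 0) w"
      unfolding std_diff_image[OF M, symmetric] by (elim imageE)
    then show ?thesis using cocyclesD(3)[OF g] by (simp del: std_mod.simps)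
  qed
  show ?thesis
    by (rule factor_surjective[OF M_std M_std N d im cocyclesD(1)[OF g] ker]) (auto intro: that)
qed

text \<open>Independence of all choices at once, in a form that mentions only a lift in degree 0:
  \<open>z\<close> is any element over \<open>\<phi>0 (d y)\<close>. The chosen product and
  \<open>c\<close> differ by a map on \<open>std_mod R L i\<close> composed with the differential,
  hence by a coboundary.\<close>

lemma yoneda_eq_ext_class:
  assumes f: "f \<in> cocycles R L M i" and g: "g \<in> cocycles R M N 1" and c: "c \<in> cocycles R L N (Suc i)"
    and \<phi>0: "lin_map R (std_mod R L i) (std_mod R M 0) \<phi>0"
    and aug: "\<And>x. x \<in> carrier (std_mod R L i) \<Longrightarrow> std_aug R M (\<phi>0 x) = f x"
    and eq: "\<And>y z. y \<in> carrier (std_mod R L (Suc i)) \<Longrightarrow> z \<in> carrier (std_mod R M 1) \<Longrightarrow>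
      std_diff R M 0 z = \<phi>0 (std_diff R L i y) \<Longrightarrow> c y = g z"
  shows "yoneda R L M N 1 i (ext_class R M N 1 g) (ext_class R L M i f) = ext_class R L N (Suc i) c"
proof -
  note LS = L_std[of i] and Y0 = M_std[of 0]
  interpret Y0: left_module R "std_mod R M 0" by (rule Y0)
  obtain g' f' \<phi> where *: "g' \<in> ext_class R M N 1 g" "f' \<in> ext_class R L M i f" "chain_lift R L M i f' \<phi>"
    "yoneda R L M N 1 i (ext_class R M N 1 g) (ext_class R L M i f) =
      ext_class R L N (Suc i) (\<lambda>y\<in>carrier (std_mod R L (Suc i)). g' (\<phi> 1 y))"
    by (rule yonedaE[OF MN.Ext_carrierI[OF g] LM.Ext_carrierI[OF f]])
  note \<phi>D = chain_liftD[OF *(3)]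
  obtain a where a: "a \<in> coboundaries R M N 1" "g' = (\<lambda>x\<in>carrier (std_mod R M 1). a x \<oplus>\<^bsub>N\<^esub> g x)"
    by (rule MN.ext_classE[OF *(1)])
  obtain b where b: "b \<in> coboundaries R L M i" "f' = (\<lambda>x\<in>carrier (std_mod R L i). b x \<oplus>\<^bsub>M\<^esub> f x)"
    by (rule LM.ext_classE[OF *(2)])
  obtain p where p: "lin_map R (std_mod R M 0) N p"
    "a = (\<lambda>x\<in>carrier (std_mod R M (Suc 0)). p (std_diff R M 0 x))"
    by (rule MN.coboundary_SucE[of a 0]) (use a(1) in simp)
  obtain u where u: "lin_map R (std_mod R L i) (std_mod R M 0) u"
    "\<And>x. x \<in> carrier (std_mod R L i) \<Longrightarrow> std_aug R M (u x) = b x"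
    "\<And>y. y \<in> carrier (std_mod R L (Suc i)) \<Longrightarrow> u (std_diff R L i y) = \<zero>\<^bsub>std_mod R M 0\<^esub>"
    by (rule coboundary_lift[OF b(1)]) blast
  obtain h where h: "lin_map R (std_mod R M 0\<lparr>carrier := std_syz R M 0\<rparr>) N h"
    "\<And>z. z \<in> carrier (std_mod R M 1) \<Longrightarrow> h (std_diff R M 0 z) = g z"
    by (rule cocycle_factor[OF g]) blast
  \<comment> \<open>The chosen lift, corrected by \<open>u\<close> so as to lie over
    \<open>f\<close>, differs from \<open>\<phi>0\<close> by values in the first syzygy of
    \<open>M\<close>. Thus \<open>h \<circ> ?w\<close> is defined on all of
    \<open>std_mod R L i\<close>.\<close>
  let ?w = "\<lambda>x. (\<phi> 0 x \<ominus>\<^bsub>std_mod R M 0\<^esub> u x) \<ominus>\<^bsub>std_mod R M 0\<^esub> \<phi>0 x"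
  have w: "lin_map R (std_mod R L i) (std_mod R M 0) ?w"
    by (rule lin_map_diff[OF Y0 lin_map_diff[OF Y0 \<phi>D(1) u(1)] \<phi>0])
  note augl = std_aug_lin_map(1)[OF M]
  have w_syz: "?w x \<in> std_syz R M 0" if x: "x \<in> carrier (std_mod R L i)" for x
  proof -
    have cl: "\<phi> 0 x \<in> carrier (std_mod R M 0)" "u x \<in> carrier (std_mod R M 0)" "\<phi>0 x \<in> carrier (std_mod R M 0)"
      using x lin_mapD(1)[OF \<phi>D(1)] lin_mapD(1)[OF u(1)] lin_mapD(1)[OF \<phi>0] by auto
    have m: "b x \<in> carrier M" "f x \<in> carrier M"
      using LM.cocycle_closed[OF f x] LM.cocycle_closed[OF subsetD[OF LM.coboundaries_subset b(1)] x] by auto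
    have "std_aug R M (?w x) = (std_aug R M (\<phi> 0 x) \<ominus>\<^bsub>M\<^esub> std_aug R M (u x)) \<ominus>\<^bsub>M\<^esub> std_aug R M (\<phi>0 x)"
      using cl by (simp add: lin_map_minus[OF Y0 M augl] del: std_mod.simps)
    also have "\<dots> = ((b x \<oplus>\<^bsub>M\<^esub> f x) \<ominus>\<^bsub>M\<^esub> b x) \<ominus>\<^bsub>M\<^esub> f x"
      using \<phi>D(3)[OF x] u(2)[OF x] aug[OF x] x b(2) by simp
    also have "\<dots> = \<zero>\<^bsub>M\<^esub>" using m by (simp add: LM.N.M.add_minus_cancel LM.N.M.minus_eq_zero_iff)
    finally show ?thesis unfolding std_aug_lin_map(4)[OF M] using lin_mapD(1)[OF w x] by blast
  qed
  \<comment> \<open>Two contributions to the coboundary: \<open>p\<close> comes from the change of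
    the representative of \<open>g\<close>, and \<open>h \<circ> ?w\<close> from the change of the
    lift.\<close>
  let ?e = "\<lambda>x. p (\<phi> 0 x) \<oplus>\<^bsub>N\<^esub> h (?w x)"
  have hw: "lin_map R (std_mod R L i) N (\<lambda>x. h (?w x))"
    by (rule lin_map_comp[OF _ h(1)]) (use w w_syz in \<open>simp add: lin_map_def\<close>)
  have e: "lin_map R (std_mod R L i) N ?e" by (rule lin_map_add[OF N lin_map_comp[OF \<phi>D(1) p(1)] hw])
  have "g' (\<phi> 1 y) = ?e (std_diff R L i y) \<oplus>\<^bsub>N\<^esub> c y" if y: "y \<in> carrier (std_mod R L (Suc i))" for y
  proof -
    let ?y = "std_diff R L i y"
    have yL: "?y \<in> carrier (std_mod R L i)" by (rule lin_mapD(1)[OF std_diff_lin_map[OF L] y])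
    have \<phi>y: "\<phi> 1 y \<in> carrier (std_mod R M 1)" by (rule lin_mapD(1)[OF \<phi>D(2) y])
    have cl: "\<phi> 0 ?y \<in> carrier (std_mod R M 0)" "\<phi>0 ?y \<in> carrier (std_mod R M 0)"
      using yL lin_mapD(1)[OF \<phi>D(1)] lin_mapD(1)[OF \<phi>0] by auto
    have "std_aug R M (\<phi>0 ?y) = \<zero>\<^bsub>M\<^esub>" using aug[OF yL] cocyclesD(3)[OF f y] by simp
    then have \<phi>0y: "\<phi>0 ?y \<in> std_syz R M 0" unfolding std_aug_lin_map(4)[OF M] using cl by blast
    then obtain z where z: "z \<in> carrier (std_mod R M 1)" "\<phi>0 ?y = std_diff R M 0 z"
      using std_diff_image[OF M, of 0] by (auto simp del: std_mod.simps std_syz.simps)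
    have wy: "?w ?y \<in> std_syz R M 0" by (rule w_syz[OF yL])
    have "?w ?y = \<phi> 0 ?y \<ominus>\<^bsub>std_mod R M 0\<^esub> \<phi>0 ?y"
      unfolding u(3)[OF y] using cl by (simp only: Y0.M.minus_zero_right)
    then have split: "\<phi> 0 ?y = \<phi>0 ?y \<oplus>\<^bsub>std_mod R M 0\<^esub> ?w ?y"
      using Y0.M.add_minus_cancel_right[OF cl(2,1)] by simp
    have "g (\<phi> 1 y) = h (\<phi> 0 ?y)" using h(2)[OF \<phi>y] \<phi>D(4)[OF y] by simp
    also have "\<dots> = h (\<phi>0 ?y) \<oplus>\<^bsub>N\<^esub> h (?w ?y)"
      using lin_mapD(2)[OF h(1), of "\<phi>0 ?y" "?w ?y"] \<phi>0y wy split by (simp del: std_mod.simps std_syz.simps)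
    also have "h (\<phi>0 ?y) = c y" using h(2)[OF z(1)] eq[OF y z(1)] z(2) by simp
    finally have g: "g (\<phi> 1 y) = c y \<oplus>\<^bsub>N\<^esub> h (?w ?y)" .
    have a': "a (\<phi> 1 y) = p (\<phi> 0 ?y)" using p(2) \<phi>y \<phi>D(4)[OF y] by (simp del: std_mod.simps)
    have cN: "p (\<phi> 0 ?y) \<in> carrier N" "c y \<in> carrier N" "h (?w ?y) \<in> carrier N"
      using lin_mapD(1)[OF p(1) cl(1)] cocycle_closed[OF c y] lin_mapD(1)[OF hw yL] by auto
    have "g' (\<phi> 1 y) = p (\<phi> 0 ?y) \<oplus>\<^bsub>N\<^esub> (c y \<oplus>\<^bsub>N\<^esub> h (?w ?y))"
      using a(2) \<phi>y a' g by simp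
    also have "\<dots> = ?e ?y \<oplus>\<^bsub>N\<^esub> c y" using cN by (simp add: N.M.a_assoc N.M.a_comm[of "c y"])
    finally show ?thesis .
  qed
  then have "(\<lambda>y\<in>carrier (std_mod R L (Suc i)). g' (\<phi> 1 y)) =
      (\<lambda>y\<in>carrier (std_mod R L (Suc i)). (\<lambda>y\<in>carrier (std_mod R L (Suc i)). ?e (std_diff R L i y)) y \<oplus>\<^bsub>N\<^esub> c y)"
    by (auto simp: restrict_def fun_eq_iff simp del: std_mod.simps)
  from ext_class_eqI[OF c coboundary_SucI[OF e] this] show ?thesis using *(4) by simp
qed

text \<open>Evaluation at \<open>y\<close> is constant on classes because coboundaries vanish there.
  The classes vanishing at \<open>y\<close> form a subgroup, which contains all products by
  \<open>prod\<close> and hence is everything by \<open>gen\<close>.\<close>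

lemma vanishing_of_products:
  assumes gen: "ext_prod R L M N 1 i = carrier (Ext R L N (Suc i))"
    and y: "y \<in> carrier (std_mod R L (Suc i))"
    and cob: "\<And>u. lin_map R (std_mod R L i) N u \<Longrightarrow> u (std_diff R L i y) = \<zero>\<^bsub>N\<^esub>"
    and prod: "\<And>f g \<phi>0 z. f \<in> cocycles R L M i \<Longrightarrow> g \<in> cocycles R M N 1 \<Longrightarrow>
      lin_map R (std_mod R L i) (std_mod R M 0) \<phi>0 \<Longrightarrow>
      (\<And>x. x \<in> carrier (std_mod R L i) \<Longrightarrow> std_aug R M (\<phi>0 x) = f x) \<Longrightarrow>
      z \<in> carrier (std_mod R M 1) \<Longrightarrow> std_diff R M 0 z = \<phi>0 (std_diff R L i y) \<Longrightarrow> g z = \<zero>\<^bsub>N\<^esub>"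
    and c: "c \<in> cocycles R L N (Suc i)"
  shows "c y = \<zero>\<^bsub>N\<^esub>"
proof -
  interpret E: group "Ext R L N (Suc i)" by (rule Ext_group)
  have class_value: "f' y = f y" if f: "f \<in> cocycles R L N (Suc i)" and f': "f' \<in> ext_class R L N (Suc i) f" for f f'
  proof -
    obtain b where b: "b \<in> coboundaries R L N (Suc i)" "f' = (\<lambda>x\<in>carrier (std_mod R L (Suc i)). b x \<oplus>\<^bsub>N\<^esub> f x)"
      by (rule ext_classE[OF f'])
    obtain h where h: "lin_map R (std_mod R L i) N h"
      "b = (\<lambda>x\<in>carrier (std_mod R L (Suc i)). h (std_diff R L i x))" by (rule coboundary_SucE[OF b(1)])
    show ?thesis using b(2) h(2) cob[OF h(1)] y cocycle_closed[OF f y] by simp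
  qed
  let ?S = "ext_class R L N (Suc i) ` {f \<in> cocycles R L N (Suc i). f y = \<zero>\<^bsub>N\<^esub>}"
  have one: "\<one>\<^bsub>Ext R L N (Suc i)\<^esub> = ext_class R L N (Suc i) (\<lambda>x\<in>carrier (std_mod R L (Suc i)). \<zero>\<^bsub>N\<^esub>)"
    using ext_class_coboundary[OF subgroup.one_closed[OF coboundaries_subgroup[of "Suc i"]]]
    by (simp add: cochain_one del: std_mod.simps)
  have "subgroup ?S (Ext R L N (Suc i))"
  proof (rule E.subgroupI)
    show "?S \<subseteq> carrier (Ext R L N (Suc i))" using Ext_carrierI by auto
    have "(\<lambda>x\<in>carrier (std_mod R L (Suc i)). \<zero>\<^bsub>N\<^esub>) \<in> {f \<in> cocycles R L N (Suc i). f y = \<zero>\<^bsub>N\<^esub>}"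
      using cocycle_zero[of "Suc i"] y by simp
    then show "?S \<noteq> {}" by blast
  next
    fix C assume "C \<in> ?S"
    then obtain f where f: "f \<in> cocycles R L N (Suc i)" "f y = \<zero>\<^bsub>N\<^esub>" "C = ext_class R L N (Suc i) f" by blast
    let ?m = "\<lambda>x\<in>carrier (std_mod R L (Suc i)). \<ominus>\<^bsub>N\<^esub> f x"
    have m: "?m \<in> cocycles R L N (Suc i)" by (rule cocycle_uminus[OF f(1)])
    have "(\<lambda>x\<in>carrier (std_mod R L (Suc i)). ?m x \<oplus>\<^bsub>N\<^esub> f x) = (\<lambda>x\<in>carrier (std_mod R L (Suc i)). \<zero>\<^bsub>N\<^esub>)"
      using cocycle_closed[OF f(1)] by (auto simp: restrict_def fun_eq_iff N.M.l_neg simp del: std_mod.simps)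
    then have "ext_class R L N (Suc i) ?m \<otimes>\<^bsub>Ext R L N (Suc i)\<^esub> C = \<one>\<^bsub>Ext R L N (Suc i)\<^esub>"
      unfolding f(3) ext_class_mult[OF m f(1)] one by simp
    then have "inv\<^bsub>Ext R L N (Suc i)\<^esub> C = ext_class R L N (Suc i) ?m"
      using Ext_carrierI[OF m] Ext_carrierI[OF f(1)] f(3) by (intro E.inv_equality) auto
    moreover have "?m y = \<zero>\<^bsub>N\<^esub>" using f(2) y N.M.minus_equality[of "\<zero>\<^bsub>N\<^esub>" "\<zero>\<^bsub>N\<^esub>"] by simp
    ultimately show "inv\<^bsub>Ext R L N (Suc i)\<^esub> C \<in> ?S" using m by blast
  next
    fix C C' assume "C \<in> ?S" "C' \<in> ?S"
    then obtain f f' where f: "f \<in> cocycles R L N (Suc i)" "f y = \<zero>\<^bsub>N\<^esub>" "C = ext_class R L N (Suc i) f"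
      and f': "f' \<in> cocycles R L N (Suc i)" "f' y = \<zero>\<^bsub>N\<^esub>" "C' = ext_class R L N (Suc i) f'" by blast
    show "C \<otimes>\<^bsub>Ext R L N (Suc i)\<^esub> C' \<in> ?S"
      unfolding f(3) f'(3) ext_class_mult[OF f(1) f'(1)]
    proof (rule imageI, rule CollectI, rule conjI)
      show "(\<lambda>x\<in>carrier (std_mod R L (Suc i)). f x \<oplus>\<^bsub>N\<^esub> f' x) \<in> cocycles R L N (Suc i)"
        by (rule cocycle_add[OF f(1) f'(1)])
      show "(\<lambda>x\<in>carrier (std_mod R L (Suc i)). f x \<oplus>\<^bsub>N\<^esub> f' x) y = \<zero>\<^bsub>N\<^esub>" using f(2) f'(2) y by simp
    qed
  qed
  moreover have "yoneda R L M N 1 i G F \<in> ?S" if G: "G \<in> carrier (Ext R M N 1)" and F: "F \<in> carrier (Ext R L M i)" for G F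
  proof -
    obtain g f \<phi> where *: "g \<in> G" "f \<in> F" "chain_lift R L M i f \<phi>"
      "yoneda R L M N 1 i G F = ext_class R L N (Suc i) (\<lambda>y\<in>carrier (std_mod R L (Suc i)). g (\<phi> 1 y))"
      by (rule yonedaE[OF G F])
    note g = MN.Ext_carrier_cocycle[OF G *(1)] and f = LM.Ext_carrier_cocycle[OF F *(2)]
    note \<phi>D = chain_liftD[OF *(3)]
    have "g (\<phi> 1 y) = \<zero>\<^bsub>N\<^esub>"
      by (rule prod[OF f g \<phi>D(1,3) lin_mapD(1)[OF \<phi>D(2) y] \<phi>D(4)[OF y]])
    then show ?thesis unfolding *(4) using product_cocycle[OF g *(3)] y by simp
  qed
  ultimately have "generate (Ext R L N (Suc i))
      {yoneda R L M N 1 i G F |G F. G \<in> carrier (Ext R M N 1) \<and> F \<in> carrier (Ext R L M i)} \<subseteq> ?S"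
    by (intro E.generate_subgroup_incl) auto
  then have "ext_prod R L M N 1 i \<subseteq> ?S" by (simp add: ext_prod_def)
  then have "ext_class R L N (Suc i) c \<in> ?S" unfolding gen using Ext_carrierI[OF c] by (rule subsetD)
  then obtain f where f: "f \<in> cocycles R L N (Suc i)" "f y = \<zero>\<^bsub>N\<^esub>"
    "ext_class R L N (Suc i) c = ext_class R L N (Suc i) f" by blast
  then show ?thesis using class_value[OF f(1), of c] ext_class_self[OF c] by simp
qed

text \<open>The cocycle is a finite sum of products plus the coboundary \<open>e \<circ> d\<close>.
  Quantifying over all \<open>z t\<close> that lie over \<open>\<phi>0 t (d y)\<close> keeps the
  hypothesis free of chain lifts in degree one.\<close>

lemma ext_class_in_ext_prod:
  assumes c: "c \<in> cocycles R L N (Suc i)" and T: "finite T"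
    and f: "\<And>t. t \<in> T \<Longrightarrow> f t \<in> cocycles R L M i" and g: "\<And>t. t \<in> T \<Longrightarrow> g t \<in> cocycles R M N 1"
    and \<phi>0: "\<And>t. t \<in> T \<Longrightarrow> lin_map R (std_mod R L i) (std_mod R M 0) (\<phi>0 t)"
    and aug: "\<And>t x. t \<in> T \<Longrightarrow> x \<in> carrier (std_mod R L i) \<Longrightarrow> std_aug R M (\<phi>0 t x) = f t x"
    and e: "lin_map R (std_mod R L i) N e"
    and eq: "\<And>y z. y \<in> carrier (std_mod R L (Suc i)) \<Longrightarrow> (\<And>t. t \<in> T \<Longrightarrow> z t \<in> carrier (std_mod R M 1)) \<Longrightarrow>
      (\<And>t. t \<in> T \<Longrightarrow> std_diff R M 0 (z t) = \<phi>0 t (std_diff R L i y)) \<Longrightarrow>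
      c y = e (std_diff R L i y) \<oplus>\<^bsub>N\<^esub> (\<Oplus>\<^bsub>N\<^esub> t\<in>T. g t (z t))"
  shows "ext_class R L N (Suc i) c \<in> ext_prod R L M N 1 i"
proof -
  have "\<exists>\<phi>. chain_lift R L M i (f t) \<phi> \<and> (\<forall>x\<in>carrier (std_mod R L i). \<phi> 0 x = \<phi>0 t x)" if t: "t \<in> T" for t
    by (rule chain_lift_exists[OF L M f[OF t] \<phi>0[OF t] aug[OF t]]) (use t in blast)+
  then have "\<forall>t\<in>T. \<exists>\<phi>. chain_lift R L M i (f t) \<phi> \<and> (\<forall>x\<in>carrier (std_mod R L i). \<phi> 0 x = \<phi>0 t x)" by blast
  from bchoice[OF this] obtain \<phi> where \<phi>': "\<forall>t\<in>T. chain_lift R L M i (f t) (\<phi> t) \<and>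
      (\<forall>x\<in>carrier (std_mod R L i). \<phi> t 0 x = \<phi>0 t x)" by (rule exE)
  have \<phi>: "chain_lift R L M i (f t) (\<phi> t)" "x \<in> carrier (std_mod R L i) \<Longrightarrow> \<phi> t 0 x = \<phi>0 t x"
    if "t \<in> T" for t x using bspec[OF \<phi>' that] by blast+
  let ?c = "\<lambda>t. \<lambda>y\<in>carrier (std_mod R L (Suc i)). g t (\<phi> t 1 y)"
  have c_cocycle: "?c t \<in> cocycles R L N (Suc i)" if "t \<in> T" for t
    by (rule product_cocycle[OF g[OF that] \<phi>(1)[OF that]])
  have incl: "ext_class R L N (Suc i) (?c t) \<in> ext_prod R L M N 1 i" if t: "t \<in> T" for t
  proof -
    obtain h where h: "lin_map R (std_mod R M 0\<lparr>carrier := std_syz R M 0\<rparr>) N h"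
      "\<And>z. z \<in> carrier (std_mod R M 1) \<Longrightarrow> h (std_diff R M 0 z) = g t z" by (rule cocycle_factor[OF g[OF t]]) blast
    note \<phi>D = chain_liftD[OF \<phi>(1)[OF t]]
    have "yoneda R L M N 1 i (ext_class R M N 1 (g t)) (ext_class R L M i (f t)) = ext_class R L N (Suc i) (?c t)"
    proof (rule yoneda_eq_ext_class[OF f[OF t] g[OF t] c_cocycle[OF t] \<phi>0[OF t] aug[OF t]])
      fix y z assume y: "y \<in> carrier (std_mod R L (Suc i))" and z: "z \<in> carrier (std_mod R M 1)"
        "std_diff R M 0 z = \<phi>0 t (std_diff R L i y)"
      have "g t (\<phi> t 1 y) = h (\<phi> t 0 (std_diff R L i y))"
        using h(2)[OF lin_mapD(1)[OF \<phi>D(2) y]] \<phi>D(4)[OF y] by simp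
      also have "\<dots> = g t z"
        using \<phi>(2)[OF t lin_mapD(1)[OF std_diff_lin_map[OF L] y]] h(2)[OF z(1)] z(2) by simp
      finally show "?c t y = g t z" using y by simp
    qed
    then show ?thesis unfolding ext_prod_def
      using MN.Ext_carrierI[OF g[OF t]] LM.Ext_carrierI[OF f[OF t]]
      by (intro generate.incl CollectI exI[of _ "ext_class R M N 1 (g t)"]
          exI[of _ "ext_class R L M i (f t)"] conjI) simp_all
  qed
  define S where "S T' = (\<lambda>y\<in>carrier (std_mod R L (Suc i)). \<Oplus>\<^bsub>N\<^esub> t\<in>T'. ?c t y)" for T'
  have sum: "S T' \<in> cocycles R L N (Suc i) \<and> ext_class R L N (Suc i) (S T') \<in> ext_prod R L M N 1 i"
    if "finite T'" "T' \<subseteq> T" for T'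
    using that
  proof (induction T')
    case empty
    have "(\<lambda>y\<in>carrier (std_mod R L (Suc i)). \<zero>\<^bsub>N\<^esub>) \<in> coboundaries R L N (Suc i)"
      using subgroup.one_closed[OF coboundaries_subgroup[of "Suc i"]] by (simp add: cochain_one del: std_mod.simps)
    note z = ext_class_coboundary[OF this]
    show ?case unfolding S_def N.M.finsum_empty
    proof (rule conjI)
      show "(\<lambda>y\<in>carrier (std_mod R L (Suc i)). \<zero>\<^bsub>N\<^esub>) \<in> cocycles R L N (Suc i)" by (rule cocycle_zero)
      show "ext_class R L N (Suc i) (\<lambda>y\<in>carrier (std_mod R L (Suc i)). \<zero>\<^bsub>N\<^esub>) \<in> ext_prod R L M N 1 i"
        unfolding z ext_prod_def using generate.one[of "Ext R L N (Suc i)"] by simp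
    qed
  next
    case (insert t T')
    have t: "t \<in> T" and s: "S T' \<in> cocycles R L N (Suc i)"
      "ext_class R L N (Suc i) (S T') \<in> ext_prod R L M N 1 i"
      using insert by auto
    have "(\<Oplus>\<^bsub>N\<^esub> t\<in>insert t T'. ?c t y) = ?c t y \<oplus>\<^bsub>N\<^esub> (\<Oplus>\<^bsub>N\<^esub> t\<in>T'. ?c t y)"
      if "y \<in> carrier (std_mod R L (Suc i))" for y
      using insert.hyps insert.prems cocycle_closed[OF c_cocycle that] by (intro N.M.finsum_insert) auto
    then have eq': "S (insert t T') = (\<lambda>y\<in>carrier (std_mod R L (Suc i)). ?c t y \<oplus>\<^bsub>N\<^esub> S T' y)"
      unfolding S_def by (intro restrict_ext) simp
    have "ext_class R L N (Suc i) (?c t) \<otimes>\<^bsub>Ext R L N (Suc i)\<^esub> ext_class R L N (Suc i) (S T') \<in> ext_prod R L M N 1 i"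
      using incl[OF t] s(2) generate.eng[of _ "Ext R L N (Suc i)"] by (simp add: ext_prod_def)
    then show ?case
      using cocycle_add[OF c_cocycle[OF t] s(1)] unfolding ext_class_mult[OF c_cocycle[OF t] s(1)] eq' by (rule conjI[rotated])
  qed
  have "c = (\<lambda>y\<in>carrier (std_mod R L (Suc i)). (\<lambda>y\<in>carrier (std_mod R L (Suc i)). e (std_diff R L i y)) y \<oplus>\<^bsub>N\<^esub> S T y)"
    (is "c = ?r")
  proof (rule cocycle_eqI[OF c])
    show "?r \<in> cocycles R L N (Suc i)"
      by (rule cocycle_add[OF subsetD[OF coboundaries_subset coboundary_SucI[OF e]] conjunct1[OF sum[OF T order_refl]]])
    fix y assume y: "y \<in> carrier (std_mod R L (Suc i))"
    have "c y = e (std_diff R L i y) \<oplus>\<^bsub>N\<^esub> (\<Oplus>\<^bsub>N\<^esub> t\<in>T. g t (\<phi> t 1 y))"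
    proof (rule eq[OF y])
      fix t assume t: "t \<in> T"
      note \<phi>D = chain_liftD[OF \<phi>(1)[OF t]]
      show "\<phi> t 1 y \<in> carrier (std_mod R M 1)" by (rule lin_mapD(1)[OF \<phi>D(2) y])
      show "std_diff R M 0 (\<phi> t 1 y) = \<phi>0 t (std_diff R L i y)"
        using \<phi>D(4)[OF y] \<phi>(2)[OF t lin_mapD(1)[OF std_diff_lin_map[OF L] y]] by simp
    qed
    then show "c y = ?r y" using y by (simp add: S_def)
  qed
  from ext_class_eqI[OF conjunct1[OF sum[OF T order_refl]] coboundary_SucI[OF e] this]
  show ?thesis using conjunct2[OF sum[OF T order_refl]] by simp
qed

end

section \<open>One step of a linear resolution\<close>

lemma (in left_module) free_lin_map_sum:
  assumes h: "lin_map R (free_module R B) M h" and f: "f \<in> carrier (free_module R B)"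
  shows "h f = (\<Oplus>\<^bsub>M\<^esub> b\<in>{b. f b \<noteq> \<zero>\<^bsub>R\<^esub>}. f b \<odot>\<^bsub>M\<^esub> h (R.unit_vec b))"
proof -
  let ?F = "free_module R B"
  have "h f = (restrict h (carrier ?F)) f" using f by simp
  also have "\<dots> = lin_ext R B M (\<lambda>b. (restrict h (carrier ?F)) (R.unit_vec b)) f"
    by (rule free_hom_eq_lin_ext[OF restrict_mod_hom[OF R.free_module_left_module h] f])
  also have "\<dots> = (\<Oplus>\<^bsub>M\<^esub> b\<in>{b. f b \<noteq> \<zero>\<^bsub>R\<^esub>}. f b \<odot>\<^bsub>M\<^esub> (restrict h (carrier ?F)) (R.unit_vec b))"
    using f by (simp add: lin_ext_def)
  also have "\<dots> = (\<Oplus>\<^bsub>M\<^esub> b\<in>{b. f b \<noteq> \<zero>\<^bsub>R\<^esub>}. f b \<odot>\<^bsub>M\<^esub> h (R.unit_vec b))"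
  proof (rule M.finsum_cong')
    have b: "f b \<in> carrier R" "f b \<noteq> \<zero>\<^bsub>R\<^esub> \<Longrightarrow> R.unit_vec b \<in> carrier ?F" for b
      using f R.unit_vec_carrier[of b B] by (auto simp: free_module_carrier)
    then show "(\<lambda>b. f b \<odot>\<^bsub>M\<^esub> h (R.unit_vec b)) \<in> {b. f b \<noteq> \<zero>\<^bsub>R\<^esub>} \<rightarrow> carrier M"
      using lin_mapD(1)[OF h] by auto
    show "f b \<odot>\<^bsub>M\<^esub> (restrict h (carrier ?F)) (R.unit_vec b) = f b \<odot>\<^bsub>M\<^esub> h (R.unit_vec b)"
      if "b \<in> {b. f b \<noteq> \<zero>\<^bsub>R\<^esub>}" for b using b(2)[of b] that by simp
  qed (rule refl)
  finally show ?thesis .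
qed

lemma (in left_module) free_lin_map_eqI:
  assumes h: "lin_map R (free_module R B) M h" and k: "lin_map R (free_module R B) M k"
    and eq: "\<And>b. b \<in> B \<Longrightarrow> h (R.unit_vec b) = k (R.unit_vec b)" and f: "f \<in> carrier (free_module R B)"
  shows "h f = k f"
proof -
  have "restrict h (carrier (free_module R B)) f = restrict k (carrier (free_module R B)) f"
    by (rule free_hom_eqI[OF restrict_mod_hom restrict_mod_hom _ f])
       (simp_all add: h k R.free_module_left_module R.unit_vec_carrier eq)
  then show ?thesis using f by simp
qed

context graded_setup
begin

text \<open>A free \<open>A\<close>-module is a direct sum of copies of \<open>A\<close>, and
  \<open>A\<close> is projective over \<open>R\<^sub>0\<close>; retracts inherit this.\<close>

lemma restricted_projective:
  fixes P :: "('a, 'p) module"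
  assumes A_proj: "projective_module R\<^sub>0 A_mod" and P: "projective_module A P"
  shows "projective_module R\<^sub>0 P"
proof -
  obtain B :: "'p set" and \<iota> \<pi> where \<iota>: "\<iota> \<in> mod_hom A P (free_module A B)" and \<pi>: "\<pi> \<in> mod_hom A (free_module A B) P"
    and ret: "\<forall>p\<in>carrier P. \<pi> (\<iota> p) = p"
    using P unfolding projective_module_def by blast
  let ?F = "free_module A B"
  have F: "left_module A ?F" by (rule A.free_module_left_module)
  interpret F: left_module A ?F by (rule F)
  have "projective_module R\<^sub>0 ?F"
  proof (rule projective_locally_finite_sum[of R\<^sub>0 ?F B "\<lambda>_. A_mod" "\<lambda>b a. a \<odot>\<^bsub>?F\<^esub> A.unit_vec b" "\<lambda>b f. f b"])
    show "left_module R\<^sub>0 ?F" by (rule left_module_R0[OF F])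
    fix b assume b: "b \<in> B"
    note u = A.unit_vec_carrier[OF b]
    have "lin_map A A_mod ?F (\<lambda>a. a \<odot>\<^bsub>?F\<^esub> A.unit_vec b)"
      by (rule lin_mapI)
         (use F.smult_closed[OF _ u] F.smult_l_distr[OF _ _ u] F.smult_assoc1[OF _ _ u] in \<open>simp_all del: free_module_simps\<close>)
    then show "lin_map R\<^sub>0 A_mod ?F (\<lambda>a. a \<odot>\<^bsub>?F\<^esub> A.unit_vec b)" by (rule lin_map_R0)
    show "lin_map R\<^sub>0 ?F A_mod (\<lambda>f. f b)"
      by (rule lin_map_R0) (auto simp: lin_map_def free_module_carrier)
  next
    fix f assume f: "f \<in> carrier ?F"
    have S: "{b \<in> B. f b \<noteq> \<zero>\<^bsub>A_mod\<^esub>} = {b. f b \<noteq> \<zero>\<^bsub>A\<^esub>}" using f by (auto simp: free_module_carrier)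
    show "finite {b \<in> B. f b \<noteq> \<zero>\<^bsub>A_mod\<^esub>}" unfolding S using f by (simp add: free_module_carrier)
    show "f = (\<Oplus>\<^bsub>?F\<^esub> b\<in>{b \<in> B. f b \<noteq> \<zero>\<^bsub>A_mod\<^esub>}. f b \<odot>\<^bsub>?F\<^esub> A.unit_vec b)"
      unfolding S by (rule F.free_lin_map_sum[OF lin_map_id f])
  qed (rule A_proj)
  then show ?thesis
    by (rule projective_retract[OF _ left_module_R0[OF projective_left_module[OF P]]
          lin_map_R0[OF mod_hom_lin_map[OF \<iota>]] lin_map_R0[OF mod_hom_lin_map[OF \<pi>]]]) (use ret in simp)
qed

lemma component_projective:
  assumes P: "graded_module A \<A> P \<P>" and proj: "projective_module R\<^sub>0 P"
  shows "projective_module R\<^sub>0 (P\<lparr>carrier := \<P> j\<rparr>)"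
proof (rule projective_retract[OF proj submodule_left_module[OF left_module_R0[OF graded_moduleD(1)[OF P]]
        component_submodule[OF P]] _ part_lin_map[OF P]])
  show "lin_map R\<^sub>0 (P\<lparr>carrier := \<P> j\<rparr>) P (\<lambda>x. x)"
    using component_carrier[OF P] by (auto simp: lin_map_def)
qed (use part_homogeneous[OF P] in simp)

section \<open>Graded submodules and single steps of a linear resolution\<close>

definition graded_submodule :: "('a, 'p) module \<Rightarrow> (nat \<Rightarrow> 'p set) \<Rightarrow> 'p set \<Rightarrow> bool" where
  "graded_submodule P \<P> N \<longleftrightarrow> submodule N A P \<and> (\<forall>x\<in>N. \<forall>j. homogeneous_part P \<P> j x \<in> N)"

text \<open>A decomposition inside \<open>N\<close> is one inside \<open>P\<close>, and the unique
  decomposition in \<open>P\<close> of an element of \<open>N\<close> has its terms in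
  \<open>N\<close>. So existence and uniqueness are both inherited.\<close>

lemma graded_submodule_module:
  assumes P: "graded_module A \<A> P \<P>" and N: "graded_submodule P \<P> N"
  shows "graded_module A \<A> (P\<lparr>carrier := N\<rparr>) (\<lambda>j. N \<inter> \<P> j)"
proof -
  note PM = graded_moduleD(1)[OF P]
  interpret P: left_module A P by (rule PM)
  have sub: "submodule N A P" and hp: "\<And>x j. x \<in> N \<Longrightarrow> homogeneous_part P \<P> j x \<in> N"
    using N by (auto simp: graded_submodule_def)
  note Nd = submoduleD[OF sub]
  have NM: "left_module A (P\<lparr>carrier := N\<rparr>)" by (rule submodule_left_module[OF PM sub])
  interpret N: left_module A "P\<lparr>carrier := N\<rparr>" by (rule NM)
  have fs: "finsum (P\<lparr>carrier := N\<rparr>) c T = finsum P c T" if "\<forall>i. c i \<in> N" for c and T :: "nat set"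
    by (rule finsum_submodule[OF PM sub]) (use that in auto)
  have parts: "homogeneous_parts (P\<lparr>carrier := N\<rparr>) (\<lambda>j. N \<inter> \<P> j) x c \<longleftrightarrow> homogeneous_parts P \<P> x c"
    if x: "x \<in> N" for x c
  proof
    assume "homogeneous_parts (P\<lparr>carrier := N\<rparr>) (\<lambda>j. N \<inter> \<P> j) x c"
    then show "homogeneous_parts P \<P> x c" using fs[of c] by (simp add: homogeneous_parts_def)
  next
    assume c: "homogeneous_parts P \<P> x c"
    have "c i \<in> N" for i
      using P.M.homogeneous_part_unique[OF M_dsd[OF P] Nd(3)[OF x] c, of i] hp[OF x, of i] by simp
    then show "homogeneous_parts (P\<lparr>carrier := N\<rparr>) (\<lambda>j. N \<inter> \<P> j) x c"
      using c fs[of c] by (simp add: homogeneous_parts_def)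
  qed
  have "\<exists>!c. homogeneous_parts (P\<lparr>carrier := N\<rparr>) (\<lambda>j. N \<inter> \<P> j) x c" if x: "x \<in> carrier (P\<lparr>carrier := N\<rparr>)" for x
  proof -
    have xN: "x \<in> N" using x by simp
    have "\<exists>!c. homogeneous_parts P \<P> x c"
      using M_dsd[OF P] Nd(3)[OF xN] by (simp add: direct_sum_decomposition_def)
    then show ?thesis unfolding parts[OF xN] .
  qed
  moreover have "subgroup (N \<inter> \<P> j) (add_monoid (P\<lparr>carrier := N\<rparr>))" for j
  proof -
    have "submodule (N \<inter> \<P> j) R\<^sub>0 P"
      by (rule Int_submodule[OF left_module_R0[OF PM] submodule_R0[OF PM sub] component_submodule[OF P]])
    then have "submodule (N \<inter> \<P> j) R\<^sub>0 (P\<lparr>carrier := N\<rparr>)"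
      using submodule_of_submodule[OF left_module_R0[OF PM] submodule_R0[OF PM sub]] by simp
    then show ?thesis by (rule submodule.axioms(1))
  qed
  ultimately have "direct_sum_decomposition (P\<lparr>carrier := N\<rparr>) (\<lambda>j. N \<inter> \<P> j)"
    unfolding direct_sum_decomposition_def by blast
  then show ?thesis
    unfolding graded_module_def using NM graded_moduleD(4)[OF P] Nd(6) A_component_carrier by auto
qed

lemma kernel_graded_submodule:
  assumes P: "graded_module A \<A> P \<P>" and Q: "graded_module A \<A> Q \<Q>" and d: "lin_map A P Q d"
    and gr: "\<And>i. d ` \<P> i \<subseteq> \<Q> i"
  shows "graded_submodule P \<P> {x \<in> carrier P. d x = \<zero>\<^bsub>Q\<^esub>}"
  unfolding graded_submodule_def
proof (intro conjI ballI allI CollectI)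
  show "submodule {x \<in> carrier P. d x = \<zero>\<^bsub>Q\<^esub>} A P"
    by (rule kernel_submodule[OF graded_moduleD(1)[OF P] graded_moduleD(1)[OF Q] d])
  fix x j assume "x \<in> {x \<in> carrier P. d x = \<zero>\<^bsub>Q\<^esub>}"
  then have x: "x \<in> carrier P" "d x = \<zero>\<^bsub>Q\<^esub>" by auto
  show "homogeneous_part P \<P> j x \<in> carrier P" by (rule part_closed[OF P x(1)])
  show "d (homogeneous_part P \<P> j x) = \<zero>\<^bsub>Q\<^esub>"
    using lin_map_homogeneous_part[OF P Q d gr x(1), of j] part_zero[OF Q] x(2) by simp
qed

text \<open>One term of a linear resolution with its syzygy \<open>N\<close>. The last condition is
  minimality: together with generation in degree \<open>n\<close> it places \<open>N\<close> in
  degrees above \<open>n\<close>, hence inside \<open>J\<close> times \<open>P\<close>.\<close>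

definition linear_step :: "nat \<Rightarrow> ('a, 'p) module \<Rightarrow> (nat \<Rightarrow> 'p set) \<Rightarrow> 'p set \<Rightarrow> bool" where
  "linear_step n P \<P> N \<longleftrightarrow> graded_module A \<A> P \<P> \<and> projective_module A P \<and>
     generated_in_degree A P \<P> n \<and> graded_submodule P \<P> N \<and> N \<inter> \<P> n = {\<zero>\<^bsub>P\<^esub>}"

lemma linear_stepD:
  assumes "linear_step n P \<P> N"
  shows "graded_module A \<A> P \<P>" "projective_module A P" "generated_in_degree A P \<P> n"
    "graded_submodule P \<P> N" "N \<inter> \<P> n = {\<zero>\<^bsub>P\<^esub>}" "submodule N A P" "left_module A P"
  using assms by (auto simp: linear_step_def graded_submodule_def intro: graded_moduleD projective_left_module)

text \<open>Above degree \<open>n\<close> an element of \<open>P\<close> is a sum of products with a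
  left factor of positive degree, which acts on \<open>D\<close> by zero; up to degree
  \<open>n\<close> the submodule \<open>N\<close> is zero. Consequently a homomorphism from
  \<open>N\<close> to \<open>D\<close> is insensitive to errors that extend to
  \<open>P\<close>.\<close>

lemma linear_step_D_zero:
  assumes st: "linear_step n P \<P> N" and h: "lin_map A P D h" and x: "x \<in> N"
  shows "h x = \<zero>\<^bsub>A\<^esub>"
proof -
  note P = linear_stepD(1)[OF st] and gen = linear_stepD(3)[OF st] and PM = linear_stepD(7)[OF st]
  interpret P: left_module A P by (rule PM)
  interpret D: left_module A D by (rule D_left_module)
  have xP: "x \<in> carrier P" by (rule submoduleD(3)[OF linear_stepD(6)[OF st] x])
  let ?p = "\<lambda>j. homogeneous_part P \<P> j x"
  have "h (?p j) = \<zero>\<^bsub>A\<^esub>" for j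
  proof -
    have pN: "?p j \<in> N" using linear_stepD(4)[OF st] x by (simp add: graded_submodule_def)
    have pj: "?p j \<in> \<P> j" by (rule part_in[OF P xP])
    consider "j < n" | "j = n" | "n < j" by linarith
    then show ?thesis
    proof cases
      case 1
      then show ?thesis using generated_component(1)[OF P gen pj] lin_map_0[OF PM D_left_module h] by simp
    next
      case 2
      then have "?p j \<in> {\<zero>\<^bsub>P\<^esub>}" using linear_stepD(5)[OF st] pN pj by blast
      then show ?thesis using lin_map_0[OF PM D_left_module h] by simp
    next
      case 3
      then show ?thesis
        using generated_component(2)[OF P gen pj] P.M.component_subset[OF M_dsd[OF P]]
        by (intro lin_map_D_span[OF PM h, of "j - n" "\<P> n"]) auto
    qed
  qed
  then have z: "(\<Oplus>\<^bsub>D\<^esub> j\<in>T. h (?p j)) = \<zero>\<^bsub>D\<^esub>" for T using D.M.add.finprod_one_eqI[of T] by simp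
  let ?T = "{j. ?p j \<noteq> \<zero>\<^bsub>P\<^esub>}"
  have T: "finite ?T" by (rule P.M.homogeneous_part_finite[OF M_dsd[OF P] xP])
  have "h (\<Oplus>\<^bsub>P\<^esub> j\<in>?T. ?p j) = (\<Oplus>\<^bsub>D\<^esub> j\<in>?T. h (?p j))"
    by (rule lin_map_finsum[OF PM D_left_module h]) (use part_closed[OF P xP] in auto)
  then show ?thesis using P.M.homogeneous_part_sum[OF M_dsd[OF P] xP T] z by simp
qed

lemma linear_step_J:
  assumes st: "linear_step n P \<P> N" and \<theta>: "lin_map A P A_mod \<theta>" and x: "x \<in> N"
  shows "\<theta> x \<in> J"
  using linear_step_D_zero[OF st lin_map_comp[OF \<theta> D_projection(1)] x]
    lin_mapD(1)[OF \<theta> submoduleD(3)[OF linear_stepD(6)[OF st] x]] by (simp add: J_def)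

text \<open>Elements of \<open>\<P> j\<close> are sums of \<open>a p\<close> with \<open>p\<close>
  in \<open>\<P> n\<close> and \<open>a\<close> of degree at least 2. Then \<open>\<theta>\<close>
  gives \<open>a (\<theta> p)\<close>, where \<open>\<gamma>\<close> vanishes. So products see
  \<open>N\<close> in degree \<open>n + 1\<close> only.\<close>

lemma linear_step_square:
  assumes st: "linear_step n P \<P> N" and \<theta>: "lin_map A P A_mod \<theta>" and \<gamma>: "lin_map A J_mod D \<gamma>"
    and x: "x \<in> \<P> j" and j: "n + 2 \<le> j"
  shows "\<gamma> (\<theta> x) = \<zero>\<^bsub>A\<^esub>"
proof -
  note P = linear_stepD(1)[OF st] and gen = linear_stepD(3)[OF st] and PM = linear_stepD(7)[OF st]
  have "submodule {a \<in> carrier J_mod. \<gamma> a = \<zero>\<^bsub>D\<^esub>} A J_mod"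
    by (rule kernel_submodule[OF J_left_module D_left_module \<gamma>])
  then have "submodule {a \<in> carrier J_mod. \<gamma> a = \<zero>\<^bsub>D\<^esub>} A A_mod"
    using submodule_of_submodule[OF regular_A(1) J_submodule] by blast
  from vimage_submodule[OF PM regular_A(1) \<theta> this]
  have "span_prod P (\<A> (j - n)) (\<P> n) \<subseteq> {x \<in> carrier P. \<theta> x \<in> {a \<in> carrier J_mod. \<gamma> a = \<zero>\<^bsub>D\<^esub>}}"
  proof (rule span_prod_least[OF PM])
    fix a p assume a: "a \<in> \<A> (j - n)" and p: "p \<in> \<P> n"
    have aA: "a \<in> carrier A" and pP: "p \<in> carrier P" and \<theta>p: "\<theta> p \<in> carrier A"
      using A_component_carrier[OF a] component_carrier[OF P p] lin_mapD(1)[OF \<theta>] by auto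
    have "a \<in> J" by (rule positive_degree_J[OF a]) (use j in simp)
    then have "a \<otimes>\<^bsub>A\<^esub> \<theta> p \<in> J" using J_mult(1) \<theta>p by blast
    moreover have "\<gamma> (a \<otimes>\<^bsub>A\<^esub> \<theta> p) = \<zero>\<^bsub>A\<^esub>" by (rule lin_map_J_square[OF \<gamma> a _ \<theta>p]) (use j in simp)
    moreover have "a \<odot>\<^bsub>P\<^esub> p \<in> carrier P" using left_module.smult_closed[OF PM aA pP] .
    ultimately show "a \<odot>\<^bsub>P\<^esub> p \<in> {x \<in> carrier P. \<theta> x \<in> {a \<in> carrier J_mod. \<gamma> a = \<zero>\<^bsub>D\<^esub>}}"
      using lin_mapD(3)[OF \<theta> aA pP] by simp
  qed
  then show ?thesis using generated_component(2)[OF P gen x] j by auto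
qed

text \<open>Ext is computed with the large standard cover of \<open>D\<close>, but the degree
  arguments take place in \<open>A\<close>. Both are projective and map onto \<open>D\<close>, so
  each maps to the other over \<open>D\<close>.\<close>

lemma D_cover_comparison:
  obtains \<psi> \<chi> where "lin_map A (std_mod A D 0) A_mod \<psi>"
    "\<And>y. y \<in> carrier (std_mod A D 0) \<Longrightarrow> A_part 0 (\<psi> y) = std_aug A D y"
    "lin_map A A_mod (std_mod A D 0) \<chi>" "\<And>a. a \<in> carrier A \<Longrightarrow> std_aug A D (\<chi> a) = A_part 0 a"
proof -
  note Y = std_aug_lin_map[OF D_left_module]
  note YM = projective_left_module[OF Y(3)]
  obtain \<psi> where \<psi>: "lin_map A (std_mod A D 0) A_mod \<psi>"
    "\<And>y. y \<in> carrier (std_mod A D 0) \<Longrightarrow> A_part 0 (\<psi> y) = std_aug A D y"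
  proof (rule projective_lift[OF Y(3) regular_A(1) D_left_module D_projection(1) Y(1)])
    show "std_aug A D ` carrier (std_mod A D 0) \<subseteq> A_part 0 ` carrier A_mod"
      unfolding D_projection(2) Y(2) by (rule order_refl)
  qed blast
  obtain \<chi> where \<chi>: "lin_map A A_mod (std_mod A D 0) \<chi>"
    "\<And>a. a \<in> carrier A_mod \<Longrightarrow> std_aug A D (\<chi> a) = A_part 0 a"
  proof (rule projective_lift[OF A.projective_regular_module YM D_left_module Y(1) D_projection(1)])
    show "A_part 0 ` carrier A_mod \<subseteq> std_aug A D ` carrier (std_mod A D 0)"
      unfolding D_projection(2) Y(2) by (rule order_refl)
  qed blast
  have \<chi>2: "std_aug A D (\<chi> a) = A_part 0 a" if a: "a \<in> carrier A" for a
    by (rule \<chi>(2)) (use a in simp)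
  show ?thesis by (rule that[OF \<psi> \<chi>(1) \<chi>2])
qed

text \<open>By \<open>generated_in_degreeI\<close> it suffices that a homomorphism \<open>h\<close>
  from \<open>N\<close> to \<open>D\<close> kills the degrees above \<open>n + 1\<close>. Comparison
  turns \<open>h\<close> into a cocycle of the standard resolution, and that cocycle vanishes at a
  suitable element because all products do.\<close>

lemma syzygy_generated:
  fixes M :: "('a, 'm) module" and P :: "('a, 'p) module"
  assumes fin: "fin_dim (opposite_ring R\<^sub>0) = 0" and M: "left_module A M"
    and st: "linear_step n P \<P> N" and fdP: "\<And>j. fd P (\<P> j)"
    and \<alpha>: "lin_map A (std_mod A M n) P \<alpha>" "\<And>x. x \<in> std_syz A M n \<Longrightarrow> \<alpha> x \<in> N"
    and \<beta>: "lin_map A P (std_mod A M n) \<beta>" "\<And>x. x \<in> N \<Longrightarrow> \<beta> x \<in> std_syz A M n"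
    and s: "lin_map A P P s" "\<And>x. x \<in> carrier P \<Longrightarrow> s x \<in> N" "\<And>x. x \<in> N \<Longrightarrow> \<alpha> (\<beta> x) = x \<oplus>\<^bsub>P\<^esub> s x"
    and ext: "ext_prod A M D D 1 n = carrier (Ext A M D (Suc n))"
  shows "generated_in_degree A (P\<lparr>carrier := N\<rparr>) (\<lambda>j. N \<inter> \<P> j) (Suc n)"
proof -
  interpret D: left_module A D by (rule D_left_module)
  interpret Y: yoneda_setting A M D D
    by (intro yoneda_setting.intro ext_setting.intro yoneda_setting_axioms.intro M D_left_module)
  note P = linear_stepD(1)[OF st] and gen = linear_stepD(3)[OF st] and PM = linear_stepD(7)[OF st]
    and N = linear_stepD(6)[OF st]
  interpret P: left_module A P by (rule PM)
  note NP = submoduleD(3)[OF N]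
  note NG = graded_submodule_module[OF P linear_stepD(4)[OF st]]
  note NM = graded_moduleD(1)[OF NG]
  note Y0 = Y.M_std[of 0]
  interpret Y0: left_module A "std_mod A D 0" by (rule Y0)
  have comp_sub: "submodule (N \<inter> \<P> j) R\<^sub>0 P" for j
    by (rule Int_submodule[OF left_module_R0[OF PM] submodule_R0[OF PM N] component_submodule[OF P]])
  obtain \<psi> \<chi> where \<psi>: "lin_map A (std_mod A D 0) A_mod \<psi>"
    "\<And>y. y \<in> carrier (std_mod A D 0) \<Longrightarrow> A_part 0 (\<psi> y) = std_aug A D y"
    and \<chi>: "lin_map A A_mod (std_mod A D 0) \<chi>" "\<And>a. a \<in> carrier A \<Longrightarrow> std_aug A D (\<chi> a) = A_part 0 a"
    by (rule D_cover_comparison) blast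
  have augl: "lin_map A (std_mod A D 0) D (std_aug A D)"
    and syz0: "std_syz A D 0 = {x \<in> carrier (std_mod A D 0). std_aug A D x = \<zero>\<^bsub>D\<^esub>}"
    using std_aug_lin_map[OF D_left_module] by blast+
  show ?thesis
  proof (rule generated_in_degreeI[OF fin NG])
    show "fd (P\<lparr>carrier := N\<rparr>) (N \<inter> \<P> j)" for j
      using fd_subset[OF PM comp_sub component_submodule[OF P] _ fdP[of j]] by simp
    show "N \<inter> \<P> i = {\<zero>\<^bsub>P\<lparr>carrier := N\<rparr>\<^esub>}" if "i < Suc n" for i
    proof (cases "i = n")
      case True
      then show ?thesis using linear_stepD(5)[OF st] by simp
    next
      case False
      then have "i < n" using that by simp
      then have "N \<inter> \<P> i \<subseteq> {\<zero>\<^bsub>P\<^esub>}" using generated_component(1)[OF P gen] by blast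
      moreover have "{\<zero>\<^bsub>P\<^esub>} \<subseteq> N \<inter> \<P> i" using submoduleD(2)[OF comp_sub[of i]] by simp
      ultimately have "N \<inter> \<P> i = {\<zero>\<^bsub>P\<^esub>}" by (rule equalityI)
      then show ?thesis by simp
    qed
  next
    fix h j x
    assume h: "lin_map A (P\<lparr>carrier := N\<rparr>) D h" and j: "Suc n < j" and xj: "x \<in> N \<inter> \<P> j"
    then have x: "x \<in> N" "x \<in> \<P> j" by auto
    \<comment> \<open>\<open>y\<close> carries \<open>x\<close> over to the standard resolution; it
      is the element at which cocycles are tested.\<close>
    have "\<beta> x \<in> std_diff A M n ` carrier (std_mod A M (Suc n))"
      using \<beta>(2)[OF x(1)] unfolding std_diff_image[OF M] .
    then obtain y where yx: "\<beta> x = std_diff A M n y" and y: "y \<in> carrier (std_mod A M (Suc n))" by (rule imageE)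
    have \<alpha>\<delta>: "\<alpha> (std_diff A M n y) \<in> N" if "y \<in> carrier (std_mod A M (Suc n))" for y
      using \<alpha>(2) imageI[OF that, of "std_diff A M n"] unfolding std_diff_image[OF M] by blast
    let ?c = "\<lambda>y\<in>carrier (std_mod A M (Suc n)). h (\<alpha> (std_diff A M n y))"
    have c: "?c \<in> cocycles A M D (Suc n)"
    proof (rule cocyclesI[OF M])
      have "lin_map A (std_mod A M (Suc n)) (P\<lparr>carrier := N\<rparr>) (\<lambda>y. \<alpha> (std_diff A M n y))"
        using lin_map_comp[OF std_diff_lin_map[OF M] \<alpha>(1)] \<alpha>\<delta> by (simp add: lin_map_def)
      from lin_map_comp[OF this h] show "lin_map A (std_mod A M (Suc n)) D (\<lambda>y. h (\<alpha> (std_diff A M n y)))" .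
      fix w assume w: "w \<in> carrier (std_mod A M (Suc (Suc n)))"
      have "\<alpha> (std_diff A M n (std_diff A M (Suc n) w)) = \<zero>\<^bsub>P\<^esub>"
        unfolding std_diff_diff[OF M w] by (rule lin_map_0[OF Y.L_std PM \<alpha>(1)])
      then show "h (\<alpha> (std_diff A M n (std_diff A M (Suc n) w))) = \<zero>\<^bsub>D\<^esub>"
        using lin_map_0[OF NM D_left_module h] by simp
    qed
    have "?c y = \<zero>\<^bsub>D\<^esub>"
    proof (rule Y.vanishing_of_products[OF ext y _ _ c])
      \<comment> \<open>Composed with \<open>\<beta>\<close>, the map \<open>u\<close> is defined on
        all of \<open>P\<close>, so it vanishes on \<open>N\<close>.\<close>
      fix u assume u: "lin_map A (std_mod A M n) D u"
      show "u (std_diff A M n y) = \<zero>\<^bsub>D\<^esub>"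
        using linear_step_D_zero[OF st lin_map_comp[OF \<beta>(1) u] x(1)] yx by simp
    next
      fix f g \<phi>0 z
      assume f: "f \<in> cocycles A M D n" and g: "g \<in> cocycles A D D 1"
        and \<phi>0: "lin_map A (std_mod A M n) (std_mod A D 0) \<phi>0"
        and aug: "\<And>x. x \<in> carrier (std_mod A M n) \<Longrightarrow> std_aug A D (\<phi>0 x) = f x"
        and z: "z \<in> carrier (std_mod A D 1)" "std_diff A D 0 z = \<phi>0 (std_diff A M n y)"
      obtain g' where g': "lin_map A (std_mod A D 0\<lparr>carrier := std_syz A D 0\<rparr>) D g'"
        "\<And>z. z \<in> carrier (std_mod A D 1) \<Longrightarrow> g' (std_diff A D 0 z) = g z"
        by (rule Y.cocycle_factor[OF g]) blast
      \<comment> \<open>The lift, pulled back to \<open>P\<close>, is split into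
        \<open>\<chi> \<circ> ?\<theta>\<close>, which passes through \<open>A\<close>, and a rest
        \<open>?\<omega>\<close> with values in the first syzygy of \<open>D\<close>. After
        \<open>g'\<close>, the former vanishes in degrees from \<open>n + 2\<close> on, and the
        latter is a homomorphism from \<open>P\<close> to \<open>D\<close> and so vanishes on
        \<open>N\<close>.\<close>
      let ?\<phi>\<beta> = "\<lambda>x. \<phi>0 (\<beta> x)"
      let ?\<theta> = "\<lambda>x. \<psi> (?\<phi>\<beta> x)"
      let ?\<omega> = "\<lambda>x. ?\<phi>\<beta> x \<ominus>\<^bsub>std_mod A D 0\<^esub> \<chi> (?\<theta> x)"
      let ?\<gamma> = "\<lambda>a. g' (\<chi> a)"
      have \<phi>\<beta>: "lin_map A P (std_mod A D 0) ?\<phi>\<beta>" by (rule lin_map_comp[OF \<beta>(1) \<phi>0])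
      have \<theta>: "lin_map A P A_mod ?\<theta>" by (rule lin_map_comp[OF \<phi>\<beta> \<psi>(1)])
      have \<chi>\<theta>: "lin_map A P (std_mod A D 0) (\<lambda>x. \<chi> (?\<theta> x))" by (rule lin_map_comp[OF \<theta> \<chi>(1)])
      have \<omega>: "lin_map A P (std_mod A D 0) ?\<omega>" by (rule lin_map_diff[OF Y0 \<phi>\<beta> \<chi>\<theta>])
      have \<omega>_syz: "?\<omega> p \<in> std_syz A D 0" if p: "p \<in> carrier P" for p
      proof -
        have \<theta>p: "?\<theta> p \<in> carrier A" using lin_mapD(1)[OF \<theta> p] by simp
        have "std_aug A D (?\<omega> p) = std_aug A D (?\<phi>\<beta> p) \<ominus>\<^bsub>D\<^esub> std_aug A D (\<chi> (?\<theta> p))"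
          by (rule lin_map_minus[OF Y0 D_left_module augl lin_mapD(1)[OF \<phi>\<beta> p] lin_mapD(1)[OF \<chi>\<theta> p]])
        also have "std_aug A D (\<chi> (?\<theta> p)) = std_aug A D (?\<phi>\<beta> p)"
          using \<chi>(2)[OF \<theta>p] \<psi>(2)[OF lin_mapD(1)[OF \<phi>\<beta> p]] by simp
        also have "std_aug A D (?\<phi>\<beta> p) \<ominus>\<^bsub>D\<^esub> std_aug A D (?\<phi>\<beta> p) = \<zero>\<^bsub>D\<^esub>"
          by (rule iffD2[OF D.M.minus_eq_zero_iff refl]) (rule lin_mapD(1)[OF augl lin_mapD(1)[OF \<phi>\<beta> p]])+
        finally show ?thesis unfolding syz0 using lin_mapD(1)[OF \<omega> p] by blast
      qed
      have \<chi>J: "\<chi> a \<in> std_syz A D 0" if a: "a \<in> J" for a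
        unfolding syz0 using \<chi>(2)[OF J_carrier[OF a]] lin_mapD(1)[OF \<chi>(1), of a] J_carrier[OF a] a
        by (simp add: J_def del: std_mod.simps)
      have \<gamma>: "lin_map A J_mod D ?\<gamma>"
        by (rule lin_map_comp[OF _ g'(1)]) (use \<chi>(1) \<chi>J J_carrier in \<open>auto simp: lin_map_def simp del: std_mod.simps std_syz.simps\<close>)
      have g'\<omega>: "lin_map A P D (\<lambda>x. g' (?\<omega> x))"
        by (rule lin_map_comp[OF _ g'(1)]) (use \<omega> \<omega>_syz in \<open>simp add: lin_map_def del: std_mod.simps std_syz.simps\<close>)
      have xP: "x \<in> carrier P" by (rule NP[OF x(1)])
      have \<theta>x: "?\<theta> x \<in> J" by (rule linear_step_J[OF st \<theta> x(1)])
      have cl: "?\<phi>\<beta> x \<in> carrier (std_mod A D 0)" "\<chi> (?\<theta> x) \<in> carrier (std_mod A D 0)"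
        using lin_mapD(1)[OF \<phi>\<beta> xP] lin_mapD(1)[OF \<chi>\<theta> xP] by auto
      have split: "?\<phi>\<beta> x = \<chi> (?\<theta> x) \<oplus>\<^bsub>std_mod A D 0\<^esub> ?\<omega> x"
        by (rule Y0.M.add_minus_cancel_right[OF cl(2,1), symmetric])
      have "g z = g' (?\<phi>\<beta> x)" using g'(2)[OF z(1)] z(2) yx by simp
      also have "g' (?\<phi>\<beta> x) = g' (\<chi> (?\<theta> x) \<oplus>\<^bsub>std_mod A D 0\<^esub> ?\<omega> x)" using split by (rule arg_cong)
      also have "\<dots> = g' (\<chi> (?\<theta> x)) \<oplus>\<^bsub>D\<^esub> g' (?\<omega> x)"
        using lin_mapD(2)[OF g'(1), of "\<chi> (?\<theta> x)" "?\<omega> x"] \<chi>J[OF \<theta>x] \<omega>_syz[OF xP] by (simp del: std_mod.simps std_syz.simps)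
      also have "g' (\<chi> (?\<theta> x)) = \<zero>\<^bsub>A\<^esub>" by (rule linear_step_square[OF st \<theta> \<gamma> x(2)]) (use j in simp)
      also have "g' (?\<omega> x) = \<zero>\<^bsub>A\<^esub>" by (rule linear_step_D_zero[OF st g'\<omega> x(1)])
      finally show "g z = \<zero>\<^bsub>D\<^esub>" by simp
    qed
    \<comment> \<open>Back to \<open>h\<close> itself: on \<open>N\<close> the composite
      \<open>\<alpha> \<circ> \<beta>\<close> is the identity plus \<open>s\<close>, and
      \<open>h \<circ> s\<close>, being defined on all of \<open>P\<close>, vanishes at
      \<open>x\<close>.\<close>
    then have "h (\<alpha> (\<beta> x)) = \<zero>\<^bsub>A\<^esub>" using y yx by simp
    moreover have "h (\<alpha> (\<beta> x)) = h x \<oplus>\<^bsub>D\<^esub> h (s x)"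
      using s(3)[OF x(1)] lin_mapD(2)[OF h, of x "s x"] x(1) s(2)[OF NP[OF x(1)]] by simp
    moreover have "h (s x) = \<zero>\<^bsub>A\<^esub>"
    proof (rule linear_step_D_zero[OF st _ x(1)])
      have "lin_map A P (P\<lparr>carrier := N\<rparr>) s" using s(1,2) by (simp add: lin_map_def)
      from lin_map_comp[OF this h] show "lin_map A P D (\<lambda>x. h (s x))" .
    qed
    ultimately show "h x = \<zero>\<^bsub>A\<^esub>"
      using lin_mapD(1)[OF h, of x] x(1) A_component_carrier[of _ 0] by simp
  qed
qed


section \<open>Factoring homomorphisms on a syzygy through a dual basis\<close>

lemma part_bottom:
  assumes P: "graded_module A \<A> P \<P>" and gen: "generated_in_degree A P \<P> n"
    and a: "a \<in> carrier A" and x: "x \<in> carrier P"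
  shows "homogeneous_part P \<P> n (a \<odot>\<^bsub>P\<^esub> x) = A_part 0 a \<odot>\<^bsub>P\<^esub> homogeneous_part P \<P> n x"
proof -
  interpret P: left_module A P by (rule graded_moduleD(1)[OF P])
  let ?t = "\<lambda>i. A_part i a \<odot>\<^bsub>P\<^esub> homogeneous_part P \<P> (n - i) x"
  have "homogeneous_part P \<P> n (a \<odot>\<^bsub>P\<^esub> x) = (\<Oplus>\<^bsub>P\<^esub> i\<in>{..n}. ?t i)" by (rule part_smult[OF P a x])
  also have "\<dots> = (\<Oplus>\<^bsub>P\<^esub> i\<in>{0}. ?t i)"
  proof (rule P.M.add.finprod_mono_neutral_cong_right)
    fix i assume i: "i \<in> {..n} - {0}"
    then have "homogeneous_part P \<P> (n - i) x = \<zero>\<^bsub>P\<^esub>"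
      by (intro generated_component(1)[OF P gen part_in[OF P x]]) auto
    then show "?t i = \<zero>\<^bsub>P\<^esub>" using P.smult_r_null[OF A_part_closed[OF a]] by simp
  qed (use A_part_closed[OF a] part_closed[OF P x] in auto)
  also have "\<dots> = ?t 0" using A_part_closed[OF a] part_closed[OF P x] by simp
  finally show ?thesis by simp
qed

text \<open>Nothing nonzero lies below degree \<open>n\<close>, so the positive parts of a scalar
  cannot contribute to degree \<open>n\<close>. This makes a functional of the lowest component a
  homomorphism of \<open>A\<close>-modules.\<close>

lemma bottom_functional:
  assumes P: "graded_module A \<A> P \<P>" and gen: "generated_in_degree A P \<P> n"
    and f: "lin_map R\<^sub>0 (P\<lparr>carrier := \<P> n\<rparr>) (regular_module R\<^sub>0) f"
  shows "lin_map A P D (\<lambda>x. f (homogeneous_part P \<P> n x))"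
proof (rule lin_mapI)
  fix x assume x: "x \<in> carrier P"
  show "f (homogeneous_part P \<P> n x) \<in> carrier D"
    using lin_mapD(1)[OF f, of "homogeneous_part P \<P> n x"] part_in[OF P x] by simp
  fix y assume y: "y \<in> carrier P"
  show "f (homogeneous_part P \<P> n (x \<oplus>\<^bsub>P\<^esub> y)) = f (homogeneous_part P \<P> n x) \<oplus>\<^bsub>D\<^esub> f (homogeneous_part P \<P> n y)"
    using lin_mapD(2)[OF f, of "homogeneous_part P \<P> n x" "homogeneous_part P \<P> n y"] part_in[OF P x] part_in[OF P y]
    by (simp add: part_add[OF P x y])
next
  fix a x assume a: "a \<in> carrier A" and x: "x \<in> carrier P"
  show "f (homogeneous_part P \<P> n (a \<odot>\<^bsub>P\<^esub> x)) = a \<odot>\<^bsub>D\<^esub> f (homogeneous_part P \<P> n x)"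
    using lin_mapD(3)[OF f, of "A_part 0 a" "homogeneous_part P \<P> n x"] part_in[OF P x] A_part_in[OF a, of 0]
    by (simp add: part_bottom[OF P gen a x])
qed

text \<open>The free module of which \<open>N\<close> is a summand may have an infinite basis.
  Finitely many generators involve finitely many coordinates, and these suffice for all of
  \<open>N\<close>.\<close>

lemma finite_dual_basis:
  fixes N :: "('a, 'p) module"
  assumes proj: "projective_module R\<^sub>0 N" and fg: "finitely_generated R\<^sub>0 N"
  obtains T :: "'p set" and f m where "finite T" "\<And>b. b \<in> T \<Longrightarrow> lin_map R\<^sub>0 N (regular_module R\<^sub>0) (f b)"
    "\<And>b. b \<in> T \<Longrightarrow> m b \<in> carrier N" "\<And>q. q \<in> carrier N \<Longrightarrow> q = (\<Oplus>\<^bsub>N\<^esub> b\<in>T. f b q \<odot>\<^bsub>N\<^esub> m b)"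
proof -
  interpret R0: ring R\<^sub>0 by (rule R0_ring)
  note NM = projective_left_module[OF proj]
  interpret N: left_module R\<^sub>0 N by (rule NM)
  obtain B :: "'p set" and \<iota> \<pi> where \<iota>: "\<iota> \<in> mod_hom R\<^sub>0 N (free_module R\<^sub>0 B)"
    and \<pi>: "\<pi> \<in> mod_hom R\<^sub>0 (free_module R\<^sub>0 B) N" and ret: "\<forall>p\<in>carrier N. \<pi> (\<iota> p) = p"
    using proj unfolding projective_module_def by blast
  obtain S where S: "S \<subseteq> carrier N" "finite S" "lspan R\<^sub>0 N S = carrier N"
    using fg finitely_generated_iff_lspan[OF NM] by blast
  note \<iota>l = mod_hom_lin_map[OF \<iota>]
  have \<iota>F: "(\<forall>x. \<iota> q x \<in> \<A> 0) \<and> {x. \<iota> q x \<noteq> \<zero>\<^bsub>A\<^esub>} \<subseteq> B \<and> finite {x. \<iota> q x \<noteq> \<zero>\<^bsub>A\<^esub>}" if "q \<in> carrier N" for q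
    using mod_homD(2)[OF \<iota> that] unfolding free_module_carrier by simp
  define T where "T = (\<Union>s\<in>S. {b. \<iota> s b \<noteq> \<zero>\<^bsub>A\<^esub>})"
  have T: "finite T" "T \<subseteq> B" using S \<iota>F by (auto simp: T_def)
  have "submodule {q \<in> carrier N. \<forall>b. b \<notin> T \<longrightarrow> \<iota> q b = \<zero>\<^bsub>A\<^esub>} R\<^sub>0 N"
  proof (rule N.submoduleI)
    show "\<zero>\<^bsub>N\<^esub> \<in> {q \<in> carrier N. \<forall>b. b \<notin> T \<longrightarrow> \<iota> q b = \<zero>\<^bsub>A\<^esub>}"
      using lin_map_0[OF NM R0.free_module_left_module \<iota>l] by simp
  qed (use lin_mapD(2,3)[OF \<iota>l] A_component_carrier[of _ 0] in auto)
  from lspan_least[OF this, of S] have "carrier N \<subseteq> {q \<in> carrier N. \<forall>b. b \<notin> T \<longrightarrow> \<iota> q b = \<zero>\<^bsub>A\<^esub>}"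
    unfolding S(3) using S(1) by (auto simp: T_def)
  then have supp: "{b. \<iota> q b \<noteq> \<zero>\<^bsub>A\<^esub>} \<subseteq> T" if "q \<in> carrier N" for q using that by blast
  let ?m = "\<lambda>b. \<pi> (R0.unit_vec b)"
  have m: "?m b \<in> carrier N" if "b \<in> B" for b by (rule mod_homD(2)[OF \<pi> R0.unit_vec_carrier[OF that]])
  show ?thesis
  proof (rule that[OF T(1), of "\<lambda>b q. \<iota> q b" ?m])
    show "lin_map R\<^sub>0 N (regular_module R\<^sub>0) (\<lambda>q. \<iota> q b)" if "b \<in> T" for b
      using lin_mapD(2,3)[OF \<iota>l] \<iota>F by (auto simp: lin_map_def)
    show "?m b \<in> carrier N" if "b \<in> T" for b using m T(2) that by blast
    fix q assume q: "q \<in> carrier N"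
    have "q = \<pi> (\<iota> q)" using ret q by simp
    also have "\<dots> = lin_ext R\<^sub>0 B N ?m (\<iota> q)" by (rule N.free_hom_eq_lin_ext[OF \<pi> mod_homD(2)[OF \<iota> q]])
    also have "\<dots> = (\<Oplus>\<^bsub>N\<^esub> b\<in>T. \<iota> q b \<odot>\<^bsub>N\<^esub> ?m b)"
      by (rule N.lin_ext_superset[OF mod_homD(2)[OF \<iota> q] _ T(1) _ T(2)]) (use m supp[OF q] in auto)
    finally show "q = (\<Oplus>\<^bsub>N\<^esub> b\<in>T. \<iota> q b \<odot>\<^bsub>N\<^esub> ?m b)" .
  qed
qed

text \<open>With a dual basis \<open>f b\<close>, \<open>m b\<close> of \<open>\<P> n\<close>, an
  element \<open>a q\<close> with \<open>a\<close> of degree 1 and \<open>q\<close> in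
  \<open>\<P> n\<close> is the sum of the terms \<open>a (f b q) (m b)\<close>. These terms leave
  \<open>N\<close>, so \<open>h\<close> is first extended by the retraction \<open>r\<close>. Here
  \<open>\<theta> b\<close> lifts \<open>f b\<close> to a map into \<open>A\<close>, and
  \<open>\<gamma> b\<close> multiplies \<open>m b\<close> by the degree 1 part and applies
  \<open>h \<circ> r\<close>.\<close>

lemma linear_factorization:
  fixes P :: "('a, 'p) module"
  assumes st: "linear_step n P \<P> N"
    and genN: "generated_in_degree A (P\<lparr>carrier := N\<rparr>) (\<lambda>j. N \<inter> \<P> j) (Suc n)"
    and proj: "projective_module R\<^sub>0 (P\<lparr>carrier := \<P> n\<rparr>)" and fdn: "fd P (\<P> n)"
    and r: "lin_map R\<^sub>0 (P\<lparr>carrier := \<P> (Suc n)\<rparr>) (P\<lparr>carrier := N \<inter> \<P> (Suc n)\<rparr>) r"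
    and r_id: "\<And>x. x \<in> N \<inter> \<P> (Suc n) \<Longrightarrow> r x = x"
    and h: "lin_map A (P\<lparr>carrier := N\<rparr>) D h"
  obtains T :: "'p set" and \<gamma> \<theta> where "finite T" "\<And>t. t \<in> T \<Longrightarrow> lin_map A J_mod D (\<gamma> t)"
    "\<And>t. t \<in> T \<Longrightarrow> lin_map A P A_mod (\<theta> t)" "\<And>x. x \<in> N \<Longrightarrow> h x = (\<Oplus>\<^bsub>D\<^esub> t\<in>T. \<gamma> t (\<theta> t x))"
proof -
  note P = linear_stepD(1)[OF st] and Pproj = linear_stepD(2)[OF st] and gen = linear_stepD(3)[OF st]
    and PM = linear_stepD(7)[OF st] and N = linear_stepD(6)[OF st]
  interpret P: left_module A P by (rule PM)
  interpret D: left_module A D by (rule D_left_module)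
  note PM0 = left_module_R0[OF PM] and DM0 = left_module_R0[OF D_left_module]
  note NP = submoduleD(3)[OF N]
  note NG = graded_submodule_module[OF P linear_stepD(4)[OF st]]
  note NM = graded_moduleD(1)[OF NG]
  note sub = component_submodule[OF P]
  let ?Pn = "P\<lparr>carrier := \<P> n\<rparr>" and ?Q = "P\<lparr>carrier := \<P> (Suc n)\<rparr>"
  have QM: "left_module R\<^sub>0 ?Q" by (rule submodule_left_module[OF PM0 sub])
  obtain T :: "'p set" and f m where T: "finite T" and f: "\<And>b. b \<in> T \<Longrightarrow> lin_map R\<^sub>0 ?Pn (regular_module R\<^sub>0) (f b)"
    and m: "\<And>b. b \<in> T \<Longrightarrow> m b \<in> carrier ?Pn"
    and basis: "\<And>q. q \<in> carrier ?Pn \<Longrightarrow> q = (\<Oplus>\<^bsub>?Pn\<^esub> b\<in>T. f b q \<odot>\<^bsub>?Pn\<^esub> m b)"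
    by (rule finite_dual_basis[OF proj fd_finitely_generated[OF PM sub fdn]]) blast
  \<comment> \<open>The functional \<open>f b\<close>, read as a homomorphism from \<open>P\<close>
    to \<open>D\<close>, lifts through \<open>A\<close> mapping onto \<open>D\<close> because
    \<open>P\<close> is projective.\<close>
  have "\<exists>\<theta>. lin_map A P A_mod \<theta> \<and> (\<forall>x\<in>carrier P. A_part 0 (\<theta> x) = f b (homogeneous_part P \<P> n x))" if b: "b \<in> T" for b
  proof -
    note fb = bottom_functional[OF P gen f[OF b]]
    obtain \<theta> where "lin_map A P A_mod \<theta>" "\<And>x. x \<in> carrier P \<Longrightarrow> A_part 0 (\<theta> x) = f b (homogeneous_part P \<P> n x)"
    proof (rule projective_lift[OF Pproj regular_A(1) D_left_module D_projection(1) fb])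
      show "(\<lambda>x. f b (homogeneous_part P \<P> n x)) ` carrier P \<subseteq> A_part 0 ` carrier A_mod"
        unfolding D_projection(2) using lin_mapD(1)[OF fb] by (rule image_subsetI)
    qed blast
    then show ?thesis by blast
  qed
  then have "\<forall>b\<in>T. \<exists>\<theta>. lin_map A P A_mod \<theta> \<and> (\<forall>x\<in>carrier P. A_part 0 (\<theta> x) = f b (homogeneous_part P \<P> n x))" by blast
  from bchoice[OF this] obtain \<theta> where \<theta>': "\<forall>b\<in>T. lin_map A P A_mod (\<theta> b) \<and>
      (\<forall>x\<in>carrier P. A_part 0 (\<theta> b x) = f b (homogeneous_part P \<P> n x))" by (rule exE)
  have \<theta>: "lin_map A P A_mod (\<theta> b)" "x \<in> carrier P \<Longrightarrow> A_part 0 (\<theta> b x) = f b (homogeneous_part P \<P> n x)"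
    if "b \<in> T" for b x using bspec[OF \<theta>' that] by simp_all
  have hr: "lin_map R\<^sub>0 ?Q D (\<lambda>x. h (r x))"
  proof -
    have "lin_map R\<^sub>0 ?Q (P\<lparr>carrier := N\<rparr>) r" using r by (auto simp: lin_map_def)
    from lin_map_comp[OF this lin_map_R0[OF h]] show ?thesis .
  qed
  have mP: "m b \<in> \<P> n" "m b \<in> carrier P" if "b \<in> T" for b
    using m[OF that] component_carrier[OF P] by auto
  have am: "a \<odot>\<^bsub>P\<^esub> m b \<in> \<P> (Suc n)" if "a \<in> \<A> 1" "b \<in> T" for a b
    using graded_moduleD(4)[OF P that(1) mP(1)[OF that(2)]] by simp
  \<comment> \<open>Linear on \<open>J\<close>, where the degree 1 part of \<open>c a\<close> is the
    degree 0 part of \<open>c\<close> times the degree 1 part of \<open>a\<close>; on all of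
    \<open>A\<close> a further term would appear.\<close>
  let ?\<gamma> = "\<lambda>b a. h (r (A_part 1 a \<odot>\<^bsub>P\<^esub> m b))"
  have \<gamma>: "lin_map A J_mod D (?\<gamma> b)" if b: "b \<in> T" for b
  proof (rule lin_mapI)
    fix a assume "a \<in> carrier J_mod"
    then have a: "a \<in> J" "a \<in> carrier A" using J_carrier[of a] by simp_all
    note a1 = A_part_in[OF a(2), of 1]
    show "?\<gamma> b a \<in> carrier D" using lin_mapD(1)[OF hr] am[OF a1 b] by simp
    fix c assume "c \<in> carrier J_mod"
    then have c: "c \<in> carrier A" using J_carrier[of c] by simp
    note c1 = A_part_in[OF c, of 1]
    have "A_part 1 (a \<oplus>\<^bsub>A\<^esub> c) \<odot>\<^bsub>P\<^esub> m b = A_part 1 a \<odot>\<^bsub>P\<^esub> m b \<oplus>\<^bsub>P\<^esub> A_part 1 c \<odot>\<^bsub>P\<^esub> m b"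
      using A_part_closed[OF a(2)] A_part_closed[OF c] mP(2)[OF b]
      by (simp add: A.homogeneous_part_add[OF A_dsd a(2) c] P.smult_l_distr)
    then show "?\<gamma> b (a \<oplus>\<^bsub>J_mod\<^esub> c) = ?\<gamma> b a \<oplus>\<^bsub>D\<^esub> ?\<gamma> b c"
      using lin_mapD(2)[OF hr, of "A_part 1 a \<odot>\<^bsub>P\<^esub> m b" "A_part 1 c \<odot>\<^bsub>P\<^esub> m b"] am[OF a1 b] am[OF c1 b] by simp
  next
    fix c a assume c: "c \<in> carrier A" and "a \<in> carrier J_mod"
    then have aJ: "a \<in> J" by simp
    then have a: "a \<in> carrier A" "A_part 0 a = \<zero>\<^bsub>A\<^esub>" by (simp_all add: J_def)
    note a1 = A_part_in[OF a(1), of 1] and c0 = A_part_in[OF c, of 0]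
    have "A_part 1 (c \<otimes>\<^bsub>A\<^esub> a) \<odot>\<^bsub>P\<^esub> m b = A_part 0 c \<odot>\<^bsub>P\<^esub> (A_part 1 a \<odot>\<^bsub>P\<^esub> m b)"
      unfolding A_part_mult_1[OF c a]
      by (rule P.smult_assoc1[OF A_part_closed[OF c] A_part_closed[OF a(1)] mP(2)[OF b]])
    then show "?\<gamma> b (c \<odot>\<^bsub>J_mod\<^esub> a) = c \<odot>\<^bsub>D\<^esub> ?\<gamma> b a"
      using lin_mapD(3)[OF hr, of "A_part 0 c" "A_part 1 a \<odot>\<^bsub>P\<^esub> m b"] am[OF a1 b] c0
      by (simp add: A_part_0_degree_0[OF c0])
  qed
  let ?S = "\<lambda>x. \<Oplus>\<^bsub>D\<^esub> b\<in>T. ?\<gamma> b (\<theta> b x)"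
  \<comment> \<open>The claim \<open>\<theta> b x \<in> J\<close> is carried along because
    \<open>?\<gamma> b\<close> is established as a linear map on \<open>J\<close> only.\<close>
  have key: "x \<in> \<P> (Suc n) \<and> (\<forall>b\<in>T. \<theta> b x \<in> J) \<and> h (r x) = ?S x" if x: "x \<in> span_prod P (\<A> 1) (\<P> n)" for x
  proof (rule span_prod_induct[OF PM A_component_subset A_component_closed(3) submoduleD(1)[OF sub] x,
        where P = "\<lambda>x. x \<in> \<P> (Suc n) \<and> (\<forall>b\<in>T. \<theta> b x \<in> J) \<and> h (r x) = ?S x"])
    have "?\<gamma> b (\<theta> b \<zero>\<^bsub>P\<^esub>) = \<zero>\<^bsub>D\<^esub>" "\<theta> b \<zero>\<^bsub>P\<^esub> = \<zero>\<^bsub>A\<^esub>" if "b \<in> T" for b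
      using lin_map_0[OF PM regular_A(1) \<theta>(1)[OF that]] lin_map_0[OF J_left_module D_left_module \<gamma>[OF that]] by simp_all
    moreover have "h (r \<zero>\<^bsub>P\<^esub>) = \<zero>\<^bsub>A\<^esub>" using lin_map_0[OF QM DM0 hr] by simp
    ultimately show "\<zero>\<^bsub>P\<^esub> \<in> \<P> (Suc n) \<and> (\<forall>b\<in>T. \<theta> b \<zero>\<^bsub>P\<^esub> \<in> J) \<and> h (r \<zero>\<^bsub>P\<^esub>) = ?S \<zero>\<^bsub>P\<^esub>"
      using submoduleD(2)[OF sub] submoduleD(2)[OF J_submodule] D.M.add.finprod_one_eqI[of T "\<lambda>b. ?\<gamma> b (\<theta> b \<zero>\<^bsub>P\<^esub>)"] by simp
  next
    fix a q assume a: "a \<in> \<A> 1" and q: "q \<in> \<P> n"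
    have aA: "a \<in> carrier A" and qP: "q \<in> carrier P" using A_component_carrier[OF a] component_carrier[OF P q] .
    have aJ: "a \<in> J" by (rule positive_degree_J[OF a]) simp
    have fq: "f b q \<in> \<A> 0" if "b \<in> T" for b using lin_mapD(1)[OF f[OF that], of q] q by simp
    have \<theta>q: "\<theta> b (a \<odot>\<^bsub>P\<^esub> q) = a \<otimes>\<^bsub>A\<^esub> \<theta> b q" "\<theta> b q \<in> carrier A" if "b \<in> T" for b
      using lin_mapD(3)[OF \<theta>(1)[OF that] aA qP] lin_mapD(1)[OF \<theta>(1)[OF that] qP] by simp_all
    have "?\<gamma> b (\<theta> b (a \<odot>\<^bsub>P\<^esub> q)) = h (r (a \<odot>\<^bsub>P\<^esub> (f b q \<odot>\<^bsub>P\<^esub> m b)))" if b: "b \<in> T" for b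
    proof -
      have "A_part 1 (a \<otimes>\<^bsub>A\<^esub> \<theta> b q) = a \<otimes>\<^bsub>A\<^esub> A_part 0 (\<theta> b q)"
        using part_smult_homogeneous[OF regular_A(2) a, of "\<theta> b q" 1] \<theta>q(2)[OF b] aA by (simp add: A_mod_part)
      also have "A_part 0 (\<theta> b q) = f b q" using \<theta>(2)[OF b qP] part_homogeneous[OF P q, of n] by simp
      finally show ?thesis
        using \<theta>q(1)[OF b] P.smult_assoc1[OF aA A_component_carrier[OF fq[OF b]] mP(2)[OF b]] by simp
    qed
    then have "?S (a \<odot>\<^bsub>P\<^esub> q) = (\<Oplus>\<^bsub>D\<^esub> b\<in>T. h (r (a \<odot>\<^bsub>P\<^esub> (f b q \<odot>\<^bsub>P\<^esub> m b))))"
    proof (intro D.M.finsum_cong')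
      show "(\<lambda>b. h (r (a \<odot>\<^bsub>P\<^esub> (f b q \<odot>\<^bsub>P\<^esub> m b)))) \<in> T \<rightarrow> carrier D"
      proof
        fix b assume b: "b \<in> T"
        have "f b q \<odot>\<^bsub>P\<^esub> m b \<in> \<P> n" using submoduleD(6)[OF sub, of "f b q" "m b" n] fq[OF b] mP(1)[OF b] by simp
        from graded_moduleD(4)[OF P a this] show "h (r (a \<odot>\<^bsub>P\<^esub> (f b q \<odot>\<^bsub>P\<^esub> m b))) \<in> carrier D"
          using lin_mapD(1)[OF hr] by simp
      qed
    qed auto
    also have "\<dots> = h (r (\<Oplus>\<^bsub>?Q\<^esub> b\<in>T. a \<odot>\<^bsub>P\<^esub> (f b q \<odot>\<^bsub>P\<^esub> m b)))"
    proof (rule lin_map_finsum[OF QM DM0 hr, symmetric], rule Pi_I)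
      fix b assume b: "b \<in> T"
      have "f b q \<odot>\<^bsub>P\<^esub> m b \<in> \<P> n" using submoduleD(6)[OF sub, of "f b q" "m b" n] fq[OF b] mP(1)[OF b] by simp
      from graded_moduleD(4)[OF P a this] show "a \<odot>\<^bsub>P\<^esub> (f b q \<odot>\<^bsub>P\<^esub> m b) \<in> carrier ?Q" by simp
    qed
    also have "(\<Oplus>\<^bsub>?Q\<^esub> b\<in>T. a \<odot>\<^bsub>P\<^esub> (f b q \<odot>\<^bsub>P\<^esub> m b)) = (\<Oplus>\<^bsub>P\<^esub> b\<in>T. a \<odot>\<^bsub>P\<^esub> (f b q \<odot>\<^bsub>P\<^esub> m b))"
    proof (rule finsum_submodule[OF PM0 sub], rule Pi_I)
      fix b assume b: "b \<in> T"
      have "f b q \<odot>\<^bsub>P\<^esub> m b \<in> \<P> n" using submoduleD(6)[OF sub, of "f b q" "m b" n] fq[OF b] mP(1)[OF b] by simp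
      from graded_moduleD(4)[OF P a this] show "a \<odot>\<^bsub>P\<^esub> (f b q \<odot>\<^bsub>P\<^esub> m b) \<in> \<P> (Suc n)" by simp
    qed
    also have "\<dots> = a \<odot>\<^bsub>P\<^esub> (\<Oplus>\<^bsub>P\<^esub> b\<in>T. f b q \<odot>\<^bsub>P\<^esub> m b)"
      by (rule P.finsum_smult[OF T aA, symmetric]) (use A_component_carrier[OF fq] mP(2) in auto)
    also have "(\<Oplus>\<^bsub>P\<^esub> b\<in>T. f b q \<odot>\<^bsub>P\<^esub> m b) = (\<Oplus>\<^bsub>?Pn\<^esub> b\<in>T. f b q \<odot>\<^bsub>P\<^esub> m b)"
      by (rule finsum_submodule[OF PM0 sub, symmetric])
         (use submoduleD(6)[OF sub] fq mP(1) in auto)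
    also have "\<dots> = q" using basis[of q] q by simp
    finally have "h (r (a \<odot>\<^bsub>P\<^esub> q)) = ?S (a \<odot>\<^bsub>P\<^esub> q)" by simp
    moreover have "a \<odot>\<^bsub>P\<^esub> q \<in> \<P> (Suc n)" using graded_moduleD(4)[OF P a q] by simp
    moreover have "\<theta> b (a \<odot>\<^bsub>P\<^esub> q) \<in> J" if "b \<in> T" for b using J_mult(1)[OF aJ \<theta>q(2)[OF that]] \<theta>q(1)[OF that] by simp
    ultimately show "a \<odot>\<^bsub>P\<^esub> q \<in> \<P> (Suc n) \<and> (\<forall>b\<in>T. \<theta> b (a \<odot>\<^bsub>P\<^esub> q) \<in> J) \<and> h (r (a \<odot>\<^bsub>P\<^esub> q)) = ?S (a \<odot>\<^bsub>P\<^esub> q)" by blast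
  next
    fix x y assume xP: "x \<in> carrier P" and yP: "y \<in> carrier P"
      and x: "x \<in> \<P> (Suc n) \<and> (\<forall>b\<in>T. \<theta> b x \<in> J) \<and> h (r x) = ?S x"
      and y: "y \<in> \<P> (Suc n) \<and> (\<forall>b\<in>T. \<theta> b y \<in> J) \<and> h (r y) = ?S y"
    have J_add: "\<theta> b (x \<oplus>\<^bsub>P\<^esub> y) = \<theta> b x \<oplus>\<^bsub>A\<^esub> \<theta> b y" "\<theta> b (x \<oplus>\<^bsub>P\<^esub> y) \<in> J" if "b \<in> T" for b
      using lin_mapD(2)[OF \<theta>(1)[OF that] xP yP] submoduleD(4)[OF J_submodule, of "\<theta> b x" "\<theta> b y"] x y that by simp_all
    have "?S (x \<oplus>\<^bsub>P\<^esub> y) = (\<Oplus>\<^bsub>D\<^esub> b\<in>T. ?\<gamma> b (\<theta> b x) \<oplus>\<^bsub>D\<^esub> ?\<gamma> b (\<theta> b y))"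
    proof (rule D.M.finsum_cong'[OF refl])
      show "(\<lambda>b. ?\<gamma> b (\<theta> b x) \<oplus>\<^bsub>D\<^esub> ?\<gamma> b (\<theta> b y)) \<in> T \<rightarrow> carrier D"
        using lin_mapD(1)[OF \<gamma>] x y D.M.a_closed by (simp add: Pi_iff del: D_simps)
      show "?\<gamma> b (\<theta> b (x \<oplus>\<^bsub>P\<^esub> y)) = ?\<gamma> b (\<theta> b x) \<oplus>\<^bsub>D\<^esub> ?\<gamma> b (\<theta> b y)" if "b \<in> T" for b
        using lin_mapD(2)[OF \<gamma>[OF that], of "\<theta> b x" "\<theta> b y"] x y that J_add(1)[OF that] by simp
    qed
    also have "\<dots> = ?S x \<oplus>\<^bsub>D\<^esub> ?S y"
      using lin_mapD(1)[OF \<gamma>] x y by (intro D.M.finsum_addf) (simp_all add: Pi_iff del: D_simps)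
    also have "\<dots> = h (r (x \<oplus>\<^bsub>P\<^esub> y))" using lin_mapD(2)[OF hr, of x y] x y by simp
    finally show "x \<oplus>\<^bsub>P\<^esub> y \<in> \<P> (Suc n) \<and> (\<forall>b\<in>T. \<theta> b (x \<oplus>\<^bsub>P\<^esub> y) \<in> J) \<and> h (r (x \<oplus>\<^bsub>P\<^esub> y)) = ?S (x \<oplus>\<^bsub>P\<^esub> y)"
      using J_add(2) submoduleD(4)[OF sub, of x _ y] x y by auto
  qed
  have S_lin: "lin_map A (P\<lparr>carrier := N\<rparr>) D ?S"
  proof (rule lin_map_sum[OF D_left_module NM])
    fix b assume b: "b \<in> T"
    have "lin_map A (P\<lparr>carrier := N\<rparr>) J_mod (\<theta> b)"
      using \<theta>(1)[OF b] NP linear_step_J[OF st \<theta>(1)[OF b]] by (auto simp: lin_map_def)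
    from lin_map_comp[OF this \<gamma>[OF b]] show "lin_map A (P\<lparr>carrier := N\<rparr>) D (\<lambda>x. ?\<gamma> b (\<theta> b x))" .
  qed
  have eq1: "h x = ?S x" if x: "x \<in> N \<inter> \<P> (Suc n)" for x
  proof -
    have "x \<in> span_prod P (\<A> (Suc n - n)) (\<P> n)" by (rule generated_component(2)[OF P gen]) (use x in auto)
    then have "x \<in> span_prod P (\<A> 1) (\<P> n)" by simp
    from key[OF this] show ?thesis using r_id[OF x] by simp
  qed
  \<comment> \<open>Both sides are homomorphisms on \<open>N\<close> that agree on its component of
    degree \<open>n + 1\<close>, and this component generates \<open>N\<close>.\<close>
  have diff: "lin_map A (P\<lparr>carrier := N\<rparr>) D (\<lambda>x. h x \<ominus>\<^bsub>D\<^esub> ?S x)" by (rule lin_map_diff[OF D_left_module h S_lin])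
  note ker = kernel_submodule[OF NM D_left_module diff]
  have "N \<inter> \<P> (Suc n) \<subseteq> {x \<in> carrier (P\<lparr>carrier := N\<rparr>). h x \<ominus>\<^bsub>D\<^esub> ?S x = \<zero>\<^bsub>D\<^esub>}"
  proof
    fix x assume x: "x \<in> N \<inter> \<P> (Suc n)"
    have "h x \<in> carrier D" using lin_mapD(1)[OF h] x by simp
    then have "h x \<ominus>\<^bsub>D\<^esub> h x = \<zero>\<^bsub>D\<^esub>" using D.M.minus_eq_zero_iff by blast
    then show "x \<in> {x \<in> carrier (P\<lparr>carrier := N\<rparr>). h x \<ominus>\<^bsub>D\<^esub> ?S x = \<zero>\<^bsub>D\<^esub>}" using x eq1[OF x] by simp
  qed
  then have "span_prod (P\<lparr>carrier := N\<rparr>) (carrier A) (N \<inter> \<P> (Suc n)) \<subseteq>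
      {x \<in> carrier (P\<lparr>carrier := N\<rparr>). h x \<ominus>\<^bsub>D\<^esub> ?S x = \<zero>\<^bsub>D\<^esub>}"
    by (intro span_prod_least[OF NM ker]) (use submoduleD(6)[OF ker] in blast)
  then have "h x \<ominus>\<^bsub>D\<^esub> ?S x = \<zero>\<^bsub>D\<^esub>" if "x \<in> N" for x
    using genN that unfolding generated_in_degree_def by auto
  then have hS: "h x = ?S x" if "x \<in> N" for x
    using that D.M.minus_eq_zero_iff[of "h x" "?S x"] lin_mapD(1)[OF h, of x] lin_mapD(1)[OF S_lin, of x]
    by (simp del: D_simps)
  show ?thesis by (rule that[of T ?\<gamma> \<theta>, OF T \<gamma> \<theta>(1) hS])
qed


text \<open>A cocycle descends to the standard syzygy, is carried to \<open>N\<close> by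
  \<open>\<beta>\<close>, factored there and pulled back along \<open>\<alpha>\<close>. The two
  transports compose to the identity plus \<open>s\<close>, and since \<open>s\<close> maps all of
  \<open>std_mod A M n\<close> into the syzygy, its contribution is a coboundary.\<close>

lemma products_generate:
  fixes M :: "('a, 'm) module" and P :: "('a, 'p) module"
  assumes M: "left_module A M" and st: "linear_step n P \<P> N"
    and genN: "generated_in_degree A (P\<lparr>carrier := N\<rparr>) (\<lambda>j. N \<inter> \<P> j) (Suc n)"
    and proj: "projective_module R\<^sub>0 (P\<lparr>carrier := \<P> n\<rparr>)" and fdn: "fd P (\<P> n)"
    and r: "lin_map R\<^sub>0 (P\<lparr>carrier := \<P> (Suc n)\<rparr>) (P\<lparr>carrier := N \<inter> \<P> (Suc n)\<rparr>) r"
    and r_id: "\<And>x. x \<in> N \<inter> \<P> (Suc n) \<Longrightarrow> r x = x"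
    and \<alpha>: "lin_map A (std_mod A M n) P \<alpha>" "\<And>x. x \<in> std_syz A M n \<Longrightarrow> \<alpha> x \<in> N"
    and \<beta>: "lin_map A P (std_mod A M n) \<beta>" "\<And>x. x \<in> N \<Longrightarrow> \<beta> x \<in> std_syz A M n"
    and s: "lin_map A (std_mod A M n) (std_mod A M n) s"
    "\<And>x. x \<in> carrier (std_mod A M n) \<Longrightarrow> s x \<in> std_syz A M n"
    "\<And>x. x \<in> std_syz A M n \<Longrightarrow> \<beta> (\<alpha> x) = x \<oplus>\<^bsub>std_mod A M n\<^esub> s x"
  shows "ext_prod A M D D 1 n = carrier (Ext A M D (Suc n))"
proof -
  interpret D: left_module A D by (rule D_left_module)
  interpret Am: left_module A A_mod by (rule regular_A)
  interpret Y: yoneda_setting A M D D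
    by (intro yoneda_setting.intro ext_setting.intro yoneda_setting_axioms.intro M D_left_module)
  note PM = linear_stepD(7)[OF st] and N = linear_stepD(6)[OF st]
  note NP = submoduleD(3)[OF N]
  note Ln = Y.L_std[of n] and dl = std_diff_lin_map[OF M, of n] and im = std_diff_image[OF M, of n]
  note Y0 = Y.M_std[of 0]
  have augl: "lin_map A (std_mod A D 0) D (std_aug A D)"
    using std_aug_lin_map[OF D_left_module] by blast
  have dlD: "lin_map A (std_mod A D 1) (std_mod A D 0) (std_diff A D 0)"
    using std_diff_lin_map[OF D_left_module, of 0] by (simp del: std_mod.simps)
  obtain \<psi> \<chi> where \<psi>: "lin_map A (std_mod A D 0) A_mod \<psi>"
    "\<And>y. y \<in> carrier (std_mod A D 0) \<Longrightarrow> A_part 0 (\<psi> y) = std_aug A D y"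
    and \<chi>: "lin_map A A_mod (std_mod A D 0) \<chi>" "\<And>a. a \<in> carrier A \<Longrightarrow> std_aug A D (\<chi> a) = A_part 0 a"
    by (rule D_cover_comparison) blast
  have "C \<in> ext_prod A M D D 1 n" if C: "C \<in> carrier (Ext A M D (Suc n))" for C
  proof -
    obtain c where c: "c \<in> cocycles A M D (Suc n)" "C = ext_class A M D (Suc n) c" by (rule Y.Ext_carrierE[OF C])
    have ker: "c y = \<zero>\<^bsub>D\<^esub>" if y: "y \<in> carrier (std_mod A M (Suc n))" "std_diff A M n y = \<zero>\<^bsub>std_mod A M n\<^esub>" for y
    proof -
      have "y \<in> std_syz A M (Suc n)" unfolding std_syz_Suc[OF M] using y by (simp del: std_mod.simps)
      then obtain w where w: "w \<in> carrier (std_mod A M (Suc (Suc n)))" "y = std_diff A M (Suc n) w"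
        unfolding std_diff_image[OF M, symmetric] by (elim imageE)
      show ?thesis unfolding w(2) by (rule cocyclesD(3)[OF c(1) w(1)])
    qed
    obtain c' where c': "lin_map A (std_mod A M n\<lparr>carrier := std_syz A M n\<rparr>) D c'"
      "\<And>y. y \<in> carrier (std_mod A M (Suc n)) \<Longrightarrow> c' (std_diff A M n y) = c y"
      by (rule factor_surjective[OF Y.L_std Ln D_left_module dl im cocyclesD(1)[OF c(1)] ker]) blast+
    have h: "lin_map A (P\<lparr>carrier := N\<rparr>) D (\<lambda>x. c' (\<beta> x))"
      by (rule lin_map_comp[OF _ c'(1)]) (use \<beta> NP in \<open>auto simp: lin_map_def simp del: std_mod.simps std_syz.simps\<close>)
    obtain T :: "'p set" and \<gamma> \<theta> where T: "finite T" and \<gamma>: "\<And>t. t \<in> T \<Longrightarrow> lin_map A J_mod D (\<gamma> t)"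
      and \<theta>: "\<And>t. t \<in> T \<Longrightarrow> lin_map A P A_mod (\<theta> t)"
      and fact: "\<And>x. x \<in> N \<Longrightarrow> c' (\<beta> x) = (\<Oplus>\<^bsub>D\<^esub> t\<in>T. \<gamma> t (\<theta> t x))"
      by (rule linear_factorization[OF st genN proj fdn r r_id h]) blast+
    let ?\<theta>\<alpha> = "\<lambda>t x. \<theta> t (\<alpha> x)"
    have \<theta>\<alpha>: "lin_map A (std_mod A M n) A_mod (?\<theta>\<alpha> t)" if "t \<in> T" for t
      by (rule lin_map_comp[OF \<alpha>(1) \<theta>[OF that]])
    have \<alpha>_syz: "\<alpha> (std_diff A M n y) \<in> N" if "y \<in> carrier (std_mod A M (Suc n))" for y
      using \<alpha>(2) imageI[OF that, of "std_diff A M n"] unfolding im by blast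
    have \<theta>\<alpha>_J: "?\<theta>\<alpha> t (std_diff A M n y) \<in> J" if "t \<in> T" "y \<in> carrier (std_mod A M (Suc n))" for t y
      by (rule linear_step_J[OF st \<theta>[OF that(1)] \<alpha>_syz[OF that(2)]])
    \<comment> \<open>A cocycle because \<open>\<alpha>\<close> sends boundaries to \<open>N\<close>
      and \<open>\<theta> t\<close> sends \<open>N\<close> into \<open>J\<close>, the kernel of
      \<open>A\<close> onto \<open>D\<close>.\<close>
    let ?f = "\<lambda>t. \<lambda>x\<in>carrier (std_mod A M n). A_part 0 (?\<theta>\<alpha> t x)"
    let ?\<phi> = "\<lambda>t x. \<chi> (?\<theta>\<alpha> t x)"
    have \<phi>: "lin_map A (std_mod A M n) (std_mod A D 0) (?\<phi> t)" if "t \<in> T" for t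
      by (rule lin_map_comp[OF \<theta>\<alpha>[OF that] \<chi>(1)])
    have f: "?f t \<in> cocycles A M D n" if t: "t \<in> T" for t
    proof (rule cocyclesI[OF M lin_map_comp[OF \<theta>\<alpha>[OF t] D_projection(1)]])
      show "A_part 0 (?\<theta>\<alpha> t (std_diff A M n y)) = \<zero>\<^bsub>D\<^esub>" if "y \<in> carrier (std_mod A M (Suc n))" for y
        using \<theta>\<alpha>_J[OF t that] by (simp add: J_def)
    qed
    have aug: "std_aug A D (?\<phi> t x) = ?f t x" if "t \<in> T" "x \<in> carrier (std_mod A M n)" for t x
      using \<chi>(2)[of "?\<theta>\<alpha> t x"] lin_mapD(1)[OF \<theta>\<alpha>[OF that(1)] that(2)] that(2) by simp
    have \<psi>\<delta>_J: "\<psi> (std_diff A D 0 z) \<in> J" if z: "z \<in> carrier (std_mod A D 1)" for z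
    proof -
      have dz: "std_diff A D 0 z \<in> carrier (std_mod A D 0)" by (rule lin_mapD(1)[OF dlD z])
      have "std_aug A D (std_diff A D 0 z) = \<zero>\<^bsub>D\<^esub>"
        using std_aug_diff[OF D_left_module, of z] z by (simp del: std_mod.simps)
      then show ?thesis using \<psi>(2)[OF dz] lin_mapD(1)[OF \<psi>(1) dz] by (simp add: J_def)
    qed
    \<comment> \<open>\<open>\<gamma> t\<close> lives on \<open>J\<close>; along
      \<open>\<psi>\<close> it becomes a cocycle of the standard resolution of
      \<open>D\<close>.\<close>
    let ?g = "\<lambda>t. \<lambda>z\<in>carrier (std_mod A D 1). \<gamma> t (\<psi> (std_diff A D 0 z))"
    have g: "?g t \<in> cocycles A D D 1" if t: "t \<in> T" for t
    proof (rule cocyclesI[OF D_left_module])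
      have "lin_map A (std_mod A D 1) J_mod (\<lambda>z. \<psi> (std_diff A D 0 z))"
        using lin_map_comp[OF dlD \<psi>(1)] \<psi>\<delta>_J by (simp add: lin_map_def)
      from lin_map_comp[OF this \<gamma>[OF t]] show "lin_map A (std_mod A D 1) D (\<lambda>z. \<gamma> t (\<psi> (std_diff A D 0 z)))" .
      fix w assume w: "w \<in> carrier (std_mod A D (Suc 1))"
      have "std_diff A D 0 (std_diff A D 1 w) = \<zero>\<^bsub>std_mod A D 0\<^esub>"
        using std_diff_diff[OF D_left_module, of w 0] w by (simp del: std_mod.simps free_module_simps)
      then show "\<gamma> t (\<psi> (std_diff A D 0 (std_diff A D 1 w))) = \<zero>\<^bsub>D\<^esub>"
        using lin_map_0[OF Y0 regular_A(1) \<psi>(1)] lin_map_0[OF J_left_module D_left_module \<gamma>[OF t]] by simp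
    qed
    \<comment> \<open>The products add up to the value of \<open>c\<close> plus that of
      \<open>c' \<circ> s\<close>; the sign cancels the second term.\<close>
    let ?e = "\<lambda>x. \<ominus>\<^bsub>D\<^esub> c' (s x)"
    have c's: "lin_map A (std_mod A M n) D (\<lambda>x. c' (s x))"
      by (rule lin_map_comp[OF _ c'(1)]) (use s(1,2) in \<open>simp add: lin_map_def del: std_mod.simps std_syz.simps\<close>)
    have e: "lin_map A (std_mod A M n) D ?e" by (rule lin_map_uminus[OF D_left_module c's])
    show ?thesis unfolding c(2)
    proof (rule Y.ext_class_in_ext_prod[OF c(1) T f g \<phi> aug e])
      fix y z assume y: "y \<in> carrier (std_mod A M (Suc n))"
        and z: "\<And>t. t \<in> T \<Longrightarrow> z t \<in> carrier (std_mod A D 1)"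
        and z\<phi>: "\<And>t. t \<in> T \<Longrightarrow> std_diff A D 0 (z t) = ?\<phi> t (std_diff A M n y)"
      let ?y = "std_diff A M n y"
      have yW: "?y \<in> std_syz A M n" using imageI[OF y, of "std_diff A M n"] unfolding im .
      have yX: "?y \<in> carrier (std_mod A M n)" by (rule lin_mapD(1)[OF dl y])
      have gz: "?g t (z t) = \<gamma> t (?\<theta>\<alpha> t ?y)" if t: "t \<in> T" for t
      proof -
        let ?a = "?\<theta>\<alpha> t ?y"
        have aJ: "?a \<in> J" by (rule \<theta>\<alpha>_J[OF t y])
        note aA = J_carrier[OF aJ]
        \<comment> \<open>\<open>\<psi> \<circ> \<chi>\<close> is the identity of \<open>A\<close>
          only modulo \<open>J\<close>. The difference maps all of \<open>A\<close> into
          \<open>J\<close>, so after \<open>\<gamma> t\<close> it is a homomorphism from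
          \<open>A\<close> to \<open>D\<close>; it kills \<open>?a\<close>, written as
          \<open>?a\<close> times one with \<open>?a\<close> in \<open>J\<close>.\<close>
        have \<kappa>: "lin_map A A_mod J_mod (\<lambda>a. \<psi> (\<chi> a) \<ominus>\<^bsub>A_mod\<^esub> a)"
        proof -
          have l: "lin_map A A_mod A_mod (\<lambda>a. \<psi> (\<chi> a) \<ominus>\<^bsub>A_mod\<^esub> a)"
            by (rule lin_map_diff[OF regular_A(1) lin_map_comp[OF \<chi>(1) \<psi>(1)] lin_map_id])
          have "\<psi> (\<chi> a) \<ominus>\<^bsub>A_mod\<^esub> a \<in> J" if a: "a \<in> carrier A" for a
          proof -
            have \<chi>a: "\<chi> a \<in> carrier (std_mod A D 0)" and \<psi>\<chi>a: "\<psi> (\<chi> a) \<in> carrier A_mod"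
              using lin_mapD(1)[OF \<chi>(1)] lin_mapD(1)[OF \<psi>(1)] a by simp_all
            have "A_part 0 (\<psi> (\<chi> a) \<ominus>\<^bsub>A_mod\<^esub> a) = A_part 0 (\<psi> (\<chi> a)) \<ominus>\<^bsub>D\<^esub> A_part 0 a"
              by (rule lin_map_minus[OF regular_A(1) D_left_module D_projection(1) \<psi>\<chi>a]) (use a in simp)
            also have "A_part 0 (\<psi> (\<chi> a)) = A_part 0 a" using \<psi>(2)[OF \<chi>a] \<chi>(2)[OF a] by simp
            also have "A_part 0 a \<ominus>\<^bsub>D\<^esub> A_part 0 a = \<zero>\<^bsub>D\<^esub>"
              by (rule iffD2[OF D.M.minus_eq_zero_iff refl]) (use A_part_in[OF a] in simp)+
            finally show ?thesis using lin_mapD(1)[OF l, of a] a by (simp add: J_def)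
          qed
          then show ?thesis using l by (simp add: lin_map_def)
        qed
        note \<gamma>\<kappa> = lin_map_comp[OF \<kappa> \<gamma>[OF t]]
        have "\<gamma> t (\<psi> (\<chi> (?a \<otimes>\<^bsub>A\<^esub> \<one>\<^bsub>A\<^esub>)) \<ominus>\<^bsub>A_mod\<^esub> (?a \<otimes>\<^bsub>A\<^esub> \<one>\<^bsub>A\<^esub>)) = \<zero>\<^bsub>A\<^esub>"
          using lin_map_D_J[OF \<gamma>\<kappa> aJ, of "\<one>\<^bsub>A\<^esub>"] by simp
        then have 0: "\<gamma> t (\<psi> (\<chi> ?a) \<ominus>\<^bsub>A_mod\<^esub> ?a) = \<zero>\<^bsub>A\<^esub>" using aA by simp
        have d: "\<psi> (\<chi> ?a) \<ominus>\<^bsub>A_mod\<^esub> ?a \<in> J" using lin_mapD(1)[OF \<kappa>, of ?a] aA by simp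
        have \<psi>\<chi>: "\<psi> (\<chi> ?a) \<in> carrier A_mod" using lin_mapD(1)[OF lin_map_comp[OF \<chi>(1) \<psi>(1)], of ?a] aA by simp
        have "\<psi> (\<chi> ?a) = ?a \<oplus>\<^bsub>A_mod\<^esub> (\<psi> (\<chi> ?a) \<ominus>\<^bsub>A_mod\<^esub> ?a)"
          by (rule Am.M.add_minus_cancel_right[symmetric]) (use aA \<psi>\<chi> in simp_all)
        also have "\<dots> = ?a \<oplus>\<^bsub>J_mod\<^esub> (\<psi> (\<chi> ?a) \<ominus>\<^bsub>A_mod\<^esub> ?a)" by simp
        finally have "\<gamma> t (\<psi> (\<chi> ?a)) = \<gamma> t (?a \<oplus>\<^bsub>J_mod\<^esub> (\<psi> (\<chi> ?a) \<ominus>\<^bsub>A_mod\<^esub> ?a))" by (rule arg_cong)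
        also have "\<dots> = \<gamma> t ?a \<oplus>\<^bsub>D\<^esub> \<gamma> t (\<psi> (\<chi> ?a) \<ominus>\<^bsub>A_mod\<^esub> ?a)"
          by (rule lin_mapD(2)[OF \<gamma>[OF t]]) (use aJ d in simp_all)
        also have "\<dots> = \<gamma> t ?a" unfolding 0 using lin_mapD(1)[OF \<gamma>[OF t], of ?a] aJ A_component_carrier[of _ 0] by simp
        finally show ?thesis using z[OF t] z\<phi>[OF t] by simp
      qed
      have cl: "c y \<in> carrier D" "c' (s ?y) \<in> carrier D"
        using Y.cocycle_closed[OF c(1) y] lin_mapD(1)[OF c's yX] by auto
      have "(\<Oplus>\<^bsub>D\<^esub> t\<in>T. ?g t (z t)) = (\<Oplus>\<^bsub>D\<^esub> t\<in>T. \<gamma> t (?\<theta>\<alpha> t ?y))"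
        using gz lin_mapD(1)[OF \<gamma>] \<theta>\<alpha>_J[OF _ y] by (intro D.M.finsum_cong'[OF refl]) (auto simp del: D_simps)
      also have "\<dots> = c' (\<beta> (\<alpha> ?y))" using fact[OF \<alpha>_syz[OF y]] by simp
      also have "\<dots> = c' (?y \<oplus>\<^bsub>std_mod A M n\<^esub> s ?y)" using s(3)[OF yW] by simp
      also have "\<dots> = c' ?y \<oplus>\<^bsub>D\<^esub> c' (s ?y)"
        using lin_mapD(2)[OF c'(1), of ?y "s ?y"] yW s(2)[OF yX] by (simp del: std_mod.simps std_syz.simps D_simps)
      also have "c' ?y = c y" by (rule c'(2)[OF y])
      finally have sum: "(\<Oplus>\<^bsub>D\<^esub> t\<in>T. ?g t (z t)) = c y \<oplus>\<^bsub>D\<^esub> c' (s ?y)" .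
      have "?e ?y \<oplus>\<^bsub>D\<^esub> (c y \<oplus>\<^bsub>D\<^esub> c' (s ?y)) = ?e ?y \<oplus>\<^bsub>D\<^esub> (c' (s ?y) \<oplus>\<^bsub>D\<^esub> c y)"
        by (simp only: D.M.a_comm[OF cl])
      also have "\<dots> = c y" by (rule D.M.r_neg1[OF cl(2,1)])
      finally show "c y = ?e ?y \<oplus>\<^bsub>D\<^esub> (\<Oplus>\<^bsub>D\<^esub> t\<in>T. ?g t (z t))" unfolding sum by simp
    qed
  qed
  then show ?thesis using Y.ext_prod_subset[of n] by blast
qed

section \<open>Graded covers\<close>

context
  fixes P :: "('a, 'p) module" and \<P> and Q :: "('a, 'q) module" and \<Q> and q :: "'p \<Rightarrow> 'q"
  assumes P: "graded_module A \<A> P \<P>" and Q: "graded_module A \<A> Q \<Q>" and q: "lin_map A P Q q"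
    and gr: "\<And>i. q ` \<P> i \<subseteq> \<Q> i" and surj: "q ` carrier P = carrier Q"
begin

abbreviation cover_kernel :: "'p set" where "cover_kernel \<equiv> {x \<in> carrier P. q x = \<zero>\<^bsub>Q\<^esub>}"

text \<open>\<open>q\<close> commutes with taking parts, so the degree \<open>j\<close> part of any
  preimage is a preimage inside degree \<open>j\<close>.\<close>

lemma cover_component: "q ` \<P> j = \<Q> j"
proof
  show "\<Q> j \<subseteq> q ` \<P> j"
  proof
    fix y assume y: "y \<in> \<Q> j"
    have "y \<in> q ` carrier P" unfolding surj by (rule component_carrier[OF Q y])
    then obtain x where x: "y = q x" "x \<in> carrier P" by (rule imageE)
    have "y = q (homogeneous_part P \<P> j x)"
      using lin_map_homogeneous_part[OF P Q q gr x(2), of j] part_homogeneous[OF Q y, of j] x(1) by simp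
    then show "y \<in> q ` \<P> j" using part_in[OF P x(2)] by (rule image_eqI)
  qed
qed (rule gr)

lemma cover_kernel_component: "cover_kernel \<inter> \<P> j = {x \<in> \<P> j. q x = \<zero>\<^bsub>Q\<^esub>}"
  using component_carrier[OF P] by blast

lemma cover_lin_map: "lin_map R\<^sub>0 (P\<lparr>carrier := \<P> j\<rparr>) (Q\<lparr>carrier := \<Q> j\<rparr>) q"
  using lin_map_R0[OF q] gr component_carrier[OF P] by (auto simp: lin_map_def image_subset_iff)

lemma P_component_module: "left_module R\<^sub>0 (P\<lparr>carrier := \<P> j\<rparr>)"
  by (rule submodule_left_module[OF left_module_R0[OF graded_moduleD(1)[OF P]] component_submodule[OF P]])

lemma Q_component_module: "left_module R\<^sub>0 (Q\<lparr>carrier := \<Q> j\<rparr>)"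
  by (rule submodule_left_module[OF left_module_R0[OF graded_moduleD(1)[OF Q]] component_submodule[OF Q]])

text \<open>In degree \<open>n\<close> the cover is bijective, so finite dimension passes from
  \<open>\<Q> n\<close> to \<open>\<P> n\<close>; the other degrees are generated from
  there.\<close>

lemma cover_fd:
  assumes gen: "generated_in_degree A P \<P> n" and ker: "cover_kernel \<inter> \<P> n = {\<zero>\<^bsub>P\<^esub>}" and fdQ: "fd Q (\<Q> n)"
  shows "fd P (\<P> j)"
proof (rule fd_generated[OF P gen])
  have inj: "inj_on q (carrier (P\<lparr>carrier := \<P> n\<rparr>))"
    by (rule lin_map_inj_on[OF P_component_module Q_component_module cover_lin_map])
       (use ker cover_kernel_component[of n] in auto)
  have sj: "q ` carrier (P\<lparr>carrier := \<P> n\<rparr>) = carrier (Q\<lparr>carrier := \<Q> n\<rparr>)" using cover_component by simp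
  have "bij_betw q (\<P> n) (\<Q> n)" using inj sj by (simp add: bij_betw_def)
  then have im: "inv_into (\<P> n) q ` \<Q> n = \<P> n" by (metis bij_betw_def bij_betw_inv_into)
  show "fd P (\<P> n)"
    by (rule fd_image[OF graded_moduleD(1)[OF Q] graded_moduleD(1)[OF P] component_submodule[OF Q] fdQ _
          component_submodule[OF P] im])
       (use lin_map_inv_into[OF P_component_module cover_lin_map inj sj] in simp)
qed

text \<open>In degree \<open>j\<close> the kernel and \<open>\<P> j\<close> form a short projective
  resolution over \<open>R\<^sub>0\<close>, to which finitistic dimension zero applies.\<close>

lemma cover_target_projective:
  assumes fin: "fin_dim R\<^sub>0 = 0" and proj: "projective_module R\<^sub>0 P" and fdQ: "fd Q (\<Q> j)"
    and ker: "projective_module R\<^sub>0 (P\<lparr>carrier := cover_kernel \<inter> \<P> j\<rparr>)"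
  shows "projective_module R\<^sub>0 (Q\<lparr>carrier := \<Q> j\<rparr>)"
proof (rule finite_dimensional_ring.projective_of_short_resolution[OF finite_dimensional_R0 fin Q_component_module
        fd_finitely_generated[OF graded_moduleD(1)[OF Q] component_submodule[OF Q] fdQ]
        component_projective[OF P proj] cover_lin_map])
  show "q ` carrier (P\<lparr>carrier := \<P> j\<rparr>) = carrier (Q\<lparr>carrier := \<Q> j\<rparr>)" using cover_component by simp
  show "projective_module R\<^sub>0 (P\<lparr>carrier := \<P> j\<rparr>\<lparr>carrier :=
      {x \<in> carrier (P\<lparr>carrier := \<P> j\<rparr>). q x = \<zero>\<^bsub>Q\<lparr>carrier := \<Q> j\<rparr>\<^esub>}\<rparr>)"
    using ker by (simp add: cover_kernel_component)
qed

lemma cover_kernel_projective: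
  assumes proj: "projective_module R\<^sub>0 P" and projQ: "projective_module R\<^sub>0 (Q\<lparr>carrier := \<Q> j\<rparr>)"
  shows "projective_module R\<^sub>0 (P\<lparr>carrier := cover_kernel \<inter> \<P> j\<rparr>)"
  using kernel_projective[OF component_projective[OF P proj] projQ cover_lin_map] cover_component[of j]
  by (simp add: cover_kernel_component)

lemma cover_kernel_retraction:
  assumes projQ: "projective_module R\<^sub>0 (Q\<lparr>carrier := \<Q> j\<rparr>)"
  obtains r where "lin_map R\<^sub>0 (P\<lparr>carrier := \<P> j\<rparr>) (P\<lparr>carrier := cover_kernel \<inter> \<P> j\<rparr>) r"
    "\<And>x. x \<in> cover_kernel \<inter> \<P> j \<Longrightarrow> r x = x"
proof -
  obtain r where "lin_map R\<^sub>0 (P\<lparr>carrier := \<P> j\<rparr>) (P\<lparr>carrier := \<P> j\<rparr>\<lparr>carrier :=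
      {x \<in> carrier (P\<lparr>carrier := \<P> j\<rparr>). q x = \<zero>\<^bsub>Q\<lparr>carrier := \<Q> j\<rparr>\<^esub>}\<rparr>) r"
    "\<And>x. x \<in> carrier (P\<lparr>carrier := \<P> j\<rparr>) \<Longrightarrow> q x = \<zero>\<^bsub>Q\<lparr>carrier := \<Q> j\<rparr>\<^esub> \<Longrightarrow> r x = x"
    by (rule kernel_retraction[OF P_component_module projQ cover_lin_map]) (use cover_component[of j] in auto)
  then show ?thesis by (intro that[of r]) (simp_all add: cover_kernel_component)
qed

lemma cover_linear_step:
  assumes proj: "projective_module A P" and gen: "generated_in_degree A P \<P> n"
    and ker: "cover_kernel \<inter> \<P> n = {\<zero>\<^bsub>P\<^esub>}"
  shows "linear_step n P \<P> cover_kernel"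
  unfolding linear_step_def using P proj gen ker kernel_graded_submodule[OF P Q q gr] by simp

end


lemma generated_in_degree_image:
  assumes P: "left_module A P" and Q: "left_module A Q" and q: "lin_map A P Q q" and surj: "q ` carrier P = carrier Q"
    and comp: "\<P> n \<subseteq> carrier P" "q ` \<P> n \<subseteq> \<Q> n" "\<Q> n \<subseteq> carrier Q" and gen: "generated_in_degree A P \<P> n"
  shows "generated_in_degree A Q \<Q> n"
proof -
  have sub: "submodule (span_prod Q (carrier A) (\<Q> n)) A Q" by (rule span_prod_submodule[OF Q comp(3)])
  have "span_prod P (carrier A) (\<P> n) \<subseteq> {x \<in> carrier P. q x \<in> span_prod Q (carrier A) (\<Q> n)}"
  proof (rule span_prod_least[OF P vimage_submodule[OF P Q q sub]])
    fix a p assume a: "a \<in> carrier A" and p: "p \<in> \<P> n"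
    have pP: "p \<in> carrier P" and qp: "q p \<in> \<Q> n" using comp(1,2) p by auto
    show "a \<odot>\<^bsub>P\<^esub> p \<in> {x \<in> carrier P. q x \<in> span_prod Q (carrier A) (\<Q> n)}"
      using lin_mapD(3)[OF q a pP] left_module.smult_closed[OF P a pP] span_prod_superset[OF a qp, of Q] by simp
  qed
  then have "q ` carrier P \<subseteq> span_prod Q (carrier A) (\<Q> n)"
    using gen unfolding generated_in_degree_def by auto
  then show ?thesis using submoduleD(1)[OF sub] surj unfolding generated_in_degree_def by auto
qed

lemma projective_of_components:
  fixes M :: "('a, 'm) module"
  assumes M: "graded_module A \<A> M \<M>" and proj: "\<And>j. projective_module R\<^sub>0 (M\<lparr>carrier := \<M> j\<rparr>)"
  shows "projective_module R\<^sub>0 M"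
proof -
  note MM = graded_moduleD(1)[OF M]
  interpret M: left_module A M by (rule MM)
  show ?thesis
  proof (rule projective_locally_finite_sum[of R\<^sub>0 M UNIV "\<lambda>j. M\<lparr>carrier := \<M> j\<rparr>" "\<lambda>j x. x" "homogeneous_part M \<M>"])
    show "left_module R\<^sub>0 M" by (rule left_module_R0[OF MM])
    show "lin_map R\<^sub>0 (M\<lparr>carrier := \<M> j\<rparr>) M (\<lambda>x. x)" for j
      using component_carrier[OF M] by (auto simp: lin_map_def)
    show "lin_map R\<^sub>0 M (M\<lparr>carrier := \<M> j\<rparr>) (homogeneous_part M \<M> j)" for j by (rule part_lin_map[OF M])
    fix x assume x: "x \<in> carrier M"
    note f = M.M.homogeneous_part_finite[OF M_dsd[OF M] x]
    show "finite {j \<in> UNIV. homogeneous_part M \<M> j x \<noteq> \<zero>\<^bsub>M\<lparr>carrier := \<M> j\<rparr>\<^esub>}" using f by simp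
    show "x = (\<Oplus>\<^bsub>M\<^esub> j\<in>{j \<in> UNIV. homogeneous_part M \<M> j x \<noteq> \<zero>\<^bsub>M\<lparr>carrier := \<M> j\<rparr>\<^esub>}. homogeneous_part M \<M> j x)"
      using M.M.homogeneous_part_sum[OF M_dsd[OF M] x f] by simp
  qed (rule proj)
qed

section \<open>The syzygies of a linear resolution\<close>

context
  fixes M :: "('a, 'm) module" and \<M> and P :: "nat \<Rightarrow> ('a, 'p) module" and \<P> and d and \<epsilon>
  assumes A_proj: "projective_module R\<^sub>0 A_mod" and fin: "fin_dim R\<^sub>0 = 0"
    and M: "graded_module A \<A> M \<M>" and fdM: "\<And>j. fd M (\<M> j)"
    and res: "projective_resolution A M P d \<epsilon>"
    and P: "\<And>n. graded_module A \<A> (P n) (\<P> n)" and gen: "\<And>n. generated_in_degree A (P n) (\<P> n) n"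
    and \<epsilon>: "\<And>i. \<epsilon> ` \<P> 0 i \<subseteq> \<M> i" and d: "\<And>n i. d n ` \<P> (Suc n) i \<subseteq> \<P> n i"
begin

abbreviation Syz :: "nat \<Rightarrow> 'p set" where "Syz n \<equiv> d n ` carrier (P (Suc n))"
abbreviation Syz_mod :: "nat \<Rightarrow> ('a, 'p) module" where "Syz_mod n \<equiv> P n\<lparr>carrier := Syz n\<rparr>"

text \<open>The zero in \<open>Syz_Suc\<close> is written as that of \<open>Syz_mod n\<close>, so
  that the right-hand side is literally the kernel of the cover of \<open>Syz_mod n\<close> by
  \<open>P (Suc n)\<close>.\<close>

lemma res_projective: "projective_module A (P n)"
  and res_diff: "lin_map A (P (Suc n)) (P n) (d n)"
  and res_aug: "lin_map A (P 0) M \<epsilon>" "\<epsilon> ` carrier (P 0) = carrier M"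
  and Syz_0: "Syz 0 = {x \<in> carrier (P 0). \<epsilon> x = \<zero>\<^bsub>M\<^esub>}"
  and Syz_Suc: "Syz (Suc n) = {x \<in> carrier (P (Suc n)). d n x = \<zero>\<^bsub>Syz_mod n\<^esub>}"
  using res unfolding projective_resolution_def by (auto intro: mod_hom_lin_map)

lemma Syz_graded: "graded_submodule (P n) (\<P> n) (Syz n)"
proof (cases n)
  case 0
  show ?thesis unfolding 0 Syz_0 by (rule kernel_graded_submodule[OF P M res_aug(1) \<epsilon>])
next
  case (Suc m)
  have "graded_submodule (P (Suc m)) (\<P> (Suc m)) {x \<in> carrier (P (Suc m)). d m x = \<zero>\<^bsub>P m\<^esub>}"
    by (rule kernel_graded_submodule[OF P P res_diff d])
  then show ?thesis unfolding Suc Syz_Suc by simp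
qed

lemma Syz_mod_graded: "graded_module A \<A> (Syz_mod n) (\<lambda>j. Syz n \<inter> \<P> n j)"
  by (rule graded_submodule_module[OF P Syz_graded])

lemma Syz_cover:
  "lin_map A (P (Suc n)) (Syz_mod n) (d n)" "\<And>i. d n ` \<P> (Suc n) i \<subseteq> Syz n \<inter> \<P> n i"
  "d n ` carrier (P (Suc n)) = carrier (Syz_mod n)"
  using res_diff[of n] d[of n] component_carrier[OF P[of "Suc n"]] by (auto simp: lin_map_def)

lemmas Syz_covers = P Syz_mod_graded Syz_cover

lemma Syz_component: "Syz n \<inter> \<P> n j = d n ` \<P> (Suc n) j"
  by (rule cover_component[OF Syz_covers, symmetric])

text \<open>The syzygy is the image of \<open>P (Suc n)\<close> degree by degree, and
  \<open>P (Suc n)\<close> is zero below degree \<open>n + 1\<close>.\<close>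

lemma Syz_low: assumes "j \<le> n" shows "Syz n \<inter> \<P> n j = {\<zero>\<^bsub>P n\<^esub>}"
proof
  have "x = \<zero>\<^bsub>P (Suc n)\<^esub>" if "x \<in> \<P> (Suc n) j" for x
    by (rule generated_component(1)[OF P gen that]) (use assms in simp)
  then show "Syz n \<inter> \<P> n j \<subseteq> {\<zero>\<^bsub>P n\<^esub>}"
    unfolding Syz_component using lin_map_0[OF graded_moduleD(1)[OF P] graded_moduleD(1)[OF P] res_diff] by auto
  show "{\<zero>\<^bsub>P n\<^esub>} \<subseteq> Syz n \<inter> \<P> n j"
    using submoduleD(2)[OF component_submodule[OF Syz_mod_graded[of n], of j]] by simp
qed

lemma Syz_linear_step: "linear_step n (P n) (\<P> n) (Syz n)"
  unfolding linear_step_def using P res_projective gen Syz_graded Syz_low by blast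

lemma Syz_generated: "generated_in_degree A (Syz_mod n) (\<lambda>j. Syz n \<inter> \<P> n j) (Suc n)"
  by (rule generated_in_degree_image[OF graded_moduleD(1)[OF P] graded_moduleD(1)[OF Syz_mod_graded] Syz_cover(1,3) _ _ _
        gen[of "Suc n"]])
     (use component_carrier[OF P] Syz_cover(2)[of n "Suc n"] in auto)

lemma fd_Syz:
  assumes "\<And>j. fd (P n) (\<P> n j)" shows "fd (Syz_mod n) (Syz n \<inter> \<P> n j)"
proof -
  have "submodule (Syz n \<inter> \<P> n j) R\<^sub>0 (P n)"
    by (rule Int_submodule[OF left_module_R0[OF graded_moduleD(1)[OF P]]
          submodule_R0[OF graded_moduleD(1)[OF P] linear_stepD(6)[OF Syz_linear_step]] component_submodule[OF P]])
  from fd_subset[OF graded_moduleD(1)[OF P] this component_submodule[OF P, of n j] _ assms]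
  show ?thesis by simp
qed

text \<open>Finite dimension climbs the resolution: each cover is bijective in its generating
  degree, and syzygies are subspaces.\<close>

lemma fd_res: "fd (P n) (\<P> n j)"
proof (induction n arbitrary: j)
  case 0
  show ?case
    by (rule cover_fd[OF P M res_aug(1) \<epsilon> res_aug(2) gen _ fdM]) (use Syz_low[of 0 0] Syz_0 in simp)
next
  case (Suc n)
  show ?case
    by (rule cover_fd[OF Syz_covers gen _ fd_Syz[OF Suc]])
       (use Syz_low[of "Suc n" "Suc n"] Syz_Suc in simp)
qed

lemma res_R0_projective: "projective_module R\<^sub>0 (P n)"
  by (rule restricted_projective[OF A_proj res_projective])

text \<open>For fixed \<open>j\<close> the components vanish from \<open>n = j\<close> on, so
  projectivity over \<open>R\<^sub>0\<close> propagates downwards in \<open>n\<close>, one short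
  exact sequence at a time.\<close>

lemma Syz_projective: "projective_module R\<^sub>0 (P n\<lparr>carrier := Syz n \<inter> \<P> n j\<rparr>)"
proof -
  \<comment> \<open>\<open>k\<close> bounds the distance from \<open>n\<close> to the range where
    the component is zero; this turns descending induction on \<open>n\<close> into induction on
    \<open>k\<close>.\<close>
  have "projective_module R\<^sub>0 (P n\<lparr>carrier := Syz n \<inter> \<P> n j\<rparr>)" if "j \<le> n + k" for n k
    using that
  proof (induction k arbitrary: n)
    case 0
    have "left_module R\<^sub>0 (P n\<lparr>carrier := Syz n \<inter> \<P> n j\<rparr>)"
      using submodule_left_module[OF left_module_R0[OF graded_moduleD(1)[OF Syz_mod_graded[of n]]]
          component_submodule[OF Syz_mod_graded[of n], of j]] by simp
    then show ?case by (rule projective_zero_module) (use Syz_low[of j n] 0 in simp)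
  next
    case (Suc k)
    have "projective_module R\<^sub>0 (P (Suc n)\<lparr>carrier := Syz (Suc n) \<inter> \<P> (Suc n) j\<rparr>)"
      by (rule Suc.IH) (use Suc.prems in simp)
    then have "projective_module R\<^sub>0 (Syz_mod n\<lparr>carrier := Syz n \<inter> \<P> n j\<rparr>)"
      by (intro cover_target_projective[OF Syz_covers fin res_R0_projective fd_Syz[OF fd_res]])
         (simp only: Syz_Suc)
    then show ?case by simp
  qed
  from this[of n j] show ?thesis by simp
qed

lemma resolved_component_projective: "projective_module R\<^sub>0 (M\<lparr>carrier := \<M> j\<rparr>)"
  by (rule cover_target_projective[OF P M res_aug(1) \<epsilon> res_aug(2) fin res_R0_projective fdM])
     (use Syz_projective[of 0 j] in \<open>simp only: Syz_0\<close>)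

text \<open>The defect \<open>s\<close> has to sit on the standard resolution, where it will become
  a coboundary. So the standard resolution plays the part of \<open>P\<close> in the comparison
  lemmas here.\<close>

lemma resolution_comparison:
  "\<exists>\<alpha> \<beta> s. lin_map A (std_mod A M n) (P n) \<alpha> \<and> (\<forall>x\<in>std_syz A M n. \<alpha> x \<in> Syz n) \<and>
     lin_map A (P n) (std_mod A M n) \<beta> \<and> (\<forall>x\<in>Syz n. \<beta> x \<in> std_syz A M n) \<and>
     lin_map A (std_mod A M n) (std_mod A M n) s \<and> (\<forall>x\<in>carrier (std_mod A M n). s x \<in> std_syz A M n) \<and>
     (\<forall>x\<in>std_syz A M n. \<beta> (\<alpha> x) = x \<oplus>\<^bsub>std_mod A M n\<^esub> s x)"
proof (induction n)
  case 0
  note MM = graded_moduleD(1)[OF M]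
  note aug = std_aug_lin_map[OF MM]
  obtain \<beta> \<alpha> s where *: "lin_map A (P 0) (std_mod A M 0) \<beta>" "\<And>x. x \<in> carrier (P 0) \<Longrightarrow> std_aug A M (\<beta> x) = \<epsilon> x"
    "lin_map A (std_mod A M 0) (P 0) \<alpha>" "\<And>x. x \<in> carrier (std_mod A M 0) \<Longrightarrow> \<epsilon> (\<alpha> x) = std_aug A M x"
    "lin_map A (std_mod A M 0) (std_mod A M 0) s" "\<And>x. x \<in> carrier (std_mod A M 0) \<Longrightarrow> std_aug A M (s x) = \<zero>\<^bsub>M\<^esub>"
    "\<And>x. x \<in> carrier (std_mod A M 0) \<Longrightarrow> \<beta> (\<alpha> x) = x \<oplus>\<^bsub>std_mod A M 0\<^esub> s x"
    by (rule comparison_base[OF MM res_projective aug(3) res_aug aug(1,2)]) blast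
  show ?case unfolding aug(4) Syz_0
    using *(2,4,6,7) lin_mapD(1)[OF *(1)] lin_mapD(1)[OF *(3)] lin_mapD(1)[OF *(5)]
    by (intro exI[of _ \<alpha>] exI[of _ \<beta>] exI[of _ s] conjI ballI CollectI *(1) *(3) *(5))
       (simp_all only: mem_Collect_eq)
next
  case (Suc n)
  note MM = graded_moduleD(1)[OF M]
  obtain \<alpha> \<beta> s where *: "lin_map A (std_mod A M n) (P n) \<alpha>" "\<forall>x\<in>std_syz A M n. \<alpha> x \<in> Syz n"
     "lin_map A (P n) (std_mod A M n) \<beta>" "\<forall>x\<in>Syz n. \<beta> x \<in> std_syz A M n"
     "lin_map A (std_mod A M n) (std_mod A M n) s" "\<forall>x\<in>carrier (std_mod A M n). s x \<in> std_syz A M n"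
     "\<forall>x\<in>std_syz A M n. \<beta> (\<alpha> x) = x \<oplus>\<^bsub>std_mod A M n\<^esub> s x"
    using Suc by blast
  note st = bspec[OF *(4)] bspec[OF *(2)] bspec[OF *(6)] bspec[OF *(7)]
  have 0: "\<beta> \<zero>\<^bsub>P n\<^esub> = \<zero>\<^bsub>std_mod A M n\<^esub>" "\<alpha> \<zero>\<^bsub>std_mod A M n\<^esub> = \<zero>\<^bsub>P n\<^esub>"
    using lin_map_0[OF graded_moduleD(1)[OF P] std_mod_left_module[OF MM] *(3)]
      lin_map_0[OF std_mod_left_module[OF MM] graded_moduleD(1)[OF P] *(1)] by auto
  show ?case
  proof (rule comparison_step[OF graded_moduleD(1)[OF P] std_mod_projective[OF MM] res_projective
          std_mod_projective[OF MM] res_diff std_diff_lin_map[OF MM] *(3) _ *(1) _ *(5), unfolded std_diff_image[OF MM], OF st])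
    fix \<beta>' \<alpha>' s'
    assume n: "lin_map A (P (Suc n)) (std_mod A M (Suc n)) \<beta>'"
      "\<And>x. x \<in> carrier (P (Suc n)) \<Longrightarrow> std_diff A M n (\<beta>' x) = \<beta> (d n x)"
      "lin_map A (std_mod A M (Suc n)) (P (Suc n)) \<alpha>'"
      "\<And>x. x \<in> carrier (std_mod A M (Suc n)) \<Longrightarrow> d n (\<alpha>' x) = \<alpha> (std_diff A M n x)"
      "lin_map A (std_mod A M (Suc n)) (std_mod A M (Suc n)) s'"
      "\<And>x. x \<in> carrier (std_mod A M (Suc n)) \<Longrightarrow> std_diff A M n (s' x) = \<zero>\<^bsub>std_mod A M n\<^esub>"
      "\<And>x. x \<in> carrier (std_mod A M (Suc n)) \<Longrightarrow> std_diff A M n x = \<zero>\<^bsub>std_mod A M n\<^esub> \<Longrightarrow>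
        \<beta>' (\<alpha>' x) = x \<oplus>\<^bsub>std_mod A M (Suc n)\<^esub> s' x"
    show ?case
      unfolding std_syz_Suc[OF MM] Syz_Suc
      using n(2,4,6,7) lin_mapD(1)[OF n(1)] lin_mapD(1)[OF n(3)] lin_mapD(1)[OF n(5)] 0
      by (intro exI[of _ \<alpha>'] exI[of _ \<beta>'] exI[of _ s'] conjI ballI CollectI n(1) n(3) n(5))
         (simp_all del: std_mod.simps std_syz.simps free_module_simps)
  qed
qed

text \<open>The cokernel of the syzygy in \<open>P n\<close> is the preceding syzygy, or
  \<open>M\<close> for \<open>n = 0\<close>; both are projective over \<open>R\<^sub>0\<close> in
  each degree.\<close>

lemma Syz_retraction:
  obtains r where "lin_map R\<^sub>0 (P n\<lparr>carrier := \<P> n j\<rparr>) (P n\<lparr>carrier := Syz n \<inter> \<P> n j\<rparr>) r"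
    "\<And>x. x \<in> Syz n \<inter> \<P> n j \<Longrightarrow> r x = x"
proof (cases n)
  case 0
  show ?thesis
    by (rule cover_kernel_retraction[OF P M res_aug(1) \<epsilon> res_aug(2) resolved_component_projective[of j]])
       (use that in \<open>simp only: 0 Syz_0\<close>)
next
  case (Suc m)
  have "projective_module R\<^sub>0 (Syz_mod m\<lparr>carrier := Syz m \<inter> \<P> m j\<rparr>)" using Syz_projective[of m j] by simp
  from cover_kernel_retraction[OF Syz_covers this] that
  show ?thesis unfolding Suc Syz_Suc by blast
qed

lemma linear_resolution_products: "ext_prod A M D D 1 n = carrier (Ext A M D (Suc n))"
proof -
  obtain \<alpha> \<beta> s where *: "lin_map A (std_mod A M n) (P n) \<alpha>" "\<forall>x\<in>std_syz A M n. \<alpha> x \<in> Syz n"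
     "lin_map A (P n) (std_mod A M n) \<beta>" "\<forall>x\<in>Syz n. \<beta> x \<in> std_syz A M n"
     "lin_map A (std_mod A M n) (std_mod A M n) s" "\<forall>x\<in>carrier (std_mod A M n). s x \<in> std_syz A M n"
     "\<forall>x\<in>std_syz A M n. \<beta> (\<alpha> x) = x \<oplus>\<^bsub>std_mod A M n\<^esub> s x"
    using resolution_comparison[of n] by blast
  obtain r where r: "lin_map R\<^sub>0 (P n\<lparr>carrier := \<P> n (Suc n)\<rparr>) (P n\<lparr>carrier := Syz n \<inter> \<P> n (Suc n)\<rparr>) r"
    "\<And>x. x \<in> Syz n \<inter> \<P> n (Suc n) \<Longrightarrow> r x = x"
    by (rule Syz_retraction) blast
  show ?thesis
    by (rule products_generate[OF graded_moduleD(1)[OF M] Syz_linear_step Syz_generated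
          component_projective[OF P res_R0_projective] fd_res r *(1) bspec[OF *(2)] *(3) bspec[OF *(4)] *(5)
          bspec[OF *(6)] bspec[OF *(7)]])
qed

lemma linear_resolution_projective: "projective_module R\<^sub>0 M"
  by (rule projective_of_components[OF M resolved_component_projective])

end

end

section \<open>Graded free modules\<close>

text \<open>The maps \<open>\<pi> j\<close> are the prospective projections. Applied to an arbitrary
  decomposition they recover its terms, which gives uniqueness.\<close>

lemma (in left_module) direct_sum_decompositionI:
  assumes V: "\<And>j. submodule (V j) R M" and \<pi>: "\<And>j. lin_map R M M (\<pi> j)"
    "\<And>j x. x \<in> carrier M \<Longrightarrow> \<pi> j x \<in> V j"
    and hom: "\<And>i j x. x \<in> V i \<Longrightarrow> \<pi> j x = (if j = i then x else \<zero>\<^bsub>M\<^esub>)"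
    and sum: "\<And>x. x \<in> carrier M \<Longrightarrow> \<exists>T. finite T \<and> {j. \<pi> j x \<noteq> \<zero>\<^bsub>M\<^esub>} \<subseteq> T \<and> x = (\<Oplus>\<^bsub>M\<^esub> j\<in>T. \<pi> j x)"
  shows "direct_sum_decomposition M V"
  unfolding direct_sum_decomposition_def
proof (intro conjI allI ballI ex1I)
  show "subgroup (V j) (add_monoid M)" for j using V by (rule submodule.axioms(1))
  fix x assume x: "x \<in> carrier M"
  obtain T where T: "finite T" "{j. \<pi> j x \<noteq> \<zero>\<^bsub>M\<^esub>} \<subseteq> T" "x = (\<Oplus>\<^bsub>M\<^esub> j\<in>T. \<pi> j x)" using sum[OF x] by blast
  show "homogeneous_parts M V x (\<lambda>j. \<pi> j x)"
    by (rule M.homogeneous_partsI[OF submoduleD(1)[OF V] \<pi>(2)[OF x] T])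
  fix c assume "homogeneous_parts M V x c"
  then have c: "\<And>i. c i \<in> V i" and S: "finite {i. c i \<noteq> \<zero>\<^bsub>M\<^esub>}" and xc: "x = (\<Oplus>\<^bsub>M\<^esub> i\<in>{i. c i \<noteq> \<zero>\<^bsub>M\<^esub>}. c i)"
    by (simp_all add: homogeneous_parts_def)
  have cM: "c i \<in> carrier M" for i by (rule submoduleD(3)[OF V c])
  show "c = (\<lambda>j. \<pi> j x)"
  proof
    fix j
    let ?S = "{i. c i \<noteq> \<zero>\<^bsub>M\<^esub>}"
    have "\<pi> j x = \<pi> j (\<Oplus>\<^bsub>M\<^esub> i\<in>?S. c i)" using xc by simp
    also have "\<dots> = (\<Oplus>\<^bsub>M\<^esub> i\<in>?S. \<pi> j (c i))"
      by (rule lin_map_finsum[OF left_module_axioms left_module_axioms \<pi>(1)]) (use cM in simp)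
    also have "\<dots> = (\<Oplus>\<^bsub>M\<^esub> i\<in>?S. if j = i then c i else \<zero>\<^bsub>M\<^esub>)" using hom[OF c] by (simp cong: if_cong)
    also have "\<dots> = c j"
    proof (cases "j \<in> ?S")
      case True
      show ?thesis by (rule M.add.finprod_singleton[OF True S]) (use cM in simp)
    next
      case False
      then have "(\<Oplus>\<^bsub>M\<^esub> i\<in>?S. if j = i then c i else \<zero>\<^bsub>M\<^esub>) = \<zero>\<^bsub>M\<^esub>" by (intro M.add.finprod_one_eqI) auto
      then show ?thesis using False by simp
    qed
    finally show "c j = \<pi> j x" by simp
  qed
qed

context graded_setup
begin

text \<open>The grading with all basis elements in degree \<open>s\<close>. The case distinction
  guards the truncated subtraction: components below \<open>s\<close> have to be zero.\<close>

definition free_part :: "nat \<Rightarrow> 'b set \<Rightarrow> nat \<Rightarrow> ('b \<Rightarrow> 'a) set" where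
  "free_part s B j = {f \<in> carrier (free_module A B). \<forall>b. f b \<in> (if s \<le> j then \<A> (j - s) else {\<zero>\<^bsub>A\<^esub>})}"

lemma free_graded: "graded_module A \<A> (free_module A B) (free_part s B)"
  unfolding graded_module_def
proof (intro conjI allI ballI)
  let ?F = "free_module A B"
  show F: "left_module A ?F" by (rule A.free_module_left_module)
  interpret F: left_module R\<^sub>0 ?F by (rule left_module_R0[OF F])
  let ?\<pi> = "\<lambda>j f b. if s \<le> j then A_part (j - s) (f b) else \<zero>\<^bsub>A\<^esub>"
  have zero: "A_part i \<zero>\<^bsub>A\<^esub> = \<zero>\<^bsub>A\<^esub>" for i using A_part_homogeneous[OF A_component_closed(1), of i i] by simp
  have part: "lin_map R\<^sub>0 A_mod (A_mod\<lparr>carrier := \<A> i\<rparr>) (homogeneous_part A_mod \<A> i)" for i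
    by (rule part_lin_map[OF regular_A(2)])
  have fA: "f b \<in> carrier A" if "f \<in> carrier ?F" for f b using that by (simp add: free_module_carrier)
  have \<pi>F: "?\<pi> j f \<in> carrier ?F" if f: "f \<in> carrier ?F" for f j
  proof -
    have "{b. ?\<pi> j f b \<noteq> \<zero>\<^bsub>A\<^esub>} \<subseteq> {b. f b \<noteq> \<zero>\<^bsub>A\<^esub>}" by (auto simp: zero)
    then show ?thesis using f A_part_closed[OF fA[OF f]] finite_subset[of "{b. ?\<pi> j f b \<noteq> \<zero>\<^bsub>A\<^esub>}" "{b. f b \<noteq> \<zero>\<^bsub>A\<^esub>}"]
      by (auto simp: free_module_carrier)
  qed
  show "direct_sum_decomposition ?F (free_part s B)"
  proof (rule F.direct_sum_decompositionI)
    show "submodule (free_part s B j) R\<^sub>0 ?F" for j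
    proof (rule F.submoduleI)
      show "free_part s B j \<subseteq> carrier ?F" by (auto simp: free_part_def)
      show "\<zero>\<^bsub>?F\<^esub> \<in> free_part s B j" using F.M.zero_closed A_component_closed(1) by (simp add: free_part_def)
      fix f g assume f: "f \<in> free_part s B j" and g: "g \<in> free_part s B j"
      have "f \<oplus>\<^bsub>?F\<^esub> g \<in> carrier ?F" by (rule F.M.a_closed) (use f g in \<open>auto simp: free_part_def\<close>)
      then show "f \<oplus>\<^bsub>?F\<^esub> g \<in> free_part s B j"
        using f g A_component_closed(2) by (auto simp: free_part_def split: if_splits)
    next
      fix a f assume a: "a \<in> carrier R\<^sub>0" and f: "f \<in> free_part s B j"
      have "a \<odot>\<^bsub>?F\<^esub> f \<in> carrier ?F" by (rule F.smult_closed[OF a]) (use f in \<open>auto simp: free_part_def\<close>)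
      then show "a \<odot>\<^bsub>?F\<^esub> f \<in> free_part s B j"
        using a f degree_0_mult A_component_carrier[of a 0] by (auto simp: free_part_def split: if_splits)
    qed
    show "lin_map R\<^sub>0 ?F ?F (?\<pi> j)" for j
    proof (rule lin_mapI)
      fix f g assume f: "f \<in> carrier ?F" and g: "g \<in> carrier ?F"
      show "?\<pi> j (f \<oplus>\<^bsub>?F\<^esub> g) = ?\<pi> j f \<oplus>\<^bsub>?F\<^esub> ?\<pi> j g"
        using lin_mapD(2)[OF part, of "f _" "g _"] fA[OF f] fA[OF g] by (auto simp: A_mod_part)
    next
      fix a f assume a: "a \<in> carrier R\<^sub>0" and f: "f \<in> carrier ?F"
      then show "?\<pi> j (a \<odot>\<^bsub>?F\<^esub> f) = a \<odot>\<^bsub>?F\<^esub> ?\<pi> j f"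
        using lin_mapD(3)[OF part, of a "f _"] fA[OF f] A_component_carrier[of a 0] by (auto simp: A_mod_part)
    qed (rule \<pi>F)
    fix f assume f: "f \<in> carrier ?F"
    show "?\<pi> j f \<in> free_part s B j" for j
      using \<pi>F[OF f, of j] A_part_in[OF fA[OF f]] by (simp add: free_part_def)
    \<comment> \<open>The degrees occurring in the finitely many nonzero coordinates of
      \<open>f\<close>; the shift by \<open>s\<close> turns them into degrees of the module.\<close>
    define T where "T = (\<Union>b\<in>{b. f b \<noteq> \<zero>\<^bsub>A\<^esub>}. {i. A_part i (f b) \<noteq> \<zero>\<^bsub>A\<^esub>})"
    let ?S = "(\<lambda>i. i + s) ` T"
    have "finite {b. f b \<noteq> \<zero>\<^bsub>A\<^esub>}" using f by (simp add: free_module_carrier)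
    then have "finite T" unfolding T_def by (rule finite_UN_I) (rule A.homogeneous_part_finite[OF A_dsd fA[OF f]])
    then have T: "finite T" "finite ?S" by auto
    have supp: "i \<in> T" if i: "A_part i (f b) \<noteq> \<zero>\<^bsub>A\<^esub>" for i b
    proof -
      have "f b \<noteq> \<zero>\<^bsub>A\<^esub>" using i zero by metis
      then show ?thesis using i unfolding T_def by blast
    qed
    have "{j. ?\<pi> j f \<noteq> \<zero>\<^bsub>?F\<^esub>} \<subseteq> ?S"
    proof
      fix j assume "j \<in> {j. ?\<pi> j f \<noteq> \<zero>\<^bsub>?F\<^esub>}"
      then obtain b where "?\<pi> j f b \<noteq> \<zero>\<^bsub>A\<^esub>" by (auto simp: fun_eq_iff)
      then have "s \<le> j" "j - s \<in> T" using supp[of "j - s" b] by (auto split: if_splits)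
      then show "j \<in> ?S" by (intro image_eqI[of _ _ "j - s"]) simp_all
    qed
    moreover have "f = (\<Oplus>\<^bsub>?F\<^esub> j\<in>?S. ?\<pi> j f)"
    proof
      fix b
      have ev: "lin_map R\<^sub>0 ?F A_mod (\<lambda>f. f b)" by (auto simp: lin_map_def free_module_carrier)
      have "f b = (\<Oplus>\<^bsub>A\<^esub> i\<in>T. A_part i (f b))"
        by (rule A.homogeneous_part_sum[OF A_dsd fA[OF f] T(1)]) (use supp in auto)
      also have "\<dots> = (\<Oplus>\<^bsub>A\<^esub> i\<in>T. ?\<pi> (i + s) f b)" by simp
      also have "\<dots> = (\<Oplus>\<^bsub>A\<^esub> j\<in>?S. ?\<pi> j f b)"
        by (rule A.finsum_reindex[symmetric]) (use A_part_closed[OF fA[OF f]] in \<open>auto simp: inj_on_def\<close>)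
      also have "\<dots> = (\<Oplus>\<^bsub>A_mod\<^esub> j\<in>?S. ?\<pi> j f b)"
        by (rule A.finsum_regular_module[symmetric]) (use A_part_closed[OF fA[OF f]] in auto)
      also have "\<dots> = (\<Oplus>\<^bsub>?F\<^esub> j\<in>?S. ?\<pi> j f) b"
        by (rule lin_map_finsum[OF F.left_module_axioms left_module_R0[OF regular_A(1)] ev, symmetric])
           (use \<pi>F[OF f] in auto)
      finally show "f b = (\<Oplus>\<^bsub>?F\<^esub> j\<in>?S. ?\<pi> j f) b" .
    qed
    ultimately show "\<exists>T. finite T \<and> {j. ?\<pi> j f \<noteq> \<zero>\<^bsub>?F\<^esub>} \<subseteq> T \<and> f = (\<Oplus>\<^bsub>?F\<^esub> j\<in>T. ?\<pi> j f)" using T(2) by blast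
  next
    fix i j f assume f: "f \<in> free_part s B i"
    show "?\<pi> j f = (if j = i then f else \<zero>\<^bsub>?F\<^esub>)"
    proof
      fix b
      have "f b \<in> (if s \<le> i then \<A> (i - s) else {\<zero>\<^bsub>A\<^esub>})" using f by (simp add: free_part_def)
      then show "?\<pi> j f b = (if j = i then f else \<zero>\<^bsub>?F\<^esub>) b"
        using A_part_homogeneous[of "f b" "i - s" "j - s"] zero by (auto split: if_splits)
    qed
  qed
  fix i j a f assume a: "a \<in> \<A> i" and f: "f \<in> free_part s B j"
  have "a \<odot>\<^bsub>?F\<^esub> f \<in> carrier ?F"
    by (rule left_module.smult_closed[OF F A_component_carrier[OF a]]) (use f in \<open>auto simp: free_part_def\<close>)
  then show "a \<odot>\<^bsub>?F\<^esub> f \<in> free_part s B (i + j)"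
    using f degree_mult[OF a, of _ "j - s"] A_component_closed(1) A_component_carrier[OF a]
    by (auto simp: free_part_def split: if_splits)
qed

lemma unit_vec_degree: "b \<in> B \<Longrightarrow> A.unit_vec b \<in> free_part s B s"
  using A.unit_vec_carrier[of b B] one_degree_0 A_component_closed(1)[of 0]
  by (simp add: free_part_def A.unit_vec_def)

lemma free_generated: "generated_in_degree A (free_module A B) (free_part s B) s"
proof -
  let ?F = "free_module A B"
  interpret F: left_module A ?F by (rule A.free_module_left_module)
  have sub: "submodule (span_prod ?F (carrier A) (free_part s B s)) A ?F"
    by (rule span_prod_submodule[OF F.left_module_axioms]) (auto simp: free_part_def)
  have "f \<in> span_prod ?F (carrier A) (free_part s B s)" if f: "f \<in> carrier ?F" for f
  proof -
    have "f = (\<Oplus>\<^bsub>?F\<^esub> b\<in>{b. f b \<noteq> \<zero>\<^bsub>A\<^esub>}. f b \<odot>\<^bsub>?F\<^esub> A.unit_vec b)"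
      by (rule F.free_lin_map_sum[OF lin_map_id f])
    moreover have "(\<Oplus>\<^bsub>?F\<^esub> b\<in>{b. f b \<noteq> \<zero>\<^bsub>A\<^esub>}. f b \<odot>\<^bsub>?F\<^esub> A.unit_vec b) \<in> span_prod ?F (carrier A) (free_part s B s)"
      by (rule submodule_finsum[OF F.left_module_axioms sub], rule Pi_I, rule span_prod_superset)
         (use f in \<open>auto simp: free_module_carrier intro!: unit_vec_degree\<close>)
    ultimately show ?thesis by simp
  qed
  then show ?thesis using submoduleD(1)[OF sub] by (auto simp: generated_in_degree_def)
qed

lemma free_graded_lin_map:
  assumes T: "graded_module A \<A> T \<T>" and h: "lin_map A (free_module A B) T h"
    and gr: "\<And>b. b \<in> B \<Longrightarrow> h (A.unit_vec b) \<in> \<T> s"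
  shows "h ` free_part s B i \<subseteq> \<T> i"
proof (rule image_subsetI)
  fix f assume f: "f \<in> free_part s B i"
  have fF: "f \<in> carrier (free_module A B)" using f by (simp add: free_part_def)
  note TM = graded_moduleD(1)[OF T]
  have "f b \<odot>\<^bsub>T\<^esub> h (A.unit_vec b) \<in> \<T> i" if b: "f b \<noteq> \<zero>\<^bsub>A\<^esub>" for b
  proof -
    have "b \<in> B" using fF b by (auto simp: free_module_carrier)
    moreover have "s \<le> i" "f b \<in> \<A> (i - s)" using f b by (auto simp: free_part_def split: if_splits)
    ultimately show ?thesis using graded_moduleD(4)[OF T, of "f b" "i - s" _ s] gr by simp
  qed
  then have "(\<Oplus>\<^bsub>T\<^esub> b\<in>{b. f b \<noteq> \<zero>\<^bsub>A\<^esub>}. f b \<odot>\<^bsub>T\<^esub> h (A.unit_vec b)) \<in> \<T> i"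
    by (intro submodule_finsum[OF left_module_R0[OF TM] component_submodule[OF T]]) simp
  then show "h f \<in> \<T> i" using left_module.free_lin_map_sum[OF TM h fF] by simp
qed


text \<open>The cover is the module induced from \<open>\<T> s\<close> along
  \<open>R\<^sub>0\<close> into \<open>A\<close>, realized without tensor products. Being
  projective, \<open>\<T> s\<close> is cut out of a free \<open>R\<^sub>0\<close>-module by an
  idempotent, and the same idempotent on the free \<open>A\<close>-module with that basis has the
  cover as its image. The injection \<open>nm\<close> provides the basis, which fixes the type of
  the cover.\<close>

lemma graded_cover:
  fixes T :: "('a, 't) module" and nm :: "'t \<Rightarrow> 'b"
  assumes T: "graded_module A \<A> T \<T>" and gen: "generated_in_degree A T \<T> s"
    and proj: "projective_module R\<^sub>0 (T\<lparr>carrier := \<T> s\<rparr>)" and inj: "inj_on nm (\<T> s)"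
  obtains Q :: "('a, 'b \<Rightarrow> 'a) module" and \<Q> q where "graded_module A \<A> Q \<Q>" "projective_module A Q"
    "generated_in_degree A Q \<Q> s" "lin_map A Q T q" "\<And>i. q ` \<Q> i \<subseteq> \<T> i" "q ` carrier Q = carrier T"
    "{x \<in> carrier Q. q x = \<zero>\<^bsub>T\<^esub>} \<inter> \<Q> s = {\<zero>\<^bsub>Q\<^esub>}" "carrier Q \<subseteq> carrier (free_module A UNIV)"
proof -
  note TM = graded_moduleD(1)[OF T]
  interpret T: left_module A T by (rule TM)
  define B where "B = nm ` \<T> s"
  define v where "v = inv_into (\<T> s) nm"
  have v: "v b \<in> \<T> s" if "b \<in> B" for b using that unfolding v_def B_def by (rule inv_into_into)
  have v_nm: "v (nm y) = y" if "y \<in> \<T> s" for y unfolding v_def by (rule inv_into_f_f[OF inj that])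
  have nm: "nm y \<in> B" if "y \<in> \<T> s" for y using that unfolding B_def by blast
  have vT: "v b \<in> carrier T" if "b \<in> B" for b by (rule component_carrier[OF T v[OF that]])
  define F where "F = free_module A B"
  define F0 where "F0 = free_module R\<^sub>0 B"
  define T0 where "T0 = T\<lparr>carrier := \<T> s\<rparr>"
  have FM: "left_module A F" unfolding F_def by (rule A.free_module_left_module)
  interpret F: left_module A F by (rule FM)
  have F0M: "left_module R\<^sub>0 F0" unfolding F0_def by (rule ring.free_module_left_module[OF R0_ring])
  have T0M: "left_module R\<^sub>0 T0"
    unfolding T0_def by (rule submodule_left_module[OF left_module_R0[OF TM] component_submodule[OF T]])
  interpret T0: left_module R\<^sub>0 T0 by (rule T0M)
  have F0_sub: "carrier F0 \<subseteq> carrier F" and F0_smult: "\<And>a f. a \<odot>\<^bsub>F0\<^esub> f = a \<odot>\<^bsub>F\<^esub> f"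
    and F0_add: "\<And>f g. f \<oplus>\<^bsub>F0\<^esub> g = f \<oplus>\<^bsub>F\<^esub> g"
    unfolding F0_def F_def using A_component_carrier[of _ 0] by (auto simp: free_module_carrier)
  have u: "A.unit_vec b \<in> carrier F" if "b \<in> B" for b unfolding F_def by (rule A.unit_vec_carrier[OF that])
  have u0: "ring.unit_vec R\<^sub>0 b = A.unit_vec b" for b
    by (simp add: ring.unit_vec_def[OF R0_ring] A.unit_vec_def fun_eq_iff)
  have part_s: "free_part s B s = carrier F0"
    unfolding free_part_def F0_def using A_component_carrier[of _ 0] by (auto simp: free_module_carrier)
  define p where "p = lin_ext R\<^sub>0 B T0 v"
  have vT0: "v \<in> B \<rightarrow> carrier T0" using v by (simp add: T0_def)
  have p: "lin_map R\<^sub>0 F0 T0 p" unfolding p_def F0_def by (rule mod_hom_lin_map[OF T0.lin_ext_hom[OF vT0]])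
  have p_unit: "p (A.unit_vec b) = v b" if "b \<in> B" for b
    using T0.lin_ext_unit_vec[OF vT0 that] by (simp add: p_def u0)
  obtain \<iota> where \<iota>: "lin_map R\<^sub>0 T0 F0 \<iota>" "\<And>y. y \<in> carrier T0 \<Longrightarrow> p (\<iota> y) = y"
  proof (rule projective_lift[OF proj[folded T0_def] F0M T0M p lin_map_id])
    show "(\<lambda>x. x) ` carrier T0 \<subseteq> p ` carrier F0"
    proof (rule subsetI)
      fix y assume "y \<in> (\<lambda>x. x) ` carrier T0"
      then have y: "y \<in> \<T> s" by (simp add: T0_def)
      have "y = p (A.unit_vec (nm y))" using p_unit[OF nm[OF y]] v_nm[OF y] by simp
      moreover have "A.unit_vec (nm y) \<in> carrier F0"
        using ring.unit_vec_carrier[OF R0_ring nm[OF y]] by (simp add: F0_def u0)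
      ultimately show "y \<in> p ` carrier F0" by (rule image_eqI)
    qed
  qed (rule that)
  \<comment> \<open>Extends the idempotent \<open>\<iota> \<circ> p\<close> of \<open>F0\<close>
    linearly over \<open>A\<close>; idempotent because \<open>p \<circ> \<iota>\<close> is the
    identity.\<close>
  define E where "E = lin_ext A B F (\<lambda>b. \<iota> (v b))"
  define q where "q = lin_ext A B T v"
  have \<iota>F: "\<iota> y \<in> carrier F0" "\<iota> y \<in> carrier F" if "y \<in> \<T> s" for y
    using lin_mapD(1)[OF \<iota>(1), of y] that F0_sub by (auto simp: T0_def)
  have E_dom: "(\<lambda>b. \<iota> (v b)) \<in> B \<rightarrow> carrier F" using \<iota>F v by auto
  have q_dom: "v \<in> B \<rightarrow> carrier T" using vT by auto
  have E: "lin_map A F F E" unfolding E_def F_def by (rule mod_hom_lin_map[OF F.lin_ext_hom[OF E_dom, unfolded F_def]])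
  have q: "lin_map A F T q" unfolding q_def F_def by (rule mod_hom_lin_map[OF T.lin_ext_hom[OF q_dom]])
  have E_unit: "E (A.unit_vec b) = \<iota> (v b)" if "b \<in> B" for b
    unfolding E_def by (rule F.lin_ext_unit_vec[OF E_dom that])
  have q_unit: "q (A.unit_vec b) = v b" if "b \<in> B" for b
    unfolding q_def by (rule T.lin_ext_unit_vec[OF q_dom that])
  have F0_unit_eq: "h f = k f"
    if "lin_map R\<^sub>0 F0 N h" "lin_map R\<^sub>0 F0 N k" "left_module R\<^sub>0 N"
      "\<And>b. b \<in> B \<Longrightarrow> h (A.unit_vec b) = k (A.unit_vec b)" "f \<in> carrier F0"
    for N :: "('a, 'c) module" and h k f
    by (rule left_module.free_lin_map_eqI[OF that(3), where B = B]) (use that in \<open>simp_all add: F0_def u0\<close>)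
  have F0F: "lin_map R\<^sub>0 F0 N h" if "lin_map A F N h" for N :: "('a, 'c) module" and h
    by (rule lin_mapI)
       (simp_all only: F0_smult F0_add subsetD[OF F0_sub] lin_mapD[OF lin_map_R0[OF that]])
  have \<iota>_F: "lin_map R\<^sub>0 T0 F \<iota>" using \<iota>(1) F0_sub by (auto simp: lin_map_def F0_smult F0_add)
  have T0_T: "lin_map R\<^sub>0 T0 T (\<lambda>x. x)" using component_carrier[OF T] by (auto simp: lin_map_def T0_def)
  have E_F0: "E f = \<iota> (p f)" if "f \<in> carrier F0" for f
    by (rule F0_unit_eq[OF F0F[OF E] lin_map_comp[OF p \<iota>_F] left_module_R0[OF FM] _ that])
       (simp add: E_unit p_unit)
  have q_F0: "q f = p f" if "f \<in> carrier F0" for f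
    by (rule F0_unit_eq[OF F0F[OF q] lin_map_comp[OF p T0_T] left_module_R0[OF TM] _ that])
       (simp add: q_unit p_unit)
  have E\<iota>: "E (\<iota> y) = \<iota> y" and q\<iota>: "q (\<iota> y) = y" if "y \<in> \<T> s" for y
    using E_F0[OF \<iota>F(1)[OF that]] q_F0[OF \<iota>F(1)[OF that]] \<iota>(2)[of y] that by (simp_all add: T0_def)
  have EE: "E (E f) = E f" and qE: "q (E f) = q f" if "f \<in> carrier F" for f
  proof -
    have f: "f \<in> carrier (free_module A B)" using that by (simp add: F_def)
    show "E (E f) = E f"
    proof (rule F.free_lin_map_eqI[OF _ _ _ f])
      show "lin_map A (free_module A B) F (\<lambda>f. E (E f))" using lin_map_comp[OF E E] unfolding F_def .
      show "lin_map A (free_module A B) F E" using E unfolding F_def .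
    qed (simp add: E_unit E\<iota> v)
    show "q (E f) = q f"
    proof (rule T.free_lin_map_eqI[OF _ _ _ f])
      show "lin_map A (free_module A B) T (\<lambda>f. q (E f))" using lin_map_comp[OF E q] unfolding F_def .
      show "lin_map A (free_module A B) T q" using q unfolding F_def .
    qed (simp add: E_unit q_unit q\<iota> v)
  qed
  have FG: "graded_module A \<A> F (free_part s B)" unfolding F_def by (rule free_graded)
  have E_gr: "E ` free_part s B i \<subseteq> free_part s B i" for i
  proof (rule free_graded_lin_map[OF FG])
    show "lin_map A (free_module A B) F E" using E unfolding F_def .
  qed (simp add: E_unit part_s \<iota>F v)
  have q_gr: "q ` free_part s B i \<subseteq> \<T> i" for i
  proof (rule free_graded_lin_map[OF T])
    show "lin_map A (free_module A B) T q" using q unfolding F_def .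
  qed (simp add: q_unit v)
  let ?Q = "F\<lparr>carrier := E ` carrier F\<rparr>"
  let ?\<Q> = "\<lambda>j. E ` carrier F \<inter> free_part s B j"
  have Qsub: "submodule (E ` carrier F) A F" by (rule image_submodule[OF FM FM E carrier_submodule[OF FM]])
  have fixed: "E f = f" if "f \<in> E ` carrier F" for f using that EE by auto
  have Qgs: "graded_submodule F (free_part s B) (E ` carrier F)"
    unfolding graded_submodule_def
  proof (intro conjI ballI allI Qsub)
    fix f j assume f: "f \<in> E ` carrier F"
    have fF: "f \<in> carrier F" by (rule submoduleD(3)[OF Qsub f])
    have "homogeneous_part F (free_part s B) j f = E (homogeneous_part F (free_part s B) j f)"
      using lin_map_homogeneous_part[OF FG FG E E_gr fF, of j] unfolding fixed[OF f] .
    then show "homogeneous_part F (free_part s B) j f \<in> E ` carrier F"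
      using part_closed[OF FG fF] by (rule image_eqI)
  qed
  have QG: "graded_module A \<A> ?Q ?\<Q>" by (rule graded_submodule_module[OF FG Qgs])
  have EQ: "lin_map A F ?Q E" using E by (auto simp: lin_map_def)
  have incl: "lin_map A ?Q F (\<lambda>x. x)" by (rule lin_mapI) (use submoduleD(3)[OF Qsub] in simp_all)
  have "projective_module A F" unfolding F_def by (rule A.projective_free_module)
  then have Qproj: "projective_module A ?Q"
    by (rule projective_retract[OF _ graded_moduleD(1)[OF QG] incl EQ]) (rule fixed, simp)
  have Qgen: "generated_in_degree A ?Q ?\<Q> s"
  proof (rule generated_in_degree_image[where \<P> = "free_part s B", OF FM graded_moduleD(1)[OF QG] EQ])
    show "E ` carrier F = carrier ?Q" by simp
    show Fs: "free_part s B s \<subseteq> carrier F" using component_carrier[OF FG] by (rule subsetI)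
    show "E ` free_part s B s \<subseteq> ?\<Q> s" using E_gr[of s] image_mono[OF Fs] by (rule Int_greatest[rotated])
    show "?\<Q> s \<subseteq> carrier ?Q" by simp
    show "generated_in_degree A F (free_part s B) s" unfolding F_def by (rule free_generated)
  qed
  have qQ: "lin_map A ?Q T q" using lin_map_comp[OF incl q] .
  have "q ` carrier F = carrier T"
  proof
    show "q ` carrier F \<subseteq> carrier T" using lin_mapD(1)[OF q] by auto
    have "span_prod T (carrier A) (\<T> s) \<subseteq> q ` carrier F"
    proof (rule span_prod_least[OF TM image_submodule[OF FM TM q carrier_submodule[OF FM]]])
      fix a y assume a: "a \<in> carrier A" and y: "y \<in> \<T> s"
      have "a \<odot>\<^bsub>T\<^esub> y = q (a \<odot>\<^bsub>F\<^esub> \<iota> y)" using lin_mapD(3)[OF q a \<iota>F(2)[OF y]] q\<iota>[OF y] by simp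
      then show "a \<odot>\<^bsub>T\<^esub> y \<in> q ` carrier F" using F.smult_closed[OF a \<iota>F(2)[OF y]] by (rule image_eqI)
    qed
    then show "carrier T \<subseteq> q ` carrier F" using gen by (simp add: generated_in_degree_def)
  qed
  then have surj: "q ` carrier ?Q = carrier T" using qE by (simp add: image_image)
  \<comment> \<open>An element of degree \<open>s\<close> fixed by \<open>E\<close> equals
    \<open>\<iota> (p f)\<close>, and \<open>p\<close> agrees with \<open>q\<close> in that degree.
    So \<open>q\<close> is injective there, which is the minimality asked for in
    \<open>linear_step\<close>.\<close>
  have ker: "{x \<in> carrier ?Q. q x = \<zero>\<^bsub>T\<^esub>} \<inter> ?\<Q> s = {\<zero>\<^bsub>?Q\<^esub>}"
  proof
    show "{x \<in> carrier ?Q. q x = \<zero>\<^bsub>T\<^esub>} \<inter> ?\<Q> s \<subseteq> {\<zero>\<^bsub>?Q\<^esub>}"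
    proof
      fix f assume "f \<in> {x \<in> carrier ?Q. q x = \<zero>\<^bsub>T\<^esub>} \<inter> ?\<Q> s"
      then have f: "f \<in> E ` carrier F" "f \<in> carrier F0" "q f = \<zero>\<^bsub>T\<^esub>" by (auto simp: part_s)
      have "f = \<iota> (p f)" using fixed[OF f(1)] E_F0[OF f(2)] by simp
      also have "p f = \<zero>\<^bsub>T0\<^esub>" using q_F0[OF f(2)] f(3) by (simp add: T0_def)
      also have "\<iota> \<zero>\<^bsub>T0\<^esub> = \<zero>\<^bsub>F\<^esub>" by (rule lin_map_0[OF T0M left_module_R0[OF FM] \<iota>_F])
      finally show "f \<in> {\<zero>\<^bsub>?Q\<^esub>}" by simp
    qed
    show "{\<zero>\<^bsub>?Q\<^esub>} \<subseteq> {x \<in> carrier ?Q. q x = \<zero>\<^bsub>T\<^esub>} \<inter> ?\<Q> s"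
      using submoduleD(2)[OF component_submodule[OF QG, of s]] lin_map_0[OF FM TM q] by auto
  qed
  \<comment> \<open>Finite support is recorded because \<open>syz_name\<close> is injective on
    finitely supported functions, which is needed to name the next basis.\<close>
  have "carrier ?Q \<subseteq> carrier (free_module A UNIV)"
    using submoduleD(1)[OF Qsub] by (auto simp: F_def free_module_carrier)
  then show ?thesis using that[OF QG Qproj Qgen qQ _ surj ker] q_gr by blast
qed


text \<open>Supplies for the kernel of the cover what is needed to cover it in turn, except for the
  degree of generation, which depends on the products in Ext.\<close>

lemma linear_cover:
  fixes T :: "('a, 't) module" and nm :: "'t \<Rightarrow> 'b"
  assumes A_proj: "projective_module R\<^sub>0 A_mod" and T: "graded_module A \<A> T \<T>"
    and gen: "generated_in_degree A T \<T> s" and fdT: "\<And>j. fd T (\<T> j)"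
    and projT: "\<And>j. projective_module R\<^sub>0 (T\<lparr>carrier := \<T> j\<rparr>)" and inj: "inj_on nm (\<T> s)"
  obtains Q :: "('a, 'b \<Rightarrow> 'a) module" and \<Q> q where "linear_step s Q \<Q> {x \<in> carrier Q. q x = \<zero>\<^bsub>T\<^esub>}"
    "\<And>j. fd Q (\<Q> j)" "\<And>j. projective_module R\<^sub>0 (Q\<lparr>carrier := {x \<in> carrier Q. q x = \<zero>\<^bsub>T\<^esub>} \<inter> \<Q> j\<rparr>)"
    "lin_map A Q T q" "\<And>i. q ` \<Q> i \<subseteq> \<T> i" "q ` carrier Q = carrier T"
    "carrier Q \<subseteq> carrier (free_module A UNIV)"
proof (rule graded_cover[OF T gen projT inj])
  fix Q :: "('a, 'b \<Rightarrow> 'a) module" and \<Q> q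
  assume Q: "graded_module A \<A> Q \<Q>" "projective_module A Q" "generated_in_degree A Q \<Q> s"
    and q: "lin_map A Q T q" "\<And>i. q ` \<Q> i \<subseteq> \<T> i" "q ` carrier Q = carrier T"
    and ker: "{x \<in> carrier Q. q x = \<zero>\<^bsub>T\<^esub>} \<inter> \<Q> s = {\<zero>\<^bsub>Q\<^esub>}"
    and free: "carrier Q \<subseteq> carrier (free_module A UNIV)"
  note cover = Q(1) T q
  show thesis
    by (rule that[OF cover_linear_step[OF cover Q(2,3) ker] cover_fd[OF cover Q(3) ker fdT]
          cover_kernel_projective[OF cover restricted_projective[OF A_proj Q(2)] projT] q free])
qed

section \<open>Construction of a linear resolution\<close>

context
  fixes M :: "('a, 'm) module" and \<M>
  assumes A_proj: "projective_module R\<^sub>0 A_mod" and fin_op: "fin_dim (opposite_ring R\<^sub>0) = 0"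
    and M: "graded_module A \<A> M \<M>" and fdM: "\<And>j. fd M (\<M> j)" and genM: "generated_in_degree A M \<M> 0"
    and projM: "projective_module R\<^sub>0 M"
    and ext: "\<And>n. ext_prod A M D D 1 n = carrier (Ext A M D (Suc n))"
begin

text \<open>Besides the data needed to continue the linear resolution, the comparison maps with the
  standard resolution are recorded; they identify homomorphisms from the syzygy \<^term>\<open>N\<close> to
  \<^term>\<open>D\<close> with cocycles up to coboundaries.\<close>

definition resolution_stage ::
  "nat \<Rightarrow> ('a, ('a, 'm) std_basis \<Rightarrow> 'a) module \<times> (nat \<Rightarrow> (('a, 'm) std_basis \<Rightarrow> 'a) set) \<times>
     (('a, 'm) std_basis \<Rightarrow> 'a) set \<Rightarrow> bool" where
  "resolution_stage n = (\<lambda>(P, \<P>, N). linear_step n P \<P> N \<and> (\<forall>j. fd P (\<P> j)) \<and>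
     (\<forall>j. projective_module R\<^sub>0 (P\<lparr>carrier := N \<inter> \<P> j\<rparr>)) \<and> carrier P \<subseteq> carrier (free_module A UNIV) \<and>
     (\<exists>\<alpha> \<beta> s. lin_map A (std_mod A M n) P \<alpha> \<and> (\<forall>x\<in>std_syz A M n. \<alpha> x \<in> N) \<and>
        lin_map A P (std_mod A M n) \<beta> \<and> (\<forall>x\<in>N. \<beta> x \<in> std_syz A M n) \<and>
        lin_map A P P s \<and> (\<forall>x\<in>carrier P. s x \<in> N) \<and> (\<forall>x\<in>N. \<alpha> (\<beta> x) = x \<oplus>\<^bsub>P\<^esub> s x)))"

definition extends :: "('a, ('a, 'm) std_basis \<Rightarrow> 'a) module \<times> (nat \<Rightarrow> (('a, 'm) std_basis \<Rightarrow> 'a) set) \<times>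
     (('a, 'm) std_basis \<Rightarrow> 'a) set \<Rightarrow> ('a, ('a, 'm) std_basis \<Rightarrow> 'a) module \<times> (nat \<Rightarrow> (('a, 'm) std_basis \<Rightarrow> 'a) set) \<times>
     (('a, 'm) std_basis \<Rightarrow> 'a) set \<Rightarrow> bool" where
  "extends = (\<lambda>(P, \<P>, N) (P', \<P>', N'). \<exists>d. lin_map A P' P d \<and> d ` carrier P' = N \<and>
     N' = {x \<in> carrier P'. d x = \<zero>\<^bsub>P\<^esub>} \<and> (\<forall>i. d ` \<P>' i \<subseteq> \<P> i))"

definition augmented :: "('a, ('a, 'm) std_basis \<Rightarrow> 'a) module \<times> (nat \<Rightarrow> (('a, 'm) std_basis \<Rightarrow> 'a) set) \<times>
     (('a, 'm) std_basis \<Rightarrow> 'a) set \<Rightarrow> bool" where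
  "augmented = (\<lambda>(P, \<P>, N). \<exists>\<epsilon>. lin_map A P M \<epsilon> \<and> \<epsilon> ` carrier P = carrier M \<and>
     N = {x \<in> carrier P. \<epsilon> x = \<zero>\<^bsub>M\<^esub>} \<and> (\<forall>i. \<epsilon> ` \<P> i \<subseteq> \<M> i))"

lemma resolution_start: "\<exists>\<sigma>. resolution_stage 0 \<sigma> \<and> augmented \<sigma>"
proof -
  note MM = graded_moduleD(1)[OF M]
  note aug = std_aug_lin_map[OF MM]
  \<comment> \<open>Basis elements are named by \<open>Gen\<close> here and by
    \<open>syz_name\<close> at later stages, as in the standard resolution; this keeps all terms in
    one type.\<close>
  have inj: "inj_on Gen (\<M> 0)" by (simp add: inj_on_def)
  show ?thesis
  proof (rule linear_cover[OF A_proj M genM fdM component_projective[OF M projM] inj])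
    fix P :: "('a, ('a, 'm) std_basis \<Rightarrow> 'a) module" and \<P> \<epsilon>
    assume st: "linear_step 0 P \<P> {x \<in> carrier P. \<epsilon> x = \<zero>\<^bsub>M\<^esub>}" and fdP: "\<And>j. fd P (\<P> j)"
      and proj: "\<And>j. projective_module R\<^sub>0 (P\<lparr>carrier := {x \<in> carrier P. \<epsilon> x = \<zero>\<^bsub>M\<^esub>} \<inter> \<P> j\<rparr>)"
      and \<epsilon>: "lin_map A P M \<epsilon>" "\<And>i. \<epsilon> ` \<P> i \<subseteq> \<M> i" "\<epsilon> ` carrier P = carrier M"
      and free: "carrier P \<subseteq> carrier (free_module A UNIV)"
    show ?thesis
    proof (rule comparison_base[OF MM aug(3) linear_stepD(2)[OF st] aug(1,2) \<epsilon>(1,3)])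
      fix \<alpha> \<beta> s
      assume c: "lin_map A (std_mod A M 0) P \<alpha>" "\<And>x. x \<in> carrier (std_mod A M 0) \<Longrightarrow> \<epsilon> (\<alpha> x) = std_aug A M x"
        "lin_map A P (std_mod A M 0) \<beta>" "\<And>x. x \<in> carrier P \<Longrightarrow> std_aug A M (\<beta> x) = \<epsilon> x"
        "lin_map A P P s" "\<And>x. x \<in> carrier P \<Longrightarrow> \<epsilon> (s x) = \<zero>\<^bsub>M\<^esub>"
        "\<And>x. x \<in> carrier P \<Longrightarrow> \<alpha> (\<beta> x) = x \<oplus>\<^bsub>P\<^esub> s x"
      have "\<exists>\<alpha> \<beta> s. lin_map A (std_mod A M 0) P \<alpha> \<and> (\<forall>x\<in>std_syz A M 0. \<alpha> x \<in> {x \<in> carrier P. \<epsilon> x = \<zero>\<^bsub>M\<^esub>}) \<and>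
        lin_map A P (std_mod A M 0) \<beta> \<and> (\<forall>x\<in>{x \<in> carrier P. \<epsilon> x = \<zero>\<^bsub>M\<^esub>}. \<beta> x \<in> std_syz A M 0) \<and>
        lin_map A P P s \<and> (\<forall>x\<in>carrier P. s x \<in> {x \<in> carrier P. \<epsilon> x = \<zero>\<^bsub>M\<^esub>}) \<and>
        (\<forall>x\<in>{x \<in> carrier P. \<epsilon> x = \<zero>\<^bsub>M\<^esub>}. \<alpha> (\<beta> x) = x \<oplus>\<^bsub>P\<^esub> s x)"
        unfolding aug(4)
        using c(2,4,6,7) lin_mapD(1)[OF c(1)] lin_mapD(1)[OF c(3)] lin_mapD(1)[OF c(5)]
        by (intro exI[of _ \<alpha>] exI[of _ \<beta>] exI[of _ s] conjI ballI CollectI c(1) c(3) c(5))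
           (simp_all only: mem_Collect_eq)
      then have "resolution_stage 0 (P, \<P>, {x \<in> carrier P. \<epsilon> x = \<zero>\<^bsub>M\<^esub>})"
        unfolding resolution_stage_def prod.case using st fdP proj free by (intro conjI allI)
      moreover have "augmented (P, \<P>, {x \<in> carrier P. \<epsilon> x = \<zero>\<^bsub>M\<^esub>})"
        unfolding augmented_def prod.case using \<epsilon> by (intro exI[of _ \<epsilon>] conjI allI) simp_all
      ultimately show ?thesis by blast
    qed
  qed
qed

lemma resolution_continue:
  assumes "resolution_stage n \<sigma>"
  shows "\<exists>\<tau>. resolution_stage (Suc n) \<tau> \<and> extends \<sigma> \<tau>"
proof -
  note MM = graded_moduleD(1)[OF M]
  obtain P \<P> N where \<sigma>: "\<sigma> = (P, \<P>, N)" by (cases \<sigma>)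
  have st: "linear_step n P \<P> N" and fdP: "\<And>j. fd P (\<P> j)"
    and proj: "\<And>j. projective_module R\<^sub>0 (P\<lparr>carrier := N \<inter> \<P> j\<rparr>)"
    and free: "carrier P \<subseteq> carrier (free_module A UNIV)"
    using assms unfolding \<sigma> resolution_stage_def by simp_all
  obtain \<alpha> \<beta> s where c: "lin_map A (std_mod A M n) P \<alpha>" "\<forall>x\<in>std_syz A M n. \<alpha> x \<in> N"
    "lin_map A P (std_mod A M n) \<beta>" "\<forall>x\<in>N. \<beta> x \<in> std_syz A M n"
    "lin_map A P P s" "\<forall>x\<in>carrier P. s x \<in> N" "\<forall>x\<in>N. \<alpha> (\<beta> x) = x \<oplus>\<^bsub>P\<^esub> s x"
    using assms unfolding \<sigma> resolution_stage_def prod.case by blast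
  note cc = c(1) bspec[OF c(2)] c(3) bspec[OF c(4)] c(5) bspec[OF c(6)] bspec[OF c(7)]
  note PM = linear_stepD(7)[OF st] and N = linear_stepD(6)[OF st] and P = linear_stepD(1)[OF st]
  \<comment> \<open>Here the products in Ext enter: they force the syzygy to be generated in degree
    \<open>n + 1\<close>, so that its cover is again linear.\<close>
  have gen: "generated_in_degree A (P\<lparr>carrier := N\<rparr>) (\<lambda>j. N \<inter> \<P> j) (Suc n)"
    by (rule syzygy_generated[OF fin_op MM st fdP cc ext])
  note NG = graded_submodule_module[OF P linear_stepD(4)[OF st]]
  have fdN: "fd (P\<lparr>carrier := N\<rparr>) (N \<inter> \<P> j)" for j
    using fd_subset[OF PM Int_submodule[OF left_module_R0[OF PM] submodule_R0[OF PM N] component_submodule[OF P]]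
        component_submodule[OF P, of j] _ fdP] by simp
  have projN: "projective_module R\<^sub>0 (P\<lparr>carrier := N\<rparr>\<lparr>carrier := N \<inter> \<P> j\<rparr>)" for j using proj[of j] by simp
  have inj: "inj_on (syz_name A) (N \<inter> \<P> (Suc n))"
    by (rule inj_on_subset[OF inj_on_syz_name[of A UNIV]]) (use free submoduleD(1)[OF N] in blast)
  show ?thesis
  proof (rule linear_cover[OF A_proj NG gen fdN projN inj])
    fix Q :: "('a, ('a, 'm) std_basis \<Rightarrow> 'a) module" and \<Q> d
    assume st': "linear_step (Suc n) Q \<Q> {x \<in> carrier Q. d x = \<zero>\<^bsub>P\<lparr>carrier := N\<rparr>\<^esub>}" and fdQ: "\<And>j. fd Q (\<Q> j)"
      and projQ: "\<And>j. projective_module R\<^sub>0 (Q\<lparr>carrier := {x \<in> carrier Q. d x = \<zero>\<^bsub>P\<lparr>carrier := N\<rparr>\<^esub>} \<inter> \<Q> j\<rparr>)"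
      and d: "lin_map A Q (P\<lparr>carrier := N\<rparr>) d" "\<And>i. d ` \<Q> i \<subseteq> N \<inter> \<P> i" "d ` carrier Q = carrier (P\<lparr>carrier := N\<rparr>)"
      and freeQ: "carrier Q \<subseteq> carrier (free_module A UNIV)"
    let ?K = "{x \<in> carrier Q. d x = \<zero>\<^bsub>P\<lparr>carrier := N\<rparr>\<^esub>}"
    have K: "?K = {x \<in> carrier Q. d x = \<zero>\<^bsub>P\<^esub>}" by simp
    have dP: "lin_map A Q P d"
      by (rule lin_mapI) (use lin_mapD[OF d(1)] submoduleD(3)[OF N] in simp_all)
    have dN: "d ` carrier Q = N" using d(3) by simp
    show ?thesis
    proof (rule comparison_step[OF std_mod_left_module[OF MM] linear_stepD(2)[OF st] std_mod_projective[OF MM]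
          linear_stepD(2)[OF st'] std_diff_lin_map[OF MM] dP c(1) _ c(3) _ c(5), unfolded std_diff_image[OF MM] dN,
          OF bspec[OF c(2)] bspec[OF c(4)] bspec[OF c(6)] bspec[OF c(7)]])
      fix \<alpha>' \<beta>' s'
      assume n: "lin_map A (std_mod A M (Suc n)) Q \<alpha>'"
        "\<And>x. x \<in> carrier (std_mod A M (Suc n)) \<Longrightarrow> d (\<alpha>' x) = \<alpha> (std_diff A M n x)"
        "lin_map A Q (std_mod A M (Suc n)) \<beta>'"
        "\<And>x. x \<in> carrier Q \<Longrightarrow> std_diff A M n (\<beta>' x) = \<beta> (d x)"
        "lin_map A Q Q s'" "\<And>x. x \<in> carrier Q \<Longrightarrow> d (s' x) = \<zero>\<^bsub>P\<^esub>"
        "\<And>x. x \<in> carrier Q \<Longrightarrow> d x = \<zero>\<^bsub>P\<^esub> \<Longrightarrow> \<alpha>' (\<beta>' x) = x \<oplus>\<^bsub>Q\<^esub> s' x"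
      have 0: "\<beta> \<zero>\<^bsub>P\<^esub> = \<zero>\<^bsub>std_mod A M n\<^esub>" "\<alpha> \<zero>\<^bsub>std_mod A M n\<^esub> = \<zero>\<^bsub>P\<^esub>"
        by (rule lin_map_0[OF PM std_mod_left_module[OF MM] c(3)], rule lin_map_0[OF std_mod_left_module[OF MM] PM c(1)])
      have "\<exists>\<alpha> \<beta> s. lin_map A (std_mod A M (Suc n)) Q \<alpha> \<and> (\<forall>x\<in>std_syz A M (Suc n). \<alpha> x \<in> ?K) \<and>
        lin_map A Q (std_mod A M (Suc n)) \<beta> \<and> (\<forall>x\<in>?K. \<beta> x \<in> std_syz A M (Suc n)) \<and>
        lin_map A Q Q s \<and> (\<forall>x\<in>carrier Q. s x \<in> ?K) \<and> (\<forall>x\<in>?K. \<alpha> (\<beta> x) = x \<oplus>\<^bsub>Q\<^esub> s x)"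
        unfolding std_syz_Suc[OF MM] K
        using n(2,4,6,7) lin_mapD(1)[OF n(1)] lin_mapD(1)[OF n(3)] lin_mapD(1)[OF n(5)] 0
        by (intro exI[of _ \<alpha>'] exI[of _ \<beta>'] exI[of _ s'] conjI ballI CollectI n(1) n(3) n(5))
           (simp_all del: std_mod.simps std_syz.simps free_module_simps)
      then have "resolution_stage (Suc n) (Q, \<Q>, ?K)"
        unfolding resolution_stage_def prod.case using st' fdQ projQ freeQ by (intro conjI allI)
      moreover have "extends \<sigma> (Q, \<Q>, ?K)"
        unfolding \<sigma> extends_def prod.case using dP dN d(2) K by (intro exI[of _ d] conjI allI) auto
      ultimately show ?thesis by blast
    qed
  qed
qed

lemma generated_products_koszul: "generalized_koszul A \<A> M \<M>"
proof -
  \<comment> \<open>Dependent choice picks the whole sequence of stages. The augmentation concerns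
    the initial stage; later stages are tied to their predecessors by
    \<open>extends\<close>.\<close>
  have "\<exists>f. \<forall>n. (resolution_stage n (f n) \<and> (n = 0 \<longrightarrow> augmented (f n))) \<and> extends (f n) (f (Suc n))"
    by (rule dependent_nat_choice) (use resolution_start resolution_continue in auto)
  then obtain f where f: "\<And>n. resolution_stage n (f n)" "augmented (f 0)" "\<And>n. extends (f n) (f (Suc n))"
    by blast
  define P where "P n = fst (f n)" for n
  define \<P> where "\<P> n = fst (snd (f n))" for n
  define N where "N n = snd (snd (f n))" for n
  have fn: "f n = (P n, \<P> n, N n)" for n by (simp add: P_def \<P>_def N_def)
  have st: "linear_step n (P n) (\<P> n) (N n)" for n
    using f(1)[of n] unfolding resolution_stage_def fn by simp
  obtain \<epsilon> where \<epsilon>: "lin_map A (P 0) M \<epsilon>" "\<epsilon> ` carrier (P 0) = carrier M"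
    "N 0 = {x \<in> carrier (P 0). \<epsilon> x = \<zero>\<^bsub>M\<^esub>}" "\<And>i. \<epsilon> ` \<P> 0 i \<subseteq> \<M> i"
    using f(2) unfolding fn augmented_def by auto
  have "\<forall>n. \<exists>d. lin_map A (P (Suc n)) (P n) d \<and> d ` carrier (P (Suc n)) = N n \<and>
     N (Suc n) = {x \<in> carrier (P (Suc n)). d x = \<zero>\<^bsub>P n\<^esub>} \<and> (\<forall>i. d ` \<P> (Suc n) i \<subseteq> \<P> n i)"
    using f(3) unfolding extends_def fn by simp
  from choice[OF this] obtain d where d: "\<forall>n. lin_map A (P (Suc n)) (P n) (d n) \<and>
     d n ` carrier (P (Suc n)) = N n \<and>
     N (Suc n) = {x \<in> carrier (P (Suc n)). d n x = \<zero>\<^bsub>P n\<^esub>} \<and> (\<forall>i. d n ` \<P> (Suc n) i \<subseteq> \<P> n i)"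
    by (rule exE)
  note d = conjunct1[OF spec[OF d]] conjunct1[OF conjunct2[OF spec[OF d]]]
    conjunct1[OF conjunct2[OF conjunct2[OF spec[OF d]]]] spec[OF conjunct2[OF conjunct2[OF conjunct2[OF spec[OF d]]]]]
  \<comment> \<open>\<open>projective_resolution\<close> asks for extensional maps, whereas those
    constructed are merely linear on the carriers.\<close>
  let ?d = "\<lambda>n. restrict (d n) (carrier (P (Suc n)))" and ?\<epsilon> = "restrict \<epsilon> (carrier (P 0))"
  have PM: "left_module A (P n)" for n by (rule linear_stepD(7)[OF st])
  have sub: "\<P> n i \<subseteq> carrier (P n)" for n i using component_carrier[OF linear_stepD(1)[OF st]] by (rule subsetI)
  have im: "?d n ` S = d n ` S" if "S \<subseteq> carrier (P (Suc n))" for n S using that by (intro image_cong) auto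
  have im\<epsilon>: "?\<epsilon> ` S = \<epsilon> ` S" if "S \<subseteq> carrier (P 0)" for S using that by (intro image_cong) auto
  have ker: "{x \<in> carrier (P (Suc n)). ?d n x = \<zero>\<^bsub>P n\<^esub>} = N (Suc n)" for n unfolding d(3) by auto
  have ker\<epsilon>: "{x \<in> carrier (P 0). ?\<epsilon> x = \<zero>\<^bsub>M\<^esub>} = N 0" unfolding \<epsilon>(3) by auto
  have "projective_resolution A M P ?d ?\<epsilon>"
    unfolding projective_resolution_def ker ker\<epsilon>
    using linear_stepD(2)[OF st] restrict_mod_hom[OF PM d(1)] restrict_mod_hom[OF PM \<epsilon>(1)] \<epsilon>(2) d(2)
    by (intro conjI allI) (simp_all add: im im\<epsilon>)
  then show ?thesis
    unfolding generalized_koszul_def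
    using linear_stepD(1,3)[OF st] \<epsilon>(4) d(4)
    by (intro exI[of _ P] exI[of _ \<P>] exI[of _ ?d] exI[of _ ?\<epsilon>] conjI allI) (simp_all only: im[OF sub] im\<epsilon>[OF sub])
qed

end

end

theorem theorem1p1:
  fixes K :: "'k ring" and A :: "('k, 'a) module" and \<A> :: "nat \<Rightarrow> 'a set"
    and M :: "('a, 'm) module" and \<M> :: "nat \<Rightarrow> 'm set"
  assumes "algebraically_closed K"
    and "graded_algebra K A \<A>"
    and "locally_finite_algebra K A \<A>"
    and "generated_in_degrees_0_1 A \<A>"
    and "fin_dim (degree_0_ring A \<A>) = 0"
    and "fin_dim (opposite_ring (degree_0_ring A \<A>)) = 0"
    and "projective_module (degree_0_ring A \<A>) (regular_module A)"
    and "graded_module A \<A> M \<M>"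
    and "locally_finite_module K A M \<M>"
    and "generated_in_degree A M \<M> 0"
  shows "generalized_koszul A \<A> M \<M> \<longleftrightarrow>
    projective_module (degree_0_ring A \<A>) M \<and>
    (\<forall>i. ext_prod A M (degree_0_module A \<A>) (degree_0_module A \<A>) 1 i =
         carrier (Ext A M (degree_0_module A \<A>) (i + 1)))"
proof -
  interpret graded_setup K A \<A>
    by (intro graded_setup.intro algebraically_closed.axioms(1) assms)
  have fdM: "fd M (\<M> j)" for j using assms(9) by (simp add: locally_finite_module_def)
  show ?thesis
  proof (intro iffI conjI allI)
    assume "generalized_koszul A \<A> M \<M>"
    then obtain P :: "nat \<Rightarrow> ('a, ('a, 'm) std_basis \<Rightarrow> 'a) module" and \<P> d \<epsilon>
      where res: "projective_resolution A M P d \<epsilon>"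
        and gr: "\<forall>n. graded_module A \<A> (P n) (\<P> n) \<and> generated_in_degree A (P n) (\<P> n) n"
        and \<epsilon>: "\<forall>i. \<epsilon> ` \<P> 0 i \<subseteq> \<M> i" and d: "\<forall>n i. d n ` \<P> (Suc n) i \<subseteq> \<P> n i"
      unfolding generalized_koszul_def by (elim exE conjE) (rule that)
    note * = assms(7,5,8) fdM res conjunct1[OF spec[OF gr]] conjunct2[OF spec[OF gr]] spec[OF \<epsilon>] spec[OF spec[OF d]]
    show "projective_module R\<^sub>0 M" by (rule linear_resolution_projective[OF *])
    show "ext_prod A M D D 1 i = carrier (Ext A M D (i + 1))" for i
      using linear_resolution_products[OF *, of i] by simp
  next
    assume *: "projective_module R\<^sub>0 M \<and> (\<forall>i. ext_prod A M D D 1 i = carrier (Ext A M D (i + 1)))"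
    show "generalized_koszul A \<A> M \<M>"
      by (rule generated_products_koszul[OF assms(7,6,8) fdM assms(10)]) (use * in simp_all)
  qed
qed

end
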